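(* Let $R$ be a commutative ring and let $A\to B$ be a DG smooth homomorphism of DG $R$-algebras. If $N$ is a bounded below semifree DG $B$-module with $\operatorname{Ext}^i_B(N,N)=0$ for all $i\ge 1$, then $N$ is naïvely liftable to $A$. Moreover, $N$ is a direct summand of a DG $B$-module that is liftable to $A$.
   Context: DG algebras. A DG $R$-algebra $A$ is a non-negatively graded $R$-algebra $A=\bigoplus_{n\ge 0}A_n$ with $ab=(-1)^{|a||b|}ba$ for homogeneous $a,b$ and $a^2=0$ when $|a|$ is odd, with an $R$-linear differential $d^A$ of degree $-1$, $(d^A)^2=0$, satisfying the Leibniz rule $d^A(ab)=d^A(a)b+(-1)^{|a|}a\,d^A(b)$. Homomorphisms are degree $0$ graded $R$-algebra homomorphisms that are chain maps. DG modules. All DG modules are right DG modules (graded modules with differential of degree $-1$ satisfying the Leibniz rule), unless stated otherwise. $\inf(M)=\inf\{i\mid M_i\ne 0\}$; $M$ is bounded below if $\inf(M)>-\infty$. A DG $B$-module is semifree if it has a semifree basis: a well-ordered subset $F$ that is a basis of the underlying graded $B$-module with $\partial(f)\in\sum_{e<f}eB$ for all $f\in F$. For $N$ semifree, $\operatorname{Ext}^i_B(N,L)=\operatorname{H}_{-i}(\operatorname{Hom}_B(N,L))$. Diagonal ideal. Let $\varphi\colon A\to B$ be a homomorphism of DG $R$-algebras with $B$ projective as a graded $A$-module. $B^o$ is the opposite DG algebra (elements $b^o$, with $a^ob^o=(-1)^{|a||b|}(ba)^o$, $d(b^o)=(d b)^o$), and $B^e=B^o\otimes_AB$ is the enveloping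 DG algebra, with $(b_1^o\otimes b_2)(b_1'^o\otimes b_2')=(-1)^{|b_1'||b_2|}b_1^ob_1'^o\otimes b_2b_2'$. DG $B^e$-modules are the same as DG $(B,B)$-bimodules. The map $\pi_B\colon B^e\to B$, $b_1^o\otimes b_2\mapsto b_1b_2$, is a DG algebra homomorphism; its kernel $J$ is the diagonal ideal of $\varphi$, and $B^e/J\cong B$. DG smoothness. $\varphi$ is DG quasi-smooth if: (i) $B$ is free as an underlying graded $A$-module; (ii) $J$ has a filtration by DG $B^e$-submodules $J=J^{[1]}\supset J^{[2]}\supset J^{[3]}\supset\cdots$ with $JJ^{[\ell]}+J^{[\ell]}J\subseteq J^{[\ell+1]}$ and $\inf(J^{[\ell]})\ge\ell$ for all $\ell\ge 1$; (iii) for every $\ell\ge 1$ the DG $B$-module $J^{[\ell]}/J^{[\ell+1]}$ (a $B$-module via $B\cong B^e/J$) is semifree. $\varphi$ is DG smooth if, moreover, each $J^{[\ell]}/J^{[\ell+1]}$ has a finite semifree basis over $B$. Liftings. A DG $B$-module $N$ is liftable to $A$ if there is a DG $A$-module $M$ with $N\cong M\otimes^{\mathbf L}_AB$ in the derived category $\mathcal D(B)$. For a semifree DG $B$-module $N$, let $N|_A$ be $N$ regarded as a DG $A$-module; $N$ is naïvely liftable to $A$ if the DG $B$-module epimorphism $\pi_N\colon N|_A\otimes_AB\to N$, $\pi_N(x\otimes b)=xb$, splits, i.e. there is a DG $B$-module homomorphism $\rho$ with $\pi_N\rho=\operatorname{id}_N$. *)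

theory Defs
  imports
    "HOL-Algebra.Module"
    "HOL-Algebra.Ideal_Product"
    "HOL-Algebra.Elementary_Groups"
    "HOL-Algebra.Free_Abelian_Groups"
    "HOL-Library.Extended_Real"
begin

section \<open>Graded objects with a differential\<close>

text \<open>
  All objects are carried by a set together with its homogeneous components, so that
  M is the internal direct sum of the groups \<open>hcomp M i\<close>.  Only the additive part of the underlying
  ring record is meaningful for complexes and modules (the same convention as for the
  record \<^type>\<open>module\<close> of HOL-Algebra).
\<close>

record 'm dg_cx = "'m ring" +
  hcomp :: "int \<Rightarrow> 'm set"
  dif :: "'m \<Rightarrow> 'm"

record ('r, 'a) dg_alg = "'a dg_cx" +
  scal :: "'r \<Rightarrow> 'a \<Rightarrow> 'a"

text \<open>\<open>ract M x b\<close> is the right action \<open>x b\<close>.\<close>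

record ('b, 'm) dg_mod = "'m dg_cx" +
  ract :: "'m \<Rightarrow> 'b \<Rightarrow> 'm"

definition sg :: "int \<Rightarrow> int" where
  "sg n = (if even n then 1 else - 1)"

definition is_decomp :: "('m, 'z) dg_cx_scheme \<Rightarrow> 'm \<Rightarrow> (int \<Rightarrow> 'm) \<Rightarrow> bool" where
  "is_decomp M x c \<longleftrightarrow> (\<forall>i. c i \<in> hcomp M i) \<and> finite {i. c i \<noteq> \<zero>\<^bsub>M\<^esub>}
     \<and> x = (\<Oplus>\<^bsub>M\<^esub>i\<in>{i. c i \<noteq> \<zero>\<^bsub>M\<^esub>}. c i)"

definition hpart :: "('m, 'z) dg_cx_scheme \<Rightarrow> 'm \<Rightarrow> int \<Rightarrow> 'm" where
  "hpart M x = (THE c. is_decomp M x c)"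

definition hsupp :: "('m, 'z) dg_cx_scheme \<Rightarrow> 'm \<Rightarrow> int set" where
  "hsupp M x = {i. hpart M x i \<noteq> \<zero>\<^bsub>M\<^esub>}"

locale dg_complex = abelian_group M for M (structure) +
  assumes hcomp_subgroup: "subgroup (hcomp M i) (add_monoid M)"
    and direct_sum: "x \<in> carrier M \<Longrightarrow> \<exists>!c. is_decomp M x c"
    and dif_hom: "dif M \<in> hom (add_monoid M) (add_monoid M)"
    and dif_degree: "x \<in> hcomp M i \<Longrightarrow> dif M x \<in> hcomp M (i - 1)"
    and dif_dif: "x \<in> carrier M \<Longrightarrow> dif M (dif M x) = \<zero>\<^bsub>M\<^esub>"

text \<open>\<open>inf(M)\<close>, which is \<open>\<infinity>\<close> for \<open>M = 0\<close>.\<close>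

definition dg_inf :: "('m, 'z) dg_cx_scheme \<Rightarrow> ereal" where
  "dg_inf M = (INF i\<in>{i. hcomp M i \<noteq> {\<zero>\<^bsub>M\<^esub>}}. ereal (real_of_int i))"

definition bounded_below :: "('m, 'z) dg_cx_scheme \<Rightarrow> bool" where
  "bounded_below M \<longleftrightarrow> dg_inf M > - \<infinity>"

text \<open>
  The n-th homology group of the complex with components \<open>C i\<close> and differentials
  \<open>d i : C i \<rightarrow> C (i - 1)\<close>, where all components share the addition \<open>p\<close> and the zero \<open>z\<close>.
\<close>

definition homology ::
  "'x \<Rightarrow> ('x \<Rightarrow> 'x \<Rightarrow> 'x) \<Rightarrow> (int \<Rightarrow> 'x set) \<Rightarrow> (int \<Rightarrow> 'x \<Rightarrow> 'x) \<Rightarrow> int \<Rightarrow> 'x set monoid" where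
  "homology z p C d n =
     \<lparr>carrier = {x \<in> C n. d n x = z}, mult = p, one = z\<rparr> Mod (d (n + 1) ` C (n + 1))"

definition dg_homology :: "('m, 'z) dg_cx_scheme \<Rightarrow> int \<Rightarrow> 'm set monoid" where
  "dg_homology M n = homology \<zero>\<^bsub>M\<^esub> (add M) (hcomp M) (\<lambda>_. dif M) n"

section \<open>DG algebras\<close>

definition as_module :: "('r, 'a, 'z) dg_alg_scheme \<Rightarrow> ('r, 'a) module" where
  "as_module A = \<lparr>carrier = carrier A, mult = mult A, one = one A, ring.zero = \<zero>\<^bsub>A\<^esub>, add = add A,
     smult = scal A\<rparr>"

locale dg_algebra = R?: cring R + A?: ring A + A?: dg_complex A
  for R :: "('r, 'y) ring_scheme" (structure) and A :: "('r, 'a) dg_alg" (structure) +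
  assumes scal_module: "Module.module R (as_module A)"
    and scal_mult:
      "\<lbrakk>r \<in> carrier R; x \<in> carrier A; y \<in> carrier A\<rbrakk> \<Longrightarrow> scal A r (x \<otimes>\<^bsub>A\<^esub> y) = scal A r x \<otimes>\<^bsub>A\<^esub> y"
      "\<lbrakk>r \<in> carrier R; x \<in> carrier A; y \<in> carrier A\<rbrakk> \<Longrightarrow> scal A r (x \<otimes>\<^bsub>A\<^esub> y) = x \<otimes>\<^bsub>A\<^esub> scal A r y"
    and scal_degree: "\<lbrakk>r \<in> carrier R; x \<in> hcomp A i\<rbrakk> \<Longrightarrow> scal A r x \<in> hcomp A i"
    and one_degree: "\<one>\<^bsub>A\<^esub> \<in> hcomp A 0"
    and mult_degree: "\<lbrakk>x \<in> hcomp A i; y \<in> hcomp A j\<rbrakk> \<Longrightarrow> x \<otimes>\<^bsub>A\<^esub> y \<in> hcomp A (i + j)"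
    and nonneg: "i < 0 \<Longrightarrow> hcomp A i = {\<zero>\<^bsub>A\<^esub>}"
    and graded_comm:
      "\<lbrakk>x \<in> hcomp A i; y \<in> hcomp A j\<rbrakk> \<Longrightarrow> x \<otimes>\<^bsub>A\<^esub> y = [sg (i * j)] \<cdot>\<^bsub>A\<^esub> (y \<otimes>\<^bsub>A\<^esub> x)"
    and odd_square: "\<lbrakk>x \<in> hcomp A i; odd i\<rbrakk> \<Longrightarrow> x \<otimes>\<^bsub>A\<^esub> x = \<zero>\<^bsub>A\<^esub>"
    and dif_scal: "\<lbrakk>r \<in> carrier R; x \<in> carrier A\<rbrakk> \<Longrightarrow> dif A (scal A r x) = scal A r (dif A x)"
    and leibniz: "\<lbrakk>x \<in> hcomp A i; y \<in> hcomp A j\<rbrakk> \<Longrightarrow>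
      dif A (x \<otimes>\<^bsub>A\<^esub> y) = (dif A x \<otimes>\<^bsub>A\<^esub> y) \<oplus>\<^bsub>A\<^esub> [sg i] \<cdot>\<^bsub>A\<^esub> (x \<otimes>\<^bsub>A\<^esub> dif A y)"

definition dg_alg_hom ::
  "('r, 'y) ring_scheme \<Rightarrow> ('r, 'a) dg_alg \<Rightarrow> ('r, 'b) dg_alg \<Rightarrow> ('a \<Rightarrow> 'b) \<Rightarrow> bool" where
  "dg_alg_hom R A B \<phi> \<longleftrightarrow> \<phi> \<in> ring_hom A B
     \<and> (\<forall>r\<in>carrier R. \<forall>a\<in>carrier A. \<phi> (scal A r a) = scal B r (\<phi> a))
     \<and> (\<forall>i. \<phi> ` hcomp A i \<subseteq> hcomp B i)
     \<and> (\<forall>a\<in>carrier A. \<phi> (dif A a) = dif B (\<phi> a))"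

text \<open>The opposite algebra, on the same carrier: \<open>x\<^sup>o y\<^sup>o = (-1)\<^bsup>|x||y|\<^esup> (y x)\<^sup>o\<close>, extended biadditively.\<close>

definition dg_op :: "('r, 'b) dg_alg \<Rightarrow> ('r, 'b) dg_alg" where
  "dg_op B = \<lparr>carrier = carrier B,
     mult = (\<lambda>x y. \<Oplus>\<^bsub>B\<^esub>i\<in>hsupp B x. \<Oplus>\<^bsub>B\<^esub>j\<in>hsupp B y.
               [sg (i * j)] \<cdot>\<^bsub>B\<^esub> (hpart B y j \<otimes>\<^bsub>B\<^esub> hpart B x i)),
     one = one B, ring.zero = \<zero>\<^bsub>B\<^esub>, add = add B, hcomp = hcomp B, dif = dif B, scal = scal B\<rparr>"

section \<open>Right DG modules\<close>

locale dg_module = dg_complex N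
  for B :: "('r, 'b) dg_alg" and N :: "('b, 'n) dg_mod" (structure) +
  assumes ract_closed: "\<lbrakk>x \<in> carrier N; b \<in> carrier B\<rbrakk> \<Longrightarrow> ract N x b \<in> carrier N"
    and ract_add_left: "\<lbrakk>x \<in> carrier N; y \<in> carrier N; b \<in> carrier B\<rbrakk> \<Longrightarrow>
      ract N (x \<oplus>\<^bsub>N\<^esub> y) b = ract N x b \<oplus>\<^bsub>N\<^esub> ract N y b"
    and ract_add_right: "\<lbrakk>x \<in> carrier N; b \<in> carrier B; c \<in> carrier B\<rbrakk> \<Longrightarrow>
      ract N x (b \<oplus>\<^bsub>B\<^esub> c) = ract N x b \<oplus>\<^bsub>N\<^esub> ract N x c"
    and ract_mult: "\<lbrakk>x \<in> carrier N; b \<in> carrier B; c \<in> carrier B\<rbrakk> \<Longrightarrow>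
      ract N x (b \<otimes>\<^bsub>B\<^esub> c) = ract N (ract N x b) c"
    and ract_one: "x \<in> carrier N \<Longrightarrow> ract N x \<one>\<^bsub>B\<^esub> = x"
    and ract_degree: "\<lbrakk>x \<in> hcomp N i; b \<in> hcomp B j\<rbrakk> \<Longrightarrow> ract N x b \<in> hcomp N (i + j)"
    and ract_leibniz: "\<lbrakk>x \<in> hcomp N i; b \<in> hcomp B j\<rbrakk> \<Longrightarrow>
      dif N (ract N x b) = ract N (dif N x) b \<oplus>\<^bsub>N\<^esub> [sg i] \<cdot>\<^bsub>N\<^esub> (ract N x (dif B b))"

definition dg_regular :: "('r, 'b) dg_alg \<Rightarrow> ('b, 'b) dg_mod" where
  "dg_regular B = \<lparr>carrier = carrier B, mult = mult B, one = one B, ring.zero = \<zero>\<^bsub>B\<^esub>, add = add B,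
     hcomp = hcomp B, dif = dif B, ract = mult B\<rparr>"

definition dg_restrict :: "('a \<Rightarrow> 'b) \<Rightarrow> ('b, 'n) dg_mod \<Rightarrow> ('a, 'n) dg_mod" where
  "dg_restrict h N = \<lparr>carrier = carrier N, mult = mult N, one = one N, ring.zero = \<zero>\<^bsub>N\<^esub>, add = add N,
     hcomp = hcomp N, dif = dif N, ract = (\<lambda>x a. ract N x (h a))\<rparr>"

definition dg_hom ::
  "('r, 'b) dg_alg \<Rightarrow> ('b, 'm) dg_mod \<Rightarrow> ('b, 'n) dg_mod \<Rightarrow> ('m \<Rightarrow> 'n) \<Rightarrow> bool" where
  "dg_hom B M N f \<longleftrightarrow> f \<in> hom (add_monoid M) (add_monoid N)
     \<and> (\<forall>x\<in>carrier M. \<forall>b\<in>carrier B. f (ract M x b) = ract N (f x) b)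
     \<and> (\<forall>i. f ` hcomp M i \<subseteq> hcomp N i)
     \<and> (\<forall>x\<in>carrier M. f (dif M x) = dif N (f x))"

definition dg_iso ::
  "('r, 'b) dg_alg \<Rightarrow> ('b, 'm) dg_mod \<Rightarrow> ('b, 'n) dg_mod \<Rightarrow> ('m \<Rightarrow> 'n) \<Rightarrow> bool" where
  "dg_iso B M N f \<longleftrightarrow> dg_hom B M N f \<and> bij_betw f (carrier M) (carrier N)"

definition dg_submodule :: "('r, 'b) dg_alg \<Rightarrow> ('b, 'm) dg_mod \<Rightarrow> 'm set \<Rightarrow> bool" where
  "dg_submodule B M S \<longleftrightarrow> subgroup S (add_monoid M)
     \<and> (\<forall>x\<in>S. \<forall>b\<in>carrier B. ract M x b \<in> S)
     \<and> (\<forall>x\<in>S. \<forall>i. hpart M x i \<in> S)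
     \<and> (\<forall>x\<in>S. dif M x \<in> S)"

definition dg_sub :: "('b, 'm) dg_mod \<Rightarrow> 'm set \<Rightarrow> ('b, 'm) dg_mod" where
  "dg_sub M S = M\<lparr>carrier := S, hcomp := (\<lambda>i. hcomp M i \<inter> S)\<rparr>"

definition dg_quot :: "('b, 'm) dg_mod \<Rightarrow> 'm set \<Rightarrow> ('b, 'm set) dg_mod" where
  "dg_quot M S = \<lparr>carrier = a_rcosets\<^bsub>M\<^esub> S, mult = undefined, one = undefined,
     ring.zero = S, add = set_add M,
     hcomp = (\<lambda>i. (\<lambda>x. S +>\<^bsub>M\<^esub> x) ` hcomp M i),
     dif = (\<lambda>X. S <+>\<^bsub>M\<^esub> (dif M ` X)),
     ract = (\<lambda>X b. S <+>\<^bsub>M\<^esub> ((\<lambda>x. ract M x b) ` X))\<rparr>"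

text \<open>N is isomorphic to a submodule of X that has a complement.\<close>

definition dg_direct_summand :: "('r, 'b) dg_alg \<Rightarrow> ('b, 'n) dg_mod \<Rightarrow> ('b, 'x) dg_mod \<Rightarrow> bool" where
  "dg_direct_summand B N X \<longleftrightarrow> (\<exists>S S'. dg_submodule B X S \<and> dg_submodule B X S'
     \<and> S \<inter> S' = {\<zero>\<^bsub>X\<^esub>} \<and> S <+>\<^bsub>X\<^esub> S' = carrier X \<and> (\<exists>f. dg_iso B N (dg_sub X S) f))"

subsection \<open>Bases\<close>

definition rspan :: "('r, 'b) dg_alg \<Rightarrow> ('b, 'n) dg_mod \<Rightarrow> 'n set \<Rightarrow> 'n set" where
  "rspan B N E = {(\<Oplus>\<^bsub>N\<^esub>e\<in>T. ract N e (c e)) | T c. finite T \<and> T \<subseteq> E \<and> c ` T \<subseteq> carrier B}"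

definition graded_basis :: "('r, 'b) dg_alg \<Rightarrow> ('b, 'n) dg_mod \<Rightarrow> 'n set \<Rightarrow> bool" where
  "graded_basis B N F \<longleftrightarrow> F \<subseteq> (\<Union>i. hcomp N i) \<and> rspan B N F = carrier N
     \<and> (\<forall>T c. finite T \<and> T \<subseteq> F \<and> c ` T \<subseteq> carrier B \<and> (\<Oplus>\<^bsub>N\<^esub>e\<in>T. ract N e (c e)) = \<zero>\<^bsub>N\<^esub>
          \<longrightarrow> (\<forall>e\<in>T. c e = \<zero>\<^bsub>B\<^esub>))"

definition semifree_basis :: "('r, 'b) dg_alg \<Rightarrow> ('b, 'n) dg_mod \<Rightarrow> 'n set \<Rightarrow> 'n rel \<Rightarrow> bool" where
  "semifree_basis B N F r \<longleftrightarrow> well_order_on F r \<and> graded_basis B N F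
     \<and> (\<forall>f\<in>F. dif N f \<in> rspan B N {e \<in> F. (e, f) \<in> r \<and> e \<noteq> f})"

definition semifree :: "('r, 'b) dg_alg \<Rightarrow> ('b, 'n) dg_mod \<Rightarrow> bool" where
  "semifree B N \<longleftrightarrow> (\<exists>F r. semifree_basis B N F r)"

definition finite_semifree :: "('r, 'b) dg_alg \<Rightarrow> ('b, 'n) dg_mod \<Rightarrow> bool" where
  "finite_semifree B N \<longleftrightarrow> (\<exists>F r. finite F \<and> semifree_basis B N F r)"

subsection \<open>Ext\<close>

text \<open>
  The complex \<open>Hom\<^sub>B(N, L)\<close>: in degree n the B-linear maps of degree n (functions on the carrier
  of N), with differential \<open>\<partial> f = d\<^sup>L f - (-1)\<^sup>n f d\<^sup>N\<close>.
\<close>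

definition Hom_comp ::
  "('r, 'b) dg_alg \<Rightarrow> ('b, 'n) dg_mod \<Rightarrow> ('b, 'l) dg_mod \<Rightarrow> int \<Rightarrow> ('n \<Rightarrow> 'l) set" where
  "Hom_comp B N L n = {f \<in> extensional (carrier N). f \<in> hom (add_monoid N) (add_monoid L)
     \<and> (\<forall>x\<in>carrier N. \<forall>b\<in>carrier B. f (ract N x b) = ract L (f x) b)
     \<and> (\<forall>i. f ` hcomp N i \<subseteq> hcomp L (i + n))}"

definition Hom_dif ::
  "('b, 'n) dg_mod \<Rightarrow> ('b, 'l) dg_mod \<Rightarrow> int \<Rightarrow> ('n \<Rightarrow> 'l) \<Rightarrow> ('n \<Rightarrow> 'l)" where
  "Hom_dif N L n f = (\<lambda>x\<in>carrier N. dif L (f x) \<ominus>\<^bsub>L\<^esub> [sg n] \<cdot>\<^bsub>L\<^esub> f (dif N x))"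

text \<open>This is Ext for semifree N.\<close>

definition Ext ::
  "('r, 'b) dg_alg \<Rightarrow> int \<Rightarrow> ('b, 'n) dg_mod \<Rightarrow> ('b, 'l) dg_mod \<Rightarrow> ('n \<Rightarrow> 'l) set monoid" where
  "Ext B i N L = homology (\<lambda>x\<in>carrier N. \<zero>\<^bsub>L\<^esub>) (\<lambda>f g. \<lambda>x\<in>carrier N. f x \<oplus>\<^bsub>L\<^esub> g x)
     (Hom_comp B N L) (Hom_dif N L) (- i)"

section \<open>Tensor products\<close>

text \<open>
  \<open>M \<otimes>\<^sub>A B\<close> for a right A-module M, with B a left A-module via \<open>\<phi>\<close>, is the free abelian
  group on all pairs modulo \<open>tens_rel\<close>.  Additive maps are given on generators
  and passed to cosets by \<open>tens_map\<close> (into the same quotient) and \<open>tens_eval\<close> (into an abelian group).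
\<close>

inductive_set tens_rel ::
  "('r, 'a) dg_alg \<Rightarrow> ('a, 'm) dg_mod \<Rightarrow> ('a \<Rightarrow> 'b) \<Rightarrow> ('r, 'b) dg_alg \<Rightarrow> ('m \<times> 'b \<Rightarrow>\<^sub>0 int) set"
  for A M \<phi> B where
    zero: "0 \<in> tens_rel A M \<phi> B"
  | diff: "\<lbrakk>u \<in> tens_rel A M \<phi> B; v \<in> tens_rel A M \<phi> B\<rbrakk> \<Longrightarrow> u - v \<in> tens_rel A M \<phi> B"
  | add_left: "\<lbrakk>x \<in> carrier M; y \<in> carrier M; b \<in> carrier B\<rbrakk> \<Longrightarrow>
      frag_of (x \<oplus>\<^bsub>M\<^esub> y, b) - frag_of (x, b) - frag_of (y, b) \<in> tens_rel A M \<phi> B"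
  | add_right: "\<lbrakk>x \<in> carrier M; b \<in> carrier B; c \<in> carrier B\<rbrakk> \<Longrightarrow>
      frag_of (x, b \<oplus>\<^bsub>B\<^esub> c) - frag_of (x, b) - frag_of (x, c) \<in> tens_rel A M \<phi> B"
  | balanced: "\<lbrakk>x \<in> carrier M; a \<in> carrier A; b \<in> carrier B\<rbrakk> \<Longrightarrow>
      frag_of (ract M x a, b) - frag_of (x, \<phi> a \<otimes>\<^bsub>B\<^esub> b) \<in> tens_rel A M \<phi> B"

definition tens_grp ::
  "('r, 'a) dg_alg \<Rightarrow> ('a, 'm) dg_mod \<Rightarrow> ('a \<Rightarrow> 'b) \<Rightarrow> ('r, 'b) dg_alg \<Rightarrow> ('m \<times> 'b \<Rightarrow>\<^sub>0 int) set monoid" where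
  "tens_grp A M \<phi> B = free_Abelian_group (carrier M \<times> carrier B) Mod tens_rel A M \<phi> B"

definition tens_map :: "('p \<Rightarrow>\<^sub>0 int) set \<Rightarrow> ('p \<Rightarrow> 'p \<Rightarrow>\<^sub>0 int) \<Rightarrow> ('p \<Rightarrow>\<^sub>0 int) set \<Rightarrow> ('p \<Rightarrow>\<^sub>0 int) set" where
  "tens_map T h X = {t + frag_extend h u | t u. t \<in> T \<and> u \<in> X}"

definition tens_eval :: "('n, 'z) ring_scheme \<Rightarrow> ('p \<Rightarrow> 'n) \<Rightarrow> ('p \<Rightarrow>\<^sub>0 int) set \<Rightarrow> 'n" where
  "tens_eval N h X =
     the_elem ((\<lambda>u. \<Oplus>\<^bsub>N\<^esub>p\<in>Poly_Mapping.keys u. [Poly_Mapping.lookup u p] \<cdot>\<^bsub>N\<^esub> h p) ` X)"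

text \<open>Degree n part: sums of \<open>x \<otimes> b\<close> with x and b homogeneous and \<open>|x| + |b| = n\<close>.\<close>

definition tens_comp ::
  "('r, 'a) dg_alg \<Rightarrow> ('a, 'm) dg_mod \<Rightarrow> ('a \<Rightarrow> 'b) \<Rightarrow> ('r, 'b) dg_alg \<Rightarrow> int \<Rightarrow> ('m \<times> 'b \<Rightarrow>\<^sub>0 int) set set" where
  "tens_comp A M \<phi> B n =
     (\<lambda>u. tens_rel A M \<phi> B #>\<^bsub>free_Abelian_group (carrier M \<times> carrier B)\<^esub> u)
       ` {u. Poly_Mapping.keys u \<subseteq> (\<Union>i. hcomp M i \<times> hcomp B (n - i))}"

text \<open>\<open>d(x \<otimes> b) = d x \<otimes> b + (-1)\<^bsup>|x|\<^esup> x \<otimes> d b\<close>, extended additively to inhomogeneous x.\<close>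

definition tens_dif ::
  "('r, 'a) dg_alg \<Rightarrow> ('a, 'm) dg_mod \<Rightarrow> ('a \<Rightarrow> 'b) \<Rightarrow> ('r, 'b) dg_alg
     \<Rightarrow> ('m \<times> 'b \<Rightarrow>\<^sub>0 int) set \<Rightarrow> ('m \<times> 'b \<Rightarrow>\<^sub>0 int) set" where
  "tens_dif A M \<phi> B = tens_map (tens_rel A M \<phi> B)
     (\<lambda>(x, b). frag_of (dif M x, b) + (\<Sum>i\<in>hsupp M x. frag_cmul (sg i) (frag_of (hpart M x i, dif B b))))"

definition dg_tensor ::
  "('r, 'a) dg_alg \<Rightarrow> ('a, 'm) dg_mod \<Rightarrow> ('a \<Rightarrow> 'b) \<Rightarrow> ('r, 'b) dg_alg
     \<Rightarrow> ('b, ('m \<times> 'b \<Rightarrow>\<^sub>0 int) set) dg_mod" where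
  "dg_tensor A M \<phi> B = \<lparr>carrier = carrier (tens_grp A M \<phi> B), mult = undefined, one = undefined,
     ring.zero = \<one>\<^bsub>tens_grp A M \<phi> B\<^esub>, add = mult (tens_grp A M \<phi> B),
     hcomp = tens_comp A M \<phi> B, dif = tens_dif A M \<phi> B,
     ract = (\<lambda>X c. tens_map (tens_rel A M \<phi> B) (\<lambda>(x, b). frag_of (x, b \<otimes>\<^bsub>B\<^esub> c)) X)\<rparr>"

text \<open>
  The tensor product \<open>C \<otimes>\<^sub>A B\<close> of algebras along \<open>\<psi> : A \<rightarrow> C\<close> and \<open>\<phi> : A \<rightarrow> B\<close>, with
  \<open>(x \<otimes> y) (x' \<otimes> y') = (-1)\<^bsup>|x'||y|\<^esup> x x' \<otimes> y y'\<close>.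
\<close>

definition dg_tensor_mult_gen ::
  "('r, 'c) dg_alg \<Rightarrow> ('r, 'b) dg_alg \<Rightarrow> 'c \<times> 'b \<Rightarrow> 'c \<times> 'b \<Rightarrow> ('c \<times> 'b \<Rightarrow>\<^sub>0 int)" where
  "dg_tensor_mult_gen C B = (\<lambda>(x, y) (x', y'). \<Sum>i\<in>hsupp C x'. \<Sum>j\<in>hsupp B y.
     frag_cmul (sg (i * j)) (frag_of (x \<otimes>\<^bsub>C\<^esub> hpart C x' i, hpart B y j \<otimes>\<^bsub>B\<^esub> y')))"

definition dg_tensor_alg ::
  "('r, 'a) dg_alg \<Rightarrow> ('a \<Rightarrow> 'c) \<Rightarrow> ('r, 'c) dg_alg \<Rightarrow> ('a \<Rightarrow> 'b) \<Rightarrow> ('r, 'b) dg_alg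
     \<Rightarrow> ('r, ('c \<times> 'b \<Rightarrow>\<^sub>0 int) set) dg_alg" where
  "dg_tensor_alg A \<psi> C \<phi> B =
    (let M = dg_restrict \<psi> (dg_regular C); T = tens_rel A M \<phi> B; G = tens_grp A M \<phi> B in
     \<lparr>carrier = carrier G,
      mult = (\<lambda>X Y. {t + frag_extend (\<lambda>p. frag_extend (dg_tensor_mult_gen C B p) v) u
                      | t u v. t \<in> T \<and> u \<in> X \<and> v \<in> Y}),
      one = T #>\<^bsub>free_Abelian_group (carrier C \<times> carrier B)\<^esub> frag_of (\<one>\<^bsub>C\<^esub>, \<one>\<^bsub>B\<^esub>),
      ring.zero = \<one>\<^bsub>G\<^esub>, add = mult G,
      hcomp = tens_comp A M \<phi> B, dif = tens_dif A M \<phi> B,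
      scal = (\<lambda>r. tens_map T (\<lambda>(x, y). frag_of (scal C r x, y)))\<rparr>)"

section \<open>Diagonal ideal and DG smoothness\<close>

definition enveloping ::
  "('r, 'a) dg_alg \<Rightarrow> ('a \<Rightarrow> 'b) \<Rightarrow> ('r, 'b) dg_alg \<Rightarrow> ('r, ('b \<times> 'b \<Rightarrow>\<^sub>0 int) set) dg_alg" where
  "enveloping A \<phi> B = dg_tensor_alg A \<phi> (dg_op B) \<phi> B"

definition pi_alg :: "('r, 'b) dg_alg \<Rightarrow> ('b \<times> 'b \<Rightarrow>\<^sub>0 int) set \<Rightarrow> 'b" where
  "pi_alg B = tens_eval B (\<lambda>(x, y). x \<otimes>\<^bsub>B\<^esub> y)"

definition diagonal_ideal ::
  "('r, 'a) dg_alg \<Rightarrow> ('a \<Rightarrow> 'b) \<Rightarrow> ('r, 'b) dg_alg \<Rightarrow> ('b \<times> 'b \<Rightarrow>\<^sub>0 int) set set" where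
  "diagonal_ideal A \<phi> B = a_kernel (enveloping A \<phi> B) B (pi_alg B)"

text \<open>
  The quotient \<open>I/I'\<close> of DG \<open>B\<^sup>e\<close>-submodules of \<open>B\<^sup>e\<close>, where \<open>I J \<subseteq> I'\<close>, as a DG B-module via \<open>B \<cong> B\<^sup>e/J\<close>:
  an element b acts through an arbitrary preimage under \<open>\<pi>\<^sub>B\<close>.
\<close>

definition subquotient ::
  "('r, 'a) dg_alg \<Rightarrow> ('a \<Rightarrow> 'b) \<Rightarrow> ('r, 'b) dg_alg \<Rightarrow> ('b \<times> 'b \<Rightarrow>\<^sub>0 int) set set
     \<Rightarrow> ('b \<times> 'b \<Rightarrow>\<^sub>0 int) set set \<Rightarrow> ('b, ('b \<times> 'b \<Rightarrow>\<^sub>0 int) set set) dg_mod" where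
  "subquotient A \<phi> B I I' =
     dg_restrict (\<lambda>b. SOME z. z \<in> carrier (enveloping A \<phi> B) \<and> pi_alg B z = b)
       (dg_quot (dg_sub (dg_regular (enveloping A \<phi> B)) I) I')"

definition diagonal_filtration ::
  "('r, 'a) dg_alg \<Rightarrow> ('a \<Rightarrow> 'b) \<Rightarrow> ('r, 'b) dg_alg \<Rightarrow> (nat \<Rightarrow> ('b \<times> 'b \<Rightarrow>\<^sub>0 int) set set) \<Rightarrow> bool" where
  "diagonal_filtration A \<phi> B Jf \<longleftrightarrow>
    (let E = enveloping A \<phi> B; J = diagonal_ideal A \<phi> B in
     Jf 1 = J \<and>
     (\<forall>l\<ge>1. dg_submodule E (dg_regular E) (Jf l) \<and> Jf (l + 1) \<subseteq> Jf l
        \<and> ideal_prod E J (Jf l) <+>\<^bsub>E\<^esub> ideal_prod E (Jf l) J \<subseteq> Jf (l + 1)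
        \<and> dg_inf (dg_sub (dg_regular E) (Jf l)) \<ge> ereal (real l)))"

definition graded_free :: "('r, 'a) dg_alg \<Rightarrow> ('a \<Rightarrow> 'b) \<Rightarrow> ('r, 'b) dg_alg \<Rightarrow> bool" where
  "graded_free A \<phi> B \<longleftrightarrow> (\<exists>F. graded_basis A (dg_restrict \<phi> (dg_regular B)) F)"

definition dg_quasi_smooth :: "('r, 'a) dg_alg \<Rightarrow> ('a \<Rightarrow> 'b) \<Rightarrow> ('r, 'b) dg_alg \<Rightarrow> bool" where
  "dg_quasi_smooth A \<phi> B \<longleftrightarrow> graded_free A \<phi> B \<and>
     (\<exists>Jf. diagonal_filtration A \<phi> B Jf \<and>
        (\<forall>l\<ge>1. semifree B (subquotient A \<phi> B (Jf l) (Jf (l + 1)))))"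

definition dg_smooth :: "('r, 'a) dg_alg \<Rightarrow> ('a \<Rightarrow> 'b) \<Rightarrow> ('r, 'b) dg_alg \<Rightarrow> bool" where
  "dg_smooth A \<phi> B \<longleftrightarrow> graded_free A \<phi> B \<and>
     (\<exists>Jf. diagonal_filtration A \<phi> B Jf \<and>
        (\<forall>l\<ge>1. finite_semifree B (subquotient A \<phi> B (Jf l) (Jf (l + 1)))))"

section \<open>Liftings\<close>

definition quasi_iso ::
  "('r, 'b) dg_alg \<Rightarrow> ('b, 'm) dg_mod \<Rightarrow> ('b, 'n) dg_mod \<Rightarrow> ('m \<Rightarrow> 'n) \<Rightarrow> bool" where
  "quasi_iso B M N f \<longleftrightarrow> dg_hom B M N f \<and>
     (\<forall>n. (\<lambda>X. (dif N ` hcomp N (n + 1)) <+>\<^bsub>N\<^esub> (f ` X)) \<in> iso (dg_homology M n) (dg_homology N n))"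

text \<open>
  Existential quantifiers over DG modules have to range over a fixed type.  The type below has
  at least \<open>2\<^sup>\<kappa>\<close> elements, where \<open>\<kappa>\<close> is the maximum of \<open>\<aleph>\<^sub>0\<close> and the cardinalities of the
  types of A, B and the given module X.  This suffices for modules of cardinality at most \<open>\<kappa>\<close>;
  in particular semifree resolutions of X over B can be found in it, and if \<open>X\<close> is isomorphic to
  \<open>P \<otimes>\<^sub>A B\<close> in the derived category for some semifree P of any size, then P can be replaced by a
  semifree submodule of cardinality at most \<open>\<kappa>\<close> spanned by part of the semifree basis.
\<close>

type_synonym ('a, 'b, 'x) universe = "(nat \<times> 'a \<times> 'b \<times> 'x) set"

text \<open>
  Isomorphism in the derived category (the localization of the category of DG B-modules at
  the quasi-isomorphisms), by calculus of fractions: a morphism X to Y is represented by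
  a roof of homomorphisms \<open>X \<leftarrow> Z \<rightarrow> Y\<close> whose left leg is a quasi-isomorphism, and it is
  invertible iff the right leg is a quasi-isomorphism as well.  The first argument
  determines the type of Z.
\<close>

definition derived_iso ::
  "'z itself \<Rightarrow> ('r, 'b) dg_alg \<Rightarrow> ('b, 'x) dg_mod \<Rightarrow> ('b, 'y) dg_mod \<Rightarrow> bool" where
  "derived_iso (_ :: 'z itself) B X Y \<longleftrightarrow>
     (\<exists>(Z :: ('b, 'z) dg_mod) f g. dg_module B Z \<and> quasi_iso B Z X f \<and> quasi_iso B Z Y g)"

text \<open>The derived tensor product \<open>M \<otimes>\<^sup>L\<^sub>A B\<close> is \<open>P \<otimes>\<^sub>A B\<close> for a semifree resolution \<open>P \<rightarrow> M\<close>.\<close>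

definition liftable :: "('r, 'a) dg_alg \<Rightarrow> ('a \<Rightarrow> 'b) \<Rightarrow> ('r, 'b) dg_alg \<Rightarrow> ('b, 'x) dg_mod \<Rightarrow> bool" where
  "liftable A \<phi> B X \<longleftrightarrow>
     (\<exists>(M :: ('a, ('a, 'b, 'x) universe) dg_mod) (P :: ('a, ('a, 'b, 'x) universe) dg_mod) q.
        dg_module A M \<and> dg_module A P \<and> semifree A P \<and> quasi_iso A P M q
        \<and> derived_iso TYPE(('a, 'b, 'x) universe) B X (dg_tensor A P \<phi> B))"

definition pi_mod :: "('b, 'n) dg_mod \<Rightarrow> ('n \<times> 'b \<Rightarrow>\<^sub>0 int) set \<Rightarrow> 'n" where
  "pi_mod N = tens_eval N (\<lambda>(x, b). ract N x b)"

definition naively_liftable :: "('r, 'a) dg_alg \<Rightarrow> ('a \<Rightarrow> 'b) \<Rightarrow> ('r, 'b) dg_alg \<Rightarrow> ('b, 'n) dg_mod \<Rightarrow> bool" where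
  "naively_liftable A \<phi> B N \<longleftrightarrow>
     (\<exists>\<rho>. dg_hom B N (dg_tensor A (dg_restrict \<phi> N) \<phi> B) \<rho> \<and> (\<forall>x\<in>carrier N. pi_mod N (\<rho> x) = x))"

end

theory Submission imports Defs begin

text \<open>
  Consider the DG B-module \<open>T = N \<otimes>\<^sub>A B\<close> and the epimorphism \<open>\<pi>\<^sub>N : T \<rightarrow> N\<close>.  As N is free as a graded
  module, \<open>\<pi>\<^sub>N\<close> has a B-linear section of degree 0, which sends a basis element f to \<open>f \<otimes> 1\<close>.  Its
  failure to commute with the differentials is a cocycle of degree -1 in \<open>Hom\<^sub>B(N, ker \<pi>\<^sub>N)\<close>, and the task is
  to make it vanish by changing the section by maps into the kernel.

  The kernel is \<open>N \<otimes>\<^sub>B J\<close> (lemma \<open>pi_mod_kernel\<close>), and it is filtered by the submodules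
  \<open>N \<otimes>\<^sub>B J\<^bsup>[l]\<^esup>\<close>. The finite semifree basis of \<open>J\<^bsup>[l]\<^esup>/J\<^bsup>[l+1]\<^esup>\<close> refines each step of this filtration: adding
  the basis elements in increasing order gives finitely many steps whose subquotients are free of
  rank one over B, on an element of some degree \<open>n \<ge> l\<close>.  Tensoring such a subquotient with N gives a
  copy of N shifted by n.  So the class of the cocycle in one step lies in a group isomorphic to
  \<open>Ext\<^sup>n\<^sup>+\<^sup>1(N, N) = 0\<close>, and a correction of the section moves the cocycle into the next step
  (lemmas \<open>cocycles_reduce_step\<close> and \<open>cocycles_reduce_filtration\<close>).  Since N is bounded below and
  \<open>J\<^bsup>[l]\<^esup>\<close> begins in degree l, only finitely many corrections act on elements of a given degree. The corrected
  sections therefore converge, and the limit commutes with the differentials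
  (lemma \<open>cocycles_reduce_limit\<close>).

  This splitting makes N a direct summand of T.  To see that T is liftable, note that N is free as a graded
  A-module, on the products of the elements of a B-basis of N and an A-basis of B.  It is bounded below
  and A lives in non-negative degrees, so that this basis, ordered by degree, is a semifree basis
  (lemmas \<open>restrict_basis\<close> and \<open>semifree_bounded_below\<close>).  Hence T is the derived tensor product of N with B.

  Two facts about the enveloping algebra enter.  As B is graded commutative, \<open>B\<^sup>e\<close> is
  \<open>B \<otimes>\<^sub>A B\<close> as a complex; and as \<open>c \<otimes> 1 - 1 \<otimes> c\<close> lies in J, the left and the right action of B agree up to
  sign on the subquotients of the filtration (lemma \<open>filtration_comm\<close>).
\<close>

section \<open>Additive maps and graded groups\<close>

abbreviation addhom :: "('m, 'y) ring_scheme \<Rightarrow> ('n, 'z) ring_scheme \<Rightarrow> ('m \<Rightarrow> 'n) \<Rightarrow> bool" where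
  "addhom M N f \<equiv> f \<in> hom (add_monoid M) (add_monoid N)"

lemma addhomI:
  assumes "\<And>x. x \<in> carrier M \<Longrightarrow> f x \<in> carrier N"
    and "\<And>x y. x \<in> carrier M \<Longrightarrow> y \<in> carrier M \<Longrightarrow> f (x \<oplus>\<^bsub>M\<^esub> y) = f x \<oplus>\<^bsub>N\<^esub> f y"
  shows "addhom M N f"
  using assms by (auto simp: hom_def)

lemma addhom_closed: "addhom M N f \<Longrightarrow> x \<in> carrier M \<Longrightarrow> f x \<in> carrier N"
  by (auto simp: hom_def)

lemma addhom_add: "addhom M N f \<Longrightarrow> x \<in> carrier M \<Longrightarrow> y \<in> carrier M \<Longrightarrow>
    f (x \<oplus>\<^bsub>M\<^esub> y) = f x \<oplus>\<^bsub>N\<^esub> f y"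
  by (auto simp: hom_def)

lemma abelian_group_homI':
  assumes "abelian_group M" "abelian_group N" "addhom M N f"
  shows "abelian_group_hom M N f"
  using assms by (intro abelian_group_homI) (auto simp: abelian_group.a_group group_hom_def group_hom_axioms_def)

lemma addhom_zero:
  assumes "abelian_group M" "abelian_group N" "addhom M N f"
  shows "f \<zero>\<^bsub>M\<^esub> = \<zero>\<^bsub>N\<^esub>"
  by (rule abelian_group_hom.hom_zero[OF abelian_group_homI'[OF assms]])

lemma addhom_minus:
  assumes "abelian_group M" "abelian_group N" "addhom M N f" "x \<in> carrier M"
  shows "f (\<ominus>\<^bsub>M\<^esub> x) = \<ominus>\<^bsub>N\<^esub> f x"
  using abelian_group_hom.hom_a_inv[OF abelian_group_homI'[OF assms(1-3)]] assms(4) by auto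

lemma addhom_diff:
  assumes "abelian_group M" "abelian_group N" "addhom M N f" "x \<in> carrier M" "y \<in> carrier M"
  shows "f (x \<ominus>\<^bsub>M\<^esub> y) = f x \<ominus>\<^bsub>N\<^esub> f y"
  by (simp add: a_minus_def addhom_add[OF assms(3)] addhom_minus[OF assms(1-3)] assms
      abelian_group.a_inv_closed)

lemma addhom_finsum:
  assumes "abelian_group M" "abelian_group N" "addhom M N f" "finite S"
    and "\<And>i. i \<in> S \<Longrightarrow> c i \<in> carrier M"
  shows "f (\<Oplus>\<^bsub>M\<^esub>i\<in>S. c i) = (\<Oplus>\<^bsub>N\<^esub>i\<in>S. f (c i))"
proof -
  interpret M: abelian_group M by fact
  interpret N: abelian_group N by fact
  show ?thesis
    using assms(4,5)
  proof (induction S rule: finite_induct)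
    case empty
    then show ?case using addhom_zero[OF assms(1-3)] by simp
  next
    case (insert a S)
    have "f (\<Oplus>\<^bsub>M\<^esub>i\<in>insert a S. c i) = f (c a \<oplus>\<^bsub>M\<^esub> (\<Oplus>\<^bsub>M\<^esub>i\<in>S. c i))"
      using insert by (subst M.finsum_insert) auto
    also have "\<dots> = f (c a) \<oplus>\<^bsub>N\<^esub> (\<Oplus>\<^bsub>N\<^esub>i\<in>S. f (c i))"
      using insert by (subst addhom_add[OF assms(3)]) (auto intro!: M.finsum_closed)
    also have "\<dots> = (\<Oplus>\<^bsub>N\<^esub>i\<in>insert a S. f (c i))"
      using insert by (subst N.finsum_insert) (auto intro!: addhom_closed[OF assms(3)])
    finally show ?case .
  qed
qed

lemma addhom_compose:
  "addhom M N f \<Longrightarrow> addhom N L g \<Longrightarrow> addhom M L (\<lambda>x. g (f x))"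
  by (rule addhomI) (simp_all add: addhom_closed addhom_add)

lemma addhom_id: "addhom M M (\<lambda>x. x)"
  by (auto simp: hom_def)

lemma addhom_const_zero: "abelian_group N \<Longrightarrow> addhom M N (\<lambda>x. \<zero>\<^bsub>N\<^esub>)"
  by (auto simp: hom_def abelian_group.axioms abelian_monoid.zero_closed abelian_monoid.l_zero)

text \<open>The sign \<open>(-1)\<^sup>n\<close> as a conditional negation. The integer multiples in the Leibniz rule are
  converted to this form, in which composing signs adds exponents.\<close>

definition sgs :: "('m, 'z) ring_scheme \<Rightarrow> int \<Rightarrow> 'm \<Rightarrow> 'm" where
  "sgs M n x = (if even n then x else \<ominus>\<^bsub>M\<^esub> x)"

context abelian_group
begin

lemma sg_add_pow: "x \<in> carrier G \<Longrightarrow> [sg n] \<cdot> x = sgs G n x"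
  using add.int_pow_1[of x] add.int_pow_neg[of x 1] by (auto simp: sg_def sgs_def)

lemma sgs_closed [simp]: "x \<in> carrier G \<Longrightarrow> sgs G n x \<in> carrier G"
  by (auto simp: sgs_def)

lemma sgs_add: "x \<in> carrier G \<Longrightarrow> y \<in> carrier G \<Longrightarrow> sgs G n (x \<oplus> y) = sgs G n x \<oplus> sgs G n y"
  by (auto simp: sgs_def minus_add)

lemma sgs_sgs: "x \<in> carrier G \<Longrightarrow> sgs G m (sgs G n x) = sgs G (m + n) x"
  by (auto simp: sgs_def)

lemma sgs_zero [simp]: "sgs G n \<zero> = \<zero>"
  by (auto simp: sgs_def)

lemma sgs_hom: "addhom G G (sgs G n)"
  by (rule addhomI) (auto simp: sgs_add)

lemma sgs_subgroup: "subgroup H (add_monoid G) \<Longrightarrow> x \<in> H \<Longrightarrow> sgs G n x \<in> H"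
  using subgroup.m_inv_closed[of H "add_monoid G" x] by (auto simp: sgs_def a_inv_def)

lemma minus_eq_zeroD:
  assumes "x \<in> carrier G" "y \<in> carrier G" "x \<ominus> y = \<zero>"
  shows "x = y"
proof -
  have "x = (x \<ominus> y) \<oplus> y" using assms(1,2) by (simp add: a_minus_def a_assoc l_neg)
  then show ?thesis using assms by simp
qed

lemma add_diff_cancel: "x \<in> carrier G \<Longrightarrow> y \<in> carrier G \<Longrightarrow> (x \<ominus> y) \<oplus> y = x"
  by (simp add: a_minus_def a_assoc l_neg)

lemma subgroup_add: "subgroup H (add_monoid G) \<Longrightarrow> x \<in> H \<Longrightarrow> y \<in> H \<Longrightarrow> x \<oplus> y \<in> H"
  using subgroup.m_closed[of H "add_monoid G"] by auto

lemma subgroup_zero: "subgroup H (add_monoid G) \<Longrightarrow> \<zero> \<in> H"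
  using subgroup.one_closed[of H "add_monoid G"] by auto

lemma subgroup_neg: "subgroup H (add_monoid G) \<Longrightarrow> x \<in> H \<Longrightarrow> \<ominus> x \<in> H"
  using subgroup.m_inv_closed[of H "add_monoid G" x] by (auto simp: a_inv_def)

lemma subgroup_diff: "subgroup H (add_monoid G) \<Longrightarrow> x \<in> H \<Longrightarrow> y \<in> H \<Longrightarrow> x \<ominus> y \<in> H"
  by (simp add: a_minus_def subgroup_add subgroup_neg)

lemma subgroup_carrier: "subgroup H (add_monoid G) \<Longrightarrow> x \<in> H \<Longrightarrow> x \<in> carrier G"
  using subgroup.subset[of H "add_monoid G"] by auto

lemma subgroup_finsum:
  assumes "subgroup H (add_monoid G)" "\<And>i. i \<in> S \<Longrightarrow> c i \<in> H"
  shows "(\<Oplus>i\<in>S. c i) \<in> H"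
proof (cases "finite S")
  case True
  then show ?thesis using assms(2)
  proof (induction S rule: finite_induct)
    case empty
    then show ?case using subgroup_zero[OF assms(1)] by simp
  next
    case (insert a S)
    then have "c \<in> S \<rightarrow> carrier G" "c a \<in> carrier G"
      using subgroup_carrier[OF assms(1)] by auto
    then show ?case using insert subgroup_add[OF assms(1)] by (simp add: finsum_insert)
  qed
next
  case False
  then show ?thesis using subgroup_zero[OF assms(1)] by (simp add: finsum_infinite)
qed

lemma subgroupI':
  assumes "H \<subseteq> carrier G" "\<zero> \<in> H" "\<And>x y. x \<in> H \<Longrightarrow> y \<in> H \<Longrightarrow> x \<oplus> y \<in> H"
    "\<And>x. x \<in> H \<Longrightarrow> \<ominus> x \<in> H"
  shows "subgroup H (add_monoid G)"
  using assms by unfold_locales (auto simp: a_inv_def)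

lemma addhom_add_fun:
  assumes "addhom M G f" "addhom M G g"
  shows "addhom M G (\<lambda>x. f x \<oplus> g x)"
  using assms by (intro addhomI) (auto simp: addhom_add addhom_closed a_ac)

lemma addhom_diff_fun:
  assumes "addhom M G f" "addhom M G g"
  shows "addhom M G (\<lambda>x. f x \<ominus> g x)"
  using assms
  by (intro addhomI) (auto simp: addhom_add addhom_closed a_ac a_minus_def minus_add)

lemma addhom_sgs_fun: "addhom M G f \<Longrightarrow> addhom M G (\<lambda>x. sgs G n (f x))"
  by (rule addhom_compose[OF _ sgs_hom])

lemma addhom_finsum_fun:
  assumes "\<And>i. i \<in> S \<Longrightarrow> addhom M G (f i)"
  shows "addhom M G (\<lambda>x. \<Oplus>i\<in>S. f i x)"
proof (rule addhomI)
  fix x assume x: "x \<in> carrier M"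
  then show "(\<Oplus>i\<in>S. f i x) \<in> carrier G"
    using addhom_closed[OF assms] by (intro finsum_closed) auto
  fix y assume y: "y \<in> carrier M"
  have "(\<Oplus>i\<in>S. f i (x \<oplus>\<^bsub>M\<^esub> y)) = (\<Oplus>i\<in>S. f i x \<oplus> f i y)"
    using x y addhom_closed[OF assms] by (intro finsum_cong') (auto simp: addhom_add[OF assms])
  also have "\<dots> = (\<Oplus>i\<in>S. f i x) \<oplus> (\<Oplus>i\<in>S. f i y)"
    using x y addhom_closed[OF assms] by (intro finsum_addf) auto
  finally show "(\<Oplus>i\<in>S. f i (x \<oplus>\<^bsub>M\<^esub> y)) = (\<Oplus>i\<in>S. f i x) \<oplus> (\<Oplus>i\<in>S. f i y)" .
qed

lemma finsum_mono_neutral: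
  assumes "finite S'" "S \<subseteq> S'" "\<And>i. i \<in> S \<Longrightarrow> c i \<in> carrier G" "\<And>i. i \<in> S' - S \<Longrightarrow> c i = \<zero>"
  shows "(\<Oplus>i\<in>S'. c i) = (\<Oplus>i\<in>S. c i)"
proof (rule add.finprod_mono_neutral_cong_right)
  show "c \<in> S' \<rightarrow> carrier G"
  proof
    fix i assume "i \<in> S'"
    then show "c i \<in> carrier G" using assms(3,4)[of i] by (cases "i \<in> S") auto
  qed
qed (use assms in auto)

end

lemma addhom_sgs:
  assumes "abelian_group M" "abelian_group N" "addhom M N f" "x \<in> carrier M"
  shows "f (sgs M n x) = sgs N n (f x)"
  using addhom_minus[OF assms] by (auto simp: sgs_def)

text \<open>A direct sum decomposition can be read off from projections: applying the k-th projection to any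
  decomposition of x gives its k-th term.\<close>

lemma is_decomp_ex1:
  assumes M: "abelian_group M"
    and H: "\<And>i. subgroup (hcomp M i) (add_monoid M)"
    and p: "\<And>i. addhom M M (p i)" "\<And>i x. x \<in> hcomp M i \<Longrightarrow> p i x = x"
      "\<And>i j x. x \<in> hcomp M j \<Longrightarrow> i \<noteq> j \<Longrightarrow> p i x = \<zero>\<^bsub>M\<^esub>"
    and S: "finite S" "\<And>i. i \<in> S \<Longrightarrow> c i \<in> hcomp M i" "x = (\<Oplus>\<^bsub>M\<^esub>i\<in>S. c i)"
  shows "\<exists>!c. is_decomp M x c"
proof -
  interpret M: abelian_group M by fact
  have car: "x \<in> hcomp M i \<Longrightarrow> x \<in> carrier M" for x i
    using M.subgroup_carrier[OF H] by blast
  have proj: "p k (\<Oplus>\<^bsub>M\<^esub>i\<in>S. c i) = (if k \<in> S then c k else \<zero>\<^bsub>M\<^esub>)"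
    if "finite S" "\<And>i. i \<in> S \<Longrightarrow> c i \<in> hcomp M i" for S c k
  proof -
    have "p k (\<Oplus>\<^bsub>M\<^esub>i\<in>S. c i) = (\<Oplus>\<^bsub>M\<^esub>i\<in>S. p k (c i))"
      using that car by (intro addhom_finsum[OF M M p(1)]) auto
    also have "\<dots> = (\<Oplus>\<^bsub>M\<^esub>i\<in>S. if k = i then c i else \<zero>\<^bsub>M\<^esub>)"
      using that car p(2) p(3) by (intro M.finsum_cong') (auto, (metis p(3))+)
    also have "\<dots> = (if k \<in> S then c k else \<zero>\<^bsub>M\<^esub>)"
    proof (cases "k \<in> S")
      case True
      then show ?thesis using that car by (subst M.add.finprod_singleton) auto
    next
      case False
      then have "(\<Oplus>\<^bsub>M\<^esub>i\<in>S. if k = i then c i else \<zero>\<^bsub>M\<^esub>) = (\<Oplus>\<^bsub>M\<^esub>i\<in>S. \<zero>\<^bsub>M\<^esub>)"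
        by (intro M.finsum_cong') auto
      then show ?thesis using False by simp
    qed
    finally show ?thesis .
  qed
  define c' where "c' = (\<lambda>i. if i \<in> S then c i else \<zero>\<^bsub>M\<^esub>)"
  have "is_decomp M x c'"
    unfolding is_decomp_def
  proof (intro conjI allI)
    show "c' i \<in> hcomp M i" for i
      using S M.subgroup_zero[OF H] by (auto simp: c'_def)
    have sub: "{i. c' i \<noteq> \<zero>\<^bsub>M\<^esub>} \<subseteq> S" by (auto simp: c'_def)
    then show "finite {i. c' i \<noteq> \<zero>\<^bsub>M\<^esub>}" using S(1) finite_subset by blast
    have "x = (\<Oplus>\<^bsub>M\<^esub>i\<in>S. c' i)"
      unfolding S(3) using car[OF S(2)] by (intro M.finsum_cong') (auto simp: c'_def)
    also have "\<dots> = (\<Oplus>\<^bsub>M\<^esub>i\<in>{i. c' i \<noteq> \<zero>\<^bsub>M\<^esub>}. c' i)"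
      using sub S car by (intro M.finsum_mono_neutral) (auto simp: c'_def)
    finally show "x = (\<Oplus>\<^bsub>M\<^esub>i\<in>{i. c' i \<noteq> \<zero>\<^bsub>M\<^esub>}. c' i)" .
  qed
  moreover have "d = (\<lambda>k. p k x)" if "is_decomp M x d" for d
  proof
    fix k
    show "d k = p k x"
      using that proj[of "{i. d i \<noteq> \<zero>\<^bsub>M\<^esub>}" d k] by (auto simp: is_decomp_def split: if_splits)
  qed
  ultimately show ?thesis by auto
qed

context dg_complex
begin

lemma hcomp_closed: "x \<in> hcomp M i \<Longrightarrow> x \<in> carrier M"
  using subgroup_carrier[OF hcomp_subgroup] .

lemma hcomp_zero [simp]: "\<zero> \<in> hcomp M i"
  using subgroup_zero[OF hcomp_subgroup] .

lemma hcomp_add: "x \<in> hcomp M i \<Longrightarrow> y \<in> hcomp M i \<Longrightarrow> x \<oplus> y \<in> hcomp M i"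
  using subgroup_add[OF hcomp_subgroup] .

lemma hcomp_neg: "x \<in> hcomp M i \<Longrightarrow> \<ominus> x \<in> hcomp M i"
  using subgroup_neg[OF hcomp_subgroup] .

lemma hcomp_sgs: "x \<in> hcomp M i \<Longrightarrow> sgs M n x \<in> hcomp M i"
  using sgs_subgroup[OF hcomp_subgroup] .

lemma hpart_decomp: "x \<in> carrier M \<Longrightarrow> is_decomp M x (hpart M x)"
  unfolding hpart_def using theI'[OF direct_sum] .

lemma hpart_unique: "x \<in> carrier M \<Longrightarrow> is_decomp M x c \<Longrightarrow> hpart M x = c"
  using hpart_decomp direct_sum by blast

lemma hpart_hcomp: "x \<in> carrier M \<Longrightarrow> hpart M x i \<in> hcomp M i"
  using hpart_decomp by (auto simp: is_decomp_def)

lemma hpart_closed [simp]: "x \<in> carrier M \<Longrightarrow> hpart M x i \<in> carrier M"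
  using hpart_hcomp hcomp_closed by blast

lemma finite_hsupp: "x \<in> carrier M \<Longrightarrow> finite (hsupp M x)"
  using hpart_decomp by (auto simp: is_decomp_def hsupp_def)

lemma hpart_sum: "x \<in> carrier M \<Longrightarrow> (\<Oplus>i\<in>hsupp M x. hpart M x i) = x"
  by (drule hpart_decomp) (unfold is_decomp_def hsupp_def, elim conjE, rule sym)

lemma hpart_sum': "x \<in> carrier M \<Longrightarrow> finite S \<Longrightarrow> hsupp M x \<subseteq> S \<Longrightarrow> (\<Oplus>i\<in>S. hpart M x i) = x"
  by (rule trans[OF finsum_mono_neutral hpart_sum]) (auto simp: hsupp_def)

lemma hpart_finsum:
  assumes "finite S" "\<And>i. i \<in> S \<Longrightarrow> c i \<in> hcomp M i"
  shows "hpart M (\<Oplus>i\<in>S. c i) = (\<lambda>i. if i \<in> S then c i else \<zero>)"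
proof (rule hpart_unique)
  let ?c = "\<lambda>i. if i \<in> S then c i else \<zero>"
  have car: "i \<in> S \<Longrightarrow> c i \<in> carrier M" for i using assms hcomp_closed by blast
  then show "(\<Oplus>i\<in>S. c i) \<in> carrier M" by (intro finsum_closed) auto
  have sub: "{i. ?c i \<noteq> \<zero>} \<subseteq> S" by auto
  have "(\<Oplus>i\<in>S. c i) = (\<Oplus>i\<in>S. ?c i)" using car by (intro finsum_cong') auto
  also have "\<dots> = (\<Oplus>i\<in>{i. ?c i \<noteq> \<zero>}. ?c i)"
    using sub assms car by (intro finsum_mono_neutral) auto
  finally show "is_decomp M (\<Oplus>i\<in>S. c i) ?c"
    unfolding is_decomp_def using assms finite_subset[OF sub] by (intro conjI allI) auto
qed

lemma hpart_homog: "x \<in> hcomp M n \<Longrightarrow> hpart M x i = (if i = n then x else \<zero>)"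
  using hpart_finsum[of "{n}" "\<lambda>_. x"] hcomp_closed[of x n] by (auto simp: fun_eq_iff)

lemma hpart_add:
  assumes "x \<in> carrier M" "y \<in> carrier M"
  shows "hpart M (x \<oplus> y) i = hpart M x i \<oplus> hpart M y i"
proof -
  let ?S = "hsupp M x \<union> hsupp M y"
  have f: "finite ?S" using assms finite_hsupp by auto
  have "x \<oplus> y = (\<Oplus>i\<in>?S. hpart M x i) \<oplus> (\<Oplus>i\<in>?S. hpart M y i)"
    using assms f by (simp add: hpart_sum')
  also have "\<dots> = (\<Oplus>i\<in>?S. hpart M x i \<oplus> hpart M y i)"
    using assms by (subst finsum_addf) auto
  finally have "hpart M (x \<oplus> y) = (\<lambda>i. if i \<in> ?S then hpart M x i \<oplus> hpart M y i else \<zero>)"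
    using hpart_finsum[OF f, of "\<lambda>i. hpart M x i \<oplus> hpart M y i"] assms
    by (auto simp: hcomp_add hpart_hcomp)
  then show ?thesis by (auto simp: hsupp_def)
qed

lemma hpart_hom: "addhom M M (\<lambda>x. hpart M x i)"
  by (rule addhomI) (auto simp: hpart_add)

text \<open>Identities between additive maps need to be checked on homogeneous elements only, where all
  signs are explicit.\<close>

lemma homog_induct [consumes 1, case_names homog add]:
  assumes x: "x \<in> carrier M"
    and homog: "\<And>i y. y \<in> hcomp M i \<Longrightarrow> P y"
    and add: "\<And>y z. y \<in> carrier M \<Longrightarrow> z \<in> carrier M \<Longrightarrow> P y \<Longrightarrow> P z \<Longrightarrow> P (y \<oplus> z)"
  shows "P x"
proof -
  have "P (\<Oplus>i\<in>S. hpart M x i)" if "finite S" for S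
    using that
  proof (induction S rule: finite_induct)
    case empty
    then show ?case using homog[OF hcomp_zero] by simp
  next
    case (insert a S)
    then show ?case using x
      by (subst finsum_insert) (auto intro!: add homog[OF hpart_hcomp] finsum_closed)
  qed
  from this[OF finite_hsupp[OF x]] show ?thesis using x by (simp add: hpart_sum)
qed

lemma addhom_eqI:
  assumes "abelian_group G" "addhom M G f" "addhom M G g" "x \<in> carrier M"
    "\<And>i y. y \<in> hcomp M i \<Longrightarrow> f y = g y"
  shows "f x = g x"
  using assms(4) by (induction x rule: homog_induct) (auto simp: assms addhom_add[OF assms(2)] addhom_add[OF assms(3)])

lemma hpart_map:
  assumes N: "dg_complex N" "addhom M N f" "\<And>i y. y \<in> hcomp M i \<Longrightarrow> f y \<in> hcomp N (i + n)"
    and x: "x \<in> carrier M"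
  shows "hpart N (f x) (i + n) = f (hpart M x i)"
proof -
  interpret N: dg_complex N by fact
  show ?thesis
    using x
  proof (induction x rule: homog_induct)
    case (homog j y)
    have "f \<zero> = \<zero>\<^bsub>N\<^esub>" using addhom_zero[OF _ _ assms(2)] abelian_group_axioms N.abelian_group_axioms by auto
    then show ?case
      using N.hpart_homog[OF assms(3)[OF homog]] by (auto simp: hpart_homog[OF homog])
  next
    case (add y z)
    then show ?case
      using addhom_closed[OF assms(2)] by (simp add: hpart_add N.hpart_add addhom_add[OF assms(2)])
  qed
qed

lemma dif_closed [simp]: "x \<in> carrier M \<Longrightarrow> dif M x \<in> carrier M"
  using addhom_closed[OF dif_hom] .

lemma dif_add: "x \<in> carrier M \<Longrightarrow> y \<in> carrier M \<Longrightarrow> dif M (x \<oplus> y) = dif M x \<oplus> dif M y"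
  using addhom_add[OF dif_hom] .

end

text \<open>The automorphism \<open>x \<mapsto> (-1)\<^bsup>|x|\<^esup> x\<close>, extended additively to inhomogeneous elements; it carries
  the sign of the Leibniz rule.\<close>

definition twist :: "('m, 'z) dg_cx_scheme \<Rightarrow> 'm \<Rightarrow> 'm" where
  "twist M x = (\<Oplus>\<^bsub>M\<^esub>i\<in>hsupp M x. sgs M i (hpart M x i))"

context dg_complex
begin

lemma finsum_hsupp:
  assumes "x \<in> carrier M" "finite S" "hsupp M x \<subseteq> S" "abelian_group G" "\<And>i. addhom M G (g i)"
  shows "(\<Oplus>\<^bsub>G\<^esub>i\<in>hsupp M x. g i (hpart M x i)) = (\<Oplus>\<^bsub>G\<^esub>i\<in>S. g i (hpart M x i))"
proof -
  interpret G: abelian_group G by fact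
  show ?thesis
    using assms addhom_closed[OF assms(5)] addhom_zero[OF abelian_group_axioms assms(4) assms(5)]
    by (intro G.finsum_mono_neutral[symmetric]) (auto simp: hsupp_def)
qed

text \<open>The supports of x, y and x + y differ, but each sum may be taken over their union, since the extra
  terms vanish.\<close>

lemma addhom_by_degree:
  assumes G: "abelian_group G" "\<And>i. addhom M G (g i)"
  shows "addhom M G (\<lambda>x. \<Oplus>\<^bsub>G\<^esub>i\<in>hsupp M x. g i (hpart M x i))"
proof (rule addhomI)
  interpret G: abelian_group G by fact
  fix x assume x: "x \<in> carrier M"
  then show "(\<Oplus>\<^bsub>G\<^esub>i\<in>hsupp M x. g i (hpart M x i)) \<in> carrier G"
    using addhom_closed[OF G(2)] by (intro G.finsum_closed) auto
  fix y assume y: "y \<in> carrier M"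
  let ?S = "hsupp M x \<union> hsupp M y \<union> hsupp M (x \<oplus> y)"
  have f: "finite ?S" using x y finite_hsupp by auto
  have s1: "hsupp M x \<subseteq> ?S" and s2: "hsupp M y \<subseteq> ?S" by blast+
  have "(\<Oplus>\<^bsub>G\<^esub>i\<in>hsupp M (x \<oplus> y). g i (hpart M (x \<oplus> y) i)) = (\<Oplus>\<^bsub>G\<^esub>i\<in>?S. g i (hpart M (x \<oplus> y) i))"
    using x y f by (intro finsum_hsupp G) auto
  also have "\<dots> = (\<Oplus>\<^bsub>G\<^esub>i\<in>?S. g i (hpart M x i) \<oplus>\<^bsub>G\<^esub> g i (hpart M y i))"
    using x y addhom_closed[OF G(2)]
    by (intro G.finsum_cong') (auto simp: hpart_add addhom_add[OF G(2)])
  also have "\<dots> = (\<Oplus>\<^bsub>G\<^esub>i\<in>?S. g i (hpart M x i)) \<oplus>\<^bsub>G\<^esub> (\<Oplus>\<^bsub>G\<^esub>i\<in>?S. g i (hpart M y i))"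
    using x y addhom_closed[OF G(2)] by (intro G.finsum_addf) auto
  also have "\<dots> = (\<Oplus>\<^bsub>G\<^esub>i\<in>hsupp M x. g i (hpart M x i)) \<oplus>\<^bsub>G\<^esub> (\<Oplus>\<^bsub>G\<^esub>i\<in>hsupp M y. g i (hpart M y i))"
    by (simp only: finsum_hsupp[OF x f s1 G(1), where g = g, OF G(2)] finsum_hsupp[OF y f s2 G(1), where g = g, OF G(2)])
  finally show "(\<Oplus>\<^bsub>G\<^esub>i\<in>hsupp M (x \<oplus> y). g i (hpart M (x \<oplus> y) i)) = \<dots>" .
qed

lemma by_degree_homog:
  assumes G: "abelian_group G" "\<And>i. addhom M G (g i)" and y: "y \<in> hcomp M n"
  shows "(\<Oplus>\<^bsub>G\<^esub>i\<in>hsupp M y. g i (hpart M y i)) = g n y"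
proof -
  interpret G: abelian_group G by fact
  have c: "y \<in> carrier M" using hcomp_closed[OF y] .
  have "hsupp M y \<subseteq> {n}" by (auto simp: hsupp_def hpart_homog[OF y])
  then show ?thesis
    using finsum_hsupp[OF c _ _ G, of "{n}"] addhom_closed[OF G(2) c]
    by (simp add: hpart_homog[OF y])
qed

lemma twist_hom: "addhom M M (twist M)"
  unfolding twist_def using addhom_by_degree[OF abelian_group_axioms, of "\<lambda>i. sgs M i"] sgs_hom by auto

lemma twist_homog: "y \<in> hcomp M n \<Longrightarrow> twist M y = sgs M n y"
  unfolding twist_def using by_degree_homog[OF abelian_group_axioms, of "\<lambda>i. sgs M i"] sgs_hom by auto

lemma twist_closed [simp]: "x \<in> carrier M \<Longrightarrow> twist M x \<in> carrier M"
  using addhom_closed[OF twist_hom] .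

end

section \<open>The tensor product with B as a DG B-module\<close>

lemma (in dg_algebra) leibniz_sgs:
  assumes "x \<in> hcomp A i" "y \<in> hcomp A j"
  shows "dif A (x \<otimes>\<^bsub>A\<^esub> y) = (dif A x \<otimes>\<^bsub>A\<^esub> y) \<oplus>\<^bsub>A\<^esub> sgs A i (x \<otimes>\<^bsub>A\<^esub> dif A y)"
  using leibniz[OF assms] assms by (simp add: A.sg_add_pow A.hcomp_closed)

lemma (in dg_algebra) graded_comm_sgs:
  assumes "x \<in> hcomp A i" "y \<in> hcomp A j"
  shows "x \<otimes>\<^bsub>A\<^esub> y = sgs A (i * j) (y \<otimes>\<^bsub>A\<^esub> x)"
  using graded_comm[OF assms] assms by (simp add: A.sg_add_pow A.hcomp_closed)

context dg_module
begin

lemma leibniz_sgs: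
  assumes "x \<in> hcomp N i" "b \<in> hcomp B j" "dif B b \<in> carrier B"
  shows "dif N (ract N x b) = ract N (dif N x) b \<oplus> sgs N i (ract N x (dif B b))"
  using ract_leibniz[OF assms(1,2)] assms(3) hcomp_closed[OF assms(1)]
  by (simp add: sg_add_pow ract_closed)

lemma ract_hom_left: "b \<in> carrier B \<Longrightarrow> addhom N N (\<lambda>x. ract N x b)"
  by (rule addhomI) (auto simp: ract_closed ract_add_left)

lemma ract_hom_right: "x \<in> carrier N \<Longrightarrow> addhom B N (\<lambda>b. ract N x b)"
  by (rule addhomI) (auto simp: ract_closed ract_add_right)

end

locale dg_ext =
  fixes R :: "('r, 'y) ring_scheme" and A :: "('r, 'a) dg_alg" and B :: "('r, 'b) dg_alg"
    and \<phi> :: "'a \<Rightarrow> 'b"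
  assumes A_alg: "dg_algebra R A" and B_alg: "dg_algebra R B" and \<phi>_hom: "dg_alg_hom R A B \<phi>"
begin

sublocale A: dg_algebra R A by (rule A_alg)
sublocale B: dg_algebra R B by (rule B_alg)

lemma \<phi>_addhom: "addhom A B \<phi>"
  using \<phi>_hom by (auto simp: dg_alg_hom_def ring_hom_def hom_def)

lemma \<phi>_closed [simp]: "a \<in> carrier A \<Longrightarrow> \<phi> a \<in> carrier B"
  using addhom_closed[OF \<phi>_addhom] .

lemma \<phi>_add: "a \<in> carrier A \<Longrightarrow> a' \<in> carrier A \<Longrightarrow> \<phi> (a \<oplus>\<^bsub>A\<^esub> a') = \<phi> a \<oplus>\<^bsub>B\<^esub> \<phi> a'"
  using addhom_add[OF \<phi>_addhom] .

lemma \<phi>_mult: "a \<in> carrier A \<Longrightarrow> a' \<in> carrier A \<Longrightarrow> \<phi> (a \<otimes>\<^bsub>A\<^esub> a') = \<phi> a \<otimes>\<^bsub>B\<^esub> \<phi> a'"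
  using \<phi>_hom by (auto simp: dg_alg_hom_def ring_hom_def)

lemma \<phi>_one: "\<phi> \<one>\<^bsub>A\<^esub> = \<one>\<^bsub>B\<^esub>"
  using \<phi>_hom by (auto simp: dg_alg_hom_def ring_hom_def)

lemma \<phi>_degree: "a \<in> hcomp A i \<Longrightarrow> \<phi> a \<in> hcomp B i"
  using \<phi>_hom by (auto simp: dg_alg_hom_def image_subset_iff)

lemma \<phi>_dif: "a \<in> carrier A \<Longrightarrow> \<phi> (dif A a) = dif B (\<phi> a)"
  using \<phi>_hom by (auto simp: dg_alg_hom_def)

end

lemma abelian_group_of_comm_group:
  assumes "comm_group G" "carrier T = carrier G" "add T = mult G" "\<zero>\<^bsub>T\<^esub> = \<one>\<^bsub>G\<^esub>"
  shows "abelian_group T"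
proof -
  interpret G: comm_group G by fact
  show ?thesis
  proof (rule abelian_groupI)
    show "\<exists>y\<in>carrier T. y \<oplus>\<^bsub>T\<^esub> x = \<zero>\<^bsub>T\<^esub>" if "x \<in> carrier T" for x
      using G.l_inv_ex[of x] that assms by auto
  qed (simp_all add: assms G.m_ac)
qed

definition tens_cls where
  "tens_cls A M \<phi> B u = tens_rel A M \<phi> B #>\<^bsub>free_Abelian_group (carrier M \<times> carrier B)\<^esub> u"

definition tens where
  "tens A M \<phi> B x b = tens_cls A M \<phi> B (frag_of (x, b))"

text \<open>The maps that factor through \<open>M \<otimes>\<^sub>A B\<close>.\<close>

definition tens_balanced where
  "tens_balanced A M \<phi> B H h \<longleftrightarrow>
     (\<forall>x\<in>carrier M. addhom B H (h x)) \<and> (\<forall>b\<in>carrier B. addhom M H (\<lambda>x. h x b))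
     \<and> (\<forall>x\<in>carrier M. \<forall>a\<in>carrier A. \<forall>b\<in>carrier B. h (ract M x a) b = h x (\<phi> a \<otimes>\<^bsub>B\<^esub> b))"

text \<open>The additive extension of h to the free abelian group, in the shape in which \<open>tens_eval\<close>
  uses it.\<close>

definition frag_sum :: "('g, 'z) ring_scheme \<Rightarrow> ('p \<Rightarrow> 'g) \<Rightarrow> ('p \<Rightarrow>\<^sub>0 int) \<Rightarrow> 'g" where
  "frag_sum H h u = (\<Oplus>\<^bsub>H\<^esub>p\<in>Poly_Mapping.keys u. [Poly_Mapping.lookup u p] \<cdot>\<^bsub>H\<^esub> h p)"

lemma frag_sum_superset:
  assumes "abelian_group H" "finite W" "Poly_Mapping.keys u \<subseteq> W" "h \<in> W \<rightarrow> carrier H"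
  shows "frag_sum H h u = (\<Oplus>\<^bsub>H\<^esub>p\<in>W. [Poly_Mapping.lookup u p] \<cdot>\<^bsub>H\<^esub> h p)"
proof -
  interpret H: abelian_group H by fact
  have z: "[(0::int)] \<cdot>\<^bsub>H\<^esub> x = \<zero>\<^bsub>H\<^esub>" for x by (simp add: add_pow_def)
  show ?thesis
    unfolding frag_sum_def using assms
    by (intro H.finsum_mono_neutral[symmetric]) (auto simp: Pi_def in_keys_iff z intro!: H.add.int_pow_closed)
qed

lemma frag_sum_hom:
  assumes "abelian_group H" "h \<in> S \<rightarrow> carrier H"
  shows "frag_sum H h \<in> hom (free_Abelian_group S) (add_monoid H)"
proof (rule homI)
  interpret H: abelian_group H by fact
  fix u assume u: "u \<in> carrier (free_Abelian_group S)"
  have c: "p \<in> S \<Longrightarrow> [(n::int)] \<cdot>\<^bsub>H\<^esub> h p \<in> carrier H" for p n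
    using assms by (auto intro!: H.add.int_pow_closed)
  show "frag_sum H h u \<in> carrier (add_monoid H)"
    unfolding frag_sum_def using u c by (auto intro!: H.finsum_closed)
  fix v assume v: "v \<in> carrier (free_Abelian_group S)"
  let ?W = "Poly_Mapping.keys u \<union> Poly_Mapping.keys v"
  have W: "?W \<subseteq> S" "finite ?W" using u v by auto
  have k: "Poly_Mapping.keys (u + v) \<subseteq> ?W" by (rule keys_add)
  have h: "h \<in> ?W \<rightarrow> carrier H" using assms W by auto
  have "frag_sum H h (u + v) = (\<Oplus>\<^bsub>H\<^esub>p\<in>?W. [Poly_Mapping.lookup (u + v) p] \<cdot>\<^bsub>H\<^esub> h p)"
    using frag_sum_superset[OF assms(1) W(2) k h] .
  also have "\<dots> = (\<Oplus>\<^bsub>H\<^esub>p\<in>?W. [Poly_Mapping.lookup u p] \<cdot>\<^bsub>H\<^esub> h p \<oplus>\<^bsub>H\<^esub> [Poly_Mapping.lookup v p] \<cdot>\<^bsub>H\<^esub> h p)"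
    using W c assms by (intro H.finsum_cong') (auto simp: Poly_Mapping.lookup_add H.add.int_pow_mult Pi_def subset_iff)
  also have "\<dots> = frag_sum H h u \<oplus>\<^bsub>H\<^esub> frag_sum H h v"
    using W c frag_sum_superset[OF assms(1) W(2) _ h]
    by (subst H.finsum_addf) (auto simp: Pi_def subset_iff)
  finally show "frag_sum H h (u \<otimes>\<^bsub>free_Abelian_group S\<^esub> v) = frag_sum H h u \<otimes>\<^bsub>add_monoid H\<^esub> frag_sum H h v"
    by simp
qed

lemma frag_sum_of:
  assumes "abelian_group H" "h p \<in> carrier H"
  shows "frag_sum H h (frag_of p) = h p"
proof -
  interpret H: abelian_group H by fact
  show ?thesis
    using assms H.add.int_pow_1[of "h p"] by (simp add: frag_sum_def)
qed

locale dg_tens = dg_ext R A B \<phi> + M: dg_module A M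
  for R :: "('r, 'y) ring_scheme" and A :: "('r, 'a) dg_alg" and B :: "('r, 'b) dg_alg"
    and \<phi> :: "'a \<Rightarrow> 'b" and M :: "('a, 'm) dg_mod"
begin

abbreviation "PS \<equiv> carrier M \<times> carrier B"
abbreviation "FG \<equiv> free_Abelian_group PS"
abbreviation "TR \<equiv> tens_rel A M \<phi> B"
abbreviation "T \<equiv> dg_tensor A M \<phi> B"
abbreviation "cls \<equiv> tens_cls A M \<phi> B"
abbreviation "tn \<equiv> tens A M \<phi> B"

lemma frag_of_closed: "x \<in> carrier M \<Longrightarrow> b \<in> carrier B \<Longrightarrow> Poly_Mapping.keys (frag_of (x, b)) \<subseteq> PS"
  by auto

lemma keys_diff_sub: "Poly_Mapping.keys u \<subseteq> W \<Longrightarrow> Poly_Mapping.keys v \<subseteq> W \<Longrightarrow> Poly_Mapping.keys (u - v) \<subseteq> W"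
  for u v :: "'p \<Rightarrow>\<^sub>0 int"
  using keys_diff[of u v] by blast

lemma keys_add_sub: "Poly_Mapping.keys u \<subseteq> W \<Longrightarrow> Poly_Mapping.keys v \<subseteq> W \<Longrightarrow> Poly_Mapping.keys (u + v) \<subseteq> W"
  for u v :: "'p \<Rightarrow>\<^sub>0 int"
  using keys_add[of u v] by blast

lemma TR_keys: "u \<in> TR \<Longrightarrow> Poly_Mapping.keys u \<subseteq> PS"
proof (induction rule: tens_rel.induct)
  case (diff u v)
  then show ?case by (intro keys_diff_sub) auto
next
  case (add_left x y b)
  then show ?case by (intro keys_diff_sub frag_of_closed) auto
next
  case (add_right x b c)
  then show ?case by (intro keys_diff_sub frag_of_closed) auto
next
  case (balanced x a b)
  then show ?case by (intro keys_diff_sub frag_of_closed M.ract_closed) auto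
qed simp

lemma TR_neg: "u \<in> TR \<Longrightarrow> - u \<in> TR"
  using tens_rel.diff[OF tens_rel.zero, of u] by simp

lemma TR_add: "u \<in> TR \<Longrightarrow> v \<in> TR \<Longrightarrow> u + v \<in> TR"
  using tens_rel.diff[OF _ TR_neg, of u v] by simp

lemma TR_subgroup: "subgroup TR FG"
  using TR_keys TR_add tens_rel.zero TR_neg
  by (intro subgroup.intro) (auto simp: TR_keys)

lemma TR_normal: "TR \<lhd> FG"
  using TR_subgroup comm_group.normal_iff_subgroup[OF abelian_free_Abelian_group] by blast

lemma cls_def': "cls u = {t + u | t. t \<in> TR}"
  by (auto simp: tens_cls_def r_coset_def)

lemma cls_eq_iff: "cls u = cls v \<longleftrightarrow> u - v \<in> TR"
proof
  assume "cls u = cls v"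
  then have "u \<in> cls v" unfolding cls_def' using tens_rel.zero[of A M \<phi> B] by force
  then show "u - v \<in> TR" by (auto simp: cls_def')
next
  assume *: "u - v \<in> TR"
  have "t + u \<in> cls v" if "t \<in> TR" for t
    unfolding cls_def' using TR_add[OF that *] by (auto intro!: exI[of _ "t + (u - v)"])
  moreover have "t + v \<in> cls u" if "t \<in> TR" for t
    unfolding cls_def' using TR_add[OF that TR_neg[OF *]] by (auto intro!: exI[of _ "t + - (u - v)"])
  ultimately show "cls u = cls v" by (auto simp: cls_def')
qed

lemma cls_self: "u \<in> cls u"
  unfolding cls_def' using tens_rel.zero[of A M \<phi> B] by force

lemma T_simps: "add T = set_mult FG" "\<zero>\<^bsub>T\<^esub> = TR" "carrier T = cls ` {u. Poly_Mapping.keys u \<subseteq> PS}"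
  by (auto simp: dg_tensor_def tens_grp_def FactGroup_def RCOSETS_def tens_cls_def)

lemma T_abelian: "abelian_group T"
  using comm_group.abelian_FactGroup[OF abelian_free_Abelian_group TR_subgroup]
  by (rule abelian_group_of_comm_group) (simp_all add: dg_tensor_def tens_grp_def)

sublocale TG: abelian_group T by (rule T_abelian)

lemma cls_closed: "Poly_Mapping.keys u \<subseteq> PS \<Longrightarrow> cls u \<in> carrier T"
  by (auto simp: T_simps)

lemma cls_add: 
  assumes "Poly_Mapping.keys u \<subseteq> PS" "Poly_Mapping.keys v \<subseteq> PS"
  shows "cls u \<oplus>\<^bsub>T\<^esub> cls v = cls (u + v)"
  using normal.rcos_sum[OF TR_normal, of u v] assms by (simp add: T_simps tens_cls_def)

lemma cls_zero: "cls 0 = \<zero>\<^bsub>T\<^esub>"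
  by (simp add: cls_def' T_simps)

lemma cls_neg: "Poly_Mapping.keys u \<subseteq> PS \<Longrightarrow> cls (- u) = \<ominus>\<^bsub>T\<^esub> cls u"
  using cls_add[of "-u" u] cls_closed[of u] cls_closed[of "-u"]
  by (intro TG.minus_equality[symmetric]) (auto simp: cls_zero)

lemma cls_cmul_sg: "Poly_Mapping.keys u \<subseteq> PS \<Longrightarrow> cls (frag_cmul (sg i) u) = sgs T i (cls u)"
  by (auto simp: sg_def sgs_def cls_neg)

lemma cls_sum:
  assumes "finite I" "\<And>i. i \<in> I \<Longrightarrow> Poly_Mapping.keys (c i) \<subseteq> PS"
  shows "cls (\<Sum>i\<in>I. c i) = (\<Oplus>\<^bsub>T\<^esub>i\<in>I. cls (c i)) \<and> Poly_Mapping.keys (\<Sum>i\<in>I. c i) \<subseteq> PS"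
  using assms
proof (induction I rule: finite_induct)
  case empty
  then show ?case by (simp add: cls_zero)
next
  case (insert a I)
  then show ?case
    by (auto simp: TG.finsum_insert cls_closed Pi_def cls_add[symmetric] keys_add_sub del: subsetI)
qed

lemma tn_closed [simp]: "x \<in> carrier M \<Longrightarrow> b \<in> carrier B \<Longrightarrow> tn x b \<in> carrier T"
  unfolding tens_def by (rule cls_closed) auto

lemma tn_add_left: "x \<in> carrier M \<Longrightarrow> y \<in> carrier M \<Longrightarrow> b \<in> carrier B \<Longrightarrow>
    tn (x \<oplus>\<^bsub>M\<^esub> y) b = tn x b \<oplus>\<^bsub>T\<^esub> tn y b"
  using tens_rel.add_left[of x M y b B A \<phi>]
  unfolding tens_def by (subst cls_add) (auto simp: cls_eq_iff algebra_simps)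

lemma tn_add_right: "x \<in> carrier M \<Longrightarrow> b \<in> carrier B \<Longrightarrow> c \<in> carrier B \<Longrightarrow>
    tn x (b \<oplus>\<^bsub>B\<^esub> c) = tn x b \<oplus>\<^bsub>T\<^esub> tn x c"
  using tens_rel.add_right[of x M b B c A \<phi>]
  unfolding tens_def by (subst cls_add) (auto simp: cls_eq_iff algebra_simps)

lemma tn_balanced: "x \<in> carrier M \<Longrightarrow> a \<in> carrier A \<Longrightarrow> b \<in> carrier B \<Longrightarrow>
    tn (ract M x a) b = tn x (\<phi> a \<otimes>\<^bsub>B\<^esub> b)"
  using tens_rel.balanced[of x M a A b B \<phi>]
  unfolding tens_def by (auto simp: cls_eq_iff)

lemma tn_hom_left: "b \<in> carrier B \<Longrightarrow> addhom M T (\<lambda>x. tn x b)"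
  by (rule addhomI) (auto simp: tn_add_left)

lemma tn_hom_right: "x \<in> carrier M \<Longrightarrow> addhom B T (tn x)"
  by (rule addhomI) (auto simp: tn_add_right)

lemma tn_zero_left [simp]: "b \<in> carrier B \<Longrightarrow> tn \<zero>\<^bsub>M\<^esub> b = \<zero>\<^bsub>T\<^esub>"
  using addhom_zero[OF M.abelian_group_axioms T_abelian tn_hom_left] .

lemma tn_zero_right [simp]: "x \<in> carrier M \<Longrightarrow> tn x \<zero>\<^bsub>B\<^esub> = \<zero>\<^bsub>T\<^esub>"
  using addhom_zero[OF B.A.abelian_group_axioms T_abelian tn_hom_right] .

lemma tn_sgs_left: "x \<in> carrier M \<Longrightarrow> b \<in> carrier B \<Longrightarrow> tn (sgs M n x) b = sgs T n (tn x b)"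
  using addhom_sgs[OF M.abelian_group_axioms T_abelian tn_hom_left] .

lemma tn_sgs_right: "x \<in> carrier M \<Longrightarrow> b \<in> carrier B \<Longrightarrow> tn x (sgs B n b) = sgs T n (tn x b)"
  using addhom_sgs[OF B.A.abelian_group_axioms T_abelian tn_hom_right] .

lemma tens_induct_all [consumes 1, case_names pure add]:
  assumes t: "t \<in> carrier T"
    and pure: "\<And>x b. x \<in> carrier M \<Longrightarrow> b \<in> carrier B \<Longrightarrow> P (tn x b)"
    and add: "\<And>s t. s \<in> carrier T \<Longrightarrow> t \<in> carrier T \<Longrightarrow> P s \<Longrightarrow> P t \<Longrightarrow> P (s \<oplus>\<^bsub>T\<^esub> t)"
  shows "P t"
proof -
  obtain u where u: "Poly_Mapping.keys u \<subseteq> PS" "t = cls u" using t by (auto simp: T_simps)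
  have "P (cls u) \<and> P (cls (- u))"
    using u(1)
  proof (induction u rule: free_Abelian_group_induct[consumes 1])
    case 1
    then show ?case using pure[of "\<zero>\<^bsub>M\<^esub>" "\<zero>\<^bsub>B\<^esub>"] by (simp add: cls_zero)
  next
    case (2 x y)
    have "P (cls x \<oplus>\<^bsub>T\<^esub> cls (- y))" "P (cls y \<oplus>\<^bsub>T\<^esub> cls (- x))"
      using 2 by (auto intro!: add cls_closed)
    then show ?case using 2 by (simp add: cls_add)
  next
    case (3 a)
    obtain x b where a: "a = (x, b)" "x \<in> carrier M" "b \<in> carrier B" using 3 by auto
    have "cls (- frag_of a) = tn (\<ominus>\<^bsub>M\<^esub> x) b"
      using a cls_neg[of "frag_of a"] tn_sgs_left[of x b 1] by (simp add: sgs_def tens_def)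
    then show ?case using pure[of x b] pure[of "\<ominus>\<^bsub>M\<^esub> x" b] a by (simp add: tens_def)
  qed
  then show ?thesis using u by simp
qed

lemma tens_induct [consumes 1, case_names pure add]:
  assumes t: "t \<in> carrier T"
    and pure: "\<And>i j x b. x \<in> hcomp M i \<Longrightarrow> b \<in> hcomp B j \<Longrightarrow> P (tn x b)"
    and add: "\<And>s t. s \<in> carrier T \<Longrightarrow> t \<in> carrier T \<Longrightarrow> P s \<Longrightarrow> P t \<Longrightarrow> P (s \<oplus>\<^bsub>T\<^esub> t)"
  shows "P t"
  using t
proof (induction t rule: tens_induct_all)
  case (pure x b)
  from pure(1) show ?case
  proof (induction x rule: M.homog_induct)
    case (homog i y)
    from pure(2) show ?case
    proof (induction b rule: B.A.homog_induct)
      case (homog j c)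
      then show ?case using \<open>y \<in> hcomp M i\<close> assms(2) by auto
    next
      case (add c d)
      then show ?case using \<open>y \<in> hcomp M i\<close> M.hcomp_closed[of y i]
        by (auto simp: tn_add_right intro!: assms(3))
    qed
  next
    case (add y z)
    then show ?case using pure(2) by (auto simp: tn_add_left intro!: assms(3))
  qed
qed (auto intro: add)

lemma tens_hom_eqI:
  assumes "addhom T H f" "addhom T H g" "t \<in> carrier T"
    "\<And>i j x b. x \<in> hcomp M i \<Longrightarrow> b \<in> hcomp B j \<Longrightarrow> f (tn x b) = g (tn x b)"
  shows "f t = g t"
  using assms(3) by (induction t rule: tens_induct)
    (auto simp: assms addhom_add[OF assms(1)] addhom_add[OF assms(2)])

text \<open>Being balanced is additive in x, a and b separately, so that homogeneous elements suffice.\<close>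

lemma tens_balancedI:
  assumes H: "abelian_group H"
    and "\<And>x. x \<in> carrier M \<Longrightarrow> addhom B H (h x)" "\<And>b. b \<in> carrier B \<Longrightarrow> addhom M H (\<lambda>x. h x b)"
    and bal: "\<And>i j k x a b. x \<in> hcomp M i \<Longrightarrow> a \<in> hcomp A j \<Longrightarrow> b \<in> hcomp B k \<Longrightarrow>
       h (ract M x a) b = h x (\<phi> a \<otimes>\<^bsub>B\<^esub> b)"
  shows "tens_balanced A M \<phi> B H h"
  unfolding tens_balanced_def
proof (intro conjI ballI)
  interpret H: abelian_group H by fact
  have add1: "h x (b \<oplus>\<^bsub>B\<^esub> c) = h x b \<oplus>\<^bsub>H\<^esub> h x c" if "x \<in> carrier M" "b \<in> carrier B" "c \<in> carrier B" for x b c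
    using addhom_add[OF assms(2)] that by auto
  have add2: "h (x \<oplus>\<^bsub>M\<^esub> y) b = h x b \<oplus>\<^bsub>H\<^esub> h y b" if "x \<in> carrier M" "y \<in> carrier M" "b \<in> carrier B" for x y b
    using addhom_add[OF assms(3)] that by auto
  fix x a b assume "x \<in> carrier M" "a \<in> carrier A" "b \<in> carrier B"
  then show "h (ract M x a) b = h x (\<phi> a \<otimes>\<^bsub>B\<^esub> b)"
  proof (induction x rule: M.homog_induct)
    case (homog i x)
    note x = homog(1) M.hcomp_closed[OF homog(1)]
    from homog(2,3) show ?case
    proof (induction a rule: A.A.homog_induct)
      case (homog j a)
      note a = homog(1) A.A.hcomp_closed[OF homog(1)]
      from homog(2) show ?case
      proof (induction b rule: B.A.homog_induct)
        case (homog k b)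
        then show ?case using bal x a by auto
      next
        case (add b c)
        then show ?case using x a by (simp add: M.ract_closed add1 B.r_distr)
      qed
    next
      case (add a a')
      then show ?case using x by (simp add: M.ract_add_right M.ract_closed add2 \<phi>_add B.l_distr add1)
    qed
  next
    case (add x y)
    then show ?case by (simp add: M.ract_add_left M.ract_closed add2)
  qed
qed (use assms in auto)

text \<open>The generators of the relations are differences on which a balanced map cancels.\<close>

lemma frag_hom_vanish:
  assumes H: "abelian_group H" and f: "f \<in> hom FG (add_monoid H)"
    and h: "tens_balanced A M \<phi> B H h" and fh: "\<And>x b. x \<in> carrier M \<Longrightarrow> b \<in> carrier B \<Longrightarrow> f (frag_of (x, b)) = h x b"
    and u: "u \<in> TR"
  shows "f u = \<zero>\<^bsub>H\<^esub>"
proof -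
  interpret H: abelian_group H by fact
  interpret F: group_hom FG "add_monoid H" f
    using f by (auto simp: group_hom_def group_hom_axioms_def H.a_group)
  have add1: "h x (b \<oplus>\<^bsub>B\<^esub> c) = h x b \<oplus>\<^bsub>H\<^esub> h x c" if "x \<in> carrier M" "b \<in> carrier B" "c \<in> carrier B" for x b c
    using h addhom_add[of "h x" B H] that by (auto simp: tens_balanced_def)
  have add2: "h (x \<oplus>\<^bsub>M\<^esub> y) b = h x b \<oplus>\<^bsub>H\<^esub> h y b" if "x \<in> carrier M" "y \<in> carrier M" "b \<in> carrier B" for x y b
    using h addhom_add[of "\<lambda>x. h x b" M H] that by (auto simp: tens_balanced_def)
  have cl: "h x b \<in> carrier H" if "x \<in> carrier M" "b \<in> carrier B" for x b
    using h that addhom_closed[of "h x" B H] by (auto simp: tens_balanced_def)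
  have diff: "f (u - v) = f u \<ominus>\<^bsub>H\<^esub> f v" if "Poly_Mapping.keys u \<subseteq> PS" "Poly_Mapping.keys v \<subseteq> PS" for u v
    using F.hom_mult[of u "-v"] F.hom_inv[of v] that by (simp add: a_minus_def a_inv_def)
  have [simp]: "f 0 = \<zero>\<^bsub>H\<^esub>" using F.hom_one by simp
  have canc: "(a \<oplus>\<^bsub>H\<^esub> b) \<ominus>\<^bsub>H\<^esub> a \<ominus>\<^bsub>H\<^esub> b = \<zero>\<^bsub>H\<^esub>" if "a \<in> carrier H" "b \<in> carrier H" for a b
  proof -
    have "(a \<oplus>\<^bsub>H\<^esub> b) \<ominus>\<^bsub>H\<^esub> a \<ominus>\<^bsub>H\<^esub> b = (a \<oplus>\<^bsub>H\<^esub> b) \<oplus>\<^bsub>H\<^esub> \<ominus>\<^bsub>H\<^esub> (a \<oplus>\<^bsub>H\<^esub> b)"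
      using that by (simp add: a_minus_def H.a_assoc H.minus_add)
    then show ?thesis using that by (simp add: H.r_neg)
  qed
  show ?thesis
    using u
  proof (induction rule: tens_rel.induct)
    case (diff u v)
    then show ?case using TR_keys[of u] TR_keys[of v] by (simp add: \<open>\<And>v u. _ \<Longrightarrow> _ \<Longrightarrow> f (u - v) = _\<close> a_minus_def)
  qed (auto simp: diff keys_diff_sub M.ract_closed fh add1 add2 cl canc[unfolded a_minus_def] H.r_neg a_minus_def
      bspec[OF bspec[OF bspec[OF conjunct2[OF conjunct2[OF h[unfolded tens_balanced_def]]]]]])
qed

end

subsection \<open>Maps on the tensor product\<close>

context dg_tens
begin

lemma tens_balanced_closed:
  "tens_balanced A M \<phi> B H h \<Longrightarrow> x \<in> carrier M \<Longrightarrow> b \<in> carrier B \<Longrightarrow> h x b \<in> carrier H"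
  unfolding tens_balanced_def using addhom_closed[of "h x" B H b] by blast

lemma tens_eval_cls:
  assumes H: "abelian_group H" and h: "tens_balanced A M \<phi> B H h" and u: "Poly_Mapping.keys u \<subseteq> PS"
  shows "tens_eval H (\<lambda>(x, b). h x b) (cls u) = frag_sum H (\<lambda>(x, b). h x b) u"
proof -
  interpret H: abelian_group H by fact
  let ?h = "\<lambda>(x, b). h x b"
  have cl: "?h \<in> PS \<rightarrow> carrier H"
    using tens_balanced_closed[OF h] by auto
  note hom = frag_sum_hom[OF H cl]
  have "frag_sum H ?h (t + u) = frag_sum H ?h u" if t: "t \<in> TR" for t
  proof -
    have "frag_sum H ?h (t + u) = frag_sum H ?h t \<oplus>\<^bsub>H\<^esub> frag_sum H ?h u"
      using hom_mult[OF hom, of t u] TR_keys[OF t] u by simp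
    moreover have "frag_sum H ?h t = \<zero>\<^bsub>H\<^esub>"
      by (rule frag_hom_vanish[OF H hom h _ t]) (simp add: frag_sum_of[OF H] tens_balanced_closed[OF h])
    moreover have "frag_sum H ?h u \<in> carrier H"
      using hom_in_carrier[OF hom, of u] u by simp
    ultimately show ?thesis by simp
  qed
  then have "frag_sum H ?h ` cls u = {frag_sum H ?h u}"
    using cls_self[of u] by (auto simp: cls_def' image_iff intro!: bexI[of _ u])
  then show ?thesis by (simp add: tens_eval_def frag_sum_def)
qed

lemma tens_eval_hom:
  assumes H: "abelian_group H" and h: "tens_balanced A M \<phi> B H h"
  shows "addhom T H (tens_eval H (\<lambda>(x, b). h x b))"
proof (rule addhomI)
  interpret H: abelian_group H by fact
  let ?h = "\<lambda>(x, b). h x b"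
  have cl: "?h \<in> PS \<rightarrow> carrier H"
    using tens_balanced_closed[OF h] by auto
  note hom = frag_sum_hom[OF H cl]
  fix X assume "X \<in> carrier T"
  then obtain u where u: "X = cls u" "Poly_Mapping.keys u \<subseteq> PS" by (auto simp: T_simps)
  show "tens_eval H ?h X \<in> carrier H"
    using hom_in_carrier[OF hom, of u] u by (simp add: tens_eval_cls[OF H h])
  fix Y assume "Y \<in> carrier T"
  then obtain v where v: "Y = cls v" "Poly_Mapping.keys v \<subseteq> PS" by (auto simp: T_simps)
  show "tens_eval H ?h (X \<oplus>\<^bsub>T\<^esub> Y) = tens_eval H ?h X \<oplus>\<^bsub>H\<^esub> tens_eval H ?h Y"
    using u v hom_mult[OF hom, of u v] keys_add_sub[of u PS v]
    by (simp add: cls_add tens_eval_cls[OF H h])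
qed

lemma tens_eval_pure:
  assumes H: "abelian_group H" and h: "tens_balanced A M \<phi> B H h" and "x \<in> carrier M" "b \<in> carrier B"
  shows "tens_eval H (\<lambda>(x, b). h x b) (tn x b) = h x b"
proof -
  have "h x b \<in> carrier H" using tens_balanced_closed[OF h] assms(3,4) by auto
  then show ?thesis
    unfolding tens_def using assms by (subst tens_eval_cls[OF H h]) (auto simp: frag_sum_of)
qed

lemma frag_extend_keys:
  "(\<And>p. p \<in> S \<Longrightarrow> Poly_Mapping.keys (g p) \<subseteq> W) \<Longrightarrow> Poly_Mapping.keys u \<subseteq> S \<Longrightarrow>
    Poly_Mapping.keys (frag_extend g u) \<subseteq> W"
  by (rule order_trans[OF keys_frag_extend]) blast

lemma cls_frag_extend_hom:
  assumes "\<And>p. p \<in> PS \<Longrightarrow> Poly_Mapping.keys (g p) \<subseteq> PS"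
  shows "(\<lambda>u. cls (frag_extend g u)) \<in> hom FG (add_monoid T)"
  using frag_extend_keys[where S = PS and g = g and W = PS, OF assms]
  by (intro homI) (simp_all add: cls_closed frag_extend_add cls_add)

lemma frag_extend_TR:
  assumes "\<And>p. p \<in> PS \<Longrightarrow> Poly_Mapping.keys (g p) \<subseteq> PS"
    and "tens_balanced A M \<phi> B T (\<lambda>x b. cls (g (x, b)))" and "t \<in> TR"
  shows "frag_extend g t \<in> TR"
proof -
  have "cls (frag_extend g t) = \<zero>\<^bsub>T\<^esub>"
    using frag_hom_vanish[OF T_abelian cls_frag_extend_hom[OF assms(1)] assms(2) _ assms(3)] by simp
  then show ?thesis using cls_eq_iff[of "frag_extend g t" 0] by (simp add: cls_zero)
qed

text \<open>A map g on pairs descends to the quotient when its composite with the projection is balanced: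
  it then maps relations to relations, and the set in \<open>tens_map\<close> is a single coset.\<close>

lemma tens_map_cls:
  assumes "\<And>p. p \<in> PS \<Longrightarrow> Poly_Mapping.keys (g p) \<subseteq> PS"
    and "tens_balanced A M \<phi> B T (\<lambda>x b. cls (g (x, b)))"
  shows "tens_map TR g (cls u) = cls (frag_extend g u)"
proof
  show "tens_map TR g (cls u) \<subseteq> cls (frag_extend g u)"
  proof
    fix z assume "z \<in> tens_map TR g (cls u)"
    then obtain t t' where z: "z = t + frag_extend g (t' + u)" "t \<in> TR" "t' \<in> TR"
      by (auto simp: tens_map_def cls_def')
    then have "z = (t + frag_extend g t') + frag_extend g u" by (simp add: frag_extend_add add.assoc)
    then show "z \<in> cls (frag_extend g u)"
      using z TR_add[OF z(2) frag_extend_TR[OF assms z(3)]] by (auto simp: cls_def')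
  qed
  show "cls (frag_extend g u) \<subseteq> tens_map TR g (cls u)"
    using cls_self[of u] unfolding tens_map_def cls_def'[where u = "frag_extend g u"] by blast
qed

lemma tens_map_hom:
  assumes "\<And>p. p \<in> PS \<Longrightarrow> Poly_Mapping.keys (g p) \<subseteq> PS"
    and "tens_balanced A M \<phi> B T (\<lambda>x b. cls (g (x, b)))"
  shows "addhom T T (tens_map TR g)"
proof (rule addhomI)
  note hom = cls_frag_extend_hom[where g = g, OF assms(1)]
  fix X assume "X \<in> carrier T"
  then obtain u where u: "X = cls u" "Poly_Mapping.keys u \<subseteq> PS" by (auto simp: T_simps)
  show "tens_map TR g X \<in> carrier T"
    using hom_in_carrier[OF hom, of u] u by (simp add: tens_map_cls[OF assms])
  fix Y assume "Y \<in> carrier T"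
  then obtain v where v: "Y = cls v" "Poly_Mapping.keys v \<subseteq> PS" by (auto simp: T_simps)
  show "tens_map TR g (X \<oplus>\<^bsub>T\<^esub> Y) = tens_map TR g X \<oplus>\<^bsub>T\<^esub> tens_map TR g Y"
    using u v hom_mult[OF hom, of u v] by (simp add: cls_add tens_map_cls[OF assms])
qed

lemma tens_map_pure:
  assumes "\<And>p. p \<in> PS \<Longrightarrow> Poly_Mapping.keys (g p) \<subseteq> PS"
    and "tens_balanced A M \<phi> B T (\<lambda>x b. cls (g (x, b)))"
  shows "tens_map TR g (tn x b) = cls (g (x, b))"
  by (simp add: tens_def tens_map_cls[OF assms])

subsection \<open>Action, differential and grading\<close>

lemma ract_T: "ract T X c = tens_map TR (\<lambda>(x, b). frag_of (x, b \<otimes>\<^bsub>B\<^esub> c)) X"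
  by (simp add: dg_tensor_def)

lemma ract_balanced:
  assumes c: "c \<in> carrier B"
  shows "tens_balanced A M \<phi> B T (\<lambda>x b. tn x (b \<otimes>\<^bsub>B\<^esub> c))"
  using c
  by (intro tens_balancedI T_abelian addhomI)
    (auto simp: tn_add_right tn_add_left B.l_distr tn_balanced B.m_assoc M.hcomp_closed A.A.hcomp_closed
       B.A.hcomp_closed)

lemma ract_T_hom: "c \<in> carrier B \<Longrightarrow> addhom T T (\<lambda>X. ract T X c)"
  unfolding ract_T using ract_balanced by (intro tens_map_hom) (auto simp: tens_def)

lemma ract_pure: "x \<in> carrier M \<Longrightarrow> b \<in> carrier B \<Longrightarrow> c \<in> carrier B \<Longrightarrow> ract T (tn x b) c = tn x (b \<otimes>\<^bsub>B\<^esub> c)"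
  unfolding ract_T using ract_balanced by (subst tens_map_pure) (auto simp: tens_def)

lemma ract_T_closed: "X \<in> carrier T \<Longrightarrow> c \<in> carrier B \<Longrightarrow> ract T X c \<in> carrier T"
  using addhom_closed[OF ract_T_hom] .

abbreviation "dgen \<equiv> (\<lambda>(x, b). frag_of (dif M x, b) + (\<Sum>i\<in>hsupp M x. frag_cmul (sg i) (frag_of (hpart M x i, dif B b))))"

lemma dif_T: "dif T = tens_map TR dgen"
  by (simp add: dg_tensor_def tens_dif_def)

lemma frag_cmul_keys: "Poly_Mapping.keys u \<subseteq> W \<Longrightarrow> Poly_Mapping.keys (frag_cmul n u) \<subseteq> W"
  for u :: "'p \<Rightarrow>\<^sub>0 int"
  using keys_cmul[of n u] by blast

lemma dgen_keys: "p \<in> PS \<Longrightarrow> Poly_Mapping.keys (dgen p) \<subseteq> PS"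
  apply (elim SigmaE)
  apply (simp only: prod.case)
  apply (intro keys_add_sub frag_of_closed conjunct2[OF cls_sum] M.finite_hsupp frag_cmul_keys)
       apply simp_all
  done

lemma cls_dgen:
  assumes "x \<in> carrier M" "b \<in> carrier B"
  shows "cls (dgen (x, b)) = tn (dif M x) b \<oplus>\<^bsub>T\<^esub> tn (twist M x) (dif B b)"
proof -
  let ?f = "\<lambda>i. frag_cmul (sg i) (frag_of (hpart M x i, dif B b))"
  have k: "Poly_Mapping.keys (?f i) \<subseteq> PS" for i
    using assms by (intro frag_cmul_keys frag_of_closed) auto
  have "cls (dgen (x, b)) = cls (frag_of (dif M x, b)) \<oplus>\<^bsub>T\<^esub> cls (\<Sum>i\<in>hsupp M x. ?f i)"
    using assms k M.finite_hsupp[OF assms(1)]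
    by (simp only: prod.case) (rule cls_add[symmetric]; intro frag_of_closed conjunct2[OF cls_sum]; simp)
  also have "cls (\<Sum>i\<in>hsupp M x. ?f i) = (\<Oplus>\<^bsub>T\<^esub>i\<in>hsupp M x. cls (?f i))"
    using k M.finite_hsupp[OF assms(1)] by (intro conjunct1[OF cls_sum]) auto
  also have "\<dots> = (\<Oplus>\<^bsub>T\<^esub>i\<in>hsupp M x. tn (sgs M i (hpart M x i)) (dif B b))"
  proof (rule TG.finsum_cong')
    show "cls (?f i) = tn (sgs M i (hpart M x i)) (dif B b)" for i
      using assms tn_sgs_left[of "hpart M x i" "dif B b" i]
      by (subst cls_cmul_sg[OF frag_of_closed]) (simp_all add: tens_def)
  qed (use assms in auto)
  also have "\<dots> = tn (twist M x) (dif B b)"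
    unfolding twist_def using assms M.finite_hsupp[OF assms(1)]
    by (intro addhom_finsum[OF M.abelian_group_axioms T_abelian tn_hom_left, symmetric]) auto
  finally show ?thesis by (simp add: tens_def)
qed

text \<open>The differential of \<open>x \<otimes> b\<close>; the automorphism \<open>twist\<close> makes the sign additive in x.\<close>

definition dmap where "dmap x b = tn (dif M x) b \<oplus>\<^bsub>T\<^esub> tn (twist M x) (dif B b)"

lemma B_leibniz:
  assumes "b \<in> hcomp B i" "c \<in> carrier B"
  shows "dif B (b \<otimes>\<^bsub>B\<^esub> c) = dif B b \<otimes>\<^bsub>B\<^esub> c \<oplus>\<^bsub>B\<^esub> sgs B i (b \<otimes>\<^bsub>B\<^esub> dif B c)"
  using assms(2)
proof (induction c rule: B.A.homog_induct)
  case (homog j c)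
  then show ?case using B.leibniz_sgs[OF assms(1)] by auto
next
  case (add c c')
  then show ?case using B.A.hcomp_closed[OF assms(1)]
    by (simp add: B.r_distr B.A.dif_add B.A.sgs_add B.A.a_ac)
qed

lemma dmap_balanced: "tens_balanced A M \<phi> B T dmap"
proof (rule tens_balancedI[OF T_abelian])
  show "addhom B T (dmap x)" if "x \<in> carrier M" for x
    unfolding dmap_def using that
    by (intro TG.addhom_add_fun tn_hom_right addhom_compose[OF B.A.dif_hom tn_hom_right]) auto
  show "addhom M T (\<lambda>x. dmap x b)" if "b \<in> carrier B" for b
    unfolding dmap_def using that
    by (intro TG.addhom_add_fun addhom_compose[OF M.dif_hom tn_hom_left] addhom_compose[OF M.twist_hom tn_hom_left]) auto
  fix i j k x a b assume x: "x \<in> hcomp M i" and a: "a \<in> hcomp A j" and b: "b \<in> hcomp B k"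
  note c = M.hcomp_closed[OF x] A.A.hcomp_closed[OF a] B.A.hcomp_closed[OF b]
  have "dmap (ract M x a) b = tn (ract M (dif M x) a \<oplus>\<^bsub>M\<^esub> sgs M i (ract M x (dif A a))) b
       \<oplus>\<^bsub>T\<^esub> tn (sgs M (i + j) (ract M x a)) (dif B b)"
    using c unfolding dmap_def
    by (simp add: M.leibniz_sgs[OF x a] M.twist_homog[OF M.ract_degree[OF x a]])
  also have "\<dots> = tn (dif M x) (\<phi> a \<otimes>\<^bsub>B\<^esub> b) \<oplus>\<^bsub>T\<^esub> sgs T i (tn x (dif B (\<phi> a) \<otimes>\<^bsub>B\<^esub> b))
       \<oplus>\<^bsub>T\<^esub> sgs T (i + j) (tn x (\<phi> a \<otimes>\<^bsub>B\<^esub> dif B b))"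
    using c by (simp add: tn_add_left M.ract_closed tn_sgs_left tn_balanced \<phi>_dif)
  also have "\<dots> = dmap x (\<phi> a \<otimes>\<^bsub>B\<^esub> b)"
    using c unfolding dmap_def
    by (simp add: B_leibniz[OF \<phi>_degree[OF a]] M.twist_homog[OF x] tn_sgs_left tn_add_right tn_sgs_right
        TG.sgs_add TG.sgs_sgs TG.a_assoc add.commute)
  finally show "dmap (ract M x a) b = dmap x (\<phi> a \<otimes>\<^bsub>B\<^esub> b)" .
qed

lemma dgen_balanced: "tens_balanced A M \<phi> B T (\<lambda>x b. cls (dgen (x, b)))"
proof -
  have eq: "cls (dgen (x, b)) = dmap x b" if "x \<in> carrier M" "b \<in> carrier B" for x b
    using cls_dgen that by (simp add: dmap_def)
  have "addhom B T (\<lambda>b. cls (dgen (x, b)))" if "x \<in> carrier M" for x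
    using dmap_balanced that eq by (auto simp: tens_balanced_def hom_def Pi_def simp del: split_paired_All prod.case)
  moreover have "addhom M T (\<lambda>x. cls (dgen (x, b)))" if "b \<in> carrier B" for b
    using dmap_balanced that eq by (auto simp: tens_balanced_def hom_def Pi_def simp del: split_paired_All prod.case)
  ultimately show ?thesis
    using dmap_balanced eq M.ract_closed unfolding tens_balanced_def by (simp del: prod.case)
qed

lemma dif_T_hom: "addhom T T (dif T)"
  unfolding dif_T by (rule tens_map_hom[OF dgen_keys dgen_balanced])

lemma dif_pure_all:
  "x \<in> carrier M \<Longrightarrow> b \<in> carrier B \<Longrightarrow> dif T (tn x b) = tn (dif M x) b \<oplus>\<^bsub>T\<^esub> tn (twist M x) (dif B b)"
  unfolding dif_T by (subst tens_map_pure[OF dgen_keys dgen_balanced]) (assumption, rule cls_dgen)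

lemma dif_pure:
  "x \<in> hcomp M i \<Longrightarrow> b \<in> carrier B \<Longrightarrow> dif T (tn x b) = tn (dif M x) b \<oplus>\<^bsub>T\<^esub> sgs T i (tn x (dif B b))"
  by (simp add: dif_pure_all M.hcomp_closed M.twist_homog tn_sgs_left)

lemma hcomp_T: "hcomp T n = cls ` {u. Poly_Mapping.keys u \<subseteq> (\<Union>i. hcomp M i \<times> hcomp B (n - i))}"
  by (simp add: dg_tensor_def tens_comp_def tens_cls_def)

lemma homog_pairs: "(\<Union>i. hcomp M i \<times> hcomp B (n - i)) \<subseteq> PS"
  using M.hcomp_closed B.A.hcomp_closed by blast

lemma hcomp_T_subgroup: "subgroup (hcomp T n) (add_monoid T)"
proof -
  let ?W = "\<Union>i. hcomp M i \<times> hcomp B (n - i)"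
  have W: "Poly_Mapping.keys u \<subseteq> ?W \<Longrightarrow> Poly_Mapping.keys u \<subseteq> PS" for u
    using homog_pairs[of n] by blast
  show ?thesis
    unfolding hcomp_T
  proof (rule TG.subgroupI')
    show "cls ` {u. Poly_Mapping.keys u \<subseteq> ?W} \<subseteq> carrier T" using W by (auto intro!: cls_closed simp del: UN_iff)
    show "\<zero>\<^bsub>T\<^esub> \<in> cls ` {u. Poly_Mapping.keys u \<subseteq> ?W}" by (rule image_eqI[of _ cls 0]) (simp_all add: cls_zero)
    fix x assume "x \<in> cls ` {u. Poly_Mapping.keys u \<subseteq> ?W}"
    then obtain u where u: "x = cls u" "Poly_Mapping.keys u \<subseteq> ?W" by blast
    show "\<ominus>\<^bsub>T\<^esub> x \<in> cls ` {u. Poly_Mapping.keys u \<subseteq> ?W}"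
      using u by (intro image_eqI[of _ _ "-u"]) (simp_all add: cls_neg[OF W])
    fix y assume "y \<in> cls ` {u. Poly_Mapping.keys u \<subseteq> ?W}"
    then obtain v where v: "y = cls v" "Poly_Mapping.keys v \<subseteq> ?W" by blast
    show "x \<oplus>\<^bsub>T\<^esub> y \<in> cls ` {u. Poly_Mapping.keys u \<subseteq> ?W}"
      using u v by (intro image_eqI[of _ _ "u + v"]) (simp_all add: cls_add[OF W W] keys_add_sub)
  qed
qed

lemma tn_degree: "x \<in> hcomp M i \<Longrightarrow> b \<in> hcomp B j \<Longrightarrow> tn x b \<in> hcomp T (i + j)"
  unfolding hcomp_T tens_def by (intro image_eqI[OF refl]) (auto intro!: exI[of _ i])

lemma hcomp_T_induct [consumes 1, case_names pure add]:
  assumes t: "t \<in> hcomp T n"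
    and pure: "\<And>i x b. x \<in> hcomp M i \<Longrightarrow> b \<in> hcomp B (n - i) \<Longrightarrow> P (tn x b)"
    and add: "\<And>s t. s \<in> hcomp T n \<Longrightarrow> t \<in> hcomp T n \<Longrightarrow> P s \<Longrightarrow> P t \<Longrightarrow> P (s \<oplus>\<^bsub>T\<^esub> t)"
  shows "P t"
proof -
  let ?W = "\<Union>i. hcomp M i \<times> hcomp B (n - i)"
  have W: "Poly_Mapping.keys u \<subseteq> ?W \<Longrightarrow> Poly_Mapping.keys u \<subseteq> PS" for u
    using homog_pairs[of n] by blast
  obtain u where u: "Poly_Mapping.keys u \<subseteq> ?W" "t = cls u" using t unfolding hcomp_T by blast
  have mem: "Poly_Mapping.keys v \<subseteq> ?W \<Longrightarrow> cls v \<in> hcomp T n" for v unfolding hcomp_T by blast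
  have "P (cls u) \<and> P (cls (- u))"
    using u(1)
  proof (induction u rule: free_Abelian_group_induct[consumes 1])
    case 1
    then show ?case using pure[of "\<zero>\<^bsub>M\<^esub>" 0 "\<zero>\<^bsub>B\<^esub>"] by (simp add: cls_zero)
  next
    case (2 x y)
    have "P (cls x \<oplus>\<^bsub>T\<^esub> cls (- y))" "P (cls y \<oplus>\<^bsub>T\<^esub> cls (- x))"
      using 2 by (auto intro!: add mem simp del: UN_iff)
    then show ?case using W[OF 2(1)] W[OF 2(2)] by (simp add: cls_add)
  next
    case (3 a)
    obtain i x b where a: "a = (x, b)" "x \<in> hcomp M i" "b \<in> hcomp B (n - i)" using 3 by auto
    have "cls (- frag_of a) = tn (\<ominus>\<^bsub>M\<^esub> x) b"
      using cls_neg[of "frag_of a"] tn_sgs_left[of x b 1] M.hcomp_closed[OF a(2)] B.A.hcomp_closed[OF a(3)] a(1)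
      by (simp add: sgs_def tens_def)
    then show ?case using pure[of x i b] pure[of "\<ominus>\<^bsub>M\<^esub> x" i b] a M.hcomp_neg by (simp add: tens_def)
  qed
  then show ?thesis using u by simp
qed

text \<open>The part of \<open>x \<otimes> b\<close> in degree n. It is balanced and so defines the projections that show the sum
  of the components to be direct.\<close>

definition pmap where "pmap n x b = (\<Oplus>\<^bsub>T\<^esub>i\<in>hsupp M x. tn (hpart M x i) (hpart B b (n - i)))"

lemma pmap_homog: "x \<in> hcomp M i \<Longrightarrow> b \<in> carrier B \<Longrightarrow> pmap n x b = tn x (hpart B b (n - i))"
  unfolding pmap_def
  by (rule M.by_degree_homog[OF T_abelian, where g = "\<lambda>i y. tn y (hpart B b (n - i))"]) (auto intro: tn_hom_left)

lemma hpart_mult_homog: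
  assumes "b \<in> hcomp B j" "c \<in> carrier B"
  shows "hpart B (b \<otimes>\<^bsub>B\<^esub> c) (k + j) = b \<otimes>\<^bsub>B\<^esub> hpart B c k"
proof -
  have bc: "b \<in> carrier B" using B.A.hcomp_closed assms(1) .
  show ?thesis
    using assms(2)
    by (intro B.A.hpart_map[where f = "\<lambda>c. b \<otimes>\<^bsub>B\<^esub> c"])
      (use bc assms B.mult_degree[OF assms(1)] in \<open>auto intro!: addhomI simp: B.r_distr B.A.dg_complex_axioms add.commute\<close>)
qed

lemma pmap_balanced: "tens_balanced A M \<phi> B T (pmap n)"
proof (rule tens_balancedI[OF T_abelian])
  show "addhom B T (pmap n x)" if "x \<in> carrier M" for x
    unfolding pmap_def using that
    by (intro TG.addhom_finsum_fun addhom_compose[OF B.A.hpart_hom tn_hom_right]) auto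
  show "addhom M T (\<lambda>x. pmap n x b)" if "b \<in> carrier B" for b
    unfolding pmap_def
    by (rule M.addhom_by_degree[OF T_abelian, where g = "\<lambda>i y. tn y (hpart B b (n - i))"])
      (use that in \<open>auto intro: tn_hom_left\<close>)
  fix i j k x a b assume x: "x \<in> hcomp M i" and a: "a \<in> hcomp A j" and b: "b \<in> hcomp B k"
  note c = M.hcomp_closed[OF x] A.A.hcomp_closed[OF a] B.A.hcomp_closed[OF b]
  show "pmap n (ract M x a) b = pmap n x (\<phi> a \<otimes>\<^bsub>B\<^esub> b)"
    using c hpart_mult_homog[OF \<phi>_degree[OF a] c(3), of "n - i - j"]
    by (simp add: pmap_homog[OF x] pmap_homog[OF M.ract_degree[OF x a]] tn_balanced algebra_simps)
qed

lemma T_direct_sum: assumes "t \<in> carrier T" shows "\<exists>!c. is_decomp T t c"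
proof -
  define p where "p n = tens_eval T (\<lambda>(x, b). pmap n x b)" for n
  have hom: "addhom T T (p n)" for n unfolding p_def by (rule tens_eval_hom[OF T_abelian pmap_balanced])
  have ppure: "p n (tn x b) = tn x (hpart B b (n - i))" if "x \<in> hcomp M i" "b \<in> carrier B" for n i x b
    unfolding p_def using that by (subst tens_eval_pure[OF T_abelian pmap_balanced]) (auto simp: pmap_homog M.hcomp_closed)
  have p1: "p n t = t" if "t \<in> hcomp T n" for n t
    using that
  proof (induction t rule: hcomp_T_induct)
    case (pure i x b)
    then show ?case by (simp add: ppure[OF pure(1)] B.A.hcomp_closed B.A.hpart_homog)
  next
    case (add s t)
    then show ?case using TG.subgroup_carrier[OF hcomp_T_subgroup] by (simp add: addhom_add[OF hom])
  qed
  have p2: "p m t = \<zero>\<^bsub>T\<^esub>" if "t \<in> hcomp T n" "m \<noteq> n" for n m t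
    using that(1)
  proof (induction t rule: hcomp_T_induct)
    case (pure i x b)
    then show ?case using that(2)
      by (simp add: ppure[OF pure(1)] B.A.hcomp_closed B.A.hpart_homog M.hcomp_closed)
  next
    case (add s t)
    then show ?case using TG.subgroup_carrier[OF hcomp_T_subgroup] by (simp add: addhom_add[OF hom])
  qed
  have "\<exists>S. finite S \<and> t = (\<Oplus>\<^bsub>T\<^esub>n\<in>S. p n t) \<and> (\<forall>n. p n t \<in> hcomp T n \<and> (n \<notin> S \<longrightarrow> p n t = \<zero>\<^bsub>T\<^esub>))"
    using assms
  proof (induction t rule: tens_induct)
    case (pure i j x b)
    have t: "tn x b \<in> hcomp T (i + j)" using tn_degree[OF pure] .
    then have c: "tn x b \<in> carrier T" using TG.subgroup_carrier[OF hcomp_T_subgroup] by blast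
    show ?case
      using p1[OF t] p2[OF t] t c TG.subgroup_zero[OF hcomp_T_subgroup]
      by (intro exI[of _ "{i + j}"]) (auto, metis)
  next
    case (add s t)
    then obtain S S' where S: "finite S" "s = (\<Oplus>\<^bsub>T\<^esub>n\<in>S. p n s)" "\<And>n. p n s \<in> hcomp T n" "\<And>n. n \<notin> S \<Longrightarrow> p n s = \<zero>\<^bsub>T\<^esub>"
      and S': "finite S'" "t = (\<Oplus>\<^bsub>T\<^esub>n\<in>S'. p n t)" "\<And>n. p n t \<in> hcomp T n" "\<And>n. n \<notin> S' \<Longrightarrow> p n t = \<zero>\<^bsub>T\<^esub>"
      by (elim exE conjE) blast
    have ext1: "(\<Oplus>\<^bsub>T\<^esub>n\<in>S \<union> S'. p n s) = s"
      using TG.finsum_mono_neutral[of "S \<union> S'" S "\<lambda>n. p n s"] S addhom_closed[OF hom] add(1) S'(1) by auto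
    have ext2: "(\<Oplus>\<^bsub>T\<^esub>n\<in>S \<union> S'. p n t) = t"
      using TG.finsum_mono_neutral[of "S \<union> S'" S' "\<lambda>n. p n t"] S' addhom_closed[OF hom] add(2) S(1) by auto
    note ext = ext1 ext2
    have "(\<Oplus>\<^bsub>T\<^esub>n\<in>S \<union> S'. p n (s \<oplus>\<^bsub>T\<^esub> t)) = (\<Oplus>\<^bsub>T\<^esub>n\<in>S \<union> S'. p n s \<oplus>\<^bsub>T\<^esub> p n t)"
      using add addhom_closed[OF hom] by (intro TG.finsum_cong') (auto simp: addhom_add[OF hom])
    also have "\<dots> = (\<Oplus>\<^bsub>T\<^esub>n\<in>S \<union> S'. p n s) \<oplus>\<^bsub>T\<^esub> (\<Oplus>\<^bsub>T\<^esub>n\<in>S \<union> S'. p n t)"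
      using add addhom_closed[OF hom] by (intro TG.finsum_addf) auto
    finally have "(\<Oplus>\<^bsub>T\<^esub>n\<in>S \<union> S'. p n (s \<oplus>\<^bsub>T\<^esub> t)) = s \<oplus>\<^bsub>T\<^esub> t" by (simp add: ext)
    then show ?case
      using S(1,3,4) S'(1,3,4) add addhom_closed[OF hom] TG.subgroup_add[OF hcomp_T_subgroup]
      by (intro exI[of _ "S \<union> S'"]) (simp add: addhom_add[OF hom])
  qed
  then obtain S where "finite S" "t = (\<Oplus>\<^bsub>T\<^esub>n\<in>S. p n t)" "\<And>n. p n t \<in> hcomp T n" by blast
  then show ?thesis
    by (intro is_decomp_ex1[OF T_abelian hcomp_T_subgroup, where p = p and S = S and c = "\<lambda>n. p n t"])
      (auto simp: p1 p2 hom)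
qed

lemma T_complex: "dg_complex T"
proof (intro dg_complex.intro dg_complex_axioms.intro)
  show "dif T x \<in> hcomp T (i - 1)" if "x \<in> hcomp T i" for x i
    using that
  proof (induction x rule: hcomp_T_induct)
    case (pure j x b)
    have "tn (dif M x) b \<in> hcomp T (i - 1)" "tn x (dif B b) \<in> hcomp T (i - 1)"
      using tn_degree[OF M.dif_degree[OF pure(1)] pure(2)] tn_degree[OF pure(1) B.A.dif_degree[OF pure(2)]]
      by (simp_all add: algebra_simps)
    then show ?case
      using pure by (auto simp: dif_pure B.A.hcomp_closed
        intro!: TG.subgroup_add[OF hcomp_T_subgroup] TG.sgs_subgroup[OF hcomp_T_subgroup])
  next
    case (add s t)
    then show ?case using TG.subgroup_carrier[OF hcomp_T_subgroup]
      by (auto simp: addhom_add[OF dif_T_hom] intro!: TG.subgroup_add[OF hcomp_T_subgroup])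
  qed
  show "dif T (dif T x) = \<zero>\<^bsub>T\<^esub>" if "x \<in> carrier T" for x
    using that
  proof (induction x rule: tens_induct)
    case (pure i j x b)
    note c = M.hcomp_closed[OF pure(1)] B.A.hcomp_closed[OF pure(2)]
    have "dif T (dif T (tn x b)) = dif T (tn (dif M x) b) \<oplus>\<^bsub>T\<^esub> sgs T i (dif T (tn x (dif B b)))"
      using c addhom_sgs[OF T_abelian T_abelian dif_T_hom]
      by (simp add: dif_pure[OF pure(1)] addhom_add[OF dif_T_hom])
    also have "\<dots> = sgs T (i - 1) (tn (dif M x) (dif B b)) \<oplus>\<^bsub>T\<^esub> sgs T i (tn (dif M x) (dif B b))"
      using c by (simp add: dif_pure[OF pure(1)] dif_pure[OF M.dif_degree[OF pure(1)]] M.dif_dif B.A.dif_dif)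
    also have "\<dots> = \<zero>\<^bsub>T\<^esub>"
      using c by (auto simp: sgs_def TG.l_neg TG.r_neg)
    finally show ?case .
  next
    case (add s t)
    then show ?case using addhom_closed[OF dif_T_hom] by (simp add: addhom_add[OF dif_T_hom])
  qed
qed (use T_abelian hcomp_T_subgroup T_direct_sum dif_T_hom in auto)

lemma T_module: "dg_module B T"
proof (intro dg_module.intro dg_module_axioms.intro)
  show "dg_complex T" by (rule T_complex)
  interpret TC: dg_complex T by (rule T_complex)
  show "ract T (x \<oplus>\<^bsub>T\<^esub> y) b = ract T x b \<oplus>\<^bsub>T\<^esub> ract T y b"
    if "x \<in> carrier T" "y \<in> carrier T" "b \<in> carrier B" for x y b
    using addhom_add[OF ract_T_hom] that by auto
  show "ract T x b \<in> carrier T" if "x \<in> carrier T" "b \<in> carrier B" for x b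
    using that by (rule ract_T_closed)
  show "ract T x (b \<oplus>\<^bsub>B\<^esub> c) = ract T x b \<oplus>\<^bsub>T\<^esub> ract T x c"
    if "x \<in> carrier T" "b \<in> carrier B" "c \<in> carrier B" for x b c
    by (rule tens_hom_eqI[OF ract_T_hom TG.addhom_add_fun[OF ract_T_hom ract_T_hom]])
      (use that in \<open>auto simp: ract_pure M.hcomp_closed B.A.hcomp_closed B.r_distr tn_add_right\<close>)
  show "ract T x (b \<otimes>\<^bsub>B\<^esub> c) = ract T (ract T x b) c"
    if "x \<in> carrier T" "b \<in> carrier B" "c \<in> carrier B" for x b c
    by (rule tens_hom_eqI[OF ract_T_hom addhom_compose[OF ract_T_hom ract_T_hom]])
      (use that in \<open>auto simp: ract_pure M.hcomp_closed B.A.hcomp_closed B.m_assoc\<close>)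
  show "ract T x \<one>\<^bsub>B\<^esub> = x" if "x \<in> carrier T" for x
    by (rule tens_hom_eqI[OF ract_T_hom addhom_id])
      (use that in \<open>auto simp: ract_pure M.hcomp_closed B.A.hcomp_closed\<close>)
  show deg: "ract T x b \<in> hcomp T (i + j)" if "x \<in> hcomp T i" "b \<in> hcomp B j" for x b i j
    using that(1)
  proof (induction x rule: hcomp_T_induct)
    case (pure k x c)
    then show ?case
      using that(2) tn_degree[OF pure(1) B.mult_degree[OF pure(2) that(2)]]
      by (simp add: ract_pure M.hcomp_closed B.A.hcomp_closed)
  next
    case (add s t)
    then show ?case using that(2)
      by (simp add: addhom_add[OF ract_T_hom] TC.hcomp_closed B.A.hcomp_closed TC.hcomp_add)
  qed
  fix x i b j assume x: "x \<in> hcomp T i" and b: "b \<in> hcomp B j"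
  note bc = B.A.hcomp_closed[OF b]
  have "dif T (ract T x b) = ract T (dif T x) b \<oplus>\<^bsub>T\<^esub> sgs T i (ract T x (dif B b))"
    using x
  proof (induction x rule: hcomp_T_induct)
    case (pure k x c)
    note cc = M.hcomp_closed[OF pure(1)] B.A.hcomp_closed[OF pure(2)]
    have "dif T (ract T (tn x c) b) = tn (dif M x) (c \<otimes>\<^bsub>B\<^esub> b)
       \<oplus>\<^bsub>T\<^esub> sgs T k (tn x (dif B c \<otimes>\<^bsub>B\<^esub> b) \<oplus>\<^bsub>T\<^esub> sgs T (i - k) (tn x (c \<otimes>\<^bsub>B\<^esub> dif B b)))"
      using cc bc by (simp add: ract_pure dif_pure[OF pure(1)] B_leibniz[OF pure(2)] tn_add_right tn_sgs_right)
    also have "\<dots> = ract T (dif T (tn x c)) b \<oplus>\<^bsub>T\<^esub> sgs T i (ract T (tn x c) (dif B b))"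
      using cc bc
      by (simp add: dif_pure[OF pure(1)] addhom_add[OF ract_T_hom] addhom_sgs[OF T_abelian T_abelian ract_T_hom]
        ract_pure TG.sgs_add TG.sgs_sgs TG.a_assoc)
    finally show ?case .
  next
    case (add s t)
    then show ?case using bc
      by (simp add: addhom_add[OF ract_T_hom] TC.hcomp_closed TC.dif_add ract_T_closed TG.sgs_add TG.a_ac)
  qed
  then show "dif T (ract T x b) = ract T (dif T x) b \<oplus>\<^bsub>T\<^esub> [sg i] \<cdot>\<^bsub>T\<^esub> ract T x (dif B b)"
    using TC.hcomp_closed[OF x] bc by (simp add: TG.sg_add_pow ract_T_closed)
qed

sublocale T: dg_module B T by (rule T_module)

end

section \<open>Functoriality of the tensor product\<close>

definition tens_fun where
  "tens_fun A M \<phi> B M' h = tens_eval (dg_tensor A M' \<phi> B) (\<lambda>(x, b). tens A M' \<phi> B (h x) b)"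

locale dg_tens_map = dg_ext R A B \<phi> + M: dg_tens R A B \<phi> M + M': dg_tens R A B \<phi> M'
  for R :: "('r, 'y) ring_scheme" and A :: "('r, 'a) dg_alg" and B :: "('r, 'b) dg_alg"
    and \<phi> :: "'a \<Rightarrow> 'b" and M :: "('a, 'm) dg_mod" and M' :: "('a, 'n) dg_mod" +
  fixes h :: "'m \<Rightarrow> 'n"
  assumes h_hom: "addhom M M' h"
    and h_lin: "x \<in> carrier M \<Longrightarrow> a \<in> carrier A \<Longrightarrow> h (ract M x a) = ract M' (h x) a"
begin

abbreviation "F \<equiv> tens_fun A M \<phi> B M' h"

lemma h_closed [simp]: "x \<in> carrier M \<Longrightarrow> h x \<in> carrier M'"
  using addhom_closed[OF h_hom] .

lemma F_balanced: "tens_balanced A M \<phi> B M'.T (\<lambda>x b. M'.tn (h x) b)"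
  by (intro M.tens_balancedI M'.T_abelian M'.tn_hom_right addhom_compose[OF h_hom M'.tn_hom_left])
    (auto simp: h_lin M'.tn_balanced M.M.hcomp_closed A.A.hcomp_closed B.A.hcomp_closed)

lemma F_hom: "addhom M.T M'.T F"
  unfolding tens_fun_def by (rule M.tens_eval_hom[OF M'.T_abelian F_balanced])

lemma F_pure: "x \<in> carrier M \<Longrightarrow> b \<in> carrier B \<Longrightarrow> F (M.tn x b) = M'.tn (h x) b"
  unfolding tens_fun_def by (rule M.tens_eval_pure[OF M'.T_abelian F_balanced])

lemma F_closed: "t \<in> carrier M.T \<Longrightarrow> F t \<in> carrier M'.T"
  using addhom_closed[OF F_hom] .

lemma F_lin: "t \<in> carrier M.T \<Longrightarrow> b \<in> carrier B \<Longrightarrow> F (ract M.T t b) = ract M'.T (F t) b"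
  by (rule M.tens_hom_eqI[OF addhom_compose[OF M.ract_T_hom F_hom] addhom_compose[OF F_hom M'.ract_T_hom]])
    (auto simp: F_pure M.ract_pure M'.ract_pure M.M.hcomp_closed B.A.hcomp_closed)

lemma F_degree:
  assumes h: "\<And>i x. x \<in> hcomp M i \<Longrightarrow> h x \<in> hcomp M' (i + n)" and t: "t \<in> hcomp M.T k"
  shows "F t \<in> hcomp M'.T (k + n)"
  using t
proof (induction t rule: M.hcomp_T_induct)
  case (pure i x b)
  then show ?case
    using M'.tn_degree[OF h[OF pure(1)] pure(2)] by (simp add: F_pure M.M.hcomp_closed B.A.hcomp_closed algebra_simps)
next
  case (add s t)
  then show ?case by (simp add: addhom_add[OF F_hom] M.T.hcomp_closed M'.T.hcomp_add)
qed

lemma F_dg_hom: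
  assumes "dg_hom A M M' h"
  shows "dg_hom B M.T M'.T F"
  unfolding dg_hom_def
proof (intro conjI ballI allI)
  show "addhom M.T M'.T F" by (rule F_hom)
  show "F (ract M.T x b) = ract M'.T (F x) b" if "x \<in> carrier M.T" "b \<in> carrier B" for x b
    using that by (rule F_lin)
  have deg: "h x \<in> hcomp M' i" if "x \<in> hcomp M i" for i x
    using assms that by (auto simp: dg_hom_def image_subset_iff)
  show "F ` hcomp M.T i \<subseteq> hcomp M'.T i" for i
    using F_degree[where n = 0] deg by auto
  show "F (dif M.T x) = dif M'.T (F x)" if "x \<in> carrier M.T" for x
  proof (rule M.tens_hom_eqI[OF addhom_compose[OF M.dif_T_hom F_hom] addhom_compose[OF F_hom M'.dif_T_hom] that])
    fix i j x b assume x: "x \<in> hcomp M i" and b: "b \<in> hcomp B j"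
    note c = M.M.hcomp_closed[OF x] B.A.hcomp_closed[OF b]
    have "h (dif M x) = dif M' (h x)" using assms c by (auto simp: dg_hom_def)
    then show "F (dif M.T (M.tn x b)) = dif M'.T (F (M.tn x b))"
      using c by (simp add: M.dif_pure[OF x] M'.dif_pure[OF deg[OF x]] F_pure addhom_add[OF F_hom]
         addhom_sgs[OF M.T_abelian M'.T_abelian F_hom])
  qed
qed

end

text \<open>By functoriality, the inverse comes from the inverse of h.\<close>

lemma (in dg_ext) tens_fun_iso:
  assumes "dg_module A M" "dg_module A M'" "dg_iso A M M' h"
  shows "dg_iso B (dg_tensor A M \<phi> B) (dg_tensor A M' \<phi> B) (tens_fun A M \<phi> B M' h)"
proof -
  interpret M: dg_tens R A B \<phi> M using assms(1) dg_ext_axioms by (simp add: dg_tens_def)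
  interpret M': dg_tens R A B \<phi> M' using assms(2) dg_ext_axioms by (simp add: dg_tens_def)
  define k where "k = the_inv_into (carrier M) h"
  have hom: "dg_hom A M M' h" and bij: "bij_betw h (carrier M) (carrier M')"
    using assms(3) by (auto simp: dg_iso_def)
  have inj: "inj_on h (carrier M)" and im: "h ` carrier M = carrier M'" using bij by (auto simp: bij_betw_def)
  have h: "addhom M M' h" "\<And>x a. x \<in> carrier M \<Longrightarrow> a \<in> carrier A \<Longrightarrow> h (ract M x a) = ract M' (h x) a"
    using hom by (auto simp: dg_hom_def)
  interpret H: dg_tens_map R A B \<phi> M M' h
    using h by unfold_locales auto
  have k1: "k (h x) = x" if "x \<in> carrier M" for x unfolding k_def using the_inv_into_f_f[OF inj that] .
  have k2: "h (k y) = y" "k y \<in> carrier M" if "y \<in> carrier M'" for y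
    unfolding k_def using f_the_inv_into_f[OF inj] the_inv_into_into[OF inj, of y "carrier M"] that im by auto
  have k_hom: "addhom M' M k"
  proof (rule addhomI)
    fix x y assume "x \<in> carrier M'" "y \<in> carrier M'"
    then show "k (x \<oplus>\<^bsub>M'\<^esub> y) = k x \<oplus>\<^bsub>M\<^esub> k y"
      using k1[of "k x \<oplus>\<^bsub>M\<^esub> k y"] k2 addhom_add[OF h(1)] by simp
  qed (rule k2)
  interpret K: dg_tens_map R A B \<phi> M' M k
  proof unfold_locales
    fix x a assume "x \<in> carrier M'" "a \<in> carrier A"
    then show "k (ract M' x a) = ract M (k x) a"
      using k1[of "ract M (k x) a"] k2 h(2)[of "k x" a] M.M.ract_closed by simp
  qed (rule k_hom)
  have "K.F (H.F t) = t" if "t \<in> carrier M.T" for t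
    by (rule M.tens_hom_eqI[OF addhom_compose[OF H.F_hom K.F_hom] addhom_id that])
      (simp add: H.F_pure K.F_pure M.M.hcomp_closed B.A.hcomp_closed k1)
  moreover have "H.F (K.F t) = t" if "t \<in> carrier M'.T" for t
    by (rule M'.tens_hom_eqI[OF addhom_compose[OF K.F_hom H.F_hom] addhom_id that])
      (simp add: H.F_pure K.F_pure M'.M.hcomp_closed B.A.hcomp_closed k2)
  ultimately have "bij_betw H.F (carrier M.T) (carrier M'.T)"
    using H.F_closed K.F_closed by (intro bij_betwI[where g = K.F]) auto
  then show ?thesis using H.F_dg_hom[OF hom] by (simp add: dg_iso_def)
qed

section \<open>Restriction of scalars and the left action\<close>

text \<open>Restriction of scalars, the passage to the regular module and the opposite algebra change neither the
  graded group nor the differential.  This locale transfers all notions that depend on these only.\<close>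

locale same_complex =
  fixes M :: "('m, 'y) dg_cx_scheme" and M' :: "('m, 'z) dg_cx_scheme"
  assumes M_complex: "dg_complex M"
    and same: "carrier M' = carrier M" "add M' = add M" "\<zero>\<^bsub>M'\<^esub> = \<zero>\<^bsub>M\<^esub>" "hcomp M' = hcomp M" "dif M' = dif M"
begin

sublocale M: dg_complex M by (rule M_complex)

lemma same_finsum: "finsum M' f S = finsum M f S"
  by (simp add: finsum_def finprod_def same)

lemma same_decomp: "is_decomp M' = is_decomp M"
  by (intro ext) (simp add: is_decomp_def same same_finsum)

lemma same_hpart: "hpart M' = hpart M"
  by (intro ext) (simp add: hpart_def same_decomp)

lemma same_hsupp: "hsupp M' = hsupp M"
  by (intro ext) (simp add: hsupp_def same_hpart same)

lemma same_abelian: "abelian_group M'"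
proof (rule abelian_groupI)
  show "\<exists>y\<in>carrier M'. y \<oplus>\<^bsub>M'\<^esub> x = \<zero>\<^bsub>M'\<^esub>" if "x \<in> carrier M'" for x
    using that M.l_neg[of x] by (auto simp: same)
qed (auto simp: same M.a_ac)

sublocale M': abelian_group M' by (rule same_abelian)

lemma same_neg: "x \<in> carrier M \<Longrightarrow> \<ominus>\<^bsub>M'\<^esub> x = \<ominus>\<^bsub>M\<^esub> x"
  using M'.minus_equality[of "\<ominus>\<^bsub>M\<^esub> x" x] by (simp add: same M.l_neg)

lemma same_sgs: "x \<in> carrier M \<Longrightarrow> sgs M' i x = sgs M i x"
  by (simp add: sgs_def same_neg)

lemma same_add_pow: "x \<in> carrier M \<Longrightarrow> [sg i] \<cdot>\<^bsub>M'\<^esub> x = sgs M i x"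
  using M'.sg_add_pow[of x i] by (simp add: same same_sgs)

lemma same_subgroup: "subgroup H (add_monoid M') \<longleftrightarrow> subgroup H (add_monoid M)"
proof
  assume H: "subgroup H (add_monoid M')"
  have "x \<in> H \<Longrightarrow> \<ominus>\<^bsub>M\<^esub> x \<in> H" for x
    using M'.subgroup_neg[OF H] M'.subgroup_carrier[OF H] same_neg same by metis
  then show "subgroup H (add_monoid M)"
    using M'.subgroup_carrier[OF H] M'.subgroup_zero[OF H] M'.subgroup_add[OF H]
    by (intro M.subgroupI') (auto simp: same)
next
  assume H: "subgroup H (add_monoid M)"
  have "x \<in> H \<Longrightarrow> \<ominus>\<^bsub>M'\<^esub> x \<in> H" for x
    using M.subgroup_neg[OF H] M.subgroup_carrier[OF H] same_neg same by metis
  then show "subgroup H (add_monoid M')"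
    using M.subgroup_carrier[OF H] M.subgroup_zero[OF H] M.subgroup_add[OF H]
    by (intro M'.subgroupI') (auto simp: same)
qed

lemma same_complex: "dg_complex M'"
proof (intro dg_complex.intro dg_complex_axioms.intro same_abelian)
  show "addhom M' M' (dif M')"
    using addhom_closed[OF M.dif_hom] addhom_add[OF M.dif_hom] by (intro addhomI) (auto simp: same)
  show "subgroup (hcomp M' i) (add_monoid M')" for i
    unfolding same_subgroup unfolding same by (rule M.hcomp_subgroup)
qed (simp_all add: same same_decomp M.direct_sum M.dif_degree M.dif_dif)

end

lemma (in dg_algebra) regular_module: "dg_module A (dg_regular A)"
proof -
  interpret C: same_complex A "dg_regular A"
    by unfold_locales (simp_all add: dg_regular_def)
  have f: "ract (dg_regular A) = mult A"
    by (simp_all add: dg_regular_def)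
  show ?thesis
    by (intro dg_module.intro C.same_complex dg_module_axioms.intro)
      (auto simp: f C.same C.same_add_pow A.l_distr A.r_distr A.m_assoc mult_degree leibniz_sgs A.hcomp_closed)
qed

lemma (in dg_ext) restrict_module:
  assumes "dg_module B N" shows "dg_module A (dg_restrict \<phi> N)"
proof -
  interpret N: dg_module B N by fact
  interpret C: same_complex N "dg_restrict \<phi> N"
    by unfold_locales (simp_all add: dg_restrict_def)
  have f: "ract (dg_restrict \<phi> N) = (\<lambda>x a. ract N x (\<phi> a))" by (simp add: dg_restrict_def)
  have l: "dif N (ract N x (\<phi> a)) = ract N (dif N x) (\<phi> a) \<oplus>\<^bsub>N\<^esub> sgs N i (ract N x (dif B (\<phi> a)))"
    if "x \<in> hcomp N i" "a \<in> hcomp A j" for x i a j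
    using N.leibniz_sgs[OF that(1) \<phi>_degree[OF that(2)]] A.A.hcomp_closed[OF that(2)] by simp
  show ?thesis
    by (intro dg_module.intro C.same_complex dg_module_axioms.intro)
      (auto simp: l f C.same C.same_add_pow N.ract_closed N.ract_add_left N.ract_add_right N.ract_mult N.ract_one
        N.ract_degree \<phi>_add \<phi>_mult \<phi>_one \<phi>_degree \<phi>_dif N.hcomp_closed A.A.hcomp_closed)
qed

locale dg_setup = dg_ext R A B \<phi> + N: dg_module B N
  for R :: "('r, 'y) ring_scheme" and A :: "('r, 'a) dg_alg" and B :: "('r, 'b) dg_alg"
    and \<phi> :: "'a \<Rightarrow> 'b" and N :: "('b, 'n) dg_mod"
begin

abbreviation "NA \<equiv> dg_restrict \<phi> N"
abbreviation "BA \<equiv> dg_restrict \<phi> (dg_regular B)"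

sublocale TN: dg_tens R A B \<phi> NA
  using restrict_module[OF N.dg_module_axioms] dg_ext_axioms by (simp add: dg_tens_def)

sublocale TB: dg_tens R A B \<phi> BA
  using restrict_module[OF B.regular_module] dg_ext_axioms by (simp add: dg_tens_def)

lemma NA_simps [simp]: "carrier NA = carrier N" "add NA = add N" "\<zero>\<^bsub>NA\<^esub> = \<zero>\<^bsub>N\<^esub>" "hcomp NA = hcomp N"
  "dif NA = dif N" "ract NA x a = ract N x (\<phi> a)"
  by (simp_all add: dg_restrict_def)

lemma BA_simps [simp]: "carrier BA = carrier B" "add BA = add B" "\<zero>\<^bsub>BA\<^esub> = \<zero>\<^bsub>B\<^esub>" "hcomp BA = hcomp B"
  "dif BA = dif B" "ract BA x a = x \<otimes>\<^bsub>B\<^esub> \<phi> a"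
  by (simp_all add: dg_restrict_def dg_regular_def)

lemma NA_sgs [simp]: "x \<in> carrier N \<Longrightarrow> sgs NA i x = sgs N i x"
  by (intro same_complex.same_sgs same_complex.intro N.dg_complex_axioms) simp_all

lemma BA_sgs [simp]: "x \<in> carrier B \<Longrightarrow> sgs BA i x = sgs B i x"
  by (intro same_complex.same_sgs same_complex.intro B.A.dg_complex_axioms) simp_all

text \<open>The pairing \<open>N \<times> (B \<otimes>\<^sub>A B) \<rightarrow> N \<otimes>\<^sub>A B\<close>, \<open>(x, b \<otimes> c) \<mapsto> x b \<otimes> c\<close>,
  which identifies \<open>N \<otimes>\<^sub>A B\<close> with \<open>N \<otimes>\<^sub>B (B \<otimes>\<^sub>A B)\<close>. There is no sign, as nothing is interchanged.\<close>

definition ndot :: "'n \<Rightarrow> ('b \<times> 'b \<Rightarrow>\<^sub>0 int) set \<Rightarrow> ('n \<times> 'b \<Rightarrow>\<^sub>0 int) set" where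
  "ndot x = tens_fun A BA \<phi> B NA (\<lambda>b. ract N x b)"

lemma ndot_map: "x \<in> carrier N \<Longrightarrow> dg_tens_map R A B \<phi> BA NA (\<lambda>b. ract N x b)"
  by (intro dg_tens_map.intro dg_tens_map_axioms.intro dg_ext_axioms TB.dg_tens_axioms TN.dg_tens_axioms addhomI)
    (simp_all add: N.ract_closed N.ract_add_right N.ract_mult)

lemma ndot_hom: "x \<in> carrier N \<Longrightarrow> addhom TB.T TN.T (ndot x)"
  unfolding ndot_def by (rule dg_tens_map.F_hom[OF ndot_map])

lemma ndot_closed: "x \<in> carrier N \<Longrightarrow> z \<in> carrier TB.T \<Longrightarrow> ndot x z \<in> carrier TN.T"
  using addhom_closed[OF ndot_hom] .

lemma ndot_pure: "x \<in> carrier N \<Longrightarrow> b \<in> carrier B \<Longrightarrow> c \<in> carrier B \<Longrightarrow>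
    ndot x (TB.tn b c) = TN.tn (ract N x b) c"
  unfolding ndot_def by (subst dg_tens_map.F_pure[OF ndot_map]) auto

lemma ndot_lin: "x \<in> carrier N \<Longrightarrow> z \<in> carrier TB.T \<Longrightarrow> b \<in> carrier B \<Longrightarrow>
    ndot x (ract TB.T z b) = ract TN.T (ndot x z) b"
  unfolding ndot_def by (rule dg_tens_map.F_lin[OF ndot_map])

lemma ndot_degree:
  assumes "x \<in> hcomp N i" "z \<in> hcomp TB.T k" shows "ndot x z \<in> hcomp TN.T (i + k)"
  using dg_tens_map.F_degree[OF ndot_map[OF N.hcomp_closed[OF assms(1)]] _ assms(2), where n = i]
    N.ract_degree[OF assms(1)]
  unfolding ndot_def by (simp add: add.commute)

lemma ndot_hom_left:
  assumes "z \<in> carrier TB.T"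
  shows "addhom N TN.T (\<lambda>x. ndot x z)"
proof (rule addhomI)
  fix x y assume xy: "x \<in> carrier N" "y \<in> carrier N"
  show "ndot (x \<oplus>\<^bsub>N\<^esub> y) z = ndot x z \<oplus>\<^bsub>TN.T\<^esub> ndot y z"
    by (rule TB.tens_hom_eqI[OF ndot_hom TN.TG.addhom_add_fun[OF ndot_hom ndot_hom]])
      (use xy assms TN.tn_add_left in \<open>auto simp: ndot_pure B.A.hcomp_closed N.ract_add_left N.ract_closed\<close>)
qed (use assms in \<open>auto intro: ndot_closed\<close>)

lemma ndot_dif:
  assumes x: "x \<in> hcomp N i" and z: "z \<in> carrier TB.T"
  shows "dif TN.T (ndot x z) = ndot (dif N x) z \<oplus>\<^bsub>TN.T\<^esub> sgs TN.T i (ndot x (dif TB.T z))"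
proof (rule TB.tens_hom_eqI[OF _ _ z])
  have xc: "x \<in> carrier N" using N.hcomp_closed[OF x] .
  show "addhom TB.T TN.T (\<lambda>z. dif TN.T (ndot x z))"
    by (rule addhom_compose[OF ndot_hom TN.dif_T_hom]) (rule xc)
  show "addhom TB.T TN.T (\<lambda>z. ndot (dif N x) z \<oplus>\<^bsub>TN.T\<^esub> sgs TN.T i (ndot x (dif TB.T z)))"
    using xc by (intro TN.TG.addhom_add_fun TN.TG.addhom_sgs_fun ndot_hom addhom_compose[OF TB.dif_T_hom ndot_hom]) auto
  fix j k b c assume "b \<in> hcomp BA j" "c \<in> hcomp B k"
  then have b: "b \<in> hcomp B j" and c: "c \<in> hcomp B k" by auto
  note cl = xc B.A.hcomp_closed[OF b] B.A.hcomp_closed[OF c]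
  have d1: "dif TB.T (TB.tn b c) = TB.tn (dif B b) c \<oplus>\<^bsub>TB.T\<^esub> sgs TB.T j (TB.tn b (dif B c))"
    using TB.dif_pure[of b j c] b cl by simp
  have d2: "dif TN.T (TN.tn (ract N x b) c)
     = TN.tn (dif N (ract N x b)) c \<oplus>\<^bsub>TN.T\<^esub> sgs TN.T (i + j) (TN.tn (ract N x b) (dif B c))"
    using TN.dif_pure[of "ract N x b" "i + j" c] N.ract_degree[OF x b] cl by simp
  have d3: "TN.tn (dif N (ract N x b)) c
     = TN.tn (ract N (dif N x) b) c \<oplus>\<^bsub>TN.T\<^esub> sgs TN.T i (TN.tn (ract N x (dif B b)) c)"
    using TN.tn_add_left[of "ract N (dif N x) b" "sgs N i (ract N x (dif B b))" c]
      TN.tn_sgs_left[of "ract N x (dif B b)" c i] cl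
    by (simp add: N.leibniz_sgs[OF x b] N.ract_closed)
  show "dif TN.T (ndot x (TB.tn b c)) = ndot (dif N x) (TB.tn b c) \<oplus>\<^bsub>TN.T\<^esub> sgs TN.T i (ndot x (dif TB.T (TB.tn b c)))"
    using cl by (simp add: d1 d2 d3 ndot_pure addhom_add[OF ndot_hom] addhom_sgs[OF TB.T_abelian TN.T_abelian ndot_hom]
        TN.TG.sgs_add TN.TG.sgs_sgs TN.TG.a_assoc N.ract_closed)
qed

text \<open>The left action of B on \<open>B \<otimes>\<^sub>A B\<close> is the pairing above for N = B.\<close>

lemma regular_setup: "dg_setup R A B \<phi> (dg_regular B)"
  by (intro dg_setup.intro dg_ext_axioms B.regular_module)

definition bdot :: "'b \<Rightarrow> ('b \<times> 'b \<Rightarrow>\<^sub>0 int) set \<Rightarrow> ('b \<times> 'b \<Rightarrow>\<^sub>0 int) set" where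
  "bdot = dg_setup.ndot A B \<phi> (dg_regular B)"

lemma regular_simps [simp]: "carrier (dg_regular B) = carrier B" "add (dg_regular B) = add B"
  "\<zero>\<^bsub>dg_regular B\<^esub> = \<zero>\<^bsub>B\<^esub>" "hcomp (dg_regular B) = hcomp B" "dif (dg_regular B) = dif B"
  "ract (dg_regular B) = mult B"
  by (simp_all add: dg_regular_def)

lemma bdot_hom: "c \<in> carrier B \<Longrightarrow> addhom TB.T TB.T (bdot c)"
  unfolding bdot_def using dg_setup.ndot_hom[OF regular_setup] by simp

lemma bdot_closed: "c \<in> carrier B \<Longrightarrow> z \<in> carrier TB.T \<Longrightarrow> bdot c z \<in> carrier TB.T"
  using addhom_closed[OF bdot_hom] .

lemma bdot_pure: "x \<in> carrier B \<Longrightarrow> b \<in> carrier B \<Longrightarrow> c \<in> carrier B \<Longrightarrow>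
    bdot x (TB.tn b c) = TB.tn (x \<otimes>\<^bsub>B\<^esub> b) c"
  unfolding bdot_def using dg_setup.ndot_pure[OF regular_setup] by simp

lemma bdot_lin: "x \<in> carrier B \<Longrightarrow> z \<in> carrier TB.T \<Longrightarrow> b \<in> carrier B \<Longrightarrow>
    bdot x (ract TB.T z b) = ract TB.T (bdot x z) b"
  unfolding bdot_def using dg_setup.ndot_lin[OF regular_setup] by simp

lemma bdot_hom_left: "z \<in> carrier TB.T \<Longrightarrow> addhom B TB.T (\<lambda>x. bdot x z)"
  unfolding bdot_def using dg_setup.ndot_hom_left[OF regular_setup, of z] by (simp add: hom_def)

lemma ndot_bdot:
  assumes "x \<in> carrier N" "c \<in> carrier B" "z \<in> carrier TB.T"
  shows "ndot (ract N x c) z = ndot x (bdot c z)"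
  by (rule TB.tens_hom_eqI[OF ndot_hom addhom_compose[OF bdot_hom ndot_hom]])
    (use assms in \<open>auto simp: ndot_pure bdot_pure B.A.hcomp_closed N.ract_closed N.ract_mult\<close>)

section \<open>The enveloping algebra\<close>

abbreviation "E \<equiv> enveloping A \<phi> B"
abbreviation "OB \<equiv> dg_op B"
abbreviation "OA \<equiv> dg_restrict \<phi> (dg_regular (dg_op B))"

lemma op_simps [simp]: "carrier OB = carrier B" "add OB = add B" "\<zero>\<^bsub>OB\<^esub> = \<zero>\<^bsub>B\<^esub>" "hcomp OB = hcomp B"
  "dif OB = dif B" "\<one>\<^bsub>OB\<^esub> = \<one>\<^bsub>B\<^esub>"
  by (simp_all add: dg_op_def)

text \<open>As B is graded commutative, the sign in the opposite multiplication undoes the interchange of the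
  factors.  Hence \<open>B\<^sup>e\<close> is \<open>B \<otimes>\<^sub>A B\<close> as a complex.\<close>

lemma op_mult:
  assumes "x \<in> carrier B" "y \<in> carrier B"
  shows "x \<otimes>\<^bsub>OB\<^esub> y = x \<otimes>\<^bsub>B\<^esub> y"
proof -
  have sw: "[sg (i * j)] \<cdot>\<^bsub>B\<^esub> (hpart B y j \<otimes>\<^bsub>B\<^esub> hpart B x i) = hpart B x i \<otimes>\<^bsub>B\<^esub> hpart B y j" for i j
    using B.graded_comm_sgs[OF B.A.hpart_hcomp[OF assms(1)] B.A.hpart_hcomp[OF assms(2)], of i j] assms
    by (simp add: B.A.sg_add_pow)
  have inner: "(\<Oplus>\<^bsub>B\<^esub>j\<in>hsupp B y. hpart B x i \<otimes>\<^bsub>B\<^esub> hpart B y j) = hpart B x i \<otimes>\<^bsub>B\<^esub> y" for i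
    using assms B.A.finite_hsupp[OF assms(2)] B.A.hpart_sum[OF assms(2)]
    by (subst B.finsum_rdistr[symmetric]) auto
  have "x \<otimes>\<^bsub>OB\<^esub> y = (\<Oplus>\<^bsub>B\<^esub>i\<in>hsupp B x. hpart B x i \<otimes>\<^bsub>B\<^esub> y)"
    by (simp add: dg_op_def sw inner)
  also have "\<dots> = x \<otimes>\<^bsub>B\<^esub> y"
    using assms B.A.finite_hsupp[OF assms(1)] B.A.hpart_sum[OF assms(1)]
    by (subst B.finsum_ldistr[symmetric]) auto
  finally show ?thesis .
qed

lemma OA_simps: "carrier OA = carrier BA" "add OA = add BA" "\<zero>\<^bsub>OA\<^esub> = \<zero>\<^bsub>BA\<^esub>" "hcomp OA = hcomp BA"
  "dif OA = dif BA" "ract OA x a = x \<otimes>\<^bsub>OB\<^esub> \<phi> a"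
  by (simp_all add: dg_restrict_def dg_regular_def)

lemma tens_rel_op: "tens_rel A OA \<phi> B = tens_rel A BA \<phi> B"
proof
  show "tens_rel A OA \<phi> B \<subseteq> tens_rel A BA \<phi> B"
  proof
    fix u assume "u \<in> tens_rel A OA \<phi> B"
    then show "u \<in> tens_rel A BA \<phi> B"
    proof induction
      case (add_left x y b)
      then show ?case using tens_rel.add_left[of x BA y b B A \<phi>] by (simp add: OA_simps)
    next
      case (add_right x b c)
      then show ?case using tens_rel.add_right[of x BA b B c A \<phi>] by (simp add: OA_simps)
    next
      case (balanced x a b)
      then show ?case using tens_rel.balanced[of x BA a A b B \<phi>] by (simp add: OA_simps op_mult)
    qed (auto intro: tens_rel.intros)
  qed
  show "tens_rel A BA \<phi> B \<subseteq> tens_rel A OA \<phi> B"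
  proof
    fix u assume "u \<in> tens_rel A BA \<phi> B"
    then show "u \<in> tens_rel A OA \<phi> B"
    proof induction
      case (add_left x y b)
      then show ?case using tens_rel.add_left[of x OA y b B A \<phi>] by (simp add: OA_simps)
    next
      case (add_right x b c)
      then show ?case using tens_rel.add_right[of x OA b B c A \<phi>] by (simp add: OA_simps)
    next
      case (balanced x a b)
      then show ?case using tens_rel.balanced[of x OA a A b B \<phi>] by (simp add: OA_simps op_mult)
    qed (auto intro: tens_rel.intros)
  qed
qed

interpretation OBA: same_complex BA OA
  by (intro same_complex.intro TB.M.dg_complex_axioms OA_simps)

interpretation OBB: same_complex B OB
  by (intro same_complex.intro B.A.dg_complex_axioms) simp_all

lemma tens_grp_op: "tens_grp A OA \<phi> B = tens_grp A BA \<phi> B"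
  by (simp add: tens_grp_def tens_rel_op OA_simps)

lemma E_simps: "carrier E = carrier TB.T" "add E = add TB.T" "\<zero>\<^bsub>E\<^esub> = \<zero>\<^bsub>TB.T\<^esub>" "hcomp E = hcomp TB.T"
  "dif E = dif TB.T"
  by (simp_all add: enveloping_def dg_tensor_alg_def Let_def dg_tensor_def tens_grp_op tens_comp_def[abs_def]
      tens_dif_def tens_rel_op OA_simps OBA.same_hpart OBA.same_hsupp)

end

context dg_setup
begin

interpretation OBA: same_complex BA OA
  by (intro same_complex.intro TB.M.dg_complex_axioms OA_simps)

interpretation OBB: same_complex B OB
  by (intro same_complex.intro B.A.dg_complex_axioms) simp_all

lemma BA_hom: "addhom BA H f \<longleftrightarrow> addhom B H f"
  by (simp add: hom_def)

lemma NA_hom: "addhom NA H f \<longleftrightarrow> addhom N H f"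
  by (simp add: hom_def)

text \<open>The factor \<open>(-1)\<^bsup>i|y|\<^esup>\<close> for moving an element of degree i past y, as an additive map in y.\<close>

definition btwist :: "int \<Rightarrow> 'b \<Rightarrow> 'b" where
  "btwist i y = (if even i then y else twist B y)"

lemma btwist_hom: "addhom B B (btwist i)"
  using addhom_id[of B] B.A.twist_hom by (cases "even i") (auto simp: btwist_def[abs_def])

lemma btwist_closed [simp]: "y \<in> carrier B \<Longrightarrow> btwist i y \<in> carrier B"
  using addhom_closed[OF btwist_hom] .

lemma btwist_homog: "y \<in> hcomp B j \<Longrightarrow> btwist i y = sgs B (i * j) y"
  by (auto simp: btwist_def B.A.twist_homog sgs_def)

lemma btwist_sum:
  assumes "y \<in> carrier B"
  shows "(\<Oplus>\<^bsub>B\<^esub>j\<in>hsupp B y. sgs B (i * j) (hpart B y j)) = btwist i y"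
proof (cases "even i")
  case True
  then show ?thesis using B.A.hpart_sum[OF assms] by (simp add: btwist_def sgs_def)
next
  case False
  then show ?thesis by (simp add: btwist_def sgs_def twist_def)
qed

lemma btwist_comm:
  assumes y: "y \<in> carrier B" and c: "c \<in> hcomp B j"
  shows "btwist i y \<otimes>\<^bsub>B\<^esub> c = c \<otimes>\<^bsub>B\<^esub> btwist (i + j) y"
proof (rule B.A.addhom_eqI[OF B.A.abelian_group_axioms _ _ y])
  have cc: "c \<in> carrier B" using B.A.hcomp_closed[OF c] .
  show "addhom B B (\<lambda>y. btwist i y \<otimes>\<^bsub>B\<^esub> c)" "addhom B B (\<lambda>y. c \<otimes>\<^bsub>B\<^esub> btwist (i + j) y)"
    using cc by (auto intro!: addhomI simp: addhom_add[OF btwist_hom] B.l_distr B.r_distr)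
  show "btwist i y \<otimes>\<^bsub>B\<^esub> c = c \<otimes>\<^bsub>B\<^esub> btwist (i + j) y" if y: "y \<in> hcomp B k" for k y
    using B.graded_comm_sgs[OF y c] cc B.A.hcomp_closed[OF y]
    by (auto simp: btwist_homog[OF y] sgs_def B.l_minus B.r_minus)
qed

abbreviation "mgen \<equiv> dg_tensor_mult_gen OB B"

text \<open>The product \<open>(x \<otimes> y) (x' \<otimes> y')\<close> in the enveloping algebra, summed over the homogeneous parts
  of x' only: the sum over those of y is absorbed into \<open>btwist\<close>.\<close>

definition pure_mult where
  "pure_mult x y x' y' = (\<Oplus>\<^bsub>TB.T\<^esub>i\<in>hsupp B x'. TB.tn (x \<otimes>\<^bsub>B\<^esub> hpart B x' i) (btwist i y \<otimes>\<^bsub>B\<^esub> y'))"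

lemma mgen_simp:
  "mgen (x, y) (x', y') = (\<Sum>i\<in>hsupp B x'. \<Sum>j\<in>hsupp B y.
     frag_cmul (sg (i * j)) (frag_of (x \<otimes>\<^bsub>OB\<^esub> hpart B x' i, hpart B y j \<otimes>\<^bsub>B\<^esub> y')))"
  by (simp add: dg_tensor_mult_gen_def OBB.same_hpart OBB.same_hsupp)

lemma mgen_pure_mult:
  assumes "x \<in> carrier B" "y \<in> carrier B" "x' \<in> carrier B" "y' \<in> carrier B"
  shows "TB.cls (mgen (x, y) (x', y')) = pure_mult x y x' y'"
    and "Poly_Mapping.keys (mgen (x, y) (x', y')) \<subseteq> TB.PS"
proof -
  let ?f = "\<lambda>i j. frag_cmul (sg (i * j)) (frag_of (x \<otimes>\<^bsub>OB\<^esub> hpart B x' i, hpart B y j \<otimes>\<^bsub>B\<^esub> y'))"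
  have k: "Poly_Mapping.keys (?f i j) \<subseteq> TB.PS" for i j
    using assms by (intro TB.frag_cmul_keys TB.frag_of_closed) (auto simp: op_mult)
  have inner: "TB.cls (\<Sum>j\<in>hsupp B y. ?f i j) = TB.tn (x \<otimes>\<^bsub>B\<^esub> hpart B x' i) (btwist i y \<otimes>\<^bsub>B\<^esub> y')"
    "Poly_Mapping.keys (\<Sum>j\<in>hsupp B y. ?f i j) \<subseteq> TB.PS" for i
  proof -
    note s = TB.cls_sum[of "hsupp B y" "?f i", OF B.A.finite_hsupp[OF assms(2)] k]
    show "Poly_Mapping.keys (\<Sum>j\<in>hsupp B y. ?f i j) \<subseteq> TB.PS" using s by blast
    have t: "TB.cls (?f i j) = TB.tn (x \<otimes>\<^bsub>B\<^esub> hpart B x' i) (sgs B (i * j) (hpart B y j) \<otimes>\<^bsub>B\<^esub> y')" for j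
    proof -
      have "TB.cls (?f i j) = sgs TB.T (i * j) (TB.tn (x \<otimes>\<^bsub>OB\<^esub> hpart B x' i) (hpart B y j \<otimes>\<^bsub>B\<^esub> y'))"
        using assms by (subst TB.cls_cmul_sg) (auto simp: tens_def op_mult simp del: keys_frag_of intro!: TB.frag_of_closed)
      then show ?thesis
        using assms TB.tn_sgs_right[of "x \<otimes>\<^bsub>B\<^esub> hpart B x' i" "hpart B y j \<otimes>\<^bsub>B\<^esub> y'" "i * j"]
        by (auto simp: op_mult sgs_def B.l_minus)
    qed
    have "TB.cls (\<Sum>j\<in>hsupp B y. ?f i j)
        = (\<Oplus>\<^bsub>TB.T\<^esub>j\<in>hsupp B y. TB.tn (x \<otimes>\<^bsub>B\<^esub> hpart B x' i) (sgs B (i * j) (hpart B y j) \<otimes>\<^bsub>B\<^esub> y'))"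
      using s t by simp
    also have "\<dots> = TB.tn (x \<otimes>\<^bsub>B\<^esub> hpart B x' i) (\<Oplus>\<^bsub>B\<^esub>j\<in>hsupp B y. sgs B (i * j) (hpart B y j) \<otimes>\<^bsub>B\<^esub> y')"
      using assms B.A.finite_hsupp[OF assms(2)]
      by (intro addhom_finsum[OF B.A.abelian_group_axioms TB.T_abelian TB.tn_hom_right, symmetric]) auto
    also have "(\<Oplus>\<^bsub>B\<^esub>j\<in>hsupp B y. sgs B (i * j) (hpart B y j) \<otimes>\<^bsub>B\<^esub> y') = btwist i y \<otimes>\<^bsub>B\<^esub> y'"
      using assms B.A.finite_hsupp[OF assms(2)]
      by (subst B.finsum_ldistr[symmetric]) (auto simp: btwist_sum)
    finally show "TB.cls (\<Sum>j\<in>hsupp B y. ?f i j) = TB.tn (x \<otimes>\<^bsub>B\<^esub> hpart B x' i) (btwist i y \<otimes>\<^bsub>B\<^esub> y')" .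
  qed
  note s = TB.cls_sum[of "hsupp B x'" "\<lambda>i. \<Sum>j\<in>hsupp B y. ?f i j", OF B.A.finite_hsupp[OF assms(3)] inner(2)]
  then show "TB.cls (mgen (x, y) (x', y')) = pure_mult x y x' y'" "Poly_Mapping.keys (mgen (x, y) (x', y')) \<subseteq> TB.PS"
    by (simp_all add: mgen_simp pure_mult_def inner(1))
qed

lemma pure_mult_homog:
  assumes "x \<in> carrier B" "y \<in> carrier B" "x' \<in> hcomp B i" "y' \<in> carrier B"
  shows "pure_mult x y x' y' = TB.tn (x \<otimes>\<^bsub>B\<^esub> x') (btwist i y \<otimes>\<^bsub>B\<^esub> y')"
  unfolding pure_mult_def using assms TB.tn_add_left
  by (intro B.A.by_degree_homog[OF TB.T_abelian, where g = "\<lambda>i x'. TB.tn (x \<otimes>\<^bsub>B\<^esub> x') (btwist i y \<otimes>\<^bsub>B\<^esub> y')"])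
    (auto intro!: addhomI simp: B.r_distr)

lemma pure_mult_balanced:
  assumes "x \<in> carrier B" "y \<in> carrier B"
  shows "tens_balanced A BA \<phi> B TB.T (pure_mult x y)"
proof (rule TB.tens_balancedI[OF TB.T_abelian])
  show "addhom B TB.T (pure_mult x y x')" if "x' \<in> carrier BA" for x'
    unfolding pure_mult_def using that assms TB.tn_add_right
    by (intro TB.TG.addhom_finsum_fun) (auto intro!: addhomI simp: B.r_distr)
  show "addhom BA TB.T (\<lambda>x'. pure_mult x y x' y')" if "y' \<in> carrier B" for y'
    unfolding pure_mult_def BA_hom using that assms TB.tn_add_left
    by (intro B.A.addhom_by_degree[OF TB.T_abelian, where g = "\<lambda>i x'. TB.tn (x \<otimes>\<^bsub>B\<^esub> x') (btwist i y \<otimes>\<^bsub>B\<^esub> y')"])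
      (auto intro!: addhomI simp: B.r_distr)
  fix i j k x' a y' assume "x' \<in> hcomp BA i" and a: "a \<in> hcomp A j" and y': "y' \<in> hcomp B k"
  then have x': "x' \<in> hcomp B i" by simp
  note c = assms B.A.hcomp_closed[OF x'] A.A.hcomp_closed[OF a] B.A.hcomp_closed[OF y']
  have "pure_mult x y (x' \<otimes>\<^bsub>B\<^esub> \<phi> a) y' = TB.tn (x \<otimes>\<^bsub>B\<^esub> x') (\<phi> a \<otimes>\<^bsub>B\<^esub> (btwist (i + j) y \<otimes>\<^bsub>B\<^esub> y'))"
    using c pure_mult_homog[OF assms B.mult_degree[OF x' \<phi>_degree[OF a]]]
      TB.tn_balanced[of "x \<otimes>\<^bsub>B\<^esub> x'" a "btwist (i + j) y \<otimes>\<^bsub>B\<^esub> y'"] by (simp add: B.m_assoc)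
  also have "\<dots> = pure_mult x y x' (\<phi> a \<otimes>\<^bsub>B\<^esub> y')"
    using c btwist_comm[OF assms(2) \<phi>_degree[OF a], of i] by (simp add: pure_mult_homog[OF assms x'] B.m_assoc[symmetric])
  finally show "pure_mult x y (ract BA x' a) y' = pure_mult x y x' (\<phi> a \<otimes>\<^bsub>B\<^esub> y')" by simp
qed

lemma tens_balanced_cong:
  assumes "tens_balanced A BA \<phi> B H h" "\<And>x b. x \<in> carrier B \<Longrightarrow> b \<in> carrier B \<Longrightarrow> h' x b = h x b"
  shows "tens_balanced A BA \<phi> B H h'"
proof -
  have "addhom B H (h' x)" if "x \<in> carrier B" for x
    using assms(1) that by (intro addhomI) (auto simp: assms(2) tens_balanced_def hom_def)
  moreover have "addhom BA H (\<lambda>x. h' x b)" if "b \<in> carrier B" for b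
    using assms(1) that unfolding BA_hom by (intro addhomI) (auto simp: assms(2) tens_balanced_def hom_def)
  ultimately show ?thesis using assms unfolding tens_balanced_def by simp
qed

text \<open>Multiplication from the left by the pure tensor \<open>x \<otimes> y\<close>.\<close>

abbreviation "pure_act \<equiv> \<lambda>x y. tens_map TB.TR (mgen (x, y))"

lemma mgen_ok:
  assumes "x \<in> carrier B" "y \<in> carrier B"
  shows "p \<in> TB.PS \<Longrightarrow> Poly_Mapping.keys (mgen (x, y) p) \<subseteq> TB.PS"
    and "tens_balanced A BA \<phi> B TB.T (\<lambda>x' y'. TB.cls (mgen (x, y) (x', y')))"
  using assms mgen_pure_mult(2) by (force, intro tens_balanced_cong[OF pure_mult_balanced[OF assms]] mgen_pure_mult(1))

lemma pure_act_hom: "x \<in> carrier B \<Longrightarrow> y \<in> carrier B \<Longrightarrow> addhom TB.T TB.T (pure_act x y)"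
  by (rule TB.tens_map_hom) (rule mgen_ok; assumption)+

lemma pure_act_cls: "x \<in> carrier B \<Longrightarrow> y \<in> carrier B \<Longrightarrow> pure_act x y (TB.cls v) = TB.cls (frag_extend (mgen (x, y)) v)"
  by (rule TB.tens_map_cls) (rule mgen_ok; assumption)+

lemma pure_act_pure:
  assumes "x \<in> carrier B" "y \<in> carrier B" "x' \<in> hcomp B i" "y' \<in> carrier B"
  shows "pure_act x y (TB.tn x' y') = TB.tn (x \<otimes>\<^bsub>B\<^esub> x') (btwist i y \<otimes>\<^bsub>B\<^esub> y')"
proof -
  have "pure_act x y (TB.tn x' y') = TB.cls (mgen (x, y) (x', y'))"
    by (rule TB.tens_map_pure) (rule mgen_ok; (rule assms | assumption))+
  then show ?thesis using assms mgen_pure_mult(1) pure_mult_homog by (simp add: B.A.hcomp_closed)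
qed

lemma pure_act_balanced:
  assumes Y: "Y \<in> carrier TB.T"
  shows "tens_balanced A BA \<phi> B TB.T (\<lambda>x y. pure_act x y Y)"
proof (rule TB.tens_balancedI[OF TB.T_abelian])
  have cl: "pure_act x y Y \<in> carrier TB.T" if "x \<in> carrier B" "y \<in> carrier B" "Y \<in> carrier TB.T" for x y Y
    using addhom_closed[OF pure_act_hom] that by auto
  have thadd: "pure_act x y (Y \<oplus>\<^bsub>TB.T\<^esub> Z) = pure_act x y Y \<oplus>\<^bsub>TB.T\<^esub> pure_act x y Z"
    if "x \<in> carrier B" "y \<in> carrier B" "Y \<in> carrier TB.T" "Z \<in> carrier TB.T" for x y Y Z
    using addhom_add[OF pure_act_hom] that by auto
  show "addhom B TB.T (\<lambda>y. pure_act x y Y)" if "x \<in> carrier BA" for x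
  proof (rule addhomI)
    fix y z assume yz: "y \<in> carrier B" "z \<in> carrier B"
    have x: "x \<in> carrier B" using that by simp
    show "pure_act x (y \<oplus>\<^bsub>B\<^esub> z) Y = pure_act x y Y \<oplus>\<^bsub>TB.T\<^esub> pure_act x z Y"
      using Y
    proof (induction Y rule: TB.tens_induct)
      case (pure i j x' b)
      then have "x' \<in> hcomp B i" "b \<in> carrier B" "x' \<in> carrier B" using B.A.hcomp_closed by auto
      then show ?case using x yz TB.tn_add_right
        by (simp add: pure_act_pure addhom_add[OF btwist_hom] B.l_distr)
    next
      case (add s t)
      then show ?case using x yz by (simp add: thadd cl TB.TG.a_ac)
    qed
  qed (use that Y cl in auto)
  show "addhom BA TB.T (\<lambda>x. pure_act x y Y)" if y: "y \<in> carrier B" for y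
    unfolding BA_hom
  proof (rule addhomI)
    fix x z assume xz: "x \<in> carrier B" "z \<in> carrier B"
    show "pure_act (x \<oplus>\<^bsub>B\<^esub> z) y Y = pure_act x y Y \<oplus>\<^bsub>TB.T\<^esub> pure_act z y Y"
      using Y
    proof (induction Y rule: TB.tens_induct)
      case (pure i j x' b)
      then have "x' \<in> hcomp B i" "b \<in> carrier B" "x' \<in> carrier B" using B.A.hcomp_closed by auto
      then show ?case using y xz TB.tn_add_left
        by (simp add: pure_act_pure B.l_distr)
    next
      case (add s t)
      then show ?case using y xz by (simp add: thadd cl TB.TG.a_ac)
    qed
  qed (use that Y cl in auto)
  fix i j k x a b assume "x \<in> hcomp BA i" and a: "a \<in> hcomp A j" and b: "b \<in> hcomp B k"
  then have x: "x \<in> hcomp B i" by simp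
  note c = B.A.hcomp_closed[OF x] A.A.hcomp_closed[OF a] B.A.hcomp_closed[OF b]
  show "pure_act (ract BA x a) b Y = pure_act x (\<phi> a \<otimes>\<^bsub>B\<^esub> b) Y"
    using Y
  proof (induction Y rule: TB.tens_induct)
    case (pure l j' x' b')
    then have x': "x' \<in> hcomp B l" and c': "b' \<in> carrier B" "x' \<in> carrier B" using B.A.hcomp_closed by auto
    have "pure_act (ract BA x a) b (TB.tn x' b') = TB.tn (x \<otimes>\<^bsub>B\<^esub> (\<phi> a \<otimes>\<^bsub>B\<^esub> x')) (btwist l b \<otimes>\<^bsub>B\<^esub> b')"
      using c c' by (simp add: pure_act_pure[OF _ _ x'] B.m_assoc)
    also have "\<phi> a \<otimes>\<^bsub>B\<^esub> x' = x' \<otimes>\<^bsub>B\<^esub> \<phi> (sgs A (j * l) a)"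
      using c c' B.graded_comm_sgs[OF \<phi>_degree[OF a] x']
      unfolding addhom_sgs[OF A.A.abelian_group_axioms B.A.abelian_group_axioms \<phi>_addhom c(2)]
      by (auto simp: sgs_def B.r_minus)
    also have "TB.tn (x \<otimes>\<^bsub>B\<^esub> (x' \<otimes>\<^bsub>B\<^esub> \<phi> (sgs A (j * l) a))) (btwist l b \<otimes>\<^bsub>B\<^esub> b')
       = TB.tn (x \<otimes>\<^bsub>B\<^esub> x') (\<phi> (sgs A (j * l) a) \<otimes>\<^bsub>B\<^esub> (btwist l b \<otimes>\<^bsub>B\<^esub> b'))"
      using c c' TB.tn_balanced[of "x \<otimes>\<^bsub>B\<^esub> x'" "sgs A (j * l) a" "btwist l b \<otimes>\<^bsub>B\<^esub> b'"] by (simp add: B.m_assoc)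
    also have "\<phi> (sgs A (j * l) a) \<otimes>\<^bsub>B\<^esub> (btwist l b \<otimes>\<^bsub>B\<^esub> b') = btwist l (\<phi> a \<otimes>\<^bsub>B\<^esub> b) \<otimes>\<^bsub>B\<^esub> b'"
      using c c'
      unfolding addhom_sgs[OF A.A.abelian_group_axioms B.A.abelian_group_axioms \<phi>_addhom c(2)]
      by (auto simp: btwist_homog[OF b] btwist_homog[OF B.mult_degree[OF \<phi>_degree[OF a] b]] sgs_def B.l_minus B.r_minus B.m_assoc)
    also have "TB.tn (x \<otimes>\<^bsub>B\<^esub> x') \<dots> = pure_act x (\<phi> a \<otimes>\<^bsub>B\<^esub> b) (TB.tn x' b')"
      using c c' by (simp add: pure_act_pure[OF _ _ x'])
    finally show ?case .
  next
    case (add s t)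
    then show ?case using c by (simp add: thadd)
  qed
qed

abbreviation "mult_gen v \<equiv> (\<lambda>p. frag_extend (mgen p) v)"

lemma mult_gen_ok:
  assumes v: "Poly_Mapping.keys v \<subseteq> TB.PS"
  shows "p \<in> TB.PS \<Longrightarrow> Poly_Mapping.keys (mult_gen v p) \<subseteq> TB.PS"
    and "tens_balanced A BA \<phi> B TB.T (\<lambda>x y. TB.cls (mult_gen v (x, y)))"
proof -
  assume "p \<in> TB.PS"
  then obtain x y where p: "p = (x, y)" "x \<in> carrier B" "y \<in> carrier B" by auto
  show "Poly_Mapping.keys (mult_gen v p) \<subseteq> TB.PS"
    unfolding p(1) by (rule TB.frag_extend_keys[OF mgen_ok(1) v]) (use p in auto)
next
  show "tens_balanced A BA \<phi> B TB.T (\<lambda>x y. TB.cls (mult_gen v (x, y)))"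
    by (rule tens_balanced_cong[OF pure_act_balanced[OF TB.cls_closed[OF v]]]) (simp add: pure_act_cls)
qed

lemma mult_gen_hom: "Poly_Mapping.keys v \<subseteq> TB.PS \<Longrightarrow> addhom TB.T TB.T (tens_map TB.TR (mult_gen v))"
  by (rule TB.tens_map_hom) (rule mult_gen_ok; assumption)+

lemma mult_gen_cls: "Poly_Mapping.keys v \<subseteq> TB.PS \<Longrightarrow> tens_map TB.TR (mult_gen v) (TB.cls u) = TB.cls (frag_extend (mult_gen v) u)"
  by (rule TB.tens_map_cls) (rule mult_gen_ok; assumption)+

lemma mult_gen_pure:
  assumes "Poly_Mapping.keys v \<subseteq> TB.PS" "x \<in> carrier B" "y \<in> carrier B"
  shows "tens_map TB.TR (mult_gen v) (TB.tn x y) = pure_act x y (TB.cls v)"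
proof -
  have "tens_map TB.TR (mult_gen v) (TB.tn x y) = TB.cls (mult_gen v (x, y))"
    by (rule TB.tens_map_pure) (rule mult_gen_ok; (rule assms | assumption))+
  then show ?thesis using assms by (simp add: pure_act_cls)
qed

text \<open>For a fixed representative v of the right factor, the product is a map induced on the tensor product.
  Other representatives induce the same map, so that the set in the definition of the product is one coset.\<close>

lemma E_mult_cls:
  assumes v: "Poly_Mapping.keys v \<subseteq> TB.PS" and X: "X \<in> carrier TB.T"
  shows "X \<otimes>\<^bsub>E\<^esub> TB.cls v = tens_map TB.TR (mult_gen v) X"
proof -
  have E: "X \<otimes>\<^bsub>E\<^esub> TB.cls v = {t + frag_extend (mult_gen v') u' | t u' v'. t \<in> TB.TR \<and> u' \<in> X \<and> v' \<in> TB.cls v}"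
    by (simp add: enveloping_def dg_tensor_alg_def Let_def tens_rel_op)
  have *: "TB.cls (frag_extend (mult_gen v') u') = tens_map TB.TR (mult_gen v) X" if u'X: "u' \<in> X" and v'v: "v' \<in> TB.cls v" for u' v'
  proof -
    obtain t where t: "t \<in> TB.TR" "v' = t + v" using v'v by (auto simp: TB.cls_def')
    then have v': "Poly_Mapping.keys v' \<subseteq> TB.PS" "TB.cls v' = TB.cls v"
      using v TB.TR_keys by (auto simp: TB.cls_eq_iff intro!: TB.keys_add_sub del: subsetI)
    obtain u where u: "X = TB.cls u" using X by (auto simp: TB.T_simps)
    have "TB.cls u' = X" using u'X u by (auto simp: TB.cls_eq_iff) (auto simp: TB.cls_def')
    then have "TB.cls (frag_extend (mult_gen v') u') = tens_map TB.TR (mult_gen v') X"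
      using mult_gen_cls[OF v'(1), of u'] by simp
    also have "\<dots> = tens_map TB.TR (mult_gen v) X"
      by (rule TB.tens_hom_eqI[OF mult_gen_hom[OF v'(1)] mult_gen_hom[OF v] X])
        (use v' v in \<open>simp add: mult_gen_pure B.A.hcomp_closed\<close>)
    finally show ?thesis .
  qed
  obtain u where u: "X = TB.cls u" using X by (auto simp: TB.T_simps)
  show ?thesis
  proof
    show "X \<otimes>\<^bsub>E\<^esub> TB.cls v \<subseteq> tens_map TB.TR (mult_gen v) X"
      unfolding E using * by (auto simp: TB.cls_def')
    show "tens_map TB.TR (mult_gen v) X \<subseteq> X \<otimes>\<^bsub>E\<^esub> TB.cls v"
    proof
      fix x assume "x \<in> tens_map TB.TR (mult_gen v) X"
      then have "x \<in> TB.cls (frag_extend (mult_gen v) u)" using *[of u v] TB.cls_self u by simp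
      then obtain t where "x = t + frag_extend (mult_gen v) u" "t \<in> TB.TR" by (auto simp: TB.cls_def')
      then show "x \<in> X \<otimes>\<^bsub>E\<^esub> TB.cls v" unfolding E using TB.cls_self u by blast
    qed
  qed
qed

lemma E_mult_hom_left:
  assumes "Y \<in> carrier TB.T"
  shows "addhom TB.T TB.T (\<lambda>X. X \<otimes>\<^bsub>E\<^esub> Y)"
proof -
  obtain v where v: "Y = TB.cls v" "Poly_Mapping.keys v \<subseteq> TB.PS" using assms by (auto simp: TB.T_simps)
  show ?thesis
    using addhom_closed[OF mult_gen_hom[OF v(2)]] addhom_add[OF mult_gen_hom[OF v(2)]]
    by (intro addhomI) (auto simp: v(1) E_mult_cls[OF v(2)])
qed

lemma E_mult_closed: "X \<in> carrier TB.T \<Longrightarrow> Y \<in> carrier TB.T \<Longrightarrow> X \<otimes>\<^bsub>E\<^esub> Y \<in> carrier TB.T"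
  using addhom_closed[OF E_mult_hom_left] .

lemma E_mult_pure:
  assumes "x \<in> carrier B" "y \<in> carrier B" "Y \<in> carrier TB.T"
  shows "TB.tn x y \<otimes>\<^bsub>E\<^esub> Y = pure_act x y Y"
proof -
  obtain v where v: "Y = TB.cls v" "Poly_Mapping.keys v \<subseteq> TB.PS" using assms by (auto simp: TB.T_simps)
  show ?thesis using assms by (simp add: v(1) E_mult_cls[OF v(2)] mult_gen_pure[OF v(2)])
qed

lemma E_mult_hom_right:
  assumes "X \<in> carrier TB.T"
  shows "addhom TB.T TB.T (\<lambda>Y. X \<otimes>\<^bsub>E\<^esub> Y)"
proof (rule addhomI)
  fix Y Z assume YZ: "Y \<in> carrier TB.T" "Z \<in> carrier TB.T"
  show "X \<otimes>\<^bsub>E\<^esub> (Y \<oplus>\<^bsub>TB.T\<^esub> Z) = X \<otimes>\<^bsub>E\<^esub> Y \<oplus>\<^bsub>TB.T\<^esub> X \<otimes>\<^bsub>E\<^esub> Z"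
    using assms
  proof (induction X rule: TB.tens_induct_all)
    case (pure x b)
    then show ?case using YZ by (simp add: E_mult_pure addhom_add[OF pure_act_hom])
  next
    case (add s t)
    then show ?case using YZ by (simp add: addhom_add[OF E_mult_hom_left] E_mult_closed TB.TG.a_ac)
  qed
qed (use assms E_mult_closed in auto)

text \<open>The two copies of B in the enveloping algebra act on it from the right: the second one by the right
  action of B on the tensor product, the first one, up to sign, by the left action.\<close>

lemma E_mult_right_factor:
  assumes z: "z \<in> carrier TB.T" and b: "b \<in> carrier B"
  shows "z \<otimes>\<^bsub>E\<^esub> TB.tn \<one>\<^bsub>B\<^esub> b = ract TB.T z b"
  by (rule TB.tens_hom_eqI[OF E_mult_hom_left TB.ract_T_hom[OF b] z])
    (use b in \<open>auto simp: E_mult_pure pure_act_pure[OF _ _ B.one_degree] btwist_def TB.ract_pure B.A.hcomp_closed\<close>)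

lemma E_mult_left_factor:
  assumes z: "z \<in> hcomp TB.T k" and c: "c \<in> hcomp B i"
  shows "z \<otimes>\<^bsub>E\<^esub> TB.tn c \<one>\<^bsub>B\<^esub> = sgs TB.T (i * k) (bdot c z)"
proof -
  have cc: "c \<in> carrier B" using B.A.hcomp_closed[OF c] .
  have t: "TB.tn c \<one>\<^bsub>B\<^esub> \<in> carrier TB.T" using cc by simp
  show ?thesis
    using z
  proof (induction z rule: TB.hcomp_T_induct)
    case (pure j x b)
    then have x: "x \<in> hcomp B j" by simp
    note cl = cc B.A.hcomp_closed[OF x] B.A.hcomp_closed[OF pure(2)]
    have "TB.tn x b \<otimes>\<^bsub>E\<^esub> TB.tn c \<one>\<^bsub>B\<^esub> = TB.tn (x \<otimes>\<^bsub>B\<^esub> c) (sgs B (i * (k - j)) b)"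
      using cl t by (simp add: E_mult_pure pure_act_pure[OF _ _ c] btwist_homog[OF pure(2)])
    also have "\<dots> = sgs TB.T (i * (k - j)) (sgs TB.T (j * i) (TB.tn (c \<otimes>\<^bsub>B\<^esub> x) b))"
      using cl TB.tn_sgs_right[of "x \<otimes>\<^bsub>B\<^esub> c" b] TB.tn_sgs_left[of "c \<otimes>\<^bsub>B\<^esub> x" b]
      by (simp add: B.graded_comm_sgs[OF x c])
    also have "\<dots> = sgs TB.T (i * k) (bdot c (TB.tn x b))"
      using cl by (simp add: TB.TG.sgs_sgs bdot_pure algebra_simps)
    finally show ?case .
  next
    case (add s u)
    then show ?case using t cc
      by (simp add: addhom_add[OF E_mult_hom_left] TB.T.hcomp_closed addhom_add[OF bdot_hom] TB.TG.sgs_add bdot_closed)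
  qed
qed

section \<open>The multiplication maps\<close>

lemma pi_alg_balanced: "tens_balanced A BA \<phi> B B (\<lambda>x y. x \<otimes>\<^bsub>B\<^esub> y)"
proof (rule TB.tens_balancedI[OF B.A.abelian_group_axioms])
  show "addhom BA B (\<lambda>x. x \<otimes>\<^bsub>B\<^esub> b)" if "b \<in> carrier B" for b
    unfolding BA_hom using that by (intro addhomI) (simp_all add: B.l_distr)
qed (auto intro!: addhomI simp: B.r_distr B.m_assoc B.A.hcomp_closed A.A.hcomp_closed)

lemma pi_alg_hom: "addhom TB.T B (pi_alg B)"
  unfolding pi_alg_def by (rule TB.tens_eval_hom[OF B.A.abelian_group_axioms pi_alg_balanced])

lemma pi_alg_pure: "x \<in> carrier B \<Longrightarrow> y \<in> carrier B \<Longrightarrow> pi_alg B (TB.tn x y) = x \<otimes>\<^bsub>B\<^esub> y"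
  unfolding pi_alg_def by (subst TB.tens_eval_pure[OF B.A.abelian_group_axioms pi_alg_balanced]) auto

lemma pi_mod_balanced: "tens_balanced A NA \<phi> B N (\<lambda>x y. ract N x y)"
proof (rule TN.tens_balancedI[OF N.abelian_group_axioms])
  show "addhom NA N (\<lambda>x. ract N x b)" if "b \<in> carrier B" for b
    unfolding NA_hom using that by (rule N.ract_hom_left)
qed (auto intro!: addhomI simp: N.ract_add_left N.ract_add_right N.ract_mult N.ract_closed N.hcomp_closed
       B.A.hcomp_closed A.A.hcomp_closed)

lemma pi_mod_hom: "addhom TN.T N (pi_mod N)"
  unfolding pi_mod_def by (rule TN.tens_eval_hom[OF N.abelian_group_axioms pi_mod_balanced])

lemma pi_mod_pure: "x \<in> carrier N \<Longrightarrow> b \<in> carrier B \<Longrightarrow> pi_mod N (TN.tn x b) = ract N x b"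
  unfolding pi_mod_def by (subst TN.tens_eval_pure[OF N.abelian_group_axioms pi_mod_balanced]) auto

lemma pi_mod_dg_hom: "dg_hom B TN.T N (pi_mod N)"
  unfolding dg_hom_def
proof (intro conjI ballI allI)
  show "addhom TN.T N (pi_mod N)" by (rule pi_mod_hom)
  show "pi_mod N (ract TN.T t b) = ract N (pi_mod N t) b" if "t \<in> carrier TN.T" "b \<in> carrier B" for t b
    by (rule TN.tens_hom_eqI[OF addhom_compose[OF TN.ract_T_hom pi_mod_hom] addhom_compose[OF pi_mod_hom N.ract_hom_left] that(1)])
      (use that in \<open>auto simp: TN.ract_pure pi_mod_pure N.hcomp_closed B.A.hcomp_closed N.ract_mult\<close>)
  have "pi_mod N t \<in> hcomp N i" if "t \<in> hcomp TN.T i" for t i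
    using that
  proof (induction t rule: TN.hcomp_T_induct)
    case (pure j x b)
    then show ?case using N.ract_degree[of x j b "i - j"] by (simp add: pi_mod_pure N.hcomp_closed B.A.hcomp_closed)
  next
    case (add s t)
    then show ?case by (simp add: addhom_add[OF pi_mod_hom] TN.T.hcomp_closed N.hcomp_add)
  qed
  then show "pi_mod N ` hcomp TN.T i \<subseteq> hcomp N i" for i by auto
  show "pi_mod N (dif TN.T t) = dif N (pi_mod N t)" if "t \<in> carrier TN.T" for t
  proof (rule TN.tens_hom_eqI[OF addhom_compose[OF TN.dif_T_hom pi_mod_hom] addhom_compose[OF pi_mod_hom N.dif_hom] that])
    fix i j x b assume "x \<in> hcomp NA i" and b: "b \<in> hcomp B j"
    then have x: "x \<in> hcomp N i" by simp
    note cl = N.hcomp_closed[OF x] B.A.hcomp_closed[OF b]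
    show "pi_mod N (dif TN.T (TN.tn x b)) = dif N (pi_mod N (TN.tn x b))"
      using TN.dif_pure[of x i b] x cl
      by (simp add: addhom_add[OF pi_mod_hom] addhom_sgs[OF TN.T_abelian N.abelian_group_axioms pi_mod_hom]
          pi_mod_pure N.leibniz_sgs[OF x b])
  qed
qed

section \<open>The filtration of the diagonal ideal\<close>

text \<open>The DG (B, B)-subbimodules of \<open>B \<otimes>\<^sub>A B\<close>.\<close>

definition diag_stable :: "('b \<times> 'b \<Rightarrow>\<^sub>0 int) set set \<Rightarrow> bool" where
  "diag_stable K \<longleftrightarrow> subgroup K (add_monoid TB.T) \<and> (\<forall>z\<in>K. \<forall>b\<in>carrier B. ract TB.T z b \<in> K)
     \<and> (\<forall>z\<in>K. \<forall>c\<in>carrier B. bdot c z \<in> K) \<and> (\<forall>z\<in>K. \<forall>i. hpart TB.T z i \<in> K) \<and> (\<forall>z\<in>K. dif TB.T z \<in> K)"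

interpretation EE: same_complex TB.T "dg_regular E"
  by (intro same_complex.intro TB.T.dg_complex_axioms) (simp_all add: dg_regular_def E_simps)

lemma bdot_sum_mem:
  assumes K: "subgroup K (add_monoid TB.T)" and z: "z \<in> carrier TB.T" and c: "c \<in> carrier B"
    and h: "\<And>i j d. d \<in> hcomp B i \<Longrightarrow> bdot d (hpart TB.T z j) \<in> K"
  shows "bdot c z \<in> K"
  using c
proof (induction c rule: B.A.homog_induct)
  case (homog i d)
  have dc: "d \<in> carrier B" using B.A.hcomp_closed[OF homog] .
  have "bdot d z = bdot d (\<Oplus>\<^bsub>TB.T\<^esub>j\<in>hsupp TB.T z. hpart TB.T z j)" using z by (simp add: TB.T.hpart_sum)
  also have "\<dots> = (\<Oplus>\<^bsub>TB.T\<^esub>j\<in>hsupp TB.T z. bdot d (hpart TB.T z j))"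
    using z TB.T.finite_hsupp by (intro addhom_finsum[OF TB.T_abelian TB.T_abelian bdot_hom[OF dc]]) auto
  finally show ?case using TB.TG.subgroup_finsum[OF K h[OF homog]] by simp
next
  case (add y c)
  then show ?case using addhom_add[OF bdot_hom_left[OF z]] TB.TG.subgroup_add[OF K] by simp
qed

text \<open>Right multiplication by \<open>c \<otimes> 1\<close> agrees up to sign with the left action of c on homogeneous elements,
  and submodules contain the homogeneous parts of their elements.\<close>

lemma dg_submodule_diag_stable:
  assumes "dg_submodule E (dg_regular E) K"
  shows "diag_stable K"
proof -
  have act: "ract (dg_regular E) = mult E" and car: "carrier E = carrier TB.T"
    by (simp_all add: dg_regular_def E_simps)
  have K: "subgroup K (add_monoid TB.T)" and m: "\<And>z w. z \<in> K \<Longrightarrow> w \<in> carrier TB.T \<Longrightarrow> z \<otimes>\<^bsub>E\<^esub> w \<in> K"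
    and h: "\<And>z i. z \<in> K \<Longrightarrow> hpart TB.T z i \<in> K" and d: "\<And>z. z \<in> K \<Longrightarrow> dif TB.T z \<in> K"
    using assms unfolding dg_submodule_def EE.same_subgroup EE.same_hpart
    by (simp_all only: EE.same act car)
  note Kc = TB.TG.subgroup_carrier[OF K]
  have r: "ract TB.T z b \<in> K" if "z \<in> K" "b \<in> carrier B" for z b
    using m[OF that(1), of "TB.tn \<one>\<^bsub>B\<^esub> b"] E_mult_right_factor[OF Kc] that by simp
  have l0: "bdot c z \<in> K" if "z \<in> K" "z \<in> hcomp TB.T j" "c \<in> hcomp B i" for z c i j
  proof -
    have "sgs TB.T (i * j) (z \<otimes>\<^bsub>E\<^esub> TB.tn c \<one>\<^bsub>B\<^esub>) \<in> K"
      using m[OF that(1), of "TB.tn c \<one>\<^bsub>B\<^esub>"] B.A.hcomp_closed[OF that(3)] TB.TG.sgs_subgroup[OF K] by simp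
    moreover have "sgs TB.T (i * j) (z \<otimes>\<^bsub>E\<^esub> TB.tn c \<one>\<^bsub>B\<^esub>) = bdot c z"
      unfolding E_mult_left_factor[OF that(2,3)]
      using bdot_closed[of c z] Kc[OF that(1)] B.A.hcomp_closed[OF that(3)]
      by (simp add: TB.TG.sgs_sgs) (simp add: sgs_def)
    ultimately show ?thesis by simp
  qed
  have l: "bdot c z \<in> K" if "z \<in> K" "c \<in> carrier B" for z c
    by (rule bdot_sum_mem[OF K Kc[OF that(1)] that(2)])
      (rule l0[OF h[OF that(1)] TB.T.hpart_hcomp[OF Kc[OF that(1)]]])
  show ?thesis using K r l h d by (auto simp: diag_stable_def)
qed

lemma diagonal_ideal_eq: "diagonal_ideal A \<phi> B = {z \<in> carrier TB.T. pi_alg B z = \<zero>\<^bsub>B\<^esub>}"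
  by (simp add: diagonal_ideal_def a_kernel_def kernel_def E_simps)

lemma diagonal_mem: "c \<in> carrier B \<Longrightarrow> TB.tn c \<one>\<^bsub>B\<^esub> \<ominus>\<^bsub>TB.T\<^esub> TB.tn \<one>\<^bsub>B\<^esub> c \<in> diagonal_ideal A \<phi> B"
  by (simp add: diagonal_ideal_eq addhom_diff[OF TB.T_abelian B.A.abelian_group_axioms pi_alg_hom] pi_alg_pure)
    (simp add: a_minus_def B.A.r_neg)

lemma filtration_facts:
  assumes "diagonal_filtration A \<phi> B Jf" and l: "l \<ge> 1"
  shows "diag_stable (Jf l)" "Jf (Suc l) \<subseteq> Jf l" "Jf 1 = diagonal_ideal A \<phi> B"
    "\<And>z w. z \<in> Jf l \<Longrightarrow> w \<in> diagonal_ideal A \<phi> B \<Longrightarrow> z \<otimes>\<^bsub>E\<^esub> w \<in> Jf (Suc l)"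
    "\<And>z i. z \<in> Jf l \<Longrightarrow> z \<in> hcomp TB.T i \<Longrightarrow> i < int l \<Longrightarrow> z = \<zero>\<^bsub>TB.T\<^esub>"
proof -
  let ?J = "diagonal_ideal A \<phi> B"
  have J1: "Jf 1 = ?J" and F: "\<forall>l\<ge>1. dg_submodule E (dg_regular E) (Jf l) \<and> Jf (l + 1) \<subseteq> Jf l
        \<and> ideal_prod E ?J (Jf l) <+>\<^bsub>E\<^esub> ideal_prod E (Jf l) ?J \<subseteq> Jf (l + 1)
        \<and> dg_inf (dg_sub (dg_regular E) (Jf l)) \<ge> ereal (real l)"
    using assms(1) unfolding diagonal_filtration_def Let_def by auto
  show "Jf 1 = ?J" by fact
  show K: "diag_stable (Jf l)" "Jf (Suc l) \<subseteq> Jf l" using F l dg_submodule_diag_stable by auto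
  have inf: "dg_inf (dg_sub (dg_regular E) (Jf l)) \<ge> ereal (real l)"
    and prod: "ideal_prod E ?J (Jf l) <+>\<^bsub>E\<^esub> ideal_prod E (Jf l) ?J \<subseteq> Jf (l + 1)" using F l by auto
  have car: "Jf l \<subseteq> carrier TB.T" using K TB.TG.subgroup_carrier by (auto simp: diag_stable_def)
  show "z \<otimes>\<^bsub>E\<^esub> w \<in> Jf (Suc l)" if z: "z \<in> Jf l" and w: "w \<in> ?J" for z w
  proof -
    have zc: "z \<in> carrier TB.T" and wc: "w \<in> carrier TB.T" using z car w by (auto simp: diagonal_ideal_eq)
    have "\<zero>\<^bsub>TB.T\<^esub> \<in> ?J"
      using addhom_zero[OF TB.T_abelian B.A.abelian_group_axioms pi_alg_hom] by (simp add: diagonal_ideal_eq)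
    then have "\<zero>\<^bsub>TB.T\<^esub> \<otimes>\<^bsub>E\<^esub> z \<in> ideal_prod E ?J (Jf l)" using z by (rule ideal_prod.prod)
    moreover have "\<zero>\<^bsub>TB.T\<^esub> \<otimes>\<^bsub>E\<^esub> z = \<zero>\<^bsub>TB.T\<^esub>"
      by (rule addhom_zero[OF TB.T_abelian TB.T_abelian E_mult_hom_left[OF zc]])
    moreover have "z \<otimes>\<^bsub>E\<^esub> w \<in> ideal_prod E (Jf l) ?J" using z w by (rule ideal_prod.prod)
    ultimately have "\<zero>\<^bsub>TB.T\<^esub> \<oplus>\<^bsub>E\<^esub> (z \<otimes>\<^bsub>E\<^esub> w) \<in> ideal_prod E ?J (Jf l) <+>\<^bsub>E\<^esub> ideal_prod E (Jf l) ?J"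
      by (auto simp: set_add_def set_mult_def)
    then show ?thesis using prod E_mult_closed[OF zc wc] by (auto simp: E_simps)
  qed
  show "z = \<zero>\<^bsub>TB.T\<^esub>" if "z \<in> Jf l" "z \<in> hcomp TB.T i" "i < int l" for z i
  proof (rule ccontr)
    assume "z \<noteq> \<zero>\<^bsub>TB.T\<^esub>"
    then have "hcomp (dg_sub (dg_regular E) (Jf l)) i \<noteq> {\<zero>\<^bsub>dg_sub (dg_regular E) (Jf l)\<^esub>}"
      using that by (auto simp: dg_sub_def EE.same)
    then have "dg_inf (dg_sub (dg_regular E) (Jf l)) \<le> ereal (real_of_int i)"
      unfolding dg_inf_def by (intro INF_lower) auto
    with inf have "ereal (real l) \<le> ereal (real_of_int i)" by (rule order_trans)
    then show False using that(3) by simp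
  qed
qed

text \<open>The element \<open>c \<otimes> 1 - 1 \<otimes> c\<close> lies in the diagonal ideal and multiplies each term of the filtration into
  the next one; so the left and the right action agree up to sign on the subquotients.\<close>

lemma filtration_comm:
  assumes "diagonal_filtration A \<phi> B Jf" and l: "l \<ge> 1"
    and z: "z \<in> Jf l" "z \<in> hcomp TB.T k" and c: "c \<in> hcomp B i"
  shows "bdot c z \<ominus>\<^bsub>TB.T\<^esub> sgs TB.T (i * k) (ract TB.T z c) \<in> Jf (Suc l)"
proof -
  have cc: "c \<in> carrier B" and zc: "z \<in> carrier TB.T" using B.A.hcomp_closed[OF c] TB.T.hcomp_closed[OF z(2)] .
  have K: "subgroup (Jf (Suc l)) (add_monoid TB.T)" using filtration_facts(1)[OF assms(1), of "Suc l"] by (simp add: diag_stable_def)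
  have "z \<otimes>\<^bsub>E\<^esub> (TB.tn c \<one>\<^bsub>B\<^esub> \<ominus>\<^bsub>TB.T\<^esub> TB.tn \<one>\<^bsub>B\<^esub> c) \<in> Jf (Suc l)"
    by (rule filtration_facts(4)[OF assms(1) l z(1) diagonal_mem[OF cc]])
  also have "z \<otimes>\<^bsub>E\<^esub> (TB.tn c \<one>\<^bsub>B\<^esub> \<ominus>\<^bsub>TB.T\<^esub> TB.tn \<one>\<^bsub>B\<^esub> c) = sgs TB.T (i * k) (bdot c z) \<ominus>\<^bsub>TB.T\<^esub> ract TB.T z c"
    using cc zc E_mult_left_factor[OF z(2) c] E_mult_right_factor[OF zc cc]
    by (subst addhom_diff[OF TB.T_abelian TB.T_abelian E_mult_hom_right[OF zc]]) auto
  finally have "sgs TB.T (i * k) (sgs TB.T (i * k) (bdot c z) \<ominus>\<^bsub>TB.T\<^esub> ract TB.T z c) \<in> Jf (Suc l)"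
    by (rule TB.TG.sgs_subgroup[OF K])
  moreover have "sgs TB.T (i * k) (sgs TB.T (i * k) (bdot c z) \<ominus>\<^bsub>TB.T\<^esub> ract TB.T z c)
      = bdot c z \<ominus>\<^bsub>TB.T\<^esub> sgs TB.T (i * k) (ract TB.T z c)"
    using bdot_closed[OF cc zc] TB.ract_T_closed[OF zc cc]
    by (auto simp: sgs_def a_minus_def TB.TG.minus_add)
  ultimately show ?thesis by simp
qed

end

section \<open>Linear maps, coordinates and Ext\<close>

text \<open>Unlike the members of \<open>Hom_comp\<close>, these maps may take any values outside the carrier of N.\<close>

definition lin_map ::
  "('r, 'b) dg_alg \<Rightarrow> ('b, 'm) dg_mod \<Rightarrow> ('b, 'n) dg_mod \<Rightarrow> int \<Rightarrow> ('m \<Rightarrow> 'n) \<Rightarrow> bool" where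
  "lin_map B N L n f \<longleftrightarrow> addhom N L f \<and> (\<forall>x\<in>carrier N. \<forall>b\<in>carrier B. f (ract N x b) = ract L (f x) b)
     \<and> (\<forall>i. \<forall>x\<in>hcomp N i. f x \<in> hcomp L (i + n))"

lemma lin_map_hom: "lin_map B N L n f \<Longrightarrow> addhom N L f" by (simp add: lin_map_def)

lemma lin_map_lin: "lin_map B N L n f \<Longrightarrow> x \<in> carrier N \<Longrightarrow> b \<in> carrier B \<Longrightarrow> f (ract N x b) = ract L (f x) b"
  by (simp add: lin_map_def)

lemma lin_map_degree: "lin_map B N L n f \<Longrightarrow> x \<in> hcomp N i \<Longrightarrow> f x \<in> hcomp L (i + n)"
  by (simp add: lin_map_def)

lemma lin_map_closed: "lin_map B N L n f \<Longrightarrow> x \<in> carrier N \<Longrightarrow> f x \<in> carrier L"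
  using addhom_closed[OF lin_map_hom] .

lemma lin_map_compose: "lin_map B N L n f \<Longrightarrow> lin_map B L K m g \<Longrightarrow> lin_map B N K (n + m) (\<lambda>x. g (f x))"
  unfolding lin_map_def by (auto simp: addhom_closed add.assoc[symmetric] intro: addhom_compose)

lemma lin_map_sgs:
  assumes "dg_module B L" "lin_map B N L n f"
  shows "lin_map B N L n (\<lambda>x. sgs L m (f x))"
proof -
  interpret L: dg_module B L by fact
  show ?thesis
    using assms(2) addhom_sgs[OF L.abelian_group_axioms L.abelian_group_axioms L.ract_hom_left]
    unfolding lin_map_def by (auto intro: L.addhom_sgs_fun L.hcomp_sgs simp: addhom_closed)
qed

lemma lin_map_diff:
  assumes "dg_module B L" "lin_map B N L n f" "lin_map B N L n g"
  shows "lin_map B N L n (\<lambda>x. f x \<ominus>\<^bsub>L\<^esub> g x)"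
proof -
  interpret L: dg_module B L by fact
  show ?thesis
    using assms(2,3) addhom_diff[OF L.abelian_group_axioms L.abelian_group_axioms L.ract_hom_left]
      L.subgroup_diff[OF L.hcomp_subgroup]
    unfolding lin_map_def by (auto intro: L.addhom_diff_fun simp: addhom_closed)
qed

text \<open>In a trivial homology group the coset of a cycle is the group of boundaries, and the cycle lies in its
  own coset.\<close>

lemma Ext_trivialD:
  assumes N: "dg_module B N" and L: "dg_module B L" and triv: "trivial_group (Ext B i N L)"
    and f: "lin_map B N L (- i) f"
    and cycle: "\<And>x. x \<in> carrier N \<Longrightarrow> dif L (f x) = sgs L i (f (dif N x))"
  shows "\<exists>g. lin_map B N L (1 - i) g \<and> (\<forall>x\<in>carrier N. f x = dif L (g x) \<ominus>\<^bsub>L\<^esub> sgs L (1 - i) (g (dif N x)))"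
proof -
  interpret N: dg_module B N by fact
  interpret L: dg_module B L by fact
  define z where "z = (\<lambda>x\<in>carrier N. \<zero>\<^bsub>L\<^esub>)"
  define p where "p = (\<lambda>f g. \<lambda>x\<in>carrier N. f x \<oplus>\<^bsub>L\<^esub> g x)"
  define G where "G = \<lparr>carrier = {f \<in> Hom_comp B N L (- i). Hom_dif N L (- i) f = z}, mult = p, one = z\<rparr>"
  define H where "H = Hom_dif N L (- i + 1) ` Hom_comp B N L (- i + 1)"
  have Ext: "Ext B i N L = G Mod H"
    by (simp add: Ext_def homology_def G_def H_def z_def p_def)
  define f' where "f' = restrict f (carrier N)"
  have comp: "restrict g (carrier N) \<in> Hom_comp B N L n" if "lin_map B N L n g" for g n
    using that unfolding lin_map_def Hom_comp_def
    by (auto simp: hom_def N.ract_closed N.hcomp_closed image_subset_iff Pi_def)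
  have "f' \<in> carrier G"
  proof -
    have "Hom_dif N L (- i) f' = z"
    proof
      fix x
      have "dif L (f x) \<ominus>\<^bsub>L\<^esub> [sg (- i)] \<cdot>\<^bsub>L\<^esub> f (dif N x) = \<zero>\<^bsub>L\<^esub>" if "x \<in> carrier N"
        using that lin_map_closed[OF f] cycle[OF that] L.sg_add_pow[of "f (dif N x)" "- i"]
        by (simp add: a_minus_def sgs_def L.r_neg)
      then show "Hom_dif N L (- i) f' x = z x"
        by (simp add: Hom_dif_def f'_def z_def)
    qed
    then show ?thesis using comp[OF f] by (simp add: G_def f'_def)
  qed
  then have "H #>\<^bsub>G\<^esub> f' \<in> carrier (G Mod H)" by (auto simp: FactGroup_def RCOSETS_def)
  then have coset: "H #>\<^bsub>G\<^esub> f' = H" using triv unfolding Ext trivial_group_def by (auto simp: FactGroup_def)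
  have "z \<in> H"
  proof -
    have "lin_map B N L (- i + 1) (\<lambda>x. \<zero>\<^bsub>L\<^esub>)"
      using addhom_zero[OF L.abelian_group_axioms L.abelian_group_axioms L.ract_hom_left]
      by (auto simp: lin_map_def intro!: addhomI)
    moreover have "Hom_dif N L (- i + 1) (restrict (\<lambda>x. \<zero>\<^bsub>L\<^esub>) (carrier N)) = z"
      using addhom_zero[OF L.abelian_group_axioms L.abelian_group_axioms L.dif_hom] L.sg_add_pow[of "\<zero>\<^bsub>L\<^esub>" "- i + 1"]
      by (auto simp: Hom_dif_def z_def a_minus_def fun_eq_iff)
    ultimately show ?thesis unfolding H_def using comp by (metis imageI)
  qed
  moreover have "p z f' = f'"
    using lin_map_closed[OF f] by (auto simp: p_def z_def f'_def fun_eq_iff)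
  ultimately have "f' \<in> H #>\<^bsub>G\<^esub> f'" by (force simp: r_coset_def G_def)
  then have "f' \<in> H" using coset by simp
  then obtain g where g: "g \<in> Hom_comp B N L (- i + 1)" "f' = Hom_dif N L (- i + 1) g" by (auto simp: H_def)
  have gl: "lin_map B N L (1 - i) g"
    using g(1) by (auto simp: Hom_comp_def lin_map_def image_subset_iff algebra_simps)
  moreover have "f x = dif L (g x) \<ominus>\<^bsub>L\<^esub> sgs L (1 - i) (g (dif N x))" if x: "x \<in> carrier N" for x
    using fun_cong[OF g(2), of x] x lin_map_closed[OF gl] L.sg_add_pow[of "g (dif N x)" "- i + 1"]
    by (simp add: f'_def Hom_dif_def)
  ultimately show ?thesis by blast
qed

locale based_module = B: dg_algebra R B + N: dg_module B N
  for R :: "('r, 'y) ring_scheme" and B :: "('r, 'b) dg_alg" and N :: "('b, 'n) dg_mod" +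
  fixes F :: "'n set"
  assumes basis: "graded_basis B N F"
begin

definition is_coord :: "'n \<Rightarrow> ('n \<Rightarrow> 'b) \<Rightarrow> bool" where
  "is_coord x c \<longleftrightarrow> (\<forall>f\<in>F. c f \<in> carrier B) \<and> finite {f. c f \<noteq> \<zero>\<^bsub>B\<^esub>} \<and> {f. c f \<noteq> \<zero>\<^bsub>B\<^esub>} \<subseteq> F
     \<and> x = (\<Oplus>\<^bsub>N\<^esub>f\<in>{f. c f \<noteq> \<zero>\<^bsub>B\<^esub>}. ract N f (c f))"

definition coord :: "'n \<Rightarrow> 'n \<Rightarrow> 'b" where
  "coord x = (THE c. is_coord x c)"

definition csupp :: "'n \<Rightarrow> 'n set" where
  "csupp x = {f. coord x f \<noteq> \<zero>\<^bsub>B\<^esub>}"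

text \<open>Over the zero ring a basis element may be 0 and then lies in every degree.\<close>

definition bdeg :: "'n \<Rightarrow> int" where
  "bdeg f = (SOME i. f \<in> hcomp N i)"

lemma basis_homog: "f \<in> F \<Longrightarrow> f \<in> hcomp N (bdeg f)"
  using basis unfolding bdeg_def graded_basis_def by (metis UN_E subsetD someI)

lemma basis_closed: "f \<in> F \<Longrightarrow> f \<in> carrier N"
  using basis_homog N.hcomp_closed by blast

lemma basis_indep: "finite T \<Longrightarrow> T \<subseteq> F \<Longrightarrow> (\<And>f. f \<in> T \<Longrightarrow> c f \<in> carrier B) \<Longrightarrow>
    (\<Oplus>\<^bsub>N\<^esub>e\<in>T. ract N e (c e)) = \<zero>\<^bsub>N\<^esub> \<Longrightarrow> e \<in> T \<Longrightarrow> c e = \<zero>\<^bsub>B\<^esub>"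
  using basis unfolding graded_basis_def by (metis image_subsetI)

lemma ract_zero [simp]: "x \<in> carrier N \<Longrightarrow> ract N x \<zero>\<^bsub>B\<^esub> = \<zero>\<^bsub>N\<^esub>"
  using addhom_zero[OF B.A.abelian_group_axioms N.abelian_group_axioms N.ract_hom_right] .

lemma is_coord_sum:
  assumes "is_coord x c" "finite S" "{f. c f \<noteq> \<zero>\<^bsub>B\<^esub>} \<subseteq> S" "S \<subseteq> F"
  shows "x = (\<Oplus>\<^bsub>N\<^esub>f\<in>S. ract N f (c f))"
proof -
  have "(\<Oplus>\<^bsub>N\<^esub>f\<in>S. ract N f (c f)) = (\<Oplus>\<^bsub>N\<^esub>f\<in>{f. c f \<noteq> \<zero>\<^bsub>B\<^esub>}. ract N f (c f))"
    using assms basis_closed by (intro N.finsum_mono_neutral) (auto simp: is_coord_def intro!: N.ract_closed)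
  then show ?thesis using assms(1) unfolding is_coord_def by (elim conjE) (rule trans, assumption, rule sym)
qed

lemma is_coord_unique:
  assumes c: "is_coord x c" and d: "is_coord x d"
  shows "c = d"
proof -
  let ?S = "{f. c f \<noteq> \<zero>\<^bsub>B\<^esub>} \<union> {f. d f \<noteq> \<zero>\<^bsub>B\<^esub>}"
  have S: "finite ?S" "?S \<subseteq> F" using c d by (auto simp: is_coord_def)
  have cl: "f \<in> ?S \<Longrightarrow> c f \<in> carrier B" "f \<in> ?S \<Longrightarrow> d f \<in> carrier B" "f \<in> ?S \<Longrightarrow> f \<in> carrier N" for f
    using S(2) c d basis_closed by (auto simp: is_coord_def)
  have xc: "x = (\<Oplus>\<^bsub>N\<^esub>f\<in>?S. ract N f (c f))" by (rule is_coord_sum[OF c S(1) _ S(2)]) blast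
  have xd: "x = (\<Oplus>\<^bsub>N\<^esub>f\<in>?S. ract N f (d f))" by (rule is_coord_sum[OF d S(1) _ S(2)]) blast
  let ?dif = "\<Oplus>\<^bsub>N\<^esub>f\<in>?S. ract N f (c f \<ominus>\<^bsub>B\<^esub> d f)"
  have clS: "?dif \<in> carrier N" "x \<in> carrier N"
    using cl by (auto intro!: N.finsum_closed N.ract_closed simp: Pi_def xc)
  have "?dif \<oplus>\<^bsub>N\<^esub> x = (\<Oplus>\<^bsub>N\<^esub>f\<in>?S. ract N f (c f \<ominus>\<^bsub>B\<^esub> d f) \<oplus>\<^bsub>N\<^esub> ract N f (d f))"
    unfolding xd using cl by (intro N.finsum_addf[symmetric]) (auto intro!: N.ract_closed)
  also have "\<dots> = (\<Oplus>\<^bsub>N\<^esub>f\<in>?S. ract N f (c f))"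
    using cl by (intro N.finsum_cong')
      (auto simp: N.ract_add_right[symmetric] B.A.add_diff_cancel intro!: N.ract_closed)
  also have "\<dots> = x" using xc by simp
  finally have "?dif = \<zero>\<^bsub>N\<^esub>"
    using clS N.add.r_cancel_one by blast
  then have "c f \<ominus>\<^bsub>B\<^esub> d f = \<zero>\<^bsub>B\<^esub>" if "f \<in> ?S" for f
    using basis_indep[OF S, of "\<lambda>f. c f \<ominus>\<^bsub>B\<^esub> d f" f] cl that by auto
  then have "c f = d f" if "f \<in> ?S" for f
    using B.A.minus_eq_zeroD[of "c f" "d f"] cl that by blast
  then show ?thesis by (intro ext) (metis (mono_tags, lifting) UnCI mem_Collect_eq)
qed

lemma is_coord_restrict:
  assumes "finite T" "T \<subseteq> F" "\<And>f. f \<in> T \<Longrightarrow> c f \<in> carrier B"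
  shows "is_coord (\<Oplus>\<^bsub>N\<^esub>e\<in>T. ract N e (c e)) (\<lambda>f. if f \<in> T then c f else \<zero>\<^bsub>B\<^esub>)"
proof -
  let ?c = "\<lambda>f. if f \<in> T then c f else \<zero>\<^bsub>B\<^esub>"
  have sub: "{f. ?c f \<noteq> \<zero>\<^bsub>B\<^esub>} \<subseteq> T" by auto
  have "(\<Oplus>\<^bsub>N\<^esub>e\<in>T. ract N e (c e)) = (\<Oplus>\<^bsub>N\<^esub>e\<in>T. ract N e (?c e))"
    using assms basis_closed by (intro N.finsum_cong') (auto intro!: N.ract_closed)
  also have "\<dots> = (\<Oplus>\<^bsub>N\<^esub>e\<in>{f. ?c f \<noteq> \<zero>\<^bsub>B\<^esub>}. ract N e (?c e))"
    using assms basis_closed sub by (intro N.finsum_mono_neutral) (auto intro!: N.ract_closed)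
  finally show ?thesis
    using assms sub finite_subset[OF sub assms(1)] unfolding is_coord_def by (intro conjI ballI) auto
qed

lemma coord_eqI:
  assumes "finite T" "T \<subseteq> F" "\<And>f. f \<in> T \<Longrightarrow> c f \<in> carrier B" "x = (\<Oplus>\<^bsub>N\<^esub>e\<in>T. ract N e (c e))"
  shows "coord x = (\<lambda>f. if f \<in> T then c f else \<zero>\<^bsub>B\<^esub>)"
  unfolding coord_def assms(4) using is_coord_restrict[OF assms(1-3)]
  by (intro the_equality is_coord_unique)

lemma is_coord_coord: assumes "x \<in> carrier N" shows "is_coord x (coord x)"
proof -
  have "x \<in> rspan B N F" using basis assms by (simp add: graded_basis_def)
  then obtain T c where T: "finite T" "T \<subseteq> F" "c ` T \<subseteq> carrier B" "x = (\<Oplus>\<^bsub>N\<^esub>e\<in>T. ract N e (c e))"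
    by (auto simp: rspan_def)
  then have "is_coord x (\<lambda>f. if f \<in> T then c f else \<zero>\<^bsub>B\<^esub>)" using is_coord_restrict[of T c] by auto
  moreover have "coord x = (\<lambda>f. if f \<in> T then c f else \<zero>\<^bsub>B\<^esub>)" using T by (intro coord_eqI) auto
  ultimately show ?thesis by simp
qed

lemma coord_closed [simp]: "x \<in> carrier N \<Longrightarrow> coord x f \<in> carrier B"
  using is_coord_coord[of x] unfolding is_coord_def by (cases "coord x f = \<zero>\<^bsub>B\<^esub>") auto

lemma csupp: "x \<in> carrier N \<Longrightarrow> finite (csupp x)" "x \<in> carrier N \<Longrightarrow> csupp x \<subseteq> F"
  using is_coord_coord[of x] unfolding is_coord_def csupp_def by auto

lemma coord_sum: "x \<in> carrier N \<Longrightarrow> finite S \<Longrightarrow> csupp x \<subseteq> S \<Longrightarrow> S \<subseteq> F \<Longrightarrow>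
    (\<Oplus>\<^bsub>N\<^esub>f\<in>S. ract N f (coord x f)) = x"
  using is_coord_sum[OF is_coord_coord, of x S] unfolding csupp_def by simp

lemma coord_add:
  assumes "x \<in> carrier N" "y \<in> carrier N"
  shows "coord (x \<oplus>\<^bsub>N\<^esub> y) f = coord x f \<oplus>\<^bsub>B\<^esub> coord y f"
proof -
  let ?S = "csupp x \<union> csupp y"
  have S: "finite ?S" "?S \<subseteq> F" using csupp assms by auto
  have cl: "f \<in> ?S \<Longrightarrow> f \<in> carrier N" for f using S basis_closed by auto
  have "x \<oplus>\<^bsub>N\<^esub> y = (\<Oplus>\<^bsub>N\<^esub>f\<in>?S. ract N f (coord x f)) \<oplus>\<^bsub>N\<^esub> (\<Oplus>\<^bsub>N\<^esub>f\<in>?S. ract N f (coord y f))"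
    using coord_sum[OF assms(1) S(1) _ S(2)] coord_sum[OF assms(2) S(1) _ S(2)] by simp
  also have "\<dots> = (\<Oplus>\<^bsub>N\<^esub>f\<in>?S. ract N f (coord x f) \<oplus>\<^bsub>N\<^esub> ract N f (coord y f))"
    using cl assms by (intro N.finsum_addf[symmetric]) (auto intro!: N.ract_closed)
  also have "\<dots> = (\<Oplus>\<^bsub>N\<^esub>f\<in>?S. ract N f (coord x f \<oplus>\<^bsub>B\<^esub> coord y f))"
    using cl assms by (intro N.finsum_cong') (auto intro!: N.ract_closed simp: N.ract_add_right)
  finally have "coord (x \<oplus>\<^bsub>N\<^esub> y) = (\<lambda>f. if f \<in> ?S then coord x f \<oplus>\<^bsub>B\<^esub> coord y f else \<zero>\<^bsub>B\<^esub>)"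
    using S assms by (intro coord_eqI) auto
  then show ?thesis by (auto simp: csupp_def)
qed

lemma coord_hom: "addhom N B (\<lambda>x. coord x f)"
  by (rule addhomI) (auto simp: coord_add)

lemma coord_ract:
  assumes "x \<in> carrier N" "b \<in> carrier B"
  shows "coord (ract N x b) f = coord x f \<otimes>\<^bsub>B\<^esub> b"
proof -
  have cl: "f \<in> csupp x \<Longrightarrow> f \<in> carrier N" for f using csupp assms basis_closed by auto
  have "ract N x b = ract N (\<Oplus>\<^bsub>N\<^esub>f\<in>csupp x. ract N f (coord x f)) b"
    using coord_sum[OF assms(1)] csupp assms by simp
  also have "\<dots> = (\<Oplus>\<^bsub>N\<^esub>f\<in>csupp x. ract N (ract N f (coord x f)) b)"
    using csupp cl assms
    by (intro addhom_finsum[OF N.abelian_group_axioms N.abelian_group_axioms N.ract_hom_left]) (auto intro!: N.ract_closed)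
  also have "\<dots> = (\<Oplus>\<^bsub>N\<^esub>f\<in>csupp x. ract N f (coord x f \<otimes>\<^bsub>B\<^esub> b))"
    using cl assms by (intro N.finsum_cong') (auto intro!: N.ract_closed simp: N.ract_mult)
  finally have "coord (ract N x b) = (\<lambda>f. if f \<in> csupp x then coord x f \<otimes>\<^bsub>B\<^esub> b else \<zero>\<^bsub>B\<^esub>)"
    using csupp assms by (intro coord_eqI) auto
  then show ?thesis using assms by (auto simp: csupp_def)
qed

lemma coord_basis: "f \<in> F \<Longrightarrow> coord f = (\<lambda>e. if e = f then \<one>\<^bsub>B\<^esub> else \<zero>\<^bsub>B\<^esub>)"
  using coord_eqI[of "{f}" "\<lambda>_. \<one>\<^bsub>B\<^esub>" f] basis_closed[of f] by (auto simp: N.ract_one)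

text \<open>The parts of degree i of the terms of the expansion of x again form an expansion of x.\<close>

lemma coord_degree:
  assumes x: "x \<in> hcomp N i" and f: "f \<in> F"
  shows "coord x f \<in> hcomp B (i - bdeg f)"
proof -
  have xc: "x \<in> carrier N" using N.hcomp_closed[OF x] .
  note S = csupp[OF xc]
  have cl: "f \<in> csupp x \<Longrightarrow> f \<in> carrier N" for f using S basis_closed by auto
  have h: "hpart N (ract N f b) i = ract N f (hpart B b (i - bdeg f))" if "f \<in> F" "b \<in> carrier B" for f b
    using B.A.hpart_map[OF N.dg_complex_axioms N.ract_hom_right[OF basis_closed[OF that(1)]] _ that(2), of "bdeg f" "i - bdeg f"]
      N.ract_degree[OF basis_homog[OF that(1)]] by (simp add: add.commute)
  have "x = hpart N (\<Oplus>\<^bsub>N\<^esub>f\<in>csupp x. ract N f (coord x f)) i"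
    using coord_sum[OF xc] S N.hpart_homog[OF x] by simp
  also have "\<dots> = (\<Oplus>\<^bsub>N\<^esub>f\<in>csupp x. hpart N (ract N f (coord x f)) i)"
    using S cl xc
    by (intro addhom_finsum[OF N.abelian_group_axioms N.abelian_group_axioms N.hpart_hom]) (auto intro!: N.ract_closed)
  also have "\<dots> = (\<Oplus>\<^bsub>N\<^esub>f\<in>csupp x. ract N f (hpart B (coord x f) (i - bdeg f)))"
    using S cl xc h by (intro N.finsum_cong') (auto intro!: N.ract_closed)
  finally have "coord x = (\<lambda>f. if f \<in> csupp x then hpart B (coord x f) (i - bdeg f) else \<zero>\<^bsub>B\<^esub>)"
    using S xc by (intro coord_eqI) auto
  then have "coord x f = (if f \<in> csupp x then hpart B (coord x f) (i - bdeg f) else \<zero>\<^bsub>B\<^esub>)" by (rule fun_cong)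
  then show ?thesis using B.A.hpart_hcomp[of "coord x f" "i - bdeg f"] xc by (auto split: if_splits)
qed

definition lin_ext :: "('b, 'l) dg_mod \<Rightarrow> ('n \<Rightarrow> 'l) \<Rightarrow> 'n \<Rightarrow> 'l" where
  "lin_ext L h x = (\<Oplus>\<^bsub>L\<^esub>f\<in>csupp x. ract L (h f) (coord x f))"

context
  fixes L :: "('b, 'l) dg_mod" and h :: "'n \<Rightarrow> 'l" and n :: int
  assumes L: "dg_module B L" and h: "\<And>f. f \<in> F \<Longrightarrow> h f \<in> hcomp L (bdeg f + n)"
begin

interpretation L: dg_module B L by (rule L)

lemma lin_ext_h_closed: "f \<in> F \<Longrightarrow> h f \<in> carrier L"
  using h L.hcomp_closed by blast

lemma lin_ext_sum:
  assumes "x \<in> carrier N" "finite S" "csupp x \<subseteq> S" "S \<subseteq> F"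
  shows "lin_ext L h x = (\<Oplus>\<^bsub>L\<^esub>f\<in>S. ract L (h f) (coord x f))"
  unfolding lin_ext_def using assms lin_ext_h_closed
    addhom_zero[OF B.A.abelian_group_axioms L.abelian_group_axioms L.ract_hom_right]
  by (intro L.finsum_mono_neutral[symmetric]) (auto simp: csupp_def intro!: L.ract_closed)

lemma lin_ext_lin_map: "lin_map B N L n (lin_ext L h)"
  unfolding lin_map_def
proof (intro conjI ballI allI)
  have cl: "f \<in> F \<Longrightarrow> x \<in> carrier N \<Longrightarrow> ract L (h f) (coord x f) \<in> carrier L" for f x
    using lin_ext_h_closed by (auto intro!: L.ract_closed)
  have lcl: "lin_ext L h x \<in> carrier L" if "x \<in> carrier N" for x
    unfolding lin_ext_def using csupp[OF that] cl[OF _ that] by (intro L.finsum_closed) auto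
  show "addhom N L (lin_ext L h)"
  proof (rule addhomI)
    fix x y assume xy: "x \<in> carrier N" "y \<in> carrier N"
    let ?S = "csupp x \<union> csupp y \<union> csupp (x \<oplus>\<^bsub>N\<^esub> y)"
    have S: "finite ?S" "?S \<subseteq> F" using csupp xy by auto
    have s: "csupp x \<subseteq> ?S" "csupp y \<subseteq> ?S" "csupp (x \<oplus>\<^bsub>N\<^esub> y) \<subseteq> ?S" by blast+
    have F: "f \<in> ?S \<Longrightarrow> f \<in> F" for f using S by blast
    have "lin_ext L h (x \<oplus>\<^bsub>N\<^esub> y) = (\<Oplus>\<^bsub>L\<^esub>f\<in>?S. ract L (h f) (coord (x \<oplus>\<^bsub>N\<^esub> y) f))"
      using xy by (intro lin_ext_sum[OF _ S(1) s(3) S(2)]) auto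
    also have "\<dots> = (\<Oplus>\<^bsub>L\<^esub>f\<in>?S. ract L (h f) (coord x f) \<oplus>\<^bsub>L\<^esub> ract L (h f) (coord y f))"
      using xy cl F lin_ext_h_closed by (intro L.finsum_cong') (simp_all add: Pi_def coord_add L.ract_add_right)
    also have "\<dots> = (\<Oplus>\<^bsub>L\<^esub>f\<in>?S. ract L (h f) (coord x f)) \<oplus>\<^bsub>L\<^esub> (\<Oplus>\<^bsub>L\<^esub>f\<in>?S. ract L (h f) (coord y f))"
      using xy cl F by (intro L.finsum_addf) (simp_all add: Pi_def)
    also have "\<dots> = lin_ext L h x \<oplus>\<^bsub>L\<^esub> lin_ext L h y"
      using lin_ext_sum[OF xy(1) S(1) s(1) S(2)] lin_ext_sum[OF xy(2) S(1) s(2) S(2)] by simp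
    finally show "lin_ext L h (x \<oplus>\<^bsub>N\<^esub> y) = lin_ext L h x \<oplus>\<^bsub>L\<^esub> lin_ext L h y" .
  qed (rule lcl)
  show "lin_ext L h (ract N x b) = ract L (lin_ext L h x) b" if xb: "x \<in> carrier N" "b \<in> carrier B" for x b
  proof -
    have F: "f \<in> csupp x \<Longrightarrow> f \<in> F" for f using csupp xb by auto
    have "csupp (ract N x b) \<subseteq> csupp x" using xb by (auto simp: csupp_def coord_ract)
    then have "lin_ext L h (ract N x b) = (\<Oplus>\<^bsub>L\<^esub>f\<in>csupp x. ract L (h f) (coord (ract N x b) f))"
      using csupp xb by (intro lin_ext_sum) (auto intro: N.ract_closed)
    also have "\<dots> = (\<Oplus>\<^bsub>L\<^esub>f\<in>csupp x. ract L (ract L (h f) (coord x f)) b)"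
      using xb F lin_ext_h_closed
      by (intro L.finsum_cong') (simp_all add: Pi_def coord_ract L.ract_mult L.ract_closed)
    also have "\<dots> = ract L (lin_ext L h x) b"
      unfolding lin_ext_def using xb F cl csupp
      by (intro addhom_finsum[OF L.abelian_group_axioms L.abelian_group_axioms L.ract_hom_left, symmetric]) auto
    finally show ?thesis .
  qed
  show "lin_ext L h x \<in> hcomp L (i + n)" if x: "x \<in> hcomp N i" for i x
  proof -
    have F: "f \<in> csupp x \<Longrightarrow> f \<in> F" for f using csupp N.hcomp_closed[OF x] by auto
    have "ract L (h f) (coord x f) \<in> hcomp L (i + n)" if "f \<in> csupp x" for f
      using L.ract_degree[OF h[OF F[OF that]] coord_degree[OF x F[OF that]]] by (simp add: algebra_simps)
    then show ?thesis unfolding lin_ext_def by (rule L.subgroup_finsum[OF L.hcomp_subgroup])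
  qed
qed

lemma lin_ext_basis:
  assumes "f \<in> F" shows "lin_ext L h f = h f"
proof -
  have "lin_ext L h f = (\<Oplus>\<^bsub>L\<^esub>e\<in>{f}. ract L (h e) (coord f e))"
    using assms basis_closed by (intro lin_ext_sum) (auto simp: csupp_def coord_basis)
  then show ?thesis using assms lin_ext_h_closed by (simp add: coord_basis L.ract_one)
qed

end

lemma lin_map_eqI:
  assumes L: "dg_module B L" and "lin_map B N L n f" "lin_map B N L m g" "\<And>e. e \<in> F \<Longrightarrow> f e = g e" "x \<in> carrier N"
  shows "f x = g x"
proof -
  interpret L: dg_module B L by fact
  note S = csupp[OF assms(5)]
  have cl: "e \<in> csupp x \<Longrightarrow> e \<in> carrier N" for e using S basis_closed by auto
  have *: "k x = (\<Oplus>\<^bsub>L\<^esub>e\<in>csupp x. ract L (k e) (coord x e))" if k: "lin_map B N L n k" for k n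
  proof -
    have "k x = k (\<Oplus>\<^bsub>N\<^esub>e\<in>csupp x. ract N e (coord x e))" using coord_sum[OF assms(5)] S by simp
    also have "\<dots> = (\<Oplus>\<^bsub>L\<^esub>e\<in>csupp x. k (ract N e (coord x e)))"
      using S cl assms(5)
      by (intro addhom_finsum[OF N.abelian_group_axioms L.abelian_group_axioms lin_map_hom[OF k]]) (auto intro: N.ract_closed)
    also have "\<dots> = (\<Oplus>\<^bsub>L\<^esub>e\<in>csupp x. ract L (k e) (coord x e))"
      using cl assms(5) lin_map_closed[OF k] by (intro L.finsum_cong') (auto simp: lin_map_lin[OF k] intro!: L.ract_closed)
    finally show ?thesis .
  qed
  show ?thesis
    unfolding *[OF assms(2)] *[OF assms(3)]
    using S cl assms(4,5) lin_map_closed[OF assms(3)] by (intro L.finsum_cong') (auto intro!: L.ract_closed)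
qed

end

section \<open>Congruence and cosets modulo a subgroup\<close>

context abelian_group
begin

definition cong_mod :: "'a set \<Rightarrow> 'a \<Rightarrow> 'a \<Rightarrow> bool" where
  "cong_mod H x y \<longleftrightarrow> x \<in> carrier G \<and> y \<in> carrier G \<and> x \<ominus> y \<in> H"

lemma cong_mod_refl: "subgroup H (add_monoid G) \<Longrightarrow> x \<in> carrier G \<Longrightarrow> cong_mod H x x"
  using subgroup_zero by (simp add: cong_mod_def a_minus_def r_neg)

lemma cong_mod_sym: "subgroup H (add_monoid G) \<Longrightarrow> cong_mod H x y \<Longrightarrow> cong_mod H y x"
  using subgroup_neg[of H "x \<ominus> y"] by (auto simp: cong_mod_def a_minus_def minus_add a_comm)

lemma cong_mod_trans:
  assumes "subgroup H (add_monoid G)" "cong_mod H x y" "cong_mod H y z"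
  shows "cong_mod H x z"
proof -
  have "x \<ominus> z = (x \<ominus> y) \<oplus> (y \<ominus> z)"
    using assms by (simp add: cong_mod_def a_minus_def a_assoc r_neg1)
  then show ?thesis using assms subgroup_add[OF assms(1), of "x \<ominus> y" "y \<ominus> z"] by (simp add: cong_mod_def)
qed

lemma cong_mod_add:
  assumes "subgroup H (add_monoid G)" "cong_mod H x y" "cong_mod H x' y'"
  shows "cong_mod H (x \<oplus> x') (y \<oplus> y')"
proof -
  have "(x \<oplus> x') \<ominus> (y \<oplus> y') = (x \<ominus> y) \<oplus> (x' \<ominus> y')"
    using assms by (simp add: cong_mod_def a_minus_def minus_add a_ac)
  then show ?thesis using assms subgroup_add[OF assms(1), of "x \<ominus> y" "x' \<ominus> y'"] by (simp add: cong_mod_def)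
qed

lemma cong_mod_sgs:
  assumes "subgroup H (add_monoid G)" "cong_mod H x y"
  shows "cong_mod H (sgs G n x) (sgs G n y)"
proof -
  have "sgs G n x \<ominus> sgs G n y = sgs G n (x \<ominus> y)"
    using assms by (auto simp add: cong_mod_def sgs_def a_minus_def minus_add)
  then show ?thesis using assms sgs_subgroup[OF assms(1), of "x \<ominus> y" n] by (simp add: cong_mod_def)
qed

lemma cong_mod_diff:
  assumes "subgroup H (add_monoid G)" "cong_mod H x y" "cong_mod H x' y'"
  shows "cong_mod H (x \<ominus> x') (y \<ominus> y')"
  using cong_mod_add[OF assms(1,2) cong_mod_sgs[OF assms(1,3), of 1]] by (simp add: sgs_def a_minus_def)

lemma cong_mod_hom:
  assumes "addhom G G f" "\<And>x. x \<in> H \<Longrightarrow> f x \<in> H" "cong_mod H x y"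
  shows "cong_mod H (f x) (f y)"
  using assms addhom_diff[OF abelian_group_axioms abelian_group_axioms assms(1), of x y]
  by (auto simp: cong_mod_def addhom_closed) metis

lemma add_diff_add:
  assumes "a \<in> carrier G" "b \<in> carrier G" "c \<in> carrier G"
  shows "(a \<oplus> c) \<ominus> (b \<oplus> c) = a \<ominus> b"
proof -
  have "(a \<oplus> c) \<ominus> (b \<oplus> c) = (a \<ominus> b) \<oplus> (c \<ominus> c)"
    using assms by (simp add: a_minus_def minus_add a_ac)
  then show ?thesis using assms by (simp add: a_minus_def r_neg)
qed

lemma neg_zero [simp]: "\<ominus> \<zero> = \<zero>"
  using minus_equality[of \<zero> \<zero>] by simp

lemma cong_mod_memI: "subgroup H (add_monoid G) \<Longrightarrow> x \<in> H \<Longrightarrow> cong_mod H x \<zero>"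
  using subgroup_carrier by (simp add: cong_mod_def a_minus_def)

lemma cong_mod_mem: "cong_mod H x \<zero> \<Longrightarrow> x \<in> H"
  by (auto simp: cong_mod_def a_minus_def)

definition acoset :: "'a set \<Rightarrow> 'a \<Rightarrow> 'a set" where
  "acoset H x = {h \<oplus> x | h. h \<in> H}"

lemma acoset_self: "subgroup H (add_monoid G) \<Longrightarrow> x \<in> carrier G \<Longrightarrow> x \<in> acoset H x"
  using subgroup_zero by (force simp: acoset_def)

lemma acoset_subset:
  assumes H: "subgroup H (add_monoid G)" and "x \<in> carrier G" "y \<in> carrier G" "x \<ominus> y \<in> H"
  shows "acoset H x \<subseteq> acoset H y"
proof
  fix z assume "z \<in> acoset H x"
  then obtain h where h: "h \<in> H" "z = h \<oplus> x" by (auto simp: acoset_def)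
  have "z = (h \<oplus> (x \<ominus> y)) \<oplus> y"
    using assms h subgroup_carrier[OF H] by (simp add: a_minus_def a_assoc l_neg)
  then show "z \<in> acoset H y" using subgroup_add[OF H h(1) assms(4)] by (auto simp: acoset_def)
qed

lemma acoset_eq:
  assumes H: "subgroup H (add_monoid G)" and c: "x \<in> carrier G" "y \<in> carrier G"
  shows "acoset H x = acoset H y \<longleftrightarrow> x \<ominus> y \<in> H"
proof
  assume "acoset H x = acoset H y"
  then obtain h where h: "h \<in> H" "x = h \<oplus> y" using acoset_self[OF H c(1)] by (auto simp: acoset_def)
  then have "x \<ominus> y = h" using c subgroup_carrier[OF H] by (simp add: a_minus_def a_assoc r_neg)
  then show "x \<ominus> y \<in> H" using h by simp
next
  assume d: "x \<ominus> y \<in> H"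
  have "y \<ominus> x \<in> H" using subgroup_neg[OF H d] c by (simp add: a_minus_def minus_add a_comm)
  then show "acoset H x = acoset H y" using acoset_subset[OF H c d] acoset_subset[OF H c(2,1)] by blast
qed

lemma acoset_add:
  assumes H: "subgroup H (add_monoid G)" and c: "x \<in> carrier G" "y \<in> carrier G"
  shows "{h \<oplus> k | h k. h \<in> acoset H x \<and> k \<in> acoset H y} = acoset H (x \<oplus> y)"
proof
  note cl = subgroup_carrier[OF H] c
  show "{h \<oplus> k | h k. h \<in> acoset H x \<and> k \<in> acoset H y} \<subseteq> acoset H (x \<oplus> y)"
  proof
    fix z assume "z \<in> {h \<oplus> k | h k. h \<in> acoset H x \<and> k \<in> acoset H y}"
    then obtain h k where h: "h \<in> H" "k \<in> H" "z = (h \<oplus> x) \<oplus> (k \<oplus> y)" by (auto simp: acoset_def)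
    then have "z = (h \<oplus> k) \<oplus> (x \<oplus> y)" using cl by (simp add: a_ac)
    then show "z \<in> acoset H (x \<oplus> y)" using subgroup_add[OF H h(1,2)] by (auto simp: acoset_def)
  qed
  show "acoset H (x \<oplus> y) \<subseteq> {h \<oplus> k | h k. h \<in> acoset H x \<and> k \<in> acoset H y}"
  proof
    fix z assume "z \<in> acoset H (x \<oplus> y)"
    then obtain h where h: "h \<in> H" "z = h \<oplus> (x \<oplus> y)" by (auto simp: acoset_def)
    then have "z = (h \<oplus> x) \<oplus> y" "h \<oplus> x \<in> acoset H x" using cl by (auto simp: a_ac acoset_def)
    then show "z \<in> {h \<oplus> k | h k. h \<in> acoset H x \<and> k \<in> acoset H y}" using acoset_self[OF H c(2)] by blast
  qed
qed

end

section \<open>The filtration of \<open>N \<otimes>\<^sub>A B\<close>\<close>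

locale lift_setup = dg_setup R A B \<phi> N + NB: based_module R B N F
  for R :: "('r, 'y) ring_scheme" and A :: "('r, 'a) dg_alg" and B :: "('r, 'b) dg_alg"
    and \<phi> :: "'a \<Rightarrow> 'b" and N :: "('b, 'n) dg_mod" and F :: "'n set"
begin

text \<open>The subgroup of \<open>N \<otimes>\<^sub>A B\<close> generated by the products of elements of N and K.  As N is free, it is
  \<open>N \<otimes>\<^sub>B K\<close> when K is a subbimodule.\<close>

inductive_set gen_sub :: "('b \<times> 'b \<Rightarrow>\<^sub>0 int) set set \<Rightarrow> ('n \<times> 'b \<Rightarrow>\<^sub>0 int) set set" for K where
  gen_sub_zero: "\<zero>\<^bsub>TN.T\<^esub> \<in> gen_sub K"
| gen_sub_step: "x \<in> carrier N \<Longrightarrow> z \<in> K \<Longrightarrow> t \<in> gen_sub K \<Longrightarrow> ndot x z \<oplus>\<^bsub>TN.T\<^esub> t \<in> gen_sub K"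

lemma diag_stableD:
  assumes "diag_stable K"
  shows "subgroup K (add_monoid TB.T)" "\<And>z. z \<in> K \<Longrightarrow> z \<in> carrier TB.T"
    "\<And>z b. z \<in> K \<Longrightarrow> b \<in> carrier B \<Longrightarrow> ract TB.T z b \<in> K"
    "\<And>z c. z \<in> K \<Longrightarrow> c \<in> carrier B \<Longrightarrow> bdot c z \<in> K"
    "\<And>z i. z \<in> K \<Longrightarrow> hpart TB.T z i \<in> K" "\<And>z. z \<in> K \<Longrightarrow> dif TB.T z \<in> K"
  using assms TB.TG.subgroup_carrier by (auto simp: diag_stable_def)

context
  fixes K assumes K: "diag_stable K"
begin

lemma gen_sub_closed: "t \<in> gen_sub K \<Longrightarrow> t \<in> carrier TN.T"
  by (induction rule: gen_sub.induct) (auto simp: ndot_closed diag_stableD[OF K])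

lemma gen_sub_ndot: "x \<in> carrier N \<Longrightarrow> z \<in> K \<Longrightarrow> ndot x z \<in> gen_sub K"
  using gen_sub_step[OF _ _ gen_sub_zero, of x z K] by (simp add: ndot_closed diag_stableD[OF K])

lemma gen_sub_add: "s \<in> gen_sub K \<Longrightarrow> t \<in> gen_sub K \<Longrightarrow> s \<oplus>\<^bsub>TN.T\<^esub> t \<in> gen_sub K"
proof (induction s rule: gen_sub.induct)
  case (gen_sub_step x z s)
  then show ?case
    using gen_sub.gen_sub_step[OF gen_sub_step(1,2) gen_sub_step(4)[OF gen_sub_step(5)]]
    by (simp add: TN.TG.a_assoc ndot_closed diag_stableD[OF K] gen_sub_closed)
qed (simp add: gen_sub_closed)

lemma gen_sub_neg: "t \<in> gen_sub K \<Longrightarrow> \<ominus>\<^bsub>TN.T\<^esub> t \<in> gen_sub K"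
proof (induction t rule: gen_sub.induct)
  case (gen_sub_step x z t)
  have "\<ominus>\<^bsub>TN.T\<^esub> ndot x z = ndot x (\<ominus>\<^bsub>TB.T\<^esub> z)"
    using addhom_minus[OF TB.T_abelian TN.T_abelian ndot_hom[OF gen_sub_step(1)]] diag_stableD(2)[OF K gen_sub_step(2)] by simp
  then show ?case
    using gen_sub_step gen_sub_ndot[OF gen_sub_step(1) TB.TG.subgroup_neg[OF diag_stableD(1)[OF K] gen_sub_step(2)]]
    by (simp add: TN.TG.minus_add ndot_closed diag_stableD[OF K] gen_sub_closed gen_sub_add)
qed (simp add: gen_sub_zero)

lemma gen_sub_subgroup: "subgroup (gen_sub K) (add_monoid TN.T)"
  using gen_sub_closed gen_sub_zero gen_sub_add gen_sub_neg by (intro TN.TG.subgroupI') auto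

text \<open>An additive map has to be followed on products x z with x homogeneous only.\<close>

lemma gen_sub_hom:
  assumes f: "addhom TN.T TN.T f" and gen: "\<And>i x z. x \<in> hcomp N i \<Longrightarrow> z \<in> K \<Longrightarrow> f (ndot x z) \<in> gen_sub K"
    and t: "t \<in> gen_sub K"
  shows "f t \<in> gen_sub K"
  using t
proof (induction t rule: gen_sub.induct)
  case gen_sub_zero
  then show ?case using addhom_zero[OF TN.T_abelian TN.T_abelian f] gen_sub.gen_sub_zero by simp
next
  case (gen_sub_step x z t)
  have z: "z \<in> carrier TB.T" using diag_stableD(2)[OF K gen_sub_step(2)] .
  have "f (ndot x z) \<in> gen_sub K"
    using gen_sub_step(1)
  proof (induction x rule: N.homog_induct)
    case (homog i y)
    then show ?case using gen gen_sub_step(2) by blast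
  next
    case (add y y')
    then show ?case
      using z by (simp add: addhom_add[OF ndot_hom_left] addhom_add[OF f] ndot_closed gen_sub_add)
  qed
  then show ?case using gen_sub_step z by (simp add: addhom_add[OF f] ndot_closed gen_sub_closed gen_sub_add)
qed

lemma gen_sub_ract: "t \<in> gen_sub K \<Longrightarrow> b \<in> carrier B \<Longrightarrow> ract TN.T t b \<in> gen_sub K"
  by (rule gen_sub_hom[OF TN.ract_T_hom])
    (auto simp: ndot_lin[symmetric] N.hcomp_closed diag_stableD[OF K] intro!: gen_sub_ndot)

lemma gen_sub_dif: "t \<in> gen_sub K \<Longrightarrow> dif TN.T t \<in> gen_sub K"
  by (rule gen_sub_hom[OF TN.dif_T_hom])
    (auto simp: ndot_dif N.hcomp_closed diag_stableD[OF K] intro!: gen_sub_add TN.TG.sgs_subgroup[OF gen_sub_subgroup] gen_sub_ndot)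

lemma hpart_ndot:
  assumes "x \<in> hcomp N i" "z \<in> carrier TB.T"
  shows "hpart TN.T (ndot x z) d = ndot x (hpart TB.T z (d - i))"
  using TB.T.hpart_map[OF TN.T_complex ndot_hom[OF N.hcomp_closed[OF assms(1)]] _ assms(2), of i "d - i"]
    ndot_degree[OF assms(1)] by (simp add: add.commute)

lemma gen_sub_hpart: "t \<in> gen_sub K \<Longrightarrow> hpart TN.T t d \<in> gen_sub K"
  by (rule gen_sub_hom[OF TN.T.hpart_hom])
    (auto simp: hpart_ndot N.hcomp_closed diag_stableD[OF K] intro!: gen_sub_ndot)

lemma gen_sub_low:
  assumes N: "\<And>i x. x \<in> hcomp N i \<Longrightarrow> i < k \<Longrightarrow> x = \<zero>\<^bsub>N\<^esub>"
    and Kl: "\<And>i z. z \<in> K \<Longrightarrow> z \<in> hcomp TB.T i \<Longrightarrow> i < l \<Longrightarrow> z = \<zero>\<^bsub>TB.T\<^esub>"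
    and t: "t \<in> gen_sub K" "t \<in> hcomp TN.T d" and d: "d < k + l"
  shows "t = \<zero>\<^bsub>TN.T\<^esub>"
proof -
  have "hpart TN.T s d = \<zero>\<^bsub>TN.T\<^esub>" if "s \<in> gen_sub K" for s
    using that
  proof (induction s rule: gen_sub.induct)
    case gen_sub_zero
    then show ?case using addhom_zero[OF TN.T_abelian TN.T_abelian TN.T.hpart_hom] by simp
  next
    case (gen_sub_step x z s)
    have z: "z \<in> carrier TB.T" using diag_stableD(2)[OF K gen_sub_step(2)] .
    have "hpart TN.T (ndot x z) d = \<zero>\<^bsub>TN.T\<^esub>"
      using gen_sub_step(1)
    proof (induction x rule: N.homog_induct)
      case (homog i y)
      show ?case
      proof (cases "i < k")
        case True
        then have "y = \<zero>\<^bsub>N\<^esub>" using N homog by blast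
        then show ?thesis
          using addhom_zero[OF N.abelian_group_axioms TN.T_abelian ndot_hom_left[OF z]]
            addhom_zero[OF TN.T_abelian TN.T_abelian TN.T.hpart_hom] by simp
      next
        case False
        then have "hpart TB.T z (d - i) = \<zero>\<^bsub>TB.T\<^esub>"
          using Kl[OF diag_stableD(5)[OF K gen_sub_step(2)] TB.T.hpart_hcomp[OF z]] d by auto
        then show ?thesis
          using addhom_zero[OF TB.T_abelian TN.T_abelian ndot_hom[OF N.hcomp_closed[OF homog]]]
          by (simp add: hpart_ndot[OF homog z])
      qed
    next
      case (add y y')
      then show ?case using z
        by (simp add: addhom_add[OF ndot_hom_left] TN.T.hpart_add ndot_closed)
    qed
    then show ?case using gen_sub_step z by (simp add: TN.T.hpart_add ndot_closed gen_sub_closed)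
  qed
  then show ?thesis using t TN.T.hpart_homog[OF t(2), of d] by simp
qed

end

lemma gen_sub_mono: "K' \<subseteq> K \<Longrightarrow> t \<in> gen_sub K' \<Longrightarrow> t \<in> gen_sub K"
  by (erule gen_sub.induct) (auto intro: gen_sub.intros)

text \<open>The tensor product \<open>N \<otimes>\<^sub>A B\<close> is free over \<open>B \<otimes>\<^sub>A B\<close> on the elements \<open>f \<otimes> 1\<close> with f in the basis of N.
  This is the coefficient of \<open>f \<otimes> 1\<close>; it detects which elements lie in \<open>gen_sub K\<close>.\<close>

definition component :: "'n \<Rightarrow> ('n \<times> 'b \<Rightarrow>\<^sub>0 int) set \<Rightarrow> ('b \<times> 'b \<Rightarrow>\<^sub>0 int) set" where
  "component f = tens_fun A NA \<phi> B BA (\<lambda>x. NB.coord x f)"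

lemma component_map: "dg_tens_map R A B \<phi> NA BA (\<lambda>x. NB.coord x f)"
  by (intro dg_tens_map.intro dg_tens_map_axioms.intro dg_ext_axioms TB.dg_tens_axioms TN.dg_tens_axioms addhomI)
    (simp_all add: NB.coord_add NB.coord_ract)

lemma component_hom: "addhom TN.T TB.T (component f)"
  unfolding component_def by (rule dg_tens_map.F_hom[OF component_map])

lemma component_pure: "x \<in> carrier N \<Longrightarrow> b \<in> carrier B \<Longrightarrow> component f (TN.tn x b) = TB.tn (NB.coord x f) b"
  unfolding component_def by (subst dg_tens_map.F_pure[OF component_map]) auto

lemma component_lin: "t \<in> carrier TN.T \<Longrightarrow> b \<in> carrier B \<Longrightarrow> component f (ract TN.T t b) = ract TB.T (component f t) b"
  unfolding component_def by (rule dg_tens_map.F_lin[OF component_map])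

lemma component_ndot: 
  assumes "x \<in> carrier N" "z \<in> carrier TB.T"
  shows "component f (ndot x z) = bdot (NB.coord x f) z"
  by (rule TB.tens_hom_eqI[OF addhom_compose[OF ndot_hom component_hom] bdot_hom])
    (use assms in \<open>auto simp: ndot_pure component_pure bdot_pure B.A.hcomp_closed N.ract_closed NB.coord_ract\<close>)

lemma component_gen_sub:
  assumes "diag_stable K" "t \<in> gen_sub K" shows "component f t \<in> K"
  using assms(2)
proof (induction t rule: gen_sub.induct)
  case gen_sub_zero
  then show ?case
    using addhom_zero[OF TN.T_abelian TB.T_abelian component_hom] TB.TG.subgroup_zero[OF diag_stableD(1)[OF assms(1)]] by simp
next
  case (gen_sub_step x z t)
  then show ?case
    using diag_stableD[OF assms(1)] gen_sub_closed[OF assms(1)] TB.TG.subgroup_add[OF diag_stableD(1)[OF assms(1)]]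
    by (simp add: addhom_add[OF component_hom] ndot_closed component_ndot)
qed

lemma bdot_one: "z \<in> carrier TB.T \<Longrightarrow> bdot \<one>\<^bsub>B\<^esub> z = z"
  by (rule TB.tens_hom_eqI[OF bdot_hom addhom_id]) (auto simp: bdot_pure B.A.hcomp_closed)

lemma bdot_zero: "z \<in> carrier TB.T \<Longrightarrow> bdot \<zero>\<^bsub>B\<^esub> z = \<zero>\<^bsub>TB.T\<^esub>"
  by (rule addhom_zero[OF B.A.abelian_group_axioms TB.T_abelian bdot_hom_left])

text \<open>Since \<open>x \<otimes> b = x b \<otimes> 1 - x (b \<otimes> 1 - 1 \<otimes> b)\<close>, every t is congruent to \<open>\<pi>\<^sub>N(t) \<otimes> 1\<close> modulo the
  products of elements of N and J.\<close>

lemma pi_mod_kernel: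
  assumes J: "diag_stable (diagonal_ideal A \<phi> B)" and t: "t \<in> carrier TN.T" "pi_mod N t = \<zero>\<^bsub>N\<^esub>"
  shows "t \<in> gen_sub (diagonal_ideal A \<phi> B)"
proof -
  let ?J = "diagonal_ideal A \<phi> B"
  note V = gen_sub_subgroup[OF J]
  have "TN.TG.cong_mod (gen_sub ?J) t (TN.tn (pi_mod N t) \<one>\<^bsub>B\<^esub>)"
    using t(1)
  proof (induction t rule: TN.tens_induct_all)
    case (pure x b)
    then have x: "x \<in> carrier N" by simp
    have "ndot x (TB.tn b \<one>\<^bsub>B\<^esub> \<ominus>\<^bsub>TB.T\<^esub> TB.tn \<one>\<^bsub>B\<^esub> b) \<in> gen_sub ?J"
      by (rule gen_sub_ndot[OF J x diagonal_mem[OF pure(2)]])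
    moreover have "ndot x (TB.tn b \<one>\<^bsub>B\<^esub> \<ominus>\<^bsub>TB.T\<^esub> TB.tn \<one>\<^bsub>B\<^esub> b) = TN.tn (ract N x b) \<one>\<^bsub>B\<^esub> \<ominus>\<^bsub>TN.T\<^esub> TN.tn x b"
      using x pure(2)
      by (subst addhom_diff[OF TB.T_abelian TN.T_abelian ndot_hom[OF x]]) (auto simp: ndot_pure N.ract_one)
    ultimately have "TN.TG.cong_mod (gen_sub ?J) (TN.tn (ract N x b) \<one>\<^bsub>B\<^esub>) (TN.tn x b)"
      using x pure(2) by (simp add: TN.TG.cong_mod_def N.ract_closed)
    then show ?case using TN.TG.cong_mod_sym[OF V] x pure(2) by (simp add: pi_mod_pure)
  next
    case (add s t)
    then show ?case
      using TN.TG.cong_mod_add[OF V add(3,4)] addhom_closed[OF pi_mod_hom] TN.tn_add_left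
      by (simp add: addhom_add[OF pi_mod_hom])
  qed
  then show ?thesis using t(2) TN.tn_zero_left[of "\<one>\<^bsub>B\<^esub>"] by (simp add: TN.TG.cong_mod_mem)
qed

lemma lin_map_add:
  assumes "dg_module B L" "lin_map B N L n f" "lin_map B N L n g"
  shows "lin_map B N L n (\<lambda>x. f x \<oplus>\<^bsub>L\<^esub> g x)"
proof -
  interpret L: dg_module B L by fact
  show ?thesis
    using assms(2,3) unfolding lin_map_def
    by (auto intro: L.addhom_add_fun L.hcomp_add simp: addhom_closed L.ract_add_left)
qed

text \<open>The differential of \<open>Hom\<^sub>B(N, N \<otimes>\<^sub>A B)\<close> on maps of degree 0, which measures the failure to be a
  chain map.\<close>

definition hom_dif :: "('n \<Rightarrow> ('n \<times> 'b \<Rightarrow>\<^sub>0 int) set) \<Rightarrow> 'n \<Rightarrow> ('n \<times> 'b \<Rightarrow>\<^sub>0 int) set" where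
  "hom_dif s x = dif TN.T (s x) \<ominus>\<^bsub>TN.T\<^esub> s (dif N x)"

lemma hom_dif_hom: "addhom N TN.T s \<Longrightarrow> addhom N TN.T (hom_dif s)"
  unfolding hom_dif_def[abs_def]
  by (intro TN.TG.addhom_diff_fun addhom_compose[OF _ TN.dif_T_hom] addhom_compose[OF N.dif_hom])

lemma hom_dif_lin_map:
  assumes s: "lin_map B N TN.T 0 s"
  shows "lin_map B N TN.T (- 1) (hom_dif s)"
  unfolding lin_map_def
proof (intro conjI ballI allI)
  note hom = hom_dif_hom[OF lin_map_hom[OF s]]
  show "addhom N TN.T (hom_dif s)" by (rule hom)
  show "hom_dif s x \<in> hcomp TN.T (i + - 1)" if "x \<in> hcomp N i" for x i
    unfolding hom_dif_def
    using TN.T.dif_degree[OF lin_map_degree[OF s that]] lin_map_degree[OF s N.dif_degree[OF that]]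
      TN.TG.subgroup_diff[OF TN.hcomp_T_subgroup] by simp
  show "hom_dif s (ract N x b) = ract TN.T (hom_dif s x) b" if x: "x \<in> carrier N" and b: "b \<in> carrier B" for x b
    using b
  proof (induction b rule: B.A.homog_induct)
    case (homog j b)
    have bc: "b \<in> carrier B" using B.A.hcomp_closed[OF homog] .
    show ?case
    proof (rule N.addhom_eqI[OF TN.T_abelian _ _ x])
      show "addhom N TN.T (\<lambda>x. hom_dif s (ract N x b))" by (rule addhom_compose[OF N.ract_hom_left[OF bc] hom])
      show "addhom N TN.T (\<lambda>x. ract TN.T (hom_dif s x) b)" by (rule addhom_compose[OF hom TN.ract_T_hom[OF bc]])
      fix i x assume x: "x \<in> hcomp N i"
      have xc: "x \<in> carrier N" using N.hcomp_closed[OF x] .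
      have l1: "dif TN.T (ract TN.T (s x) b) = ract TN.T (dif TN.T (s x)) b \<oplus>\<^bsub>TN.T\<^esub> sgs TN.T i (ract TN.T (s x) (dif B b))"
        using TN.T.leibniz_sgs[OF _ homog, of "s x" i] lin_map_degree[OF s x] bc by simp
      have l2: "s (dif N (ract N x b)) = ract TN.T (s (dif N x)) b \<oplus>\<^bsub>TN.T\<^esub> sgs TN.T i (ract TN.T (s x) (dif B b))"
        using xc bc by (simp add: N.leibniz_sgs[OF x homog] addhom_add[OF lin_map_hom[OF s]] N.ract_closed
            addhom_sgs[OF N.abelian_group_axioms TN.T_abelian lin_map_hom[OF s]] lin_map_lin[OF s])
      have "hom_dif s (ract N x b) = ract TN.T (dif TN.T (s x)) b \<ominus>\<^bsub>TN.T\<^esub> ract TN.T (s (dif N x)) b"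
        unfolding hom_dif_def l2 lin_map_lin[OF s xc bc] l1
        using xc bc lin_map_closed[OF s]
        by (intro TN.TG.add_diff_add) (simp_all add: TN.ract_T_closed)
      also have "\<dots> = ract TN.T (hom_dif s x) b"
        unfolding hom_dif_def using xc bc lin_map_closed[OF s]
        by (simp add: addhom_diff[OF TN.T_abelian TN.T_abelian TN.ract_T_hom])
      finally show "hom_dif s (ract N x b) = ract TN.T (hom_dif s x) b" .
    qed
  next
    case (add b c)
    then show ?case using x addhom_closed[OF hom]
      by (simp add: N.ract_add_right addhom_add[OF hom] N.ract_closed TN.T.ract_add_right)
  qed
qed

lemma hom_dif_anticomm:
  assumes s: "lin_map B N TN.T 0 s" and x: "x \<in> carrier N"
  shows "dif TN.T (hom_dif s x) = \<ominus>\<^bsub>TN.T\<^esub> hom_dif s (dif N x)"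
proof -
  have "dif TN.T (hom_dif s x) = \<zero>\<^bsub>TN.T\<^esub> \<ominus>\<^bsub>TN.T\<^esub> dif TN.T (s (dif N x))"
    unfolding hom_dif_def using x lin_map_closed[OF s]
    by (simp add: addhom_diff[OF TN.T_abelian TN.T_abelian TN.dif_T_hom] TN.T.dif_dif)
  moreover have "hom_dif s (dif N x) = dif TN.T (s (dif N x)) \<ominus>\<^bsub>TN.T\<^esub> \<zero>\<^bsub>TN.T\<^esub>"
    unfolding hom_dif_def using x addhom_zero[OF N.abelian_group_axioms TN.T_abelian lin_map_hom[OF s]] by (simp add: N.dif_dif)
  ultimately show ?thesis using x lin_map_closed[OF s] by (simp add: a_minus_def)
qed

section \<open>Removing the obstruction step by step\<close>

text \<open>Every cocycle of degree \<open>-1\<close> with values in V is cohomologous, through maps with values in V,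
  to a cocycle with values in V'.\<close>

definition cocycles_reduce where
  "cocycles_reduce V V' \<longleftrightarrow> (\<forall>th. lin_map B N TN.T (- 1) th \<and> (\<forall>x\<in>carrier N. th x \<in> V)
      \<and> (\<forall>x\<in>carrier N. dif TN.T (th x) = \<ominus>\<^bsub>TN.T\<^esub> th (dif N x))
    \<longrightarrow> (\<exists>s. lin_map B N TN.T 0 s \<and> (\<forall>x\<in>carrier N. s x \<in> V) \<and> (\<forall>x\<in>carrier N. th x \<ominus>\<^bsub>TN.T\<^esub> hom_dif s x \<in> V')))"

lemma cocycles_reduceE:
  assumes "cocycles_reduce V V'" "lin_map B N TN.T (- 1) th" "\<And>x. x \<in> carrier N \<Longrightarrow> th x \<in> V"
    "\<And>x. x \<in> carrier N \<Longrightarrow> dif TN.T (th x) = \<ominus>\<^bsub>TN.T\<^esub> th (dif N x)"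
  obtains s where "lin_map B N TN.T 0 s" "\<forall>x\<in>carrier N. s x \<in> V"
    "\<forall>x\<in>carrier N. th x \<ominus>\<^bsub>TN.T\<^esub> hom_dif s x \<in> V'"
  using assms(1)[unfolded cocycles_reduce_def, THEN spec[of _ th]] assms(2-4) that by blast

lemma cocycles_reduceI:
  assumes "\<And>th. lin_map B N TN.T (- 1) th \<Longrightarrow> (\<And>x. x \<in> carrier N \<Longrightarrow> th x \<in> V) \<Longrightarrow>
    (\<And>x. x \<in> carrier N \<Longrightarrow> dif TN.T (th x) = \<ominus>\<^bsub>TN.T\<^esub> th (dif N x)) \<Longrightarrow>
    \<exists>s. lin_map B N TN.T 0 s \<and> (\<forall>x\<in>carrier N. s x \<in> V) \<and> (\<forall>x\<in>carrier N. th x \<ominus>\<^bsub>TN.T\<^esub> hom_dif s x \<in> V')"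
  shows "cocycles_reduce V V'"
  unfolding cocycles_reduce_def using assms by simp

lemma cocycles_reduce_refl:
  assumes V: "subgroup V (add_monoid TN.T)"
  shows "cocycles_reduce V V"
  unfolding cocycles_reduce_def
proof (intro allI impI, elim conjE)
  fix th assume th: "lin_map B N TN.T (- 1) th" "\<forall>x\<in>carrier N. th x \<in> V"
  have z: "lin_map B N TN.T 0 (\<lambda>x. \<zero>\<^bsub>TN.T\<^esub>)"
    using addhom_zero[OF TN.T_abelian TN.T_abelian TN.ract_T_hom] by (auto simp: lin_map_def intro!: addhomI)
  have "hom_dif (\<lambda>x. \<zero>\<^bsub>TN.T\<^esub>) x = \<zero>\<^bsub>TN.T\<^esub>" for x
    using addhom_zero[OF TN.T_abelian TN.T_abelian TN.dif_T_hom] by (simp add: hom_dif_def a_minus_def)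
  then show "\<exists>s. lin_map B N TN.T 0 s \<and> (\<forall>x\<in>carrier N. s x \<in> V) \<and> (\<forall>x\<in>carrier N. th x \<ominus>\<^bsub>TN.T\<^esub> hom_dif s x \<in> V)"
    using z th TN.TG.subgroup_zero[OF V] TN.TG.subgroup_carrier[OF V]
    by (intro exI[of _ "\<lambda>x. \<zero>\<^bsub>TN.T\<^esub>"]) (auto simp: a_minus_def)
qed

lemma hom_dif_add:
  assumes "lin_map B N TN.T 0 s" "lin_map B N TN.T 0 t" "x \<in> carrier N"
  shows "hom_dif (\<lambda>x. s x \<oplus>\<^bsub>TN.T\<^esub> t x) x = hom_dif s x \<oplus>\<^bsub>TN.T\<^esub> hom_dif t x"
  using assms(3) lin_map_closed[OF assms(1)] lin_map_closed[OF assms(2)]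
  by (simp add: hom_dif_def addhom_add[OF TN.dif_T_hom] a_minus_def TN.TG.minus_add TN.TG.a_ac)

lemma cocycles_reduce_trans:
  assumes V: "subgroup V (add_monoid TN.T)" and sub: "V' \<subseteq> V" and c1: "cocycles_reduce V V'" and c2: "cocycles_reduce V' V''"
  shows "cocycles_reduce V V''"
  unfolding cocycles_reduce_def
proof (intro allI impI, elim conjE)
  fix th assume th: "lin_map B N TN.T (- 1) th" "\<forall>x\<in>carrier N. th x \<in> V"
    "\<forall>x\<in>carrier N. dif TN.T (th x) = \<ominus>\<^bsub>TN.T\<^esub> th (dif N x)"
  then obtain s where s: "lin_map B N TN.T 0 s" "\<forall>x\<in>carrier N. s x \<in> V"
    "\<forall>x\<in>carrier N. th x \<ominus>\<^bsub>TN.T\<^esub> hom_dif s x \<in> V'"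
    using cocycles_reduceE[OF c1 th(1)] by blast
  let ?th = "\<lambda>x. th x \<ominus>\<^bsub>TN.T\<^esub> hom_dif s x"
  note D = hom_dif_lin_map[OF s(1)]
  have g: "lin_map B N TN.T (- 1) ?th" by (rule lin_map_diff[OF TN.T_module th(1) D])
  have "dif TN.T (?th x) = \<ominus>\<^bsub>TN.T\<^esub> ?th (dif N x)" if "x \<in> carrier N" for x
    using that th(3) lin_map_closed[OF th(1)] lin_map_closed[OF D]
    by (simp add: addhom_diff[OF TN.T_abelian TN.T_abelian TN.dif_T_hom] hom_dif_anticomm[OF s(1)])
      (simp add: a_minus_def TN.TG.minus_add)
  then obtain t where t: "lin_map B N TN.T 0 t" "\<forall>x\<in>carrier N. t x \<in> V'"
    "\<forall>x\<in>carrier N. ?th x \<ominus>\<^bsub>TN.T\<^esub> hom_dif t x \<in> V''"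
    using cocycles_reduceE[OF c2 g] s(3) by blast
  have "th x \<ominus>\<^bsub>TN.T\<^esub> hom_dif (\<lambda>x. s x \<oplus>\<^bsub>TN.T\<^esub> t x) x \<in> V''" if "x \<in> carrier N" for x
  proof -
    have "th x \<ominus>\<^bsub>TN.T\<^esub> hom_dif (\<lambda>x. s x \<oplus>\<^bsub>TN.T\<^esub> t x) x = ?th x \<ominus>\<^bsub>TN.T\<^esub> hom_dif t x"
      using that lin_map_closed[OF th(1)] lin_map_closed[OF D] lin_map_closed[OF hom_dif_lin_map[OF t(1)]]
      by (simp add: hom_dif_add[OF s(1) t(1)] a_minus_def TN.TG.minus_add TN.TG.a_assoc)
    then show ?thesis using t(3) that by simp
  qed
  moreover have "\<forall>x\<in>carrier N. s x \<oplus>\<^bsub>TN.T\<^esub> t x \<in> V"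
    using s(2) t(2) sub TN.TG.subgroup_add[OF V] by blast
  ultimately show "\<exists>s. lin_map B N TN.T 0 s \<and> (\<forall>x\<in>carrier N. s x \<in> V) \<and> (\<forall>x\<in>carrier N. th x \<ominus>\<^bsub>TN.T\<^esub> hom_dif s x \<in> V'')"
    using lin_map_add[OF TN.T_module s(1) t(1)] by (intro exI[of _ "\<lambda>x. s x \<oplus>\<^bsub>TN.T\<^esub> t x"]) blast
qed

end

lemma sgs_parity: "even m = even k \<Longrightarrow> sgs M m x = sgs M k x"
  by (simp add: sgs_def)

context based_module
begin

lemma based_induct [consumes 1, case_names zero gen add]:
  assumes x: "x \<in> carrier N" and zero: "P \<zero>\<^bsub>N\<^esub>"
    and gen: "\<And>f j c. f \<in> F \<Longrightarrow> c \<in> hcomp B j \<Longrightarrow> P (ract N f c)"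
    and add: "\<And>y z. y \<in> carrier N \<Longrightarrow> z \<in> carrier N \<Longrightarrow> P y \<Longrightarrow> P z \<Longrightarrow> P (y \<oplus>\<^bsub>N\<^esub> z)"
  shows "P x"
proof -
  note S = csupp[OF x]
  have gen': "P (ract N f c)" if f: "f \<in> F" and c: "c \<in> carrier B" for f c
    using c
  proof (induction c rule: B.A.homog_induct)
    case (homog i c)
    then show ?case using gen f by blast
  next
    case (add c d)
    then show ?case
      using basis_closed[OF f] assms(4) by (simp add: N.ract_add_right N.ract_closed)
  qed
  have "P (\<Oplus>\<^bsub>N\<^esub>f\<in>S. ract N f (coord x f))" if "finite S" "S \<subseteq> F" for S
    using that
  proof (induction S rule: finite_induct)
    case empty
    then show ?case using zero by simp
  next
    case (insert a S)
    then have cl: "(\<lambda>f. ract N f (coord x f)) \<in> S \<rightarrow> carrier N" "ract N a (coord x a) \<in> carrier N"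
      using x basis_closed by (auto intro!: N.ract_closed)
    then have "(\<Oplus>\<^bsub>N\<^esub>f\<in>insert a S. ract N f (coord x f)) = ract N a (coord x a) \<oplus>\<^bsub>N\<^esub> (\<Oplus>\<^bsub>N\<^esub>f\<in>S. ract N f (coord x f))"
      using insert by (intro N.finsum_insert) auto
    then show ?case using insert x cl by (auto intro!: add gen')
  qed
  from this[OF S] show ?thesis using coord_sum[OF x S(1) order_refl S(2)] by simp
qed

end

context lift_setup
begin

definition ntwist :: "int \<Rightarrow> 'n \<Rightarrow> 'n" where
  "ntwist n x = (if even n then x else twist N x)"

lemma ntwist_hom: "addhom N N (ntwist n)"
  using addhom_id[of N] N.twist_hom by (cases "even n") (auto simp: ntwist_def[abs_def])

lemma ntwist_homog: "x \<in> hcomp N i \<Longrightarrow> ntwist n x = sgs N (n * i) x"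
  by (auto simp: ntwist_def N.twist_homog sgs_def)

lemma ntwist_closed: "x \<in> carrier N \<Longrightarrow> ntwist n x \<in> carrier N"
  using addhom_closed[OF ntwist_hom] .

text \<open>One step of the refined filtration: K/K' is free of rank one over B on the class of a homogeneous
  element e of degree n.  Then \<open>N \<otimes>\<^sub>B K/K'\<close> is a copy of N shifted by n.\<close>

context
  fixes K K' :: "('b \<times> 'b \<Rightarrow>\<^sub>0 int) set set" and e :: "('b \<times> 'b \<Rightarrow>\<^sub>0 int) set" and n :: int
  assumes K: "diag_stable K" and K': "diag_stable K'" and sub: "K' \<subseteq> K" and e: "e \<in> K" "e \<in> hcomp TB.T n"
    and gen: "\<And>z. z \<in> K \<Longrightarrow> \<exists>b\<in>carrier B. z \<ominus>\<^bsub>TB.T\<^esub> ract TB.T e b \<in> K'"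
    and free: "\<And>b. b \<in> carrier B \<Longrightarrow> ract TB.T e b \<in> K' \<Longrightarrow> b = \<zero>\<^bsub>B\<^esub>"
    and de: "dif TB.T e \<in> K'"
    and comm: "\<And>c i. c \<in> hcomp B i \<Longrightarrow> bdot c e \<ominus>\<^bsub>TB.T\<^esub> sgs TB.T (i * n) (ract TB.T e c) \<in> K'"
begin

abbreviation (input) "V' \<equiv> gen_sub K'"
abbreviation (input) "eqv \<equiv> TN.TG.cong_mod V'"

lemmas V' = gen_sub_subgroup[OF K']
lemmas eqv_trans = TN.TG.cong_mod_trans[OF V']
lemmas eqv_sym = TN.TG.cong_mod_sym[OF V']

text \<open>The identification of the shifted N with \<open>N \<otimes>\<^sub>B K/K'\<close> sends a homogeneous x to \<open>(-1)\<^bsup>n|x|\<^esup> x e\<close>, with the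
  sign that makes it linear over B acting from the right. It is lifted to a map that is linear on the
  nose, by prescribing it on the basis only.\<close>

definition eps :: "'n \<Rightarrow> ('n \<times> 'b \<Rightarrow>\<^sub>0 int) set" where
  "eps = NB.lin_ext TN.T (\<lambda>f. sgs TN.T (n * NB.bdeg f) (ndot f e))"

lemma ec: "e \<in> carrier TB.T" using TB.T.hcomp_closed[OF e(2)] .

lemma eps_ok: "f \<in> F \<Longrightarrow> sgs TN.T (n * NB.bdeg f) (ndot f e) \<in> hcomp TN.T (NB.bdeg f + n)"
  using TN.T.hcomp_sgs[OF ndot_degree[OF NB.basis_homog e(2)]] .

lemma eps_lin_map: "lin_map B N TN.T n eps"
  unfolding eps_def by (rule NB.lin_ext_lin_map[OF TN.T_module eps_ok])

lemmas eps_hom = lin_map_hom[OF eps_lin_map]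
lemmas eps_closed = lin_map_closed[OF eps_lin_map]

lemma eps_gen: "f \<in> F \<Longrightarrow> c \<in> carrier B \<Longrightarrow> eps (ract N f c) = sgs TN.T (n * NB.bdeg f) (ract TN.T (ndot f e) c)"
  using NB.lin_ext_basis[OF TN.T_module eps_ok] NB.basis_closed[of f] lin_map_lin[OF eps_lin_map, of f c] ec
  by (simp add: eps_def addhom_sgs[OF TN.T_abelian TN.T_abelian TN.ract_T_hom] ndot_closed)

lemma eps_sgs: "x \<in> carrier N \<Longrightarrow> eps (sgs N m x) = sgs TN.T m (eps x)"
  using addhom_sgs[OF N.abelian_group_axioms TN.T_abelian eps_hom] .

lemma eqv_ndot: "x \<in> carrier N \<Longrightarrow> TB.TG.cong_mod K' z w \<Longrightarrow> eqv (ndot x z) (ndot x w)"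
  using gen_sub_ndot[OF K'] by (auto simp: TB.TG.cong_mod_def TN.TG.cong_mod_def ndot_closed
     addhom_diff[OF TB.T_abelian TN.T_abelian ndot_hom, symmetric])

lemma eqv_ract: "c \<in> carrier B \<Longrightarrow> eqv s t \<Longrightarrow> eqv (ract TN.T s c) (ract TN.T t c)"
  by (rule TN.TG.cong_mod_hom[OF TN.ract_T_hom]) (auto intro: gen_sub_ract[OF K'])

lemma eqv_dif: "eqv s t \<Longrightarrow> eqv (dif TN.T s) (dif TN.T t)"
  by (rule TN.TG.cong_mod_hom[OF TN.dif_T_hom]) (auto intro: gen_sub_dif[OF K'])

lemma ndot_eps: "x \<in> carrier N \<Longrightarrow> eqv (ndot x e) (eps (ntwist n x))"
proof (induction x rule: NB.based_induct)
  case zero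
  have "ndot \<zero>\<^bsub>N\<^esub> e = \<zero>\<^bsub>TN.T\<^esub>" by (rule addhom_zero[OF N.abelian_group_axioms TN.T_abelian ndot_hom_left[OF ec]])
  moreover have "eps (ntwist n \<zero>\<^bsub>N\<^esub>) = \<zero>\<^bsub>TN.T\<^esub>"
    using addhom_zero[OF N.abelian_group_axioms TN.T_abelian addhom_compose[OF ntwist_hom eps_hom]] .
  ultimately show ?case using TN.TG.cong_mod_refl[OF V'] by simp
next
  case (gen f j c)
  have fc: "f \<in> carrier N" and cc: "c \<in> carrier B" using NB.basis_closed[OF gen(1)] B.A.hcomp_closed[OF gen(2)] .
  have "TB.TG.cong_mod K' (bdot c e) (sgs TB.T (j * n) (ract TB.T e c))"
    using comm[OF gen(2)] bdot_closed[OF cc ec] TB.ract_T_closed[OF ec cc] by (simp add: TB.TG.cong_mod_def)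
  then have "eqv (ndot f (bdot c e)) (ndot f (sgs TB.T (j * n) (ract TB.T e c)))" by (rule eqv_ndot[OF fc])
  moreover have "ndot f (sgs TB.T (j * n) (ract TB.T e c)) = sgs TN.T (j * n) (ract TN.T (ndot f e) c)"
    using addhom_sgs[OF TB.T_abelian TN.T_abelian ndot_hom[OF fc] TB.ract_T_closed[OF ec cc]] ndot_lin[OF fc ec cc] by simp
  moreover have "eps (ntwist n (ract N f c)) = sgs TN.T (j * n) (ract TN.T (ndot f e) c)"
  proof -
    have "eps (ntwist n (ract N f c)) = sgs TN.T (n * (NB.bdeg f + j)) (sgs TN.T (n * NB.bdeg f) (ract TN.T (ndot f e) c))"
      using fc cc gen by (simp add: ntwist_homog[OF N.ract_degree[OF NB.basis_homog[OF gen(1)] gen(2)]]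
        eps_sgs N.ract_closed eps_gen)
    also have "\<dots> = sgs TN.T (n * (NB.bdeg f + j) + n * NB.bdeg f) (ract TN.T (ndot f e) c)"
      using fc cc ec by (simp add: TN.TG.sgs_sgs ndot_closed TN.ract_T_closed)
    also have "\<dots> = sgs TN.T (j * n) (ract TN.T (ndot f e) c)" by (rule sgs_parity) auto
    finally show ?thesis .
  qed
  moreover have "ndot (ract N f c) e = ndot f (bdot c e)" by (rule ndot_bdot[OF fc cc ec])
  ultimately show ?case by simp
next
  case (add y z)
  then show ?case using TN.TG.cong_mod_add[OF V' add(3,4)]
    by (simp add: addhom_add[OF ndot_hom_left[OF ec]] addhom_add[OF addhom_compose[OF ntwist_hom eps_hom]])
qed

lemma eps_generates:
  assumes "t \<in> gen_sub K" shows "\<exists>y\<in>carrier N. eqv t (eps y)"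
  using assms
proof (induction t rule: gen_sub.induct)
  case gen_sub_zero
  have "eps \<zero>\<^bsub>N\<^esub> = \<zero>\<^bsub>TN.T\<^esub>" by (rule addhom_zero[OF N.abelian_group_axioms TN.T_abelian eps_hom])
  then show ?case using TN.TG.cong_mod_refl[OF V' TN.TG.zero_closed] by (intro bexI[of _ "\<zero>\<^bsub>N\<^esub>"]) auto
next
  case (gen_sub_step x z t)
  obtain y where y: "y \<in> carrier N" "eqv t (eps y)" using gen_sub_step(4) by blast
  have zc: "z \<in> carrier TB.T" using diag_stableD(2)[OF K gen_sub_step(2)] .
  obtain b where b: "b \<in> carrier B" "z \<ominus>\<^bsub>TB.T\<^esub> ract TB.T e b \<in> K'" using gen[OF gen_sub_step(2)] by blast
  have "TB.TG.cong_mod K' z (ract TB.T e b)" using b zc TB.ract_T_closed[OF ec] by (simp add: TB.TG.cong_mod_def)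
  then have "eqv (ndot x z) (ndot x (ract TB.T e b))" by (rule eqv_ndot[OF gen_sub_step(1)])
  also have "ndot x (ract TB.T e b) = ract TN.T (ndot x e) b" by (rule ndot_lin[OF gen_sub_step(1) ec b(1)])
  finally have 1: "eqv (ndot x z) (ract TN.T (ndot x e) b)" .
  have "eqv (ract TN.T (ndot x e) b) (ract TN.T (eps (ntwist n x)) b)"
    by (rule eqv_ract[OF b(1) ndot_eps[OF gen_sub_step(1)]])
  also have "ract TN.T (eps (ntwist n x)) b = eps (ract N (ntwist n x) b)"
    using lin_map_lin[OF eps_lin_map ntwist_closed[OF gen_sub_step(1)] b(1)] by simp
  finally have "eqv (ndot x z) (eps (ract N (ntwist n x) b))" by (rule eqv_trans[OF 1])
  then have "eqv (ndot x z \<oplus>\<^bsub>TN.T\<^esub> t) (eps (ract N (ntwist n x) b) \<oplus>\<^bsub>TN.T\<^esub> eps y)"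
    by (rule TN.TG.cong_mod_add[OF V' _ y(2)])
  also have "eps (ract N (ntwist n x) b) \<oplus>\<^bsub>TN.T\<^esub> eps y = eps (ract N (ntwist n x) b \<oplus>\<^bsub>N\<^esub> y)"
    using addhom_add[OF eps_hom] N.ract_closed[OF ntwist_closed[OF gen_sub_step(1)] b(1)] y by simp
  finally show ?case
    using N.ract_closed[OF ntwist_closed[OF gen_sub_step(1)] b(1)] y(1) by blast
qed

lemma component_eps:
  assumes x: "x \<in> carrier N" and f: "f \<in> F"
  shows "component f (eps x) = sgs TB.T (n * NB.bdeg f) (ract TB.T e (NB.coord x f))"
  using x
proof (induction x rule: NB.based_induct)
  case zero
  have "component f (eps \<zero>\<^bsub>N\<^esub>) = \<zero>\<^bsub>TB.T\<^esub>"
    by (rule addhom_zero[OF N.abelian_group_axioms TB.T_abelian addhom_compose[OF eps_hom component_hom]])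
  moreover have "NB.coord \<zero>\<^bsub>N\<^esub> f = \<zero>\<^bsub>B\<^esub>"
    by (rule addhom_zero[OF N.abelian_group_axioms B.A.abelian_group_axioms NB.coord_hom])
  moreover have "ract TB.T e \<zero>\<^bsub>B\<^esub> = \<zero>\<^bsub>TB.T\<^esub>"
    by (rule addhom_zero[OF B.A.abelian_group_axioms TB.T_abelian TB.T.ract_hom_right[OF ec]])
  ultimately show ?case by simp
next
  case (gen g j c)
  have gc: "g \<in> carrier N" and cc: "c \<in> carrier B" using NB.basis_closed[OF gen(1)] B.A.hcomp_closed[OF gen(2)] .
  have z: "ract TB.T e \<zero>\<^bsub>B\<^esub> = \<zero>\<^bsub>TB.T\<^esub>"
    by (rule addhom_zero[OF B.A.abelian_group_axioms TB.T_abelian TB.T.ract_hom_right[OF ec]])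
  have z': "ract TB.T \<zero>\<^bsub>TB.T\<^esub> c = \<zero>\<^bsub>TB.T\<^esub>"
    by (rule addhom_zero[OF TB.T_abelian TB.T_abelian TB.ract_T_hom[OF cc]])
  have "component f (eps (ract N g c)) = sgs TB.T (n * NB.bdeg g) (ract TB.T (bdot (NB.coord g f) e) c)"
    using gen gc cc ec
    by (simp add: eps_gen addhom_sgs[OF TN.T_abelian TB.T_abelian component_hom] TN.ract_T_closed ndot_closed component_lin component_ndot)
  also have "\<dots> = sgs TB.T (n * NB.bdeg f) (ract TB.T e (NB.coord (ract N g c) f))"
    using gen gc cc ec
    by (cases "f = g") (auto simp: NB.coord_basis NB.coord_ract bdot_one bdot_zero z z')
  finally show ?case .
next
  case (add y z)
  then show ?case
    using ec by (simp add: addhom_add[OF addhom_compose[OF eps_hom component_hom]] NB.coord_add TB.T.ract_add_right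
      TB.TG.sgs_add TB.ract_T_closed)
qed

text \<open>The component of \<open>eps x\<close> along f is, up to sign, e times the coordinate of x along f.\<close>

lemma eps_inj:
  assumes "x \<in> carrier N" "eps x \<in> V'"
  shows "x = \<zero>\<^bsub>N\<^esub>"
proof -
  have "NB.coord x f = \<zero>\<^bsub>B\<^esub>" if f: "f \<in> F" for f
  proof -
    have "sgs TB.T (n * NB.bdeg f) (ract TB.T e (NB.coord x f)) \<in> K'"
      using component_gen_sub[OF K' assms(2), of f] component_eps[OF assms(1) f] by simp
    then have "sgs TB.T (n * NB.bdeg f) (sgs TB.T (n * NB.bdeg f) (ract TB.T e (NB.coord x f))) \<in> K'"
      by (rule TB.TG.sgs_subgroup[OF diag_stableD(1)[OF K']])
    also have "sgs TB.T (n * NB.bdeg f) (sgs TB.T (n * NB.bdeg f) (ract TB.T e (NB.coord x f))) = ract TB.T e (NB.coord x f)"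
      using ec assms(1) by (simp add: TB.TG.sgs_sgs TB.ract_T_closed) (simp add: sgs_def)
    finally show ?thesis using free assms(1) by simp
  qed
  then have "NB.csupp x = {}" using NB.csupp(2)[OF assms(1)] unfolding NB.csupp_def by blast
  then show ?thesis using NB.coord_sum[OF assms(1), of "{}"] by simp
qed

lemma eps_inj2:
  assumes "x \<in> carrier N" "y \<in> carrier N" "eqv (eps x) (eps y)"
  shows "x = y"
proof -
  have "eps (x \<ominus>\<^bsub>N\<^esub> y) \<in> V'"
    using assms by (simp add: addhom_diff[OF N.abelian_group_axioms TN.T_abelian eps_hom] TN.TG.cong_mod_def)
  then have "x \<ominus>\<^bsub>N\<^esub> y = \<zero>\<^bsub>N\<^esub>" by (intro eps_inj) (simp_all add: assms)
  then show ?thesis by (rule N.minus_eq_zeroD[OF assms(1,2)])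
qed

text \<open>By the Leibniz rule \<open>d(x e)\<close> is \<open>(d x) e\<close> up to \<open>x (d e)\<close>, and \<open>d e\<close> lies in K'.\<close>

lemma eps_dif: "x \<in> carrier N \<Longrightarrow> eqv (dif TN.T (eps x)) (sgs TN.T n (eps (dif N x)))"
proof (induction x rule: N.homog_induct)
  case (homog i x)
  have xc: "x \<in> carrier N" using N.hcomp_closed[OF homog] .
  have ndot_eps': "eqv (ndot y e) (sgs TN.T (n * j) (eps y))" if "y \<in> hcomp N j" for y j
    using ndot_eps[OF N.hcomp_closed[OF that]] N.hcomp_closed[OF that] by (simp add: ntwist_homog[OF that] eps_sgs)
  have "eqv (sgs TN.T (n * i) (sgs TN.T (n * i) (eps x))) (sgs TN.T (n * i) (ndot x e))"
    by (rule TN.TG.cong_mod_sgs[OF V' eqv_sym[OF ndot_eps'[OF homog]]])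
  moreover have "sgs TN.T (n * i) (sgs TN.T (n * i) (eps x)) = eps x"
    using eps_closed[OF xc] by (simp add: TN.TG.sgs_sgs) (simp add: sgs_def)
  ultimately have "eqv (eps x) (sgs TN.T (n * i) (ndot x e))" by simp
  then have "eqv (dif TN.T (eps x)) (dif TN.T (sgs TN.T (n * i) (ndot x e)))" by (rule eqv_dif)
  moreover have "dif TN.T (sgs TN.T (n * i) (ndot x e)) = sgs TN.T (n * i) (dif TN.T (ndot x e))"
    by (rule addhom_sgs[OF TN.T_abelian TN.T_abelian TN.dif_T_hom ndot_closed[OF xc ec]])
  moreover have "eqv (dif TN.T (ndot x e)) (sgs TN.T (n * (i - 1)) (eps (dif N x)))"
  proof -
    have "eqv (sgs TN.T i (ndot x (dif TB.T e))) \<zero>\<^bsub>TN.T\<^esub>"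
      by (rule TN.TG.cong_mod_memI[OF V' TN.TG.sgs_subgroup[OF V' gen_sub_ndot[OF K' xc de]]])
    then have "eqv (ndot (dif N x) e \<oplus>\<^bsub>TN.T\<^esub> sgs TN.T i (ndot x (dif TB.T e)))
        (sgs TN.T (n * (i - 1)) (eps (dif N x)) \<oplus>\<^bsub>TN.T\<^esub> \<zero>\<^bsub>TN.T\<^esub>)"
      by (rule TN.TG.cong_mod_add[OF V' ndot_eps'[OF N.dif_degree[OF homog]]])
    then show ?thesis using eps_closed[OF N.dif_closed[OF xc]] by (simp add: ndot_dif[OF homog ec])
  qed
  ultimately have "eqv (dif TN.T (eps x)) (sgs TN.T (n * i) (sgs TN.T (n * (i - 1)) (eps (dif N x))))"
    using eqv_trans TN.TG.cong_mod_sgs[OF V'] by metis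
  moreover have "sgs TN.T (n * i) (sgs TN.T (n * (i - 1)) (eps (dif N x))) = sgs TN.T n (eps (dif N x))"
  proof -
    have "sgs TN.T (n * i) (sgs TN.T (n * (i - 1)) (eps (dif N x))) = sgs TN.T (n * i + n * (i - 1)) (eps (dif N x))"
      using eps_closed[OF N.dif_closed[OF xc]] by (simp add: TN.TG.sgs_sgs)
    also have "\<dots> = sgs TN.T n (eps (dif N x))" by (rule sgs_parity) auto
    finally show ?thesis .
  qed
  ultimately show ?case by simp
next
  case (add y z)
  then show ?case using TN.TG.cong_mod_add[OF V' add(3,4)] eps_closed
    by (simp add: addhom_add[OF addhom_compose[OF eps_hom TN.dif_T_hom]]
       addhom_add[OF addhom_compose[OF N.dif_hom eps_hom]] TN.TG.sgs_add)
qed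

text \<open>Modulo \<open>N \<otimes>\<^sub>B K'\<close>, a cocycle with values in \<open>N \<otimes>\<^sub>B K\<close> is \<open>eps \<circ> psi\<close> for a unique psi, and psi is a
  cocycle of degree \<open>-(n + 1)\<close> in \<open>Hom\<^sub>B(N, N)\<close>.  The vanishing of \<open>Ext\<^sup>n\<^sup>+\<^sup>1(N, N)\<close> makes psi the
  boundary of some chi, and the cocycle is then the boundary of \<open>\<plusminus> eps \<circ> chi\<close> modulo \<open>N \<otimes>\<^sub>B K'\<close>.\<close>

lemma cocycles_reduce_step:
  assumes ext: "trivial_group (Ext B (n + 1) N N)"
  shows "cocycles_reduce (gen_sub K) V'"
proof (rule cocycles_reduceI)
  fix th assume th: "lin_map B N TN.T (- 1) th" and thV: "\<And>x. x \<in> carrier N \<Longrightarrow> th x \<in> gen_sub K"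
    and dth: "\<And>x. x \<in> carrier N \<Longrightarrow> dif TN.T (th x) = \<ominus>\<^bsub>TN.T\<^esub> th (dif N x)"
  note thc = lin_map_closed[OF th]
  define psi where "psi x = (SOME y. y \<in> carrier N \<and> eqv (th x) (eps y))" for x
  have psi: "psi x \<in> carrier N" "eqv (th x) (eps (psi x))" if "x \<in> carrier N" for x
    using someI_ex[of "\<lambda>y. y \<in> carrier N \<and> eqv (th x) (eps y)"] eps_generates[OF thV[OF that]]
    unfolding psi_def by blast+
  have psi_eq: "psi x = y" if "x \<in> carrier N" "y \<in> carrier N" "eqv (th x) (eps y)" for x y
    by (rule eps_inj2[OF psi(1)[OF that(1)] that(2) eqv_trans[OF eqv_sym[OF psi(2)[OF that(1)]] that(3)]])
  have psi_lin_map: "lin_map B N N (- (n + 1)) psi"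
    unfolding lin_map_def
  proof (intro conjI ballI allI)
    show "addhom N N psi"
    proof (rule addhomI)
      fix x y assume xy: "x \<in> carrier N" "y \<in> carrier N"
      show "psi (x \<oplus>\<^bsub>N\<^esub> y) = psi x \<oplus>\<^bsub>N\<^esub> psi y"
        using TN.TG.cong_mod_add[OF V' psi(2)[OF xy(1)] psi(2)[OF xy(2)]] xy psi(1)
        by (intro psi_eq) (auto simp: addhom_add[OF lin_map_hom[OF th]] addhom_add[OF eps_hom])
    qed (rule psi(1))
    show "psi (ract N x b) = ract N (psi x) b" if "x \<in> carrier N" "b \<in> carrier B" for x b
      using eqv_ract[OF that(2) psi(2)[OF that(1)]] that psi(1)
      by (intro psi_eq) (auto simp: lin_map_lin[OF th] lin_map_lin[OF eps_lin_map] N.ract_closed)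
    show "psi x \<in> hcomp N (i + - (n + 1))" if x: "x \<in> hcomp N i" for x i
    proof -
      have xc: "x \<in> carrier N" using N.hcomp_closed[OF x] .
      let ?y = "hpart N (psi x) (i - 1 - n)"
      have yc: "?y \<in> carrier N" using psi(1)[OF xc] by simp
      have "hpart TN.T (eps (psi x)) ((i - 1 - n) + n) = eps ?y"
        by (rule N.hpart_map[OF TN.T_complex eps_hom lin_map_degree[OF eps_lin_map] psi(1)[OF xc]])
      moreover have "hpart TN.T (th x) (i - 1) = th x"
        using TN.T.hpart_homog[OF lin_map_degree[OF th x]] by simp
      moreover have "eqv (hpart TN.T (th x) (i - 1)) (hpart TN.T (eps (psi x)) (i - 1))"
        by (rule TN.TG.cong_mod_hom[OF TN.T.hpart_hom gen_sub_hpart[OF K'] psi(2)[OF xc]])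
      ultimately have "psi x = ?y" using psi_eq[OF xc yc] by simp
      then show ?thesis using N.hpart_hcomp[OF psi(1)[OF xc], of "i - 1 - n"] by (simp add: algebra_simps)
    qed
  qed
  have cycle: "dif N (psi x) = sgs N (n + 1) (psi (dif N x))" if x: "x \<in> carrier N" for x
  proof (rule eps_inj2)
    have dx: "dif N x \<in> carrier N" using x by simp
    show c1: "dif N (psi x) \<in> carrier N" using psi(1)[OF x] by simp
    show c2: "sgs N (n + 1) (psi (dif N x)) \<in> carrier N" using psi(1)[OF dx] by simp
    have s: "sgs TN.T n (sgs TN.T n t) = t" if "t \<in> carrier TN.T" for t
      using that by (simp add: TN.TG.sgs_sgs) (simp add: sgs_def)
    have "eqv (sgs TN.T n (sgs TN.T n (eps (dif N (psi x))))) (sgs TN.T n (dif TN.T (eps (psi x))))"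
      by (rule TN.TG.cong_mod_sgs[OF V' eqv_sym[OF eps_dif[OF psi(1)[OF x]]]])
    then have 1: "eqv (eps (dif N (psi x))) (sgs TN.T n (dif TN.T (eps (psi x))))"
      using s eps_closed[OF c1] by simp
    have 2: "eqv (sgs TN.T n (dif TN.T (eps (psi x)))) (sgs TN.T n (dif TN.T (th x)))"
      by (rule TN.TG.cong_mod_sgs[OF V' eqv_dif[OF eqv_sym[OF psi(2)[OF x]]]])
    have "sgs TN.T n (dif TN.T (th x)) = sgs TN.T (n + 1) (th (dif N x))"
      using thc[OF dx] by (auto simp: dth[OF x] sgs_def)
    moreover have "eqv (sgs TN.T (n + 1) (th (dif N x))) (sgs TN.T (n + 1) (eps (psi (dif N x))))"
      by (rule TN.TG.cong_mod_sgs[OF V' psi(2)[OF dx]])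
    ultimately have "eqv (sgs TN.T n (dif TN.T (th x))) (eps (sgs N (n + 1) (psi (dif N x))))"
      by (simp add: eps_sgs psi(1)[OF dx])
    then show "eqv (eps (dif N (psi x))) (eps (sgs N (n + 1) (psi (dif N x))))"
      by (rule eqv_trans[OF 1 eqv_trans[OF 2]])
  qed
  obtain chi where chi: "lin_map B N N (1 - (n + 1)) chi"
    "\<And>x. x \<in> carrier N \<Longrightarrow> psi x = dif N (chi x) \<ominus>\<^bsub>N\<^esub> sgs N (1 - (n + 1)) (chi (dif N x))"
    using Ext_trivialD[OF N.dg_module_axioms N.dg_module_axioms ext psi_lin_map cycle] by blast
  \<comment> \<open>The sign compensates for \<open>d eps \<equiv> (-1)\<^sup>n eps d\<close>.\<close>
  define s where "s x = sgs TN.T n (eps (chi x))" for x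
  have s_lin_map: "lin_map B N TN.T 0 s"
    using lin_map_sgs[OF TN.T_module lin_map_compose[OF chi(1) eps_lin_map], of n] by (simp add: s_def[abs_def])
  have chic: "x \<in> carrier N \<Longrightarrow> chi x \<in> carrier N" for x using lin_map_closed[OF chi(1)] .
  have epsV: "eps x \<in> gen_sub K" if "x \<in> carrier N" for x
    using that
  proof (induction x rule: NB.based_induct)
    case zero
    then show ?case using addhom_zero[OF N.abelian_group_axioms TN.T_abelian eps_hom] gen_sub_zero by simp
  next
    case (gen f j c)
    then show ?case
      using NB.basis_closed[OF gen(1)] e(1)
      by (simp add: eps_gen B.A.hcomp_closed)
        (intro TN.TG.sgs_subgroup[OF gen_sub_subgroup[OF K]] gen_sub_ract[OF K] gen_sub_ndot[OF K]; simp add: B.A.hcomp_closed)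
  next
    case (add y z)
    then show ?case by (simp add: addhom_add[OF eps_hom] gen_sub_add[OF K])
  qed
  have "th x \<ominus>\<^bsub>TN.T\<^esub> hom_dif s x \<in> V'" if x: "x \<in> carrier N" for x
  proof -
    have dx: "dif N x \<in> carrier N" using x by simp
    have sc: "sgs TN.T n (eps (chi (dif N x))) \<in> carrier TN.T" using eps_closed chic dx by simp
    have "eqv (sgs TN.T n (dif TN.T (eps (chi x)))) (sgs TN.T n (sgs TN.T n (eps (dif N (chi x)))))"
      by (rule TN.TG.cong_mod_sgs[OF V' eps_dif[OF chic[OF x]]])
    then have "eqv (dif TN.T (s x)) (eps (dif N (chi x)))"
      using eps_closed chic[OF x] addhom_sgs[OF TN.T_abelian TN.T_abelian TN.dif_T_hom]
      by (simp add: s_def TN.TG.sgs_sgs) (simp add: sgs_def)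
    then have "eqv (hom_dif s x) (eps (dif N (chi x)) \<ominus>\<^bsub>TN.T\<^esub> s (dif N x))"
      unfolding hom_dif_def by (rule TN.TG.cong_mod_diff[OF V' _ TN.TG.cong_mod_refl[OF V']]) (simp add: s_def eps_closed chic dx)
    also have "eps (dif N (chi x)) \<ominus>\<^bsub>TN.T\<^esub> s (dif N x) = eps (psi x)"
    proof -
      have "sgs N (1 - (n + 1)) (chi (dif N x)) = sgs N n (chi (dif N x))" by (rule sgs_parity) simp
      then show ?thesis
        using chic[OF x] chic[OF dx]
        by (simp add: chi(2)[OF x] addhom_diff[OF N.abelian_group_axioms TN.T_abelian eps_hom] s_def eps_sgs)
    qed
    finally have "eqv (th x) (hom_dif s x)" using eqv_trans[OF psi(2)[OF x] eqv_sym] by blast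
    then show ?thesis by (simp add: TN.TG.cong_mod_def)
  qed
  moreover have "s x \<in> gen_sub K" if "x \<in> carrier N" for x
    unfolding s_def by (rule TN.TG.sgs_subgroup[OF gen_sub_subgroup[OF K] epsV[OF chic[OF that]]])
  ultimately show "\<exists>s. lin_map B N TN.T 0 s \<and> (\<forall>x\<in>carrier N. s x \<in> gen_sub K) \<and> (\<forall>x\<in>carrier N. th x \<ominus>\<^bsub>TN.T\<^esub> hom_dif s x \<in> V')"
    using s_lin_map by blast
qed

end

end

section \<open>The subquotients of the filtration\<close>

lemma abelian_group_image:
  assumes M: "abelian_group M" and C: "carrier Q = q ` carrier M" and z: "\<zero>\<^bsub>Q\<^esub> = q \<zero>\<^bsub>M\<^esub>"
    and add: "\<And>x y. x \<in> carrier M \<Longrightarrow> y \<in> carrier M \<Longrightarrow> q x \<oplus>\<^bsub>Q\<^esub> q y = q (x \<oplus>\<^bsub>M\<^esub> y)"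
  shows "abelian_group Q"
proof -
  interpret M: abelian_group M by fact
  show ?thesis
  proof (rule abelian_groupI)
    show "\<exists>y\<in>carrier Q. y \<oplus>\<^bsub>Q\<^esub> x = \<zero>\<^bsub>Q\<^esub>" if x: "x \<in> carrier Q" for x
    proof -
      obtain u where u: "x = q u" "u \<in> carrier M" using x C by auto
      then have "q (\<ominus>\<^bsub>M\<^esub> u) \<oplus>\<^bsub>Q\<^esub> x = \<zero>\<^bsub>Q\<^esub>" by (simp add: add z M.l_neg)
      then show ?thesis using u C by blast
    qed
  qed (auto simp: C z add M.a_ac)
qed

context dg_setup
begin

context
  fixes Jf :: "nat \<Rightarrow> ('b \<times> 'b \<Rightarrow>\<^sub>0 int) set set" and l :: nat
  assumes fil: "diagonal_filtration A \<phi> B Jf" and l: "l \<ge> 1"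
begin

abbreviation (input) "I \<equiv> Jf l"
abbreviation (input) "I' \<equiv> Jf (Suc l)"
abbreviation (input) "Q \<equiv> subquotient A \<phi> B I I'"

lemma I_diag_stable: "diag_stable I" using filtration_facts(1)[OF fil l] .
lemma I'_diag_stable: "diag_stable I'" using filtration_facts(1)[OF fil, of "Suc l"] by simp
lemma I_subgroup: "subgroup I (add_monoid TB.T)" using I_diag_stable by (simp add: diag_stable_def)
lemma I'_subgroup: "subgroup I' (add_monoid TB.T)" using I'_diag_stable by (simp add: diag_stable_def)
lemma I_closed: "z \<in> I \<Longrightarrow> z \<in> carrier TB.T" using TB.TG.subgroup_carrier[OF I_subgroup] .
lemma I_ract: "z \<in> I \<Longrightarrow> b \<in> carrier B \<Longrightarrow> ract TB.T z b \<in> I" using I_diag_stable by (simp add: diag_stable_def)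

abbreviation (input) "q \<equiv> TB.TG.acoset I'"

lemmas q_def = TB.TG.acoset_def

lemma q_self: "x \<in> I \<Longrightarrow> x \<in> q x"
  by (rule TB.TG.acoset_self[OF I'_subgroup I_closed])

lemma q_eq: "x \<in> I \<Longrightarrow> y \<in> I \<Longrightarrow> q x = q y \<longleftrightarrow> x \<ominus>\<^bsub>TB.T\<^esub> y \<in> I'"
  by (rule TB.TG.acoset_eq[OF I'_subgroup I_closed I_closed])

text \<open>An additive map that preserves I' acts on a coset through any representative.\<close>

lemma q_map:
  assumes f: "addhom TB.T TB.T f" "\<And>h. h \<in> I' \<Longrightarrow> f h \<in> I'" and x: "x \<in> I" and y: "y \<in> I" "f x \<ominus>\<^bsub>TB.T\<^esub> y \<in> I'"
  shows "{h \<oplus>\<^bsub>TB.T\<^esub> k | h k. h \<in> I' \<and> k \<in> f ` q x} = q y"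
proof -
  note xc = I_closed[OF x] and yc = I_closed[OF y(1)] and S = I'_subgroup
  note cl = TB.TG.subgroup_carrier[OF S]
  have fx: "f x \<in> carrier TB.T" using addhom_closed[OF f(1) xc] .
  show ?thesis
  proof
    show "{h \<oplus>\<^bsub>TB.T\<^esub> k | h k. h \<in> I' \<and> k \<in> f ` q x} \<subseteq> q y"
    proof
      fix z assume "z \<in> {h \<oplus>\<^bsub>TB.T\<^esub> k | h k. h \<in> I' \<and> k \<in> f ` q x}"
      then obtain h h' where h: "h \<in> I'" "h' \<in> I'" "z = h \<oplus>\<^bsub>TB.T\<^esub> f (h' \<oplus>\<^bsub>TB.T\<^esub> x)" by (auto simp: q_def)
      have fh: "f h' \<in> I'" using f(2) h by blast
      have "z = h \<oplus>\<^bsub>TB.T\<^esub> f h' \<oplus>\<^bsub>TB.T\<^esub> (f x \<ominus>\<^bsub>TB.T\<^esub> y) \<oplus>\<^bsub>TB.T\<^esub> y"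
        using h fh fx yc cl[OF h(1)] cl[OF h(2)] cl[OF fh] xc
        by (simp add: addhom_add[OF f(1)] a_minus_def TB.TG.a_assoc TB.TG.l_neg)
      then show "z \<in> q y"
        using TB.TG.subgroup_add[OF S TB.TG.subgroup_add[OF S h(1) fh] y(2)] by (auto simp: q_def)
    qed
    show "q y \<subseteq> {h \<oplus>\<^bsub>TB.T\<^esub> k | h k. h \<in> I' \<and> k \<in> f ` q x}"
    proof
      fix z assume "z \<in> q y"
      then obtain h where h: "h \<in> I'" "z = h \<oplus>\<^bsub>TB.T\<^esub> y" by (auto simp: q_def)
      have "z = (h \<ominus>\<^bsub>TB.T\<^esub> (f x \<ominus>\<^bsub>TB.T\<^esub> y)) \<oplus>\<^bsub>TB.T\<^esub> f x"
      proof -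
        have "(h \<ominus>\<^bsub>TB.T\<^esub> (f x \<ominus>\<^bsub>TB.T\<^esub> y)) \<oplus>\<^bsub>TB.T\<^esub> f x = h \<oplus>\<^bsub>TB.T\<^esub> (y \<oplus>\<^bsub>TB.T\<^esub> (\<ominus>\<^bsub>TB.T\<^esub> f x \<oplus>\<^bsub>TB.T\<^esub> f x))"
          using fx yc cl[OF h(1)] by (simp add: a_minus_def TB.TG.minus_add TB.TG.a_ac del: TB.TG.l_neg TB.TG.r_neg)
        then show ?thesis using h(2) fx yc cl[OF h(1)] by (simp add: TB.TG.l_neg)
      qed
      moreover have "h \<ominus>\<^bsub>TB.T\<^esub> (f x \<ominus>\<^bsub>TB.T\<^esub> y) \<in> I'" by (rule TB.TG.subgroup_diff[OF S h(1) y(2)])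
      ultimately show "z \<in> {h \<oplus>\<^bsub>TB.T\<^esub> k | h k. h \<in> I' \<and> k \<in> f ` q x}" using q_self[OF x] by blast
    qed
  qed
qed

definition sec where "sec b = (SOME z. z \<in> carrier E \<and> pi_alg B z = b)"

lemma sec: assumes "b \<in> carrier B" shows "sec b \<in> carrier TB.T" "pi_alg B (sec b) = b"
proof -
  have "\<exists>z. z \<in> carrier E \<and> pi_alg B z = b"
    using assms pi_alg_pure[of "\<one>\<^bsub>B\<^esub>" b] by (intro exI[of _ "TB.tn \<one>\<^bsub>B\<^esub> b"]) (simp add: E_simps)
  from someI_ex[OF this] show "sec b \<in> carrier TB.T" "pi_alg B (sec b) = b" by (auto simp: sec_def E_simps)
qed

text \<open>Two preimages of b under the multiplication map differ by an element of J, which acts as zero on the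
  subquotient. So the chosen preimage may be replaced by \<open>1 \<otimes> b\<close>.\<close>

lemma mult_sec:
  assumes m: "m \<ge> 1" and z: "z \<in> Jf m" and b: "b \<in> carrier B"
  shows "z \<otimes>\<^bsub>E\<^esub> sec b \<ominus>\<^bsub>TB.T\<^esub> ract TB.T z b \<in> Jf (Suc m)"
proof -
  have zc: "z \<in> carrier TB.T" using filtration_facts(1)[OF fil m] z TB.TG.subgroup_carrier by (auto simp: diag_stable_def)
  have "sec b \<ominus>\<^bsub>TB.T\<^esub> TB.tn \<one>\<^bsub>B\<^esub> b \<in> diagonal_ideal A \<phi> B"
    using b sec[OF b]
    by (simp add: diagonal_ideal_eq addhom_diff[OF TB.T_abelian B.A.abelian_group_axioms pi_alg_hom] pi_alg_pure)
      (simp add: a_minus_def B.A.r_neg)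
  then have "z \<otimes>\<^bsub>E\<^esub> (sec b \<ominus>\<^bsub>TB.T\<^esub> TB.tn \<one>\<^bsub>B\<^esub> b) \<in> Jf (Suc m)" by (rule filtration_facts(4)[OF fil m z])
  then show ?thesis
    using b sec[OF b] E_mult_right_factor[OF zc b]
    by (simp add: addhom_diff[OF TB.T_abelian TB.T_abelian E_mult_hom_right[OF zc]])
qed

abbreviation (input) "D \<equiv> dg_sub (dg_regular E) I"

lemma D_simps: "carrier D = I" "add D = add TB.T" "hcomp D = (\<lambda>i. hcomp TB.T i \<inter> I)" "dif D = dif TB.T" "ract D = mult E"
  by (simp_all add: dg_sub_def dg_regular_def E_simps)

lemma D_coset: "I' +>\<^bsub>D\<^esub> x = q x"
  by (auto simp: a_r_coset_def r_coset_def q_def D_simps)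

lemma D_set_add: "X <+>\<^bsub>D\<^esub> Y = {h \<oplus>\<^bsub>TB.T\<^esub> k | h k. h \<in> X \<and> k \<in> Y}"
  by (auto simp: set_add_def set_mult_def D_simps)

lemma Q_carrier: "carrier Q = q ` I"
proof -
  have "carrier Q = a_rcosets\<^bsub>D\<^esub> I'" by (simp add: subquotient_def dg_restrict_def dg_quot_def)
  also have "\<dots> = q ` I" unfolding A_RCOSETS_def' D_coset by (auto simp: D_simps)
  finally show ?thesis .
qed

lemma Q_zero: "\<zero>\<^bsub>Q\<^esub> = q \<zero>\<^bsub>TB.T\<^esub>"
proof -
  have "h \<oplus>\<^bsub>TB.T\<^esub> \<zero>\<^bsub>TB.T\<^esub> = h" if "h \<in> I'" for h
    using TB.TG.subgroup_carrier[OF I'_subgroup that] by simp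
  then have "q \<zero>\<^bsub>TB.T\<^esub> = I'" by (force simp: q_def)
  then show ?thesis by (simp add: subquotient_def dg_restrict_def dg_quot_def)
qed

lemma Q_hcomp: "hcomp Q i = q ` (hcomp TB.T i \<inter> I)"
  by (simp add: subquotient_def dg_restrict_def dg_quot_def D_coset D_simps)

lemma Q_add: "x \<in> I \<Longrightarrow> y \<in> I \<Longrightarrow> q x \<oplus>\<^bsub>Q\<^esub> q y = q (x \<oplus>\<^bsub>TB.T\<^esub> y)"
proof -
  assume x: "x \<in> I" and y: "y \<in> I"
  note cl = TB.TG.subgroup_carrier[OF I'_subgroup] I_closed[OF x] I_closed[OF y]
  have "q x \<oplus>\<^bsub>Q\<^esub> q y = {h \<oplus>\<^bsub>TB.T\<^esub> k | h k. h \<in> q x \<and> k \<in> q y}"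
    by (simp add: subquotient_def dg_restrict_def dg_quot_def D_set_add)
  also have "\<dots> = q (x \<oplus>\<^bsub>TB.T\<^esub> y)" by (rule TB.TG.acoset_add[OF I'_subgroup cl(2,3)])
  finally show ?thesis .
qed

lemma Q_dif: "x \<in> I \<Longrightarrow> dif Q (q x) = q (dif TB.T x)"
proof -
  assume x: "x \<in> I"
  have dx: "dif TB.T x \<in> I" using I_diag_stable x by (simp add: diag_stable_def)
  have "dif Q (q x) = {h \<oplus>\<^bsub>TB.T\<^esub> k | h k. h \<in> I' \<and> k \<in> dif TB.T ` q x}"
    by (simp add: subquotient_def dg_restrict_def dg_quot_def D_set_add D_simps)
  also have "\<dots> = q (dif TB.T x)"
    using I_closed[OF dx] TB.TG.subgroup_zero[OF I'_subgroup] I'_diag_stable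
    by (intro q_map[OF TB.dif_T_hom _ x dx]) (auto simp: diag_stable_def a_minus_def TB.TG.r_neg)
  finally show ?thesis .
qed

lemma Q_ract: "x \<in> I \<Longrightarrow> b \<in> carrier B \<Longrightarrow> ract Q (q x) b = q (ract TB.T x b)"
proof -
  assume x: "x \<in> I" and b: "b \<in> carrier B"
  have h: "h \<otimes>\<^bsub>E\<^esub> sec b \<in> I'" if h: "h \<in> I'" for h
  proof -
    have "h \<otimes>\<^bsub>E\<^esub> sec b \<ominus>\<^bsub>TB.T\<^esub> ract TB.T h b \<in> I'"
      using mult_sec[OF _ h b] filtration_facts(2)[OF fil, of "Suc l"] by auto
    moreover have "ract TB.T h b \<in> I'" using I'_diag_stable h b by (simp add: diag_stable_def)
    ultimately have "(h \<otimes>\<^bsub>E\<^esub> sec b \<ominus>\<^bsub>TB.T\<^esub> ract TB.T h b) \<oplus>\<^bsub>TB.T\<^esub> ract TB.T h b \<in> I'"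
      by (rule TB.TG.subgroup_add[OF I'_subgroup])
    then show ?thesis
      using TB.TG.subgroup_carrier[OF I'_subgroup h] sec[OF b] b
      by (simp add: TB.TG.add_diff_cancel E_mult_closed TB.ract_T_closed)
  qed
  have "ract Q (q x) b = {h \<oplus>\<^bsub>TB.T\<^esub> k | h k. h \<in> I' \<and> k \<in> (\<lambda>x. x \<otimes>\<^bsub>E\<^esub> sec b) ` q x}"
    by (simp add: subquotient_def dg_restrict_def dg_quot_def D_set_add D_simps sec_def)
  also have "\<dots> = q (ract TB.T x b)"
    by (rule q_map[OF E_mult_hom_left[OF sec(1)[OF b]] h x I_ract[OF x b] mult_sec[OF l x b]])
  finally show ?thesis .
qed

lemma Q_abelian: "abelian_group Q"
proof (rule abelian_group_image[where q = q])
  let ?M = "TB.T\<lparr>carrier := I\<rparr>"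
  show "abelian_group ?M"
  proof (rule abelian_groupI)
    show "\<exists>y\<in>carrier ?M. y \<oplus>\<^bsub>?M\<^esub> x = \<zero>\<^bsub>?M\<^esub>" if "x \<in> carrier ?M" for x
      using that TB.TG.subgroup_neg[OF I_subgroup, of x] I_closed TB.TG.l_neg
      by (intro bexI[of _ "\<ominus>\<^bsub>TB.T\<^esub> x"]) auto
  qed (use TB.TG.subgroup_add[OF I_subgroup] TB.TG.subgroup_zero[OF I_subgroup] I_closed in \<open>auto simp: TB.TG.a_ac\<close>)
  show "carrier Q = q ` carrier ?M" by (simp add: Q_carrier)
  show "\<zero>\<^bsub>Q\<^esub> = q \<zero>\<^bsub>?M\<^esub>" by (simp add: Q_zero)
  show "q x \<oplus>\<^bsub>Q\<^esub> q y = q (x \<oplus>\<^bsub>?M\<^esub> y)" if "x \<in> carrier ?M" "y \<in> carrier ?M" for x y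
    using that by (simp add: Q_add)
qed

lemma Q_finsum:
  assumes "finite S" "\<And>e. e \<in> S \<Longrightarrow> z e \<in> I"
  shows "(\<Oplus>\<^bsub>Q\<^esub>e\<in>S. q (z e)) = q (\<Oplus>\<^bsub>TB.T\<^esub>e\<in>S. z e)"
proof -
  interpret Q: abelian_group Q by (rule Q_abelian)
  show ?thesis
    using assms
  proof (induction S rule: finite_induct)
    case empty
    then show ?case by (simp add: Q_zero)
  next
    case (insert a S)
    have "(\<Oplus>\<^bsub>Q\<^esub>e\<in>insert a S. q (z e)) = q (z a) \<oplus>\<^bsub>Q\<^esub> (\<Oplus>\<^bsub>Q\<^esub>e\<in>S. q (z e))"
      using insert by (intro Q.finsum_insert) (auto simp: Q_carrier)
    also have "\<dots> = q (z a \<oplus>\<^bsub>TB.T\<^esub> (\<Oplus>\<^bsub>TB.T\<^esub>e\<in>S. z e))"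
      using insert TB.TG.subgroup_finsum[OF I_subgroup, of S z] by (simp add: Q_add)
    also have "z a \<oplus>\<^bsub>TB.T\<^esub> (\<Oplus>\<^bsub>TB.T\<^esub>e\<in>S. z e) = (\<Oplus>\<^bsub>TB.T\<^esub>e\<in>insert a S. z e)"
      using insert I_closed by (intro TB.TG.finsum_insert[symmetric]) auto
    finally show ?case .
  qed
qed

text \<open>A semifree basis of the subquotient, in terms of homogeneous representatives in \<open>B \<otimes>\<^sub>A B\<close>.\<close>

lemma subquotient_basis:
  assumes sf: "semifree_basis B Q G r"
  obtains rep deg where
    "\<And>g. g \<in> G \<Longrightarrow> rep g \<in> I" "\<And>g. g \<in> G \<Longrightarrow> rep g \<in> hcomp TB.T (deg g)" "\<And>g. g \<in> G \<Longrightarrow> deg g \<ge> int l"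
    "\<And>z. z \<in> I \<Longrightarrow> \<exists>T c. finite T \<and> T \<subseteq> G \<and> (\<forall>e\<in>T. c e \<in> carrier B)
        \<and> z \<ominus>\<^bsub>TB.T\<^esub> (\<Oplus>\<^bsub>TB.T\<^esub>e\<in>T. ract TB.T (rep e) (c e)) \<in> I'"
    "\<And>T c e. finite T \<Longrightarrow> T \<subseteq> G \<Longrightarrow> (\<And>e. e \<in> T \<Longrightarrow> c e \<in> carrier B) \<Longrightarrow>
        (\<Oplus>\<^bsub>TB.T\<^esub>e\<in>T. ract TB.T (rep e) (c e)) \<in> I' \<Longrightarrow> e \<in> T \<Longrightarrow> c e = \<zero>\<^bsub>B\<^esub>"
    "\<And>g. g \<in> G \<Longrightarrow> \<exists>T c. finite T \<and> T \<subseteq> {e \<in> G. (e, g) \<in> r \<and> e \<noteq> g} \<and> (\<forall>e\<in>T. c e \<in> carrier B)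
        \<and> dif TB.T (rep g) \<ominus>\<^bsub>TB.T\<^esub> (\<Oplus>\<^bsub>TB.T\<^esub>e\<in>T. ract TB.T (rep e) (c e)) \<in> I'"
proof -
  have gb: "graded_basis B Q G" using sf by (simp add: semifree_basis_def)
  have "\<exists>z i. z \<in> I \<and> z \<in> hcomp TB.T i \<and> i \<ge> int l \<and> q z = g" if gG: "g \<in> G" for g
  proof -
    have "G \<subseteq> (\<Union>i. hcomp Q i)" using gb unfolding graded_basis_def by (elim conjE)
    then obtain i where "g \<in> hcomp Q i" using gG by auto
    then obtain z where z: "z \<in> I" "z \<in> hcomp TB.T i" "q z = g" by (auto simp: Q_hcomp)
    show ?thesis
    proof (cases "i \<ge> int l")
      case True
      then show ?thesis using z by blast
    next
      case False
      \<comment> \<open>A representative of degree less than l is zero and hence also of degree l.\<close>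
      then have "z = \<zero>\<^bsub>TB.T\<^esub>" using filtration_facts(5)[OF fil l z(1,2)] by simp
      then show ?thesis using z by (intro exI[of _ z] exI[of _ "int l"]) auto
    qed
  qed
  then obtain rep deg where rep: "\<And>g. g \<in> G \<Longrightarrow> rep g \<in> I" "\<And>g. g \<in> G \<Longrightarrow> rep g \<in> hcomp TB.T (deg g)"
    "\<And>g. g \<in> G \<Longrightarrow> deg g \<ge> int l" "\<And>g. g \<in> G \<Longrightarrow> q (rep g) = g"
    by metis
  interpret Q: abelian_group Q by (rule Q_abelian)
  have sum: "(\<Oplus>\<^bsub>Q\<^esub>e\<in>T. ract Q e (c e)) = q (\<Oplus>\<^bsub>TB.T\<^esub>e\<in>T. ract TB.T (rep e) (c e))"
    "(\<Oplus>\<^bsub>TB.T\<^esub>e\<in>T. ract TB.T (rep e) (c e)) \<in> I"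
    if "finite T" "T \<subseteq> G" "\<And>e. e \<in> T \<Longrightarrow> c e \<in> carrier B" for T c
  proof -
    have m: "e \<in> T \<Longrightarrow> ract TB.T (rep e) (c e) \<in> I" for e using that rep(1) I_ract by blast
    have "ract Q e (c e) = q (ract TB.T (rep e) (c e))" if "e \<in> T" for e
    proof -
      have "e \<in> G" using that \<open>T \<subseteq> G\<close> by blast
      then show ?thesis
        using Q_ract[OF rep(1), of e "c e"] rep(4) \<open>\<And>e. e \<in> T \<Longrightarrow> c e \<in> carrier B\<close>[OF that] by simp
    qed
    then have "(\<Oplus>\<^bsub>Q\<^esub>e\<in>T. ract Q e (c e)) = (\<Oplus>\<^bsub>Q\<^esub>e\<in>T. q (ract TB.T (rep e) (c e)))"
      using m by (intro Q.finsum_cong') (auto simp: Q_carrier)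
    then show "(\<Oplus>\<^bsub>Q\<^esub>e\<in>T. ract Q e (c e)) = q (\<Oplus>\<^bsub>TB.T\<^esub>e\<in>T. ract TB.T (rep e) (c e))"
      using Q_finsum[OF that(1) m] by simp
    show "(\<Oplus>\<^bsub>TB.T\<^esub>e\<in>T. ract TB.T (rep e) (c e)) \<in> I" by (rule TB.TG.subgroup_finsum[OF I_subgroup m])
  qed
  have span: "\<exists>T c. finite T \<and> T \<subseteq> W \<and> (\<forall>e\<in>T. c e \<in> carrier B)
        \<and> z \<ominus>\<^bsub>TB.T\<^esub> (\<Oplus>\<^bsub>TB.T\<^esub>e\<in>T. ract TB.T (rep e) (c e)) \<in> I'" if zI: "z \<in> I" and zr: "q z \<in> rspan B Q W" and WG: "W \<subseteq> G" for z W
  proof -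
    obtain T c where T: "finite T" "T \<subseteq> W" "c ` T \<subseteq> carrier B" "q z = (\<Oplus>\<^bsub>Q\<^esub>e\<in>T. ract Q e (c e))"
      using zr by (auto simp: rspan_def)
    have T': "T \<subseteq> G" "\<And>e. e \<in> T \<Longrightarrow> c e \<in> carrier B" using T WG by auto
    note s = sum[OF T(1) T']
    have "q z = q (\<Oplus>\<^bsub>TB.T\<^esub>e\<in>T. ract TB.T (rep e) (c e))" using T(4) s(1) by simp
    then have "z \<ominus>\<^bsub>TB.T\<^esub> (\<Oplus>\<^bsub>TB.T\<^esub>e\<in>T. ract TB.T (rep e) (c e)) \<in> I'" using q_eq[OF zI s(2)] by simp
    then show ?thesis using T T' by blast
  qed
  show thesis
  proof (rule that[OF rep(1) rep(2) rep(3)])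
    show "\<exists>T c. finite T \<and> T \<subseteq> G \<and> (\<forall>e\<in>T. c e \<in> carrier B)
        \<and> z \<ominus>\<^bsub>TB.T\<^esub> (\<Oplus>\<^bsub>TB.T\<^esub>e\<in>T. ract TB.T (rep e) (c e)) \<in> I'" if "z \<in> I" for z
    proof (rule span[OF that _ order_refl])
      have "rspan B Q G = carrier Q" using gb unfolding graded_basis_def by (elim conjE)
      then show "q z \<in> rspan B Q G" using that by (simp add: Q_carrier)
    qed
    show "c e = \<zero>\<^bsub>B\<^esub>" if T: "finite T" "T \<subseteq> G" "\<And>e. e \<in> T \<Longrightarrow> c e \<in> carrier B"
        "(\<Oplus>\<^bsub>TB.T\<^esub>e\<in>T. ract TB.T (rep e) (c e)) \<in> I'" "e \<in> T" for T c e
    proof -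
      let ?s = "\<Oplus>\<^bsub>TB.T\<^esub>e\<in>T. ract TB.T (rep e) (c e)"
      note s = sum[OF T(1-3)]
      have "?s \<ominus>\<^bsub>TB.T\<^esub> \<zero>\<^bsub>TB.T\<^esub> \<in> I'" using T(4) I_closed[OF s(2)] by (simp add: a_minus_def)
      then have "q ?s = q \<zero>\<^bsub>TB.T\<^esub>" using q_eq[OF s(2) TB.TG.subgroup_zero[OF I_subgroup]] by simp
      then have "(\<Oplus>\<^bsub>Q\<^esub>e\<in>T. ract Q e (c e)) = \<zero>\<^bsub>Q\<^esub>" using s(1) Q_zero by simp
      moreover have "\<forall>T c. finite T \<and> T \<subseteq> G \<and> c ` T \<subseteq> carrier B \<and> (\<Oplus>\<^bsub>Q\<^esub>e\<in>T. ract Q e (c e)) = \<zero>\<^bsub>Q\<^esub>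
          \<longrightarrow> (\<forall>e\<in>T. c e = \<zero>\<^bsub>B\<^esub>)"
        using gb unfolding graded_basis_def by (elim conjE)
      then have "finite T \<and> T \<subseteq> G \<and> c ` T \<subseteq> carrier B \<and> (\<Oplus>\<^bsub>Q\<^esub>e\<in>T. ract Q e (c e)) = \<zero>\<^bsub>Q\<^esub>
          \<longrightarrow> (\<forall>e\<in>T. c e = \<zero>\<^bsub>B\<^esub>)" by (elim allE)
      ultimately show ?thesis using T(1-3,5) by blast
    qed
    show "\<exists>T c. finite T \<and> T \<subseteq> {e \<in> G. (e, g) \<in> r \<and> e \<noteq> g} \<and> (\<forall>e\<in>T. c e \<in> carrier B)
        \<and> dif TB.T (rep g) \<ominus>\<^bsub>TB.T\<^esub> (\<Oplus>\<^bsub>TB.T\<^esub>e\<in>T. ract TB.T (rep e) (c e)) \<in> I'" if g: "g \<in> G" for g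
    proof (rule span)
      show "dif TB.T (rep g) \<in> I" using I_diag_stable rep(1)[OF g] by (simp add: diag_stable_def)
      show "q (dif TB.T (rep g)) \<in> rspan B Q {e \<in> G. (e, g) \<in> r \<and> e \<noteq> g}"
      proof -
        have "\<forall>f\<in>G. dif Q f \<in> rspan B Q {e \<in> G. (e, f) \<in> r \<and> e \<noteq> f}"
          using sf unfolding semifree_basis_def by (elim conjE)
        then have "dif Q g \<in> rspan B Q {e \<in> G. (e, g) \<in> r \<and> e \<noteq> g}" using g by (rule bspec)
        moreover have "dif Q g = q (dif TB.T (rep g))" using Q_dif[OF rep(1)[OF g]] rep(4)[OF g] by simp
        ultimately show ?thesis by simp
      qed
    qed blast
  qed
qed

end

end

section \<open>Refining one term of the filtration\<close>

lemma finite_total_max: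
  assumes "total_on G r" "trans r" "refl_on G r" "finite S" "S \<noteq> {}" "S \<subseteq> G"
  shows "\<exists>m\<in>S. \<forall>e\<in>S. (e, m) \<in> r"
  using assms(4-6)
proof (induction S rule: finite_ne_induct)
  case (singleton x)
  then show ?case using assms(3) by (auto simp: refl_on_def)
next
  case (insert x S)
  then obtain m where m: "m \<in> S" "\<forall>e\<in>S. (e, m) \<in> r" by auto
  consider "(x, m) \<in> r" | "(m, x) \<in> r"
  proof -
    have "x \<in> G" "m \<in> G" using insert(5) m(1) by auto
    then have "(x, m) \<in> r \<or> (m, x) \<in> r"
      using assms(1,3) unfolding total_on_def refl_on_def by (cases "x = m") auto
    then show thesis using that by blast
  qed
  then show ?case
  proof cases
    case 1
    then show ?thesis using m by auto
  next
    case 2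
    then have "(e, x) \<in> r" if "e \<in> S" for e using m(2) that assms(2) by (meson transD)
    moreover have "(x, x) \<in> r" using assms(3) insert by (auto simp: refl_on_def)
    ultimately show ?thesis by auto
  qed
qed

context lift_setup
begin

text \<open>The right B-submodule generated by I' and the representatives of the basis elements in S.  For
  downward closed S these submodules interpolate between two terms of the filtration, one basis element
  at a time.\<close>

inductive_set adjoin for I' rep S where
  adjoin_base: "z \<in> I' \<Longrightarrow> z \<in> adjoin I' rep S"
| adjoin_step: "e \<in> S \<Longrightarrow> b \<in> carrier B \<Longrightarrow> t \<in> adjoin I' rep S \<Longrightarrow> ract TB.T (rep e) b \<oplus>\<^bsub>TB.T\<^esub> t \<in> adjoin I' rep S"

context
  fixes Jf :: "nat \<Rightarrow> ('b \<times> 'b \<Rightarrow>\<^sub>0 int) set set" and l :: nat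
    and G :: "('b \<times> 'b \<Rightarrow>\<^sub>0 int) set set set" and r rep deg
  assumes fil: "diagonal_filtration A \<phi> B Jf" and l: "l \<ge> 1"
    and wo: "well_order_on G r"
    and rep: "\<And>g. g \<in> G \<Longrightarrow> rep g \<in> Jf l" "\<And>g. g \<in> G \<Longrightarrow> rep g \<in> hcomp TB.T (deg g)"
    and span: "\<And>z. z \<in> Jf l \<Longrightarrow> \<exists>T c. finite T \<and> T \<subseteq> G \<and> (\<forall>e\<in>T. c e \<in> carrier B)
        \<and> z \<ominus>\<^bsub>TB.T\<^esub> (\<Oplus>\<^bsub>TB.T\<^esub>e\<in>T. ract TB.T (rep e) (c e)) \<in> Jf (Suc l)"
    and indep: "\<And>T c e. finite T \<Longrightarrow> T \<subseteq> G \<Longrightarrow> (\<And>e. e \<in> T \<Longrightarrow> c e \<in> carrier B) \<Longrightarrow>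
        (\<Oplus>\<^bsub>TB.T\<^esub>e\<in>T. ract TB.T (rep e) (c e)) \<in> Jf (Suc l) \<Longrightarrow> e \<in> T \<Longrightarrow> c e = \<zero>\<^bsub>B\<^esub>"
    and repdif: "\<And>g. g \<in> G \<Longrightarrow> \<exists>T c. finite T \<and> T \<subseteq> {e \<in> G. (e, g) \<in> r \<and> e \<noteq> g} \<and> (\<forall>e\<in>T. c e \<in> carrier B)
        \<and> dif TB.T (rep g) \<ominus>\<^bsub>TB.T\<^esub> (\<Oplus>\<^bsub>TB.T\<^esub>e\<in>T. ract TB.T (rep e) (c e)) \<in> Jf (Suc l)"
begin

abbreviation (input) "I0 \<equiv> Jf (Suc l)"
abbreviation (input) "KK \<equiv> adjoin I0 rep"

lemma I0_diag_stable: "diag_stable I0" using filtration_facts(1)[OF fil, of "Suc l"] by simp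
lemmas I0D = diag_stableD[OF I0_diag_stable]
lemma Il_diag_stable: "diag_stable (Jf l)" using filtration_facts(1)[OF fil l] .
lemmas IlD = diag_stableD[OF Il_diag_stable]

lemma rep_closed: "g \<in> G \<Longrightarrow> rep g \<in> carrier TB.T"
  using rep(1) IlD(2) by blast

context
  fixes S assumes S: "S \<subseteq> G"
begin

lemma gen_closed: "e \<in> S \<Longrightarrow> b \<in> carrier B \<Longrightarrow> ract TB.T (rep e) b \<in> carrier TB.T"
  using TB.ract_T_closed rep_closed S by blast

lemma adjoin_closed: "z \<in> KK S \<Longrightarrow> z \<in> carrier TB.T"
  by (induction rule: adjoin.induct) (auto simp: I0D gen_closed)

lemma adjoin_add: "s \<in> KK S \<Longrightarrow> t \<in> KK S \<Longrightarrow> s \<oplus>\<^bsub>TB.T\<^esub> t \<in> KK S"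
proof (induction s rule: adjoin.induct)
  case (adjoin_base z)
  from adjoin_base(2) show ?case
  proof (induction t rule: adjoin.induct)
    case (adjoin_base w)
    then show ?case using adjoin.adjoin_base[OF TB.TG.subgroup_add[OF I0D(1) \<open>z \<in> I0\<close>]] by blast
  next
    case (adjoin_step e b t)
    have "z \<oplus>\<^bsub>TB.T\<^esub> (ract TB.T (rep e) b \<oplus>\<^bsub>TB.T\<^esub> t) = ract TB.T (rep e) b \<oplus>\<^bsub>TB.T\<^esub> (z \<oplus>\<^bsub>TB.T\<^esub> t)"
      using adjoin_step adjoin_closed gen_closed I0D(2)[OF \<open>z \<in> I0\<close>] by (simp add: TB.TG.a_lcomm)
    then show ?case using adjoin.adjoin_step[OF adjoin_step(1,2,4)] by simp
  qed
next
  case (adjoin_step e b s)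
  have "ract TB.T (rep e) b \<oplus>\<^bsub>TB.T\<^esub> s \<oplus>\<^bsub>TB.T\<^esub> t = ract TB.T (rep e) b \<oplus>\<^bsub>TB.T\<^esub> (s \<oplus>\<^bsub>TB.T\<^esub> t)"
    using adjoin_step adjoin_closed gen_closed by (simp add: TB.TG.a_assoc)
  then show ?case using adjoin.adjoin_step[OF adjoin_step(1,2)] adjoin_step by simp
qed

lemma adjoin_zero: "\<zero>\<^bsub>TB.T\<^esub> \<in> KK S"
  by (rule adjoin_base[OF TB.TG.subgroup_zero[OF I0D(1)]])

lemma adjoin_gen: "e \<in> S \<Longrightarrow> b \<in> carrier B \<Longrightarrow> ract TB.T (rep e) b \<in> KK S"
  using adjoin_step[OF _ _ adjoin_zero, of e b] gen_closed by simp

lemma adjoin_map: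
  assumes f: "addhom TB.T TB.T f" "\<And>z. z \<in> I0 \<Longrightarrow> f z \<in> I0"
    and gen: "\<And>e j b. e \<in> S \<Longrightarrow> b \<in> hcomp B j \<Longrightarrow> f (ract TB.T (rep e) b) \<in> KK S"
    and t: "t \<in> KK S"
  shows "f t \<in> KK S"
  using t
proof (induction t rule: adjoin.induct)
  case (adjoin_base z)
  then show ?case using f(2) adjoin.adjoin_base by blast
next
  case (adjoin_step e b t)
  have ec: "rep e \<in> carrier TB.T" using adjoin_step(1) S rep_closed by blast
  have "f (ract TB.T (rep e) b) \<in> KK S"
    using adjoin_step(2)
  proof (induction b rule: B.A.homog_induct)
    case (homog i b)
    then show ?case using gen adjoin_step(1) by blast
  next
    case (add b c)
    then show ?case using ec adjoin_add by (simp add: TB.T.ract_add_right addhom_add[OF f(1)] TB.ract_T_closed)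
  qed
  then show ?case using adjoin_step adjoin_closed gen_closed adjoin_add by (simp add: addhom_add[OF f(1)])
qed

lemma adjoin_subgroup: "subgroup (KK S) (add_monoid TB.T)"
proof (rule TB.TG.subgroupI')
  fix x assume x: "x \<in> KK S"
  have "sgs TB.T 1 x \<in> KK S"
  proof (rule adjoin_map[OF TB.TG.sgs_hom _ _ x])
    show "sgs TB.T 1 z \<in> I0" if "z \<in> I0" for z using TB.TG.sgs_subgroup[OF I0D(1) that] .
    show "sgs TB.T 1 (ract TB.T (rep e) b) \<in> KK S" if "e \<in> S" "b \<in> hcomp B j" for e j b
      using that S rep_closed adjoin_gen[OF that(1), of "sgs B 1 b"] B.A.hcomp_closed[OF that(2)]
        addhom_sgs[OF B.A.abelian_group_axioms TB.T_abelian TB.T.ract_hom_right, of "rep e" b 1] by auto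
  qed
  then show "\<ominus>\<^bsub>TB.T\<^esub> x \<in> KK S" by (simp add: sgs_def)
qed (use adjoin_closed adjoin_zero adjoin_add in auto)

lemma adjoin_ract: "t \<in> KK S \<Longrightarrow> c \<in> carrier B \<Longrightarrow> ract TB.T t c \<in> KK S"
  by (rule adjoin_map[OF TB.ract_T_hom])
    (use S rep_closed I0D in \<open>auto simp: TB.T.ract_mult[symmetric] B.A.hcomp_closed subset_iff intro!: adjoin_gen\<close>)

lemma adjoin_hpart: "t \<in> KK S \<Longrightarrow> hpart TB.T t i \<in> KK S"
proof (rule adjoin_map[OF TB.T.hpart_hom])
  show "hpart TB.T (ract TB.T (rep e) b) i \<in> KK S" if "e \<in> S" "b \<in> hcomp B j" for e j b
    using TB.T.hpart_homog[OF TB.T.ract_degree[OF rep(2) that(2)], of e i] that S adjoin_gen[OF that(1) B.A.hcomp_closed[OF that(2)]]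
      adjoin_zero by auto
qed (auto simp: I0D)

lemma adjoin_bdot: 
  assumes t: "t \<in> KK S" and c: "c \<in> carrier B"
  shows "bdot c t \<in> KK S"
  using c
proof (induction c rule: B.A.homog_induct)
  case (homog i c)
  have cc: "c \<in> carrier B" using B.A.hcomp_closed[OF homog] .
  show ?case
  proof (rule adjoin_map[OF bdot_hom[OF cc] _ _ t])
    fix e j b assume e: "e \<in> S" and b: "b \<in> hcomp B j"
    have eG: "e \<in> G" and bc: "b \<in> carrier B" using e S B.A.hcomp_closed[OF b] by auto
    note rc = rep_closed[OF eG]
    have "bdot c (rep e) \<ominus>\<^bsub>TB.T\<^esub> sgs TB.T (i * deg e) (ract TB.T (rep e) c) \<in> KK S"
      by (rule adjoin_base[OF filtration_comm[OF fil l rep(1)[OF eG] rep(2)[OF eG] homog]]) 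
    moreover have "sgs TB.T (i * deg e) (ract TB.T (rep e) c) \<in> KK S"
      by (rule TB.TG.sgs_subgroup[OF adjoin_subgroup adjoin_gen[OF e cc]])
    ultimately have "(bdot c (rep e) \<ominus>\<^bsub>TB.T\<^esub> sgs TB.T (i * deg e) (ract TB.T (rep e) c))
        \<oplus>\<^bsub>TB.T\<^esub> sgs TB.T (i * deg e) (ract TB.T (rep e) c) \<in> KK S" by (rule adjoin_add)
    then have "bdot c (rep e) \<in> KK S"
      using rc cc by (simp add: TB.TG.add_diff_cancel bdot_closed TB.ract_T_closed)
    then have "ract TB.T (bdot c (rep e)) b \<in> KK S" by (rule adjoin_ract[OF _ bc])
    then show "bdot c (ract TB.T (rep e) b) \<in> KK S" by (simp add: bdot_lin[OF cc rc bc])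
  qed (use I0D cc in auto)
next
  case (add y c)
  then show ?case using adjoin_closed[OF t] by (simp add: addhom_add[OF bdot_hom_left] adjoin_add)
qed

lemma adjoin_diff_sum:
  assumes z: "z \<in> carrier TB.T" and "T \<subseteq> S" "\<forall>e\<in>T. c e \<in> carrier B"
    and d: "z \<ominus>\<^bsub>TB.T\<^esub> (\<Oplus>\<^bsub>TB.T\<^esub>e\<in>T. ract TB.T (rep e) (c e)) \<in> I0"
  shows "z \<in> KK S"
proof -
  let ?s = "\<Oplus>\<^bsub>TB.T\<^esub>e\<in>T. ract TB.T (rep e) (c e)"
  have s: "?s \<in> KK S" by (rule TB.TG.subgroup_finsum[OF adjoin_subgroup]) (use assms in \<open>auto intro!: adjoin_gen\<close>)
  have "(z \<ominus>\<^bsub>TB.T\<^esub> ?s) \<oplus>\<^bsub>TB.T\<^esub> ?s \<in> KK S" by (rule adjoin_add[OF adjoin_base[OF d] s])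
  then show ?thesis using z adjoin_closed[OF s] by (simp add: TB.TG.add_diff_cancel)
qed

text \<open>The differential of a basis element involves smaller basis elements only, which again lie in S.\<close>

lemma adjoin_diag_stable:
  assumes down: "\<And>g e. g \<in> S \<Longrightarrow> e \<in> G \<Longrightarrow> (e, g) \<in> r \<Longrightarrow> e \<in> S"
  shows "diag_stable (KK S)"
proof -
  have "dif TB.T t \<in> KK S" if "t \<in> KK S" for t
  proof (rule adjoin_map[OF TB.dif_T_hom _ _ that])
    fix e j b assume e: "e \<in> S" and b: "b \<in> hcomp B j"
    have eG: "e \<in> G" and bc: "b \<in> carrier B" using e S B.A.hcomp_closed[OF b] by auto
    obtain T c where T: "finite T" "T \<subseteq> {e' \<in> G. (e', e) \<in> r \<and> e' \<noteq> e}" "\<forall>e\<in>T. c e \<in> carrier B"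
      "dif TB.T (rep e) \<ominus>\<^bsub>TB.T\<^esub> (\<Oplus>\<^bsub>TB.T\<^esub>e\<in>T. ract TB.T (rep e) (c e)) \<in> I0" using repdif[OF eG] by blast
    have "T \<subseteq> S" using T(2) down[OF e] by blast
    then have "dif TB.T (rep e) \<in> KK S"
      using T rep_closed[OF eG] by (intro adjoin_diff_sum[of _ T c]) auto
    then have "ract TB.T (dif TB.T (rep e)) b \<in> KK S" by (rule adjoin_ract[OF _ bc])
    moreover have "sgs TB.T (deg e) (ract TB.T (rep e) (dif B b)) \<in> KK S"
      using bc by (intro TB.TG.sgs_subgroup[OF adjoin_subgroup adjoin_gen[OF e]]) simp
    ultimately show "dif TB.T (ract TB.T (rep e) b) \<in> KK S"
      using TB.T.leibniz_sgs[OF rep(2)[OF eG] b] bc adjoin_add by simp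
  qed (use I0D in auto)
  then show ?thesis using adjoin_subgroup adjoin_ract adjoin_bdot adjoin_hpart by (auto simp: diag_stable_def)
qed

text \<open>Moving all terms to one side lets linear independence of S together with one more basis element be
  applied directly.\<close>

lemma adjoin_normal:
  assumes "finite S" "z \<in> KK S"
  shows "\<exists>c. (\<forall>e\<in>S. c e \<in> carrier B) \<and> z \<oplus>\<^bsub>TB.T\<^esub> (\<Oplus>\<^bsub>TB.T\<^esub>e\<in>S. ract TB.T (rep e) (c e)) \<in> I0"
  using assms(2)
proof (induction z rule: adjoin.induct)
  case (adjoin_base z)
  have z: "ract TB.T (rep e) \<zero>\<^bsub>B\<^esub> = \<zero>\<^bsub>TB.T\<^esub>" if "e \<in> S" for e
    using addhom_zero[OF B.A.abelian_group_axioms TB.T_abelian TB.T.ract_hom_right] rep_closed that S by blast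
  then have "(\<Oplus>\<^bsub>TB.T\<^esub>e\<in>S. ract TB.T (rep e) \<zero>\<^bsub>B\<^esub>) = (\<Oplus>\<^bsub>TB.T\<^esub>e\<in>S. \<zero>\<^bsub>TB.T\<^esub>)"
    by (intro TB.TG.finsum_cong') auto
  then show ?case using adjoin_base I0D(2)[OF adjoin_base] by (intro exI[of _ "\<lambda>_. \<zero>\<^bsub>B\<^esub>"]) simp
next
  case (adjoin_step e b t)
  then obtain c where c: "\<forall>e\<in>S. c e \<in> carrier B" "t \<oplus>\<^bsub>TB.T\<^esub> (\<Oplus>\<^bsub>TB.T\<^esub>e\<in>S. ract TB.T (rep e) (c e)) \<in> I0" by blast
  let ?c = "c(e := c e \<oplus>\<^bsub>B\<^esub> \<ominus>\<^bsub>B\<^esub> b)"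
  let ?t = "\<lambda>c. \<Oplus>\<^bsub>TB.T\<^esub>e\<in>S - {e}. ract TB.T (rep e) (c e)"
  have eG: "e \<in> G" using adjoin_step(1) S by blast
  have ins: "(\<Oplus>\<^bsub>TB.T\<^esub>e\<in>S. ract TB.T (rep e) (c e)) = ract TB.T (rep e) (c e) \<oplus>\<^bsub>TB.T\<^esub> ?t c"
    if "\<forall>e\<in>S. c e \<in> carrier B" for c
    using TB.TG.finsum_insert[of "S - {e}" e "\<lambda>e. ract TB.T (rep e) (c e)"] assms(1) that adjoin_step(1) gen_closed
    by (simp add: insert_absorb Pi_def)
  have same: "?t ?c = ?t c" using c(1) gen_closed by (intro TB.TG.finsum_cong') auto
  have tc: "?t c \<in> carrier TB.T" using c(1) gen_closed by (intro TB.TG.finsum_closed) auto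
  have c': "\<forall>e\<in>S. ?c e \<in> carrier B" using c(1) adjoin_step by auto
  have n: "ract TB.T (rep e) (c e \<oplus>\<^bsub>B\<^esub> \<ominus>\<^bsub>B\<^esub> b) = ract TB.T (rep e) (c e) \<oplus>\<^bsub>TB.T\<^esub> \<ominus>\<^bsub>TB.T\<^esub> ract TB.T (rep e) b"
    using c(1) adjoin_step rep_closed[OF eG]
      addhom_minus[OF B.A.abelian_group_axioms TB.T_abelian TB.T.ract_hom_right]
    by (simp add: TB.T.ract_add_right)
  have "(ract TB.T (rep e) b \<oplus>\<^bsub>TB.T\<^esub> t) \<oplus>\<^bsub>TB.T\<^esub> (\<Oplus>\<^bsub>TB.T\<^esub>e\<in>S. ract TB.T (rep e) (?c e))
      = t \<oplus>\<^bsub>TB.T\<^esub> (\<Oplus>\<^bsub>TB.T\<^esub>e\<in>S. ract TB.T (rep e) (c e))"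
  proof -
    let ?x = "ract TB.T (rep e) b" and ?y = "ract TB.T (rep e) (c e)"
    have cl: "?x \<in> carrier TB.T" "?y \<in> carrier TB.T" "t \<in> carrier TB.T"
      using gen_closed adjoin_step c(1) adjoin_closed by auto
    have "(\<Oplus>\<^bsub>TB.T\<^esub>e\<in>S. ract TB.T (rep e) (?c e)) = ?y \<oplus>\<^bsub>TB.T\<^esub> \<ominus>\<^bsub>TB.T\<^esub> ?x \<oplus>\<^bsub>TB.T\<^esub> ?t c"
      using ins[OF c'] same n by simp
    moreover have "(?x \<oplus>\<^bsub>TB.T\<^esub> t) \<oplus>\<^bsub>TB.T\<^esub> (?y \<oplus>\<^bsub>TB.T\<^esub> \<ominus>\<^bsub>TB.T\<^esub> ?x \<oplus>\<^bsub>TB.T\<^esub> ?t c)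
        = (?x \<oplus>\<^bsub>TB.T\<^esub> \<ominus>\<^bsub>TB.T\<^esub> ?x) \<oplus>\<^bsub>TB.T\<^esub> (t \<oplus>\<^bsub>TB.T\<^esub> (?y \<oplus>\<^bsub>TB.T\<^esub> ?t c))"
      using cl tc by (simp only: TB.TG.a_ac TB.TG.a_inv_closed TB.TG.add.m_closed)
    ultimately show ?thesis using ins[OF c(1)] cl tc by (simp add: TB.TG.r_neg)
  qed
  then show ?case using c c' by (intro exI[of _ ?c]) simp
qed

end

text \<open>Basis elements are removed from S in decreasing order.\<close>

lemma cocycles_reduce_adjoin:
  assumes ext: "\<And>g. g \<in> G \<Longrightarrow> trivial_group (Ext B (deg g + 1) N N)"
    and "finite S" "S \<subseteq> G" "\<And>g e. g \<in> S \<Longrightarrow> e \<in> G \<Longrightarrow> (e, g) \<in> r \<Longrightarrow> e \<in> S"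
  shows "cocycles_reduce (gen_sub (KK S)) (gen_sub I0)"
  using assms(2-4)
proof (induction "card S" arbitrary: S)
  case 0
  then have S: "S = {}" by simp
  have "KK {} = I0"
  proof
    show "KK {} \<subseteq> I0"
    proof
      fix z assume "z \<in> KK {}"
      then show "z \<in> I0" by (induction rule: adjoin.induct) auto
    qed
  qed (auto intro: adjoin_base)
  then show ?case unfolding S using cocycles_reduce_refl[OF gen_sub_subgroup[OF I0_diag_stable]] by simp
next
  case (Suc k)
  have lin: "total_on G r" "trans r" "refl_on G r" "antisym r"
    using wo unfolding well_order_on_def linear_order_on_def partial_order_on_def preorder_on_def by auto
  have "S \<noteq> {}" using Suc(2) by auto
  then obtain m where m: "m \<in> S" "\<forall>e\<in>S. (e, m) \<in> r" using finite_total_max[OF lin(1-3) Suc(3) _ Suc(4)] by blast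
  let ?S = "S - {m}"
  have mG: "m \<in> G" and sG: "?S \<subseteq> G" using m Suc(4) by auto
  have down: "e \<in> ?S" if "g \<in> ?S" "e \<in> G" "(e, g) \<in> r" for g e
  proof -
    have "e \<in> S" using Suc(5)[of g e] that by auto
    moreover have "e \<noteq> m" using that m(2) lin(4) unfolding antisym_def by blast
    ultimately show ?thesis by simp
  qed
  have IH: "cocycles_reduce (gen_sub (KK ?S)) (gen_sub I0)"
  proof (rule Suc(1)[of ?S])
    show "k = card ?S" using Suc(2,3) m(1) by simp
    show "finite ?S" using Suc(3) by simp
  qed (fact sG, fact down)
  have K: "diag_stable (KK S)" by (rule adjoin_diag_stable[OF Suc(4) Suc(5)])
  have K': "diag_stable (KK ?S)" by (rule adjoin_diag_stable[OF sG down])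
  have mono: "KK ?S \<subseteq> KK S"
  proof
    fix z assume "z \<in> KK ?S"
    then show "z \<in> KK S" by (induction rule: adjoin.induct) (auto intro: adjoin.intros)
  qed
  have mc: "rep m \<in> carrier TB.T" using rep_closed[OF mG] .
  have "cocycles_reduce (gen_sub (KK S)) (gen_sub (KK ?S))"
  proof (rule cocycles_reduce_step[OF K K' mono _ rep(2)[OF mG] _ _ _ _ ext[OF mG]])
    show "rep m \<in> KK S" using adjoin_gen[OF Suc(4) m(1), of "\<one>\<^bsub>B\<^esub>"] mc by (simp add: TB.T.ract_one)
    show "\<exists>b\<in>carrier B. z \<ominus>\<^bsub>TB.T\<^esub> ract TB.T (rep m) b \<in> KK ?S" if "z \<in> KK S" for z
      using that
    proof (induction z rule: adjoin.induct)
      case (adjoin_base z)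
      have "ract TB.T (rep m) \<zero>\<^bsub>B\<^esub> = \<zero>\<^bsub>TB.T\<^esub>"
        by (rule addhom_zero[OF B.A.abelian_group_axioms TB.T_abelian TB.T.ract_hom_right[OF mc]])
      then show ?case
        using adjoin.adjoin_base[OF adjoin_base, of rep ?S] I0D(2)[OF adjoin_base]
        by (intro bexI[of _ "\<zero>\<^bsub>B\<^esub>"]) (auto simp: a_minus_def)
    next
      case (adjoin_step e b t)
      then obtain b' where b': "b' \<in> carrier B" "t \<ominus>\<^bsub>TB.T\<^esub> ract TB.T (rep m) b' \<in> KK ?S" by blast
      have tc: "t \<in> carrier TB.T" using adjoin_closed[OF Suc(4) adjoin_step(3)] .
      have cl: "ract TB.T (rep m) b' \<in> carrier TB.T" "ract TB.T (rep e) b \<in> carrier TB.T"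
        using gen_closed[OF Suc(4)] m(1) adjoin_step b' by auto
      show ?case
      proof (cases "e = m")
        case True
        have "(ract TB.T (rep e) b \<oplus>\<^bsub>TB.T\<^esub> t) \<ominus>\<^bsub>TB.T\<^esub> ract TB.T (rep m) (b' \<oplus>\<^bsub>B\<^esub> b) = t \<ominus>\<^bsub>TB.T\<^esub> ract TB.T (rep m) b'"
          using True mc b' adjoin_step(2) tc cl TB.TG.add_diff_add[of t "ract TB.T (rep m) b'" "ract TB.T (rep m) b"]
          by (simp add: TB.T.ract_add_right TB.TG.a_comm)
        then show ?thesis using b' adjoin_step(2) by (intro bexI[of _ "b' \<oplus>\<^bsub>B\<^esub> b"]) auto
      next
        case False
        then have e: "e \<in> ?S" using adjoin_step(1) by simp
        have "(ract TB.T (rep e) b \<oplus>\<^bsub>TB.T\<^esub> t) \<ominus>\<^bsub>TB.T\<^esub> ract TB.T (rep m) b'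
           = ract TB.T (rep e) b \<oplus>\<^bsub>TB.T\<^esub> (t \<ominus>\<^bsub>TB.T\<^esub> ract TB.T (rep m) b')"
          using tc cl by (simp add: a_minus_def TB.TG.a_assoc)
        then show ?thesis using b' adjoin.adjoin_step[OF e adjoin_step(2) b'(2)] by (intro bexI[of _ b']) auto
      qed
    qed
    show "b = \<zero>\<^bsub>B\<^esub>" if b: "b \<in> carrier B" "ract TB.T (rep m) b \<in> KK ?S" for b
    proof -
      have fin: "finite ?S" using Suc(3) by simp
      obtain c where c: "\<forall>e\<in>?S. c e \<in> carrier B"
        "ract TB.T (rep m) b \<oplus>\<^bsub>TB.T\<^esub> (\<Oplus>\<^bsub>TB.T\<^esub>e\<in>?S. ract TB.T (rep e) (c e)) \<in> I0"
        using adjoin_normal[OF sG fin b(2)] by blast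
      let ?c = "c(m := b)"
      have "(\<Oplus>\<^bsub>TB.T\<^esub>e\<in>S. ract TB.T (rep e) (?c e)) = ract TB.T (rep m) b \<oplus>\<^bsub>TB.T\<^esub> (\<Oplus>\<^bsub>TB.T\<^esub>e\<in>?S. ract TB.T (rep e) (?c e))"
        using TB.TG.finsum_insert[of ?S m "\<lambda>e. ract TB.T (rep e) (?c e)"] fin c(1) b(1) m(1) gen_closed[OF Suc(4)]
        by (simp add: insert_absorb Pi_def)
      also have "(\<Oplus>\<^bsub>TB.T\<^esub>e\<in>?S. ract TB.T (rep e) (?c e)) = (\<Oplus>\<^bsub>TB.T\<^esub>e\<in>?S. ract TB.T (rep e) (c e))"
        using c(1) gen_closed[OF sG] by (intro TB.TG.finsum_cong') auto
      finally have "(\<Oplus>\<^bsub>TB.T\<^esub>e\<in>S. ract TB.T (rep e) (?c e)) \<in> I0" using c(2) by simp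
      then have "?c m = \<zero>\<^bsub>B\<^esub>" using c(1) b(1) m(1) by (intro indep[OF Suc(3,4)]) auto
      then show ?thesis by simp
    qed
    show "dif TB.T (rep m) \<in> KK ?S"
    proof -
      obtain T c where T: "finite T" "T \<subseteq> {e' \<in> G. (e', m) \<in> r \<and> e' \<noteq> m}" "\<forall>e\<in>T. c e \<in> carrier B"
        "dif TB.T (rep m) \<ominus>\<^bsub>TB.T\<^esub> (\<Oplus>\<^bsub>TB.T\<^esub>e\<in>T. ract TB.T (rep e) (c e)) \<in> I0" using repdif[OF mG] by blast
      have "T \<subseteq> ?S" using T(2) Suc(5)[OF m(1)] by blast
      then show ?thesis using T mc by (intro adjoin_diff_sum[OF sG, of _ T c]) auto
    qed
    show "bdot c (rep m) \<ominus>\<^bsub>TB.T\<^esub> sgs TB.T (i * deg m) (ract TB.T (rep m) c) \<in> KK ?S" if "c \<in> hcomp B i" for c i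
      by (rule adjoin_base[OF filtration_comm[OF fil l rep(1)[OF mG] rep(2)[OF mG] that]])
  qed
  then show ?case
    using gen_sub_mono[OF mono] by (intro cocycles_reduce_trans[OF gen_sub_subgroup[OF K] _ _ IH]) auto
qed

lemma adjoin_all: "KK G = Jf l"
proof
  show "KK G \<subseteq> Jf l"
  proof
    fix z assume "z \<in> KK G"
    then show "z \<in> Jf l"
      using filtration_facts(2)[OF fil l]
      by (induction rule: adjoin.induct) (auto intro!: TB.TG.subgroup_add[OF IlD(1)] IlD rep(1))
  qed
  show "Jf l \<subseteq> KK G"
  proof
    fix z assume z: "z \<in> Jf l"
    obtain T c where "finite T" "T \<subseteq> G" "\<forall>e\<in>T. c e \<in> carrier B"
      "z \<ominus>\<^bsub>TB.T\<^esub> (\<Oplus>\<^bsub>TB.T\<^esub>e\<in>T. ract TB.T (rep e) (c e)) \<in> I0" using span[OF z] by blast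
    then show "z \<in> KK G" using IlD(2)[OF z] by (intro adjoin_diff_sum[OF order_refl, of z T c]) auto
  qed
qed

end

lemma cocycles_reduce_filtration:
  assumes fil: "diagonal_filtration A \<phi> B Jf" and l: "l \<ge> 1"
    and fs: "finite_semifree B (subquotient A \<phi> B (Jf l) (Jf (Suc l)))"
    and ext: "\<And>i. i \<ge> 1 \<Longrightarrow> trivial_group (Ext B i N N)"
  shows "cocycles_reduce (gen_sub (Jf l)) (gen_sub (Jf (Suc l)))"
proof -
  obtain G r where G: "finite G" "semifree_basis B (subquotient A \<phi> B (Jf l) (Jf (Suc l))) G r"
    using fs by (auto simp: finite_semifree_def)
  have wo: "well_order_on G r" using G(2) by (simp add: semifree_basis_def)
  show ?thesis
  proof (rule subquotient_basis[OF fil l G(2)])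
    fix rep deg assume *:
    "\<And>g. g \<in> G \<Longrightarrow> rep g \<in> Jf l" "\<And>g. g \<in> G \<Longrightarrow> rep g \<in> hcomp TB.T (deg g)" "\<And>g. g \<in> G \<Longrightarrow> deg g \<ge> int l"
    "\<And>z. z \<in> Jf l \<Longrightarrow> \<exists>T c. finite T \<and> T \<subseteq> G \<and> (\<forall>e\<in>T. c e \<in> carrier B)
        \<and> z \<ominus>\<^bsub>TB.T\<^esub> (\<Oplus>\<^bsub>TB.T\<^esub>e\<in>T. ract TB.T (rep e) (c e)) \<in> Jf (Suc l)"
    "\<And>T c e. finite T \<Longrightarrow> T \<subseteq> G \<Longrightarrow> (\<And>e. e \<in> T \<Longrightarrow> c e \<in> carrier B) \<Longrightarrow>
        (\<Oplus>\<^bsub>TB.T\<^esub>e\<in>T. ract TB.T (rep e) (c e)) \<in> Jf (Suc l) \<Longrightarrow> e \<in> T \<Longrightarrow> c e = \<zero>\<^bsub>B\<^esub>"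
    "\<And>g. g \<in> G \<Longrightarrow> \<exists>T c. finite T \<and> T \<subseteq> {e \<in> G. (e, g) \<in> r \<and> e \<noteq> g} \<and> (\<forall>e\<in>T. c e \<in> carrier B)
        \<and> dif TB.T (rep g) \<ominus>\<^bsub>TB.T\<^esub> (\<Oplus>\<^bsub>TB.T\<^esub>e\<in>T. ract TB.T (rep e) (c e)) \<in> Jf (Suc l)"
  have e: "trivial_group (Ext B (deg g + 1) N N)" if "g \<in> G" for g
    using *(3)[OF that] by (intro ext) simp
  have "cocycles_reduce (gen_sub (adjoin (Jf (Suc l)) rep G)) (gen_sub (Jf (Suc l)))"
    by (rule cocycles_reduce_adjoin[where Jf = Jf and l = l and G = G and r = r and rep = rep and deg = deg and S = G])
      (fact fil l wo * e G(1) order_refl | assumption)+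
  moreover have "adjoin (Jf (Suc l)) rep G = Jf l"
    by (rule adjoin_all[where Jf = Jf and l = l and G = G and r = r and rep = rep and deg = deg]) (fact fil l wo *)+
  ultimately show ?thesis by simp
  qed
qed

end

section \<open>Passing to the limit\<close>

lemma bounded_below_bound:
  assumes "bounded_below N"
  obtains k where "\<And>i x. x \<in> hcomp N i \<Longrightarrow> i < k \<Longrightarrow> x = \<zero>\<^bsub>N\<^esub>"
proof -
  obtain m :: real where m: "ereal m < dg_inf N"
    using assms ereal_dense2[of "- \<infinity>" "dg_inf N"] by (auto simp: bounded_below_def)
  show thesis
  proof (rule that[of "\<lfloor>m\<rfloor>"])
    fix i x assume x: "x \<in> hcomp N i" and i: "i < \<lfloor>m\<rfloor>"
    show "x = \<zero>\<^bsub>N\<^esub>"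
    proof (rule ccontr)
      assume "x \<noteq> \<zero>\<^bsub>N\<^esub>"
      then have "dg_inf N \<le> ereal (real_of_int i)" unfolding dg_inf_def using x by (intro INF_lower) auto
      with m have "ereal m < ereal (real_of_int i)" by (rule less_le_trans)
      then have "m < real_of_int i" by simp
      then show False using i by linarith
    qed
  qed
qed

context lift_setup
begin

lemma hom_dif_diff:
  assumes "lin_map B N TN.T 0 s" "lin_map B N TN.T 0 t" "x \<in> carrier N"
  shows "hom_dif (\<lambda>x. s x \<ominus>\<^bsub>TN.T\<^esub> t x) x = hom_dif s x \<ominus>\<^bsub>TN.T\<^esub> hom_dif t x"
  using assms(3) lin_map_closed[OF assms(1)] lin_map_closed[OF assms(2)]
  by (simp add: hom_dif_def addhom_diff[OF TN.T_abelian TN.T_abelian TN.dif_T_hom])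
    (simp add: a_minus_def TN.TG.minus_add TN.TG.a_ac)

text \<open>The l-th correction takes values in \<open>gen_sub (K (l + 1))\<close>, which vanishes in degrees below
  \<open>k + l + 1\<close>.  So on each element the corrected maps become stationary, and the obstruction of the limit
  lies in all \<open>gen_sub (K l)\<close>.\<close>

lemma cocycles_reduce_limit:
  assumes K: "\<And>l. l \<ge> 1 \<Longrightarrow> diag_stable (K l)" and dec: "\<And>l. l \<ge> 1 \<Longrightarrow> K (Suc l) \<subseteq> K l"
    and c: "\<And>l. l \<ge> 1 \<Longrightarrow> cocycles_reduce (gen_sub (K l)) (gen_sub (K (Suc l)))"
    and low: "\<And>l t d. l \<ge> 1 \<Longrightarrow> t \<in> gen_sub (K l) \<Longrightarrow> t \<in> hcomp TN.T d \<Longrightarrow> d < k + int l \<Longrightarrow> t = \<zero>\<^bsub>TN.T\<^esub>"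
    and s0: "lin_map B N TN.T 0 s0" "\<And>x. x \<in> carrier N \<Longrightarrow> hom_dif s0 x \<in> gen_sub (K 1)"
  shows "\<exists>s. lin_map B N TN.T 0 s \<and> (\<forall>x\<in>carrier N. hom_dif s x = \<zero>\<^bsub>TN.T\<^esub>)
     \<and> (\<forall>x\<in>carrier N. s x \<ominus>\<^bsub>TN.T\<^esub> s0 x \<in> gen_sub (K 1))"
proof -
  let ?P = "\<lambda>l s. lin_map B N TN.T 0 s \<and> (\<forall>x\<in>carrier N. hom_dif s x \<in> gen_sub (K (Suc l)))
     \<and> (\<forall>x\<in>carrier N. s x \<ominus>\<^bsub>TN.T\<^esub> s0 x \<in> gen_sub (K 1))"
  let ?R = "\<lambda>l s t. \<forall>x\<in>carrier N. t x \<ominus>\<^bsub>TN.T\<^esub> s x \<in> gen_sub (K (Suc l))"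
  have V: "subgroup (gen_sub (K (Suc l))) (add_monoid TN.T)" for l by (rule gen_sub_subgroup[OF K]) simp
  have V1: "subgroup (gen_sub (K 1)) (add_monoid TN.T)" by (rule gen_sub_subgroup[OF K]) simp
  have sub1: "gen_sub (K (Suc l)) \<subseteq> gen_sub (K 1)" for l
  proof (induction l)
    case (Suc l)
    then show ?case using gen_sub_mono[OF dec[of "Suc l"]] by auto
  qed simp
  have base: "?P 0 s0"
    using s0 lin_map_closed[OF s0(1)] TN.TG.subgroup_zero[OF V1] by (auto simp: a_minus_def TN.TG.r_neg)
  have step: "\<exists>t. ?P (Suc l) t \<and> ?R l s t" if "?P l s" for l s
  proof -
    have s: "lin_map B N TN.T 0 s" "\<forall>x\<in>carrier N. hom_dif s x \<in> gen_sub (K (Suc l))"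
      "\<forall>x\<in>carrier N. s x \<ominus>\<^bsub>TN.T\<^esub> s0 x \<in> gen_sub (K 1)" using that by auto
    obtain u where u: "lin_map B N TN.T 0 u" "\<forall>x\<in>carrier N. u x \<in> gen_sub (K (Suc l))"
      "\<forall>x\<in>carrier N. hom_dif s x \<ominus>\<^bsub>TN.T\<^esub> hom_dif u x \<in> gen_sub (K (Suc (Suc l)))"
      using cocycles_reduceE[OF c[of "Suc l"] hom_dif_lin_map[OF s(1)]] s(2) hom_dif_anticomm[OF s(1)] by auto
    let ?t = "\<lambda>x. s x \<ominus>\<^bsub>TN.T\<^esub> u x"
    note cl = lin_map_closed[OF s(1)] lin_map_closed[OF u(1)] lin_map_closed[OF s0(1)]
    have "lin_map B N TN.T 0 ?t" by (rule lin_map_diff[OF TN.T_module s(1) u(1)])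
    moreover have "\<forall>x\<in>carrier N. hom_dif ?t x \<in> gen_sub (K (Suc (Suc l)))" using u(3) hom_dif_diff[OF s(1) u(1)] by simp
    moreover have "?t x \<ominus>\<^bsub>TN.T\<^esub> s x \<in> gen_sub (K (Suc l))" if x: "x \<in> carrier N" for x
    proof -
      have "?t x \<ominus>\<^bsub>TN.T\<^esub> s x = \<ominus>\<^bsub>TN.T\<^esub> u x \<oplus>\<^bsub>TN.T\<^esub> (s x \<oplus>\<^bsub>TN.T\<^esub> \<ominus>\<^bsub>TN.T\<^esub> s x)"
        unfolding a_minus_def using cl[OF x] by (simp only: TN.TG.a_ac TN.TG.a_inv_closed TN.TG.add.m_closed)
      also have "\<dots> = \<ominus>\<^bsub>TN.T\<^esub> u x" using cl[OF x] by (simp add: TN.TG.r_neg)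
      finally show ?thesis using TN.TG.subgroup_neg[OF V] u(2) x by simp
    qed
    moreover have "?t x \<ominus>\<^bsub>TN.T\<^esub> s0 x \<in> gen_sub (K 1)" if x: "x \<in> carrier N" for x
    proof -
      have "?t x \<ominus>\<^bsub>TN.T\<^esub> s0 x = (s x \<ominus>\<^bsub>TN.T\<^esub> s0 x) \<ominus>\<^bsub>TN.T\<^esub> u x"
        unfolding a_minus_def using cl[OF x] by (simp only: TN.TG.a_ac TN.TG.a_inv_closed TN.TG.add.m_closed)
      moreover have "u x \<in> gen_sub (K 1)" using u(2) x sub1 by blast
      ultimately show ?thesis using TN.TG.subgroup_diff[OF V1] s(3) x by simp
    qed
    ultimately show ?thesis by blast
  qed
  have "\<exists>S. \<forall>l. ?P l (S l) \<and> ?R l (S l) (S (Suc l))"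
    by (rule dependent_nat_choice[of ?P ?R, OF exI[of "?P 0", OF base] step])
  then obtain S where S0: "\<forall>l. ?P l (S l) \<and> ?R l (S l) (S (Suc l))" by (elim exE)
  have S: "?P l (S l)" "?R l (S l) (S (Suc l))" for l
    by (rule conjunct1[OF S0[THEN spec[of _ l]]], rule conjunct2[OF S0[THEN spec[of _ l]]])
  have Sg: "lin_map B N TN.T 0 (S l)" for l using S(1) by blast
  have SD: "hom_dif (S l) x \<in> gen_sub (K (Suc l))" if "x \<in> carrier N" for l x using S(1) that by blast
  note Sc = lin_map_closed[OF Sg]
  have stab: "S (Suc l) x = S l x" if x: "x \<in> hcomp N d" and l: "d < k + int (Suc l)" for x d l
  proof -
    have xc: "x \<in> carrier N" using N.hcomp_closed[OF x] .
    have "S (Suc l) x \<ominus>\<^bsub>TN.T\<^esub> S l x \<in> hcomp TN.T d"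
      using lin_map_degree[OF Sg x, of l] lin_map_degree[OF Sg x, of "Suc l"] TN.TG.subgroup_diff[OF TN.hcomp_T_subgroup] by simp
    then have "S (Suc l) x \<ominus>\<^bsub>TN.T\<^esub> S l x = \<zero>\<^bsub>TN.T\<^esub>"
      using low[of "Suc l" _ d] S(2) xc l by auto
    then show ?thesis by (rule TN.TG.minus_eq_zeroD[OF Sc[OF xc] Sc[OF xc]])
  qed
  have ev: "\<exists>y. eventually (\<lambda>l. S l x = y) sequentially" if "x \<in> carrier N" for x
    using that
  proof (induction x rule: N.homog_induct)
    case (homog d x)
    define L where "L = nat (d - k)"
    have "S l x = S L x" if "l \<ge> L" for l
      using that
    proof (induction l rule: dec_induct)
      case (step l)
      then have "d < k + int (Suc l)" by (auto simp: L_def)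
      then show ?case using stab[OF homog] step by simp
    qed simp
    then show ?case by (auto simp: eventually_sequentially)
  next
    case (add x y)
    then obtain u v where "eventually (\<lambda>l. S l x = u) sequentially" "eventually (\<lambda>l. S l y = v) sequentially" by blast
    then have "eventually (\<lambda>l. S l (x \<oplus>\<^bsub>N\<^esub> y) = u \<oplus>\<^bsub>TN.T\<^esub> v) sequentially"
      by eventually_elim (simp add: addhom_add[OF lin_map_hom[OF Sg]] add)
    then show ?case by blast
  qed
  define s where "s x = (SOME y. eventually (\<lambda>l. S l x = y) sequentially)" for x
  have s: "eventually (\<lambda>l. S l x = s x) sequentially" if "x \<in> carrier N" for x
    using someI_ex[OF ev[OF that]] by (simp add: s_def)
  have now: "P" if "eventually (\<lambda>l. P) sequentially" for P
    using that unfolding eventually_sequentially by blast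
  have s_lin_map: "lin_map B N TN.T 0 s"
    unfolding lin_map_def
  proof (intro conjI ballI allI)
    show "addhom N TN.T s"
    proof (rule addhomI)
      show "s x \<in> carrier TN.T" if "x \<in> carrier N" for x
        by (rule now, rule eventually_mono[OF s[OF that]]) (metis Sc[OF that])
      show "s (x \<oplus>\<^bsub>N\<^esub> y) = s x \<oplus>\<^bsub>TN.T\<^esub> s y" if xy: "x \<in> carrier N" "y \<in> carrier N" for x y
      proof (rule now)
        show "eventually (\<lambda>l. s (x \<oplus>\<^bsub>N\<^esub> y) = s x \<oplus>\<^bsub>TN.T\<^esub> s y) sequentially"
          using s[OF xy(1)] s[OF xy(2)] s[OF N.a_closed[OF xy]]
          by eventually_elim (metis addhom_add[OF lin_map_hom[OF Sg]] xy)
      qed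
    qed
    show "s (ract N x b) = ract TN.T (s x) b" if x: "x \<in> carrier N" and b: "b \<in> carrier B" for x b
    proof (rule now)
      show "eventually (\<lambda>l. s (ract N x b) = ract TN.T (s x) b) sequentially"
        using s[OF x] s[OF N.ract_closed[OF x b]] by eventually_elim (metis lin_map_lin[OF Sg] x b)
    qed
    show "s x \<in> hcomp TN.T (i + 0)" if x: "x \<in> hcomp N i" for x i
    proof (rule now)
      show "eventually (\<lambda>l. s x \<in> hcomp TN.T (i + 0)) sequentially"
        using s[OF N.hcomp_closed[OF x]] by eventually_elim (metis lin_map_degree[OF Sg] x)
    qed
  qed
  have "hom_dif s x = \<zero>\<^bsub>TN.T\<^esub>" if x: "x \<in> carrier N" for x
  proof (rule N.addhom_eqI[OF TN.T_abelian hom_dif_hom[OF lin_map_hom[OF s_lin_map]] addhom_const_zero[OF TN.T_abelian] x])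
    fix d x assume x: "x \<in> hcomp N d"
    have xc: "x \<in> carrier N" using N.hcomp_closed[OF x] .
    show "hom_dif s x = \<zero>\<^bsub>TN.T\<^esub>"
    proof (rule now)
      have "eventually (\<lambda>l. l \<ge> nat (d - k)) sequentially" by (rule eventually_ge_at_top)
      then show "eventually (\<lambda>l. hom_dif s x = \<zero>\<^bsub>TN.T\<^esub>) sequentially"
        using s[OF xc] s[OF N.dif_closed[OF xc]]
      proof eventually_elim
        case (elim l)
        have "hom_dif s x = hom_dif (S l) x" using elim by (simp add: hom_dif_def)
        moreover have "hom_dif (S l) x \<in> hcomp TN.T (d - 1)" using lin_map_degree[OF hom_dif_lin_map[OF Sg] x] by simp
        moreover have "d - 1 < k + int (Suc l)" using elim(1) by auto
        ultimately show ?case using low[of "Suc l" _ "d - 1"] SD[OF xc, of l] by simp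
      qed
    qed
  qed
  moreover have "s x \<ominus>\<^bsub>TN.T\<^esub> s0 x \<in> gen_sub (K 1)" if x: "x \<in> carrier N" for x
  proof (rule now)
    show "eventually (\<lambda>l. s x \<ominus>\<^bsub>TN.T\<^esub> s0 x \<in> gen_sub (K 1)) sequentially"
      using s[OF x] by eventually_elim (use S(1) x in metis)
  qed
  ultimately show ?thesis using s_lin_map by blast
qed

lemma pi_mod_ndot:
  assumes "x \<in> carrier N" "z \<in> carrier TB.T"
  shows "pi_mod N (ndot x z) = ract N x (pi_alg B z)"
  by (rule TB.tens_hom_eqI[OF addhom_compose[OF ndot_hom pi_mod_hom] addhom_compose[OF pi_alg_hom N.ract_hom_right]])
    (use assms in \<open>auto simp: ndot_pure pi_mod_pure pi_alg_pure B.A.hcomp_closed N.ract_closed N.ract_mult\<close>)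

lemma pi_mod_gen_sub:
  assumes "t \<in> gen_sub (diagonal_ideal A \<phi> B)"
  shows "t \<in> carrier TN.T \<and> pi_mod N t = \<zero>\<^bsub>N\<^esub>"
  using assms
proof (induction t rule: gen_sub.induct)
  case gen_sub_zero
  then show ?case using addhom_zero[OF TN.T_abelian N.abelian_group_axioms pi_mod_hom] by simp
next
  case (gen_sub_step x z t)
  then show ?case
    by (auto simp: diagonal_ideal_eq addhom_add[OF pi_mod_hom] ndot_closed pi_mod_ndot)
qed

text \<open>The graded section \<open>f \<mapsto> f \<otimes> 1\<close> of \<open>\<pi>\<^sub>N\<close> is corrected to a chain map by maps with values in the
  kernel.\<close>

lemma naive_lifting:
  assumes sm: "dg_smooth A \<phi> B" and bb: "bounded_below N"
    and ext: "\<And>i. i \<ge> 1 \<Longrightarrow> trivial_group (Ext B i N N)"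
  shows "naively_liftable A \<phi> B N"
proof -
  obtain Jf where fil: "diagonal_filtration A \<phi> B Jf"
    and fs: "\<And>l. l \<ge> 1 \<Longrightarrow> finite_semifree B (subquotient A \<phi> B (Jf l) (Jf (l + 1)))"
    using sm by (auto simp: dg_smooth_def)
  have J1: "Jf 1 = diagonal_ideal A \<phi> B" using filtration_facts(3)[OF fil, of 1] by simp
  obtain k where k: "\<And>i x. x \<in> hcomp N i \<Longrightarrow> i < k \<Longrightarrow> x = \<zero>\<^bsub>N\<^esub>" using bounded_below_bound[OF bb] by blast
  define s0 where "s0 = NB.lin_ext TN.T (\<lambda>f. TN.tn f \<one>\<^bsub>B\<^esub>)"
  have deg: "TN.tn f \<one>\<^bsub>B\<^esub> \<in> hcomp TN.T (NB.bdeg f + 0)" if "f \<in> F" for f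
    using TN.tn_degree[OF _ B.one_degree, of f "NB.bdeg f"] NB.basis_homog[OF that] by simp
  have s0: "lin_map B N TN.T 0 s0" unfolding s0_def by (rule NB.lin_ext_lin_map[OF TN.T_module deg])
  have pi: "lin_map B TN.T N 0 (pi_mod N)"
    using pi_mod_dg_hom by (auto simp: dg_hom_def lin_map_def image_subset_iff)
  have id: "lin_map B N N 0 (\<lambda>x. x)" using addhom_id[of N] by (simp add: lin_map_def)
  have pis0: "pi_mod N (s0 x) = x" if "x \<in> carrier N" for x
    using that
    by (rule NB.lin_map_eqI[OF N.dg_module_axioms lin_map_compose[OF s0 pi] id, rotated])
      (simp add: s0_def NB.lin_ext_basis[OF TN.T_module deg] pi_mod_pure NB.basis_closed N.ract_one)
  have pid: "pi_mod N (dif TN.T t) = dif N (pi_mod N t)" if "t \<in> carrier TN.T" for t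
    using pi_mod_dg_hom that by (simp add: dg_hom_def)
  have D0: "hom_dif s0 x \<in> gen_sub (Jf 1)" if x: "x \<in> carrier N" for x
    unfolding J1
  proof (rule pi_mod_kernel)
    show "diag_stable (diagonal_ideal A \<phi> B)" using filtration_facts(1)[OF fil, of 1] J1 by simp
    show "hom_dif s0 x \<in> carrier TN.T" using addhom_closed[OF hom_dif_hom[OF lin_map_hom[OF s0]] x] .
    show "pi_mod N (hom_dif s0 x) = \<zero>\<^bsub>N\<^esub>"
      unfolding hom_dif_def using x lin_map_closed[OF s0]
      by (simp add: addhom_diff[OF TN.T_abelian N.abelian_group_axioms pi_mod_hom] pid pis0)
        (simp add: a_minus_def N.r_neg)
  qed
  have "\<exists>s. lin_map B N TN.T 0 s \<and> (\<forall>x\<in>carrier N. hom_dif s x = \<zero>\<^bsub>TN.T\<^esub>)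
     \<and> (\<forall>x\<in>carrier N. s x \<ominus>\<^bsub>TN.T\<^esub> s0 x \<in> gen_sub (Jf 1))"
  proof (rule cocycles_reduce_limit[where K = Jf and k = k and ?s0.0 = s0, OF _ _ _ _ s0 D0])
    fix l :: nat assume l: "l \<ge> 1"
    show "diag_stable (Jf l)" "Jf (Suc l) \<subseteq> Jf l" using filtration_facts(1,2)[OF fil l] by auto
    show "cocycles_reduce (gen_sub (Jf l)) (gen_sub (Jf (Suc l)))"
      using cocycles_reduce_filtration[OF fil l _ ext] fs[OF l] by simp
    show "t = \<zero>\<^bsub>TN.T\<^esub>" if "t \<in> gen_sub (Jf l)" "t \<in> hcomp TN.T d" "d < k + int l" for t d
      by (rule gen_sub_low[OF filtration_facts(1)[OF fil l] k filtration_facts(5)[OF fil l] that])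
  qed
  then obtain s where s: "lin_map B N TN.T 0 s" "\<And>x. x \<in> carrier N \<Longrightarrow> hom_dif s x = \<zero>\<^bsub>TN.T\<^esub>"
    "\<And>x. x \<in> carrier N \<Longrightarrow> s x \<ominus>\<^bsub>TN.T\<^esub> s0 x \<in> gen_sub (Jf 1)" by blast
  note sc = lin_map_closed[OF s(1)]
  have "s (dif N x) = dif TN.T (s x)" if x: "x \<in> carrier N" for x
    using TN.TG.minus_eq_zeroD[OF _ _ s(2)[OF x, unfolded hom_dif_def]] sc x by simp
  then have "dg_hom B N TN.T s"
    using s(1) by (auto simp: dg_hom_def lin_map_def)
  moreover have "pi_mod N (s x) = x" if x: "x \<in> carrier N" for x
  proof -
    have "pi_mod N (s x \<ominus>\<^bsub>TN.T\<^esub> s0 x) = \<zero>\<^bsub>N\<^esub>" using pi_mod_gen_sub[of "s x \<ominus>\<^bsub>TN.T\<^esub> s0 x"] s(3)[OF x] J1 by simp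
    then have "pi_mod N (s x) \<ominus>\<^bsub>N\<^esub> x = \<zero>\<^bsub>N\<^esub>"
      using sc[OF x] lin_map_closed[OF s0 x] by (simp add: addhom_diff[OF TN.T_abelian N.abelian_group_axioms pi_mod_hom] pis0[OF x])
    then show ?thesis by (rule N.minus_eq_zeroD[OF addhom_closed[OF pi_mod_hom sc[OF x]] x])
  qed
  ultimately show ?thesis unfolding naively_liftable_def by blast
qed

end

section \<open>Semifreeness of N over A\<close>

lemma (in dg_module) ract_zero_right: "abelian_group B \<Longrightarrow> x \<in> carrier N \<Longrightarrow> ract N x \<zero>\<^bsub>B\<^esub> = \<zero>"
  by (rule addhom_zero[OF _ abelian_group_axioms ract_hom_right])

lemma (in dg_module) trivial_semifree:
  assumes B: "abelian_group B" and one: "\<one>\<^bsub>B\<^esub> = \<zero>\<^bsub>B\<^esub>"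
  shows "semifree B N"
proof -
  have z: "x = \<zero>" if "x \<in> carrier N" for x
    using ract_one[OF that] ract_zero_right[OF B that] one by simp
  have "rspan B N {} = carrier N"
    using z zero_closed by (auto simp: rspan_def)
  then have "semifree_basis B N {} {}"
    by (simp add: semifree_basis_def graded_basis_def)
  then show ?thesis unfolding semifree_def by blast
qed

lemma rspan_add:
  assumes N: "dg_module B N" and B: "ring B" and H: "H \<subseteq> carrier N" and x: "x \<in> rspan B N H" and y: "y \<in> rspan B N H"
  shows "x \<oplus>\<^bsub>N\<^esub> y \<in> rspan B N H"
proof -
  interpret N: dg_module B N by fact
  interpret B: ring B by fact
  obtain T c where T: "finite T" "T \<subseteq> H" "c ` T \<subseteq> carrier B" "x = (\<Oplus>\<^bsub>N\<^esub>e\<in>T. ract N e (c e))"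
    using x by (auto simp: rspan_def)
  obtain T' c' where T': "finite T'" "T' \<subseteq> H" "c' ` T' \<subseteq> carrier B" "y = (\<Oplus>\<^bsub>N\<^esub>e\<in>T'. ract N e (c' e))"
    using y by (auto simp: rspan_def)
  define d where "d e = (if e \<in> T then c e else \<zero>\<^bsub>B\<^esub>)" for e
  define d' where "d' e = (if e \<in> T' then c' e else \<zero>\<^bsub>B\<^esub>)" for e
  let ?U = "T \<union> T'"
  have dc: "d e \<in> carrier B" "d' e \<in> carrier B" for e using T T' by (auto simp: d_def d'_def)
  have UH: "e \<in> ?U \<Longrightarrow> e \<in> carrier N" for e using T T' H by blast
  have 1: "x = (\<Oplus>\<^bsub>N\<^esub>e\<in>?U. ract N e (d e))"
  proof -
    have "x = (\<Oplus>\<^bsub>N\<^esub>e\<in>T. ract N e (d e))"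
      unfolding T(4) using UH dc by (intro N.finsum_cong') (auto simp: d_def intro!: N.ract_closed)
    also have "\<dots> = (\<Oplus>\<^bsub>N\<^esub>e\<in>?U. ract N e (d e))"
      using UH dc T T' N.ract_zero_right[OF B.abelian_group_axioms]
      by (intro N.finsum_mono_neutral[symmetric]) (auto simp: d_def intro!: N.ract_closed)
    finally show ?thesis .
  qed
  have 2: "y = (\<Oplus>\<^bsub>N\<^esub>e\<in>?U. ract N e (d' e))"
  proof -
    have "y = (\<Oplus>\<^bsub>N\<^esub>e\<in>T'. ract N e (d' e))"
      unfolding T'(4) using UH dc by (intro N.finsum_cong') (auto simp: d'_def intro!: N.ract_closed)
    also have "\<dots> = (\<Oplus>\<^bsub>N\<^esub>e\<in>?U. ract N e (d' e))"
      using UH dc T T' N.ract_zero_right[OF B.abelian_group_axioms]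
      by (intro N.finsum_mono_neutral[symmetric]) (auto simp: d'_def intro!: N.ract_closed)
    finally show ?thesis .
  qed
  have "x \<oplus>\<^bsub>N\<^esub> y = (\<Oplus>\<^bsub>N\<^esub>e\<in>?U. ract N e (d e) \<oplus>\<^bsub>N\<^esub> ract N e (d' e))"
    unfolding 1 2 using UH dc by (intro N.finsum_addf[symmetric]) (auto intro!: N.ract_closed)
  also have "\<dots> = (\<Oplus>\<^bsub>N\<^esub>e\<in>?U. ract N e (d e \<oplus>\<^bsub>B\<^esub> d' e))"
    using UH dc by (intro N.finsum_cong') (auto intro!: N.ract_closed simp: N.ract_add_right)
  finally show ?thesis
    unfolding rspan_def using T T' dc by (auto intro!: exI[of _ ?U] exI[of _ "\<lambda>e. d e \<oplus>\<^bsub>B\<^esub> d' e"])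
qed

lemma rspan_single:
  assumes N: "dg_module B N" and "h \<in> H" "h \<in> carrier N" "b \<in> carrier B"
  shows "ract N h b \<in> rspan B N H"
proof -
  interpret N: dg_module B N by fact
  show ?thesis
    unfolding rspan_def using assms N.ract_closed
    by (auto intro!: exI[of _ "{h}"] exI[of _ "\<lambda>_. b"])
qed

lemma rspan_zero: "dg_module B N \<Longrightarrow> \<zero>\<^bsub>N\<^esub> \<in> rspan B N H"
proof -
  assume "dg_module B N"
  then interpret N: dg_module B N .
  show ?thesis unfolding rspan_def by (auto intro!: exI[of _ "{}"])
qed

context based_module
begin

lemma basis_nonzero:
  assumes "\<one>\<^bsub>B\<^esub> \<noteq> \<zero>\<^bsub>B\<^esub>" "f \<in> F"
  shows "f \<noteq> \<zero>\<^bsub>N\<^esub>"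
proof
  assume "f = \<zero>\<^bsub>N\<^esub>"
  then have "(\<Oplus>\<^bsub>N\<^esub>e\<in>{f}. ract N e \<one>\<^bsub>B\<^esub>) = \<zero>\<^bsub>N\<^esub>"
    using basis_closed[OF assms(2)] by (simp add: N.ract_one)
  then show False using basis_indep[of "{f}" "\<lambda>_. \<one>\<^bsub>B\<^esub>" f] assms by auto
qed

text \<open>Order a basis by degree.  The coefficient of e in \<open>d f\<close> has degree \<open>|f| - 1 - |e|\<close>, which is
  negative unless e precedes f; and the lower bound makes the order a well-order.\<close>

lemma semifree_bounded_below:
  assumes k: "\<And>i x. x \<in> hcomp N i \<Longrightarrow> i < k \<Longrightarrow> x = \<zero>\<^bsub>N\<^esub>"
  shows "semifree B N"
proof (cases "\<one>\<^bsub>B\<^esub> = \<zero>\<^bsub>B\<^esub>")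
  case True
  then show ?thesis by (rule N.trivial_semifree[OF B.A.abelian_group_axioms])
next
  case False
  \<comment> \<open>Over a nonzero ring basis elements are nonzero and respect the lower bound.\<close>
  have low: "bdeg f \<ge> k" if "f \<in> F" for f
    using k[OF basis_homog[OF that]] basis_nonzero[OF False that] by force
  obtain r0 where r0: "well_order_on F r0" using well_order_on by blast
  have r0': "refl_on F r0" "trans r0" "antisym r0" "total_on F r0" "wf (r0 - Id)"
    using r0 unfolding well_order_on_def linear_order_on_def partial_order_on_def preorder_on_def by auto
  define r where "r = {(f, g). f \<in> F \<and> g \<in> F \<and> (bdeg f < bdeg g \<or> bdeg f = bdeg g \<and> (f, g) \<in> r0)}"
  have "well_order_on F r"
    unfolding well_order_on_def linear_order_on_def partial_order_on_def preorder_on_def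
  proof (intro conjI)
    show "wf (r - Id)"
    proof (rule wf_subset)
      show "wf (inv_image (less_than <*lex*> (r0 - Id)) (\<lambda>f. (nat (bdeg f - k), f)))"
        using r0'(5) by (intro wf_inv_image wf_lex_prod) auto
      show "r - Id \<subseteq> inv_image (less_than <*lex*> (r0 - Id)) (\<lambda>f. (nat (bdeg f - k), f))"
      proof
        fix p assume "p \<in> r - Id"
        then obtain a b where p: "p = (a, b)" "a \<in> F" "b \<in> F" "a \<noteq> b" "bdeg a < bdeg b \<or> bdeg a = bdeg b \<and> (a, b) \<in> r0"
          by (auto simp: r_def)
        then show "p \<in> inv_image (less_than <*lex*> (r0 - Id)) (\<lambda>f. (nat (bdeg f - k), f))"
          using low[OF p(2)] low[OF p(3)] by (auto simp: inv_image_def)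
      qed
    qed
    show "trans r" using r0'(2) by (auto simp: r_def trans_def) 
    show "antisym r" using r0'(3) by (auto simp: r_def antisym_def)
    show "total_on F r" using r0'(4) by (auto simp: r_def total_on_def)
  qed (use r0'(1) in \<open>auto simp: r_def refl_on_def\<close>)
  moreover have "dif N f \<in> rspan B N {e \<in> F. (e, f) \<in> r \<and> e \<noteq> f}" if f: "f \<in> F" for f
  proof -
    have dh: "dif N f \<in> hcomp N (bdeg f - 1)" using N.dif_degree[OF basis_homog[OF f]] .
    have dc: "dif N f \<in> carrier N" using N.hcomp_closed[OF dh] .
    have "bdeg e < bdeg f" if e: "e \<in> csupp (dif N f)" for e
    proof (rule ccontr)
      assume "\<not> bdeg e < bdeg f"
      then have "hcomp B (bdeg f - 1 - bdeg e) = {\<zero>\<^bsub>B\<^esub>}" by (intro B.nonneg) simp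
      moreover have "e \<in> F" using csupp(2)[OF dc] e by blast
      ultimately have "coord (dif N f) e = \<zero>\<^bsub>B\<^esub>" using coord_degree[OF dh] by auto
      then show False using e by (simp add: csupp_def)
    qed
    then have sub: "csupp (dif N f) \<subseteq> {e \<in> F. (e, f) \<in> r \<and> e \<noteq> f}"
      using csupp(2)[OF dc] f by (auto simp: r_def)
    show ?thesis
      unfolding rspan_def using sub csupp[OF dc] coord_sum[OF dc csupp(1)[OF dc] order_refl csupp(2)[OF dc]] dc
      by (auto intro!: exI[of _ "csupp (dif N f)"] exI[of _ "coord (dif N f)"])
  qed
  ultimately have "semifree_basis B N F r" using basis by (simp add: semifree_basis_def)
  then show ?thesis unfolding semifree_def by blast
qed

end

context lift_setup
begin

text \<open>For independence, the coordinate along f isolates the products f g with this first factor, and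
  leaves a relation between the g.\<close>

lemma restrict_basis:
  assumes G: "graded_basis A BA G" and one: "\<one>\<^bsub>A\<^esub> \<noteq> \<zero>\<^bsub>A\<^esub>"
  shows "graded_basis A NA {ract N f g | f g. f \<in> F \<and> g \<in> G}"
proof -
  interpret BG: based_module R A BA G
    using TB.M.dg_module_axioms A_alg G by (simp add: based_module_def based_module_axioms_def)
  let ?H = "{ract N f g | f g. f \<in> F \<and> g \<in> G}"
  have gc: "g \<in> carrier B" if "g \<in> G" for g using BG.basis_closed[OF that] by simp
  have Hc: "?H \<subseteq> carrier N" using NB.basis_closed gc by (auto intro!: N.ract_closed)
  have "?H \<subseteq> (\<Union>i. hcomp NA i)"
    using N.ract_degree[OF NB.basis_homog] BG.basis_homog by fastforce
  moreover have "rspan A NA ?H = carrier NA"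
  proof
    show "rspan A NA ?H \<subseteq> carrier NA"
    proof
      fix x assume "x \<in> rspan A NA ?H"
      then obtain T c where T: "finite T" "T \<subseteq> ?H" "c ` T \<subseteq> carrier A" "x = (\<Oplus>\<^bsub>NA\<^esub>e\<in>T. ract NA e (c e))"
        by (auto simp: rspan_def)
      have "ract NA e (c e) \<in> carrier NA" if "e \<in> T" for e
        using that T(2,3) Hc by (intro TN.M.ract_closed) auto
      then show "x \<in> carrier NA" unfolding T(4) by (intro TN.M.finsum_closed) blast
    qed
    note radd = rspan_add[OF TN.M.dg_module_axioms A.A.ring_axioms, of ?H]
    show "carrier NA \<subseteq> rspan A NA ?H"
    proof
      fix x assume "x \<in> carrier NA"
      then have "x \<in> carrier N" by simp
      then show "x \<in> rspan A NA ?H"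
      proof (induction x rule: NB.based_induct)
        case zero
        then show ?case using rspan_zero[OF TN.M.dg_module_axioms, of ?H] by simp
      next
        case (gen f j c)
        have fc: "f \<in> carrier N" using NB.basis_closed[OF gen(1)] .
        have "c \<in> carrier BA" using B.A.hcomp_closed[OF gen(2)] by simp
        then show ?case
        proof (induction c rule: BG.based_induct)
          case zero
          then show ?case using rspan_zero[OF TN.M.dg_module_axioms, of ?H] fc by simp
        next
          case (gen g i a)
          have ac: "a \<in> carrier A" using A.A.hcomp_closed[OF gen(2)] .
          have "ract NA (ract N f g) a \<in> rspan A NA ?H"
            using \<open>f \<in> F\<close> gen(1) ac fc gc N.ract_closed
            by (intro rspan_single[OF TN.M.dg_module_axioms]) auto
          then show ?case using fc gc[OF gen(1)] ac by (simp add: N.ract_mult)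
        next
          case (add y z)
          then show ?case using radd[of "ract N f y" "ract N f z"] Hc fc by (simp add: N.ract_add_right)
        qed
      next
        case (add y z)
        then show ?case using radd[of y z] Hc by simp
      qed
    qed
  qed
  moreover have "a h = \<zero>\<^bsub>A\<^esub>"
    if T: "finite T" "T \<subseteq> ?H" "a ` T \<subseteq> carrier A" "(\<Oplus>\<^bsub>NA\<^esub>e\<in>T. ract NA e (a e)) = \<zero>\<^bsub>NA\<^esub>" "h \<in> T" for T a h
  proof -
    interpret CN: same_complex N NA
      by (intro same_complex.intro N.dg_complex_axioms) simp_all
    interpret CB: same_complex B BA
      by (intro same_complex.intro B.A.dg_complex_axioms) simp_all
    obtain f g where h: "h = ract N f g" "f \<in> F" "g \<in> G" using T(2,5) by auto
    have fc: "f \<in> carrier N" using NB.basis_closed[OF h(2)] .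
    let ?S = "{g \<in> G. ract N f g \<in> T}"
    have coord: "NB.coord (ract N f' g') f = (if f' = f then g' else \<zero>\<^bsub>B\<^esub>)" if "f' \<in> F" "g' \<in> G" for f' g'
      using that gc NB.basis_closed by (auto simp: NB.coord_ract NB.coord_basis)
    have inj: "inj_on (\<lambda>g. ract N f g) ?S"
      using coord[OF h(2)] by (auto simp: inj_on_def) metis
    have im: "(\<lambda>g. ract N f g) ` ?S \<subseteq> T" by auto
    have finS: "finite ?S" using finite_imageD[OF finite_subset[OF im T(1)] inj] .
    have ac: "e \<in> T \<Longrightarrow> a e \<in> carrier A" for e using T(3) by auto
    have Tc: "e \<in> T \<Longrightarrow> e \<in> carrier N" for e using T(2) Hc by auto
    have "\<zero>\<^bsub>B\<^esub> = NB.coord (\<Oplus>\<^bsub>N\<^esub>e\<in>T. ract N e (\<phi> (a e))) f"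
      using T(4) addhom_zero[OF N.abelian_group_axioms B.A.abelian_group_axioms NB.coord_hom]
      by (simp add: CN.same_finsum)
    also have "\<dots> = (\<Oplus>\<^bsub>B\<^esub>e\<in>T. NB.coord (ract N e (\<phi> (a e))) f)"
      using T(1) Tc ac by (intro addhom_finsum[OF N.abelian_group_axioms B.A.abelian_group_axioms NB.coord_hom])
        (auto intro: N.ract_closed)
    also have "\<dots> = (\<Oplus>\<^bsub>B\<^esub>e\<in>T. NB.coord e f \<otimes>\<^bsub>B\<^esub> \<phi> (a e))"
      using Tc ac by (intro B.A.finsum_cong') (auto simp: NB.coord_ract)
    also have "\<dots> = (\<Oplus>\<^bsub>B\<^esub>e\<in>(\<lambda>g. ract N f g) ` ?S. NB.coord e f \<otimes>\<^bsub>B\<^esub> \<phi> (a e))"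
    proof (rule B.A.finsum_mono_neutral[OF T(1) im])
      show "NB.coord e f \<otimes>\<^bsub>B\<^esub> \<phi> (a e) \<in> carrier B" if "e \<in> (\<lambda>g. ract N f g) ` ?S" for e
        using that im Tc ac by auto
      show "NB.coord e f \<otimes>\<^bsub>B\<^esub> \<phi> (a e) = \<zero>\<^bsub>B\<^esub>" if e: "e \<in> T - (\<lambda>g. ract N f g) ` ?S" for e
      proof -
        obtain f' g' where e': "e = ract N f' g'" "f' \<in> F" "g' \<in> G" using T(2) e by auto
        then have "f' \<noteq> f" using e by auto
        then show ?thesis using coord[OF e'(2,3)] e' ac e by simp
      qed
    qed
    also have "\<dots> = (\<Oplus>\<^bsub>B\<^esub>g\<in>?S. NB.coord (ract N f g) f \<otimes>\<^bsub>B\<^esub> \<phi> (a (ract N f g)))"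
      using inj im Tc ac by (intro B.A.finsum_reindex) auto
    also have "\<dots> = (\<Oplus>\<^bsub>B\<^esub>g\<in>?S. ract BA g (a (ract N f g)))"
      using coord[OF h(2)] gc ac by (intro B.A.finsum_cong') auto
    finally have "(\<Oplus>\<^bsub>BA\<^esub>g\<in>?S. ract BA g (a (ract N f g))) = \<zero>\<^bsub>BA\<^esub>"
      by (simp add: CB.same_finsum)
    then have "a (ract N f g) = \<zero>\<^bsub>A\<^esub>"
      using h T(5) ac by (intro BG.basis_indep[OF finS]) auto
    then show ?thesis using h by simp
  qed
  ultimately show ?thesis unfolding graded_basis_def by blast
qed

end

section \<open>Isomorphisms and transport of structure\<close>

lemma dg_isoD:
  assumes "dg_iso B M N f"
  shows "addhom M N f" "\<And>x b. x \<in> carrier M \<Longrightarrow> b \<in> carrier B \<Longrightarrow> f (ract M x b) = ract N (f x) b"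
    "\<And>i x. x \<in> hcomp M i \<Longrightarrow> f x \<in> hcomp N i" "\<And>x. x \<in> carrier M \<Longrightarrow> f (dif M x) = dif N (f x)"
    "inj_on f (carrier M)" "f ` carrier M = carrier N"
  using assms by (auto simp: dg_iso_def dg_hom_def bij_betw_def image_subset_iff)

lemma dg_iso_comp:
  assumes f: "dg_iso B M N f" and g: "dg_iso B N L g"
  shows "dg_iso B M L (\<lambda>x. g (f x))"
proof -
  note F = dg_isoD[OF f] and G = dg_isoD[OF g]
  have fc: "x \<in> carrier M \<Longrightarrow> f x \<in> carrier N" for x using F(6) by auto
  have "bij_betw (g \<circ> f) (carrier M) (carrier L)"
    using f g by (intro bij_betw_trans) (auto simp: dg_iso_def)
  then show ?thesis
    using addhom_compose[OF F(1) G(1)] F G fc by (auto simp: dg_iso_def dg_hom_def comp_def)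
qed

lemma dg_iso_hcomp:
  assumes M: "dg_module B M" and N: "dg_module B N" and f: "dg_iso B M N f"
  shows "f ` hcomp M i = hcomp N i"
proof
  interpret M: dg_module B M by fact
  interpret N: dg_module B N by fact
  note F = dg_isoD[OF f]
  show "f ` hcomp M i \<subseteq> hcomp N i" using F(3) by auto
  show "hcomp N i \<subseteq> f ` hcomp M i"
  proof
    fix y assume y: "y \<in> hcomp N i"
    then obtain x where x: "x \<in> carrier M" "y = f x" using N.hcomp_closed F(6) by blast
    have "hpart N (f x) (i + 0) = f (hpart M x i)"
      by (rule M.hpart_map[OF N.dg_complex_axioms F(1) _ x(1)]) (simp add: F(3))
    then have "y = f (hpart M x i)" using N.hpart_homog[OF y, of i] x(2) by simp
    then show "y \<in> f ` hcomp M i" using M.hpart_hcomp[OF x(1)] by blast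
  qed
qed

lemma dg_iso_inv:
  assumes M: "dg_module B M" and N: "dg_module B N" and f: "dg_iso B M N f"
  shows "dg_iso B N M (the_inv_into (carrier M) f)"
proof -
  interpret M: dg_module B M by fact
  interpret N: dg_module B N by fact
  note F = dg_isoD[OF f]
  let ?g = "the_inv_into (carrier M) f"
  have g1: "?g (f x) = x" if "x \<in> carrier M" for x using the_inv_into_f_f[OF F(5) that] .
  have fc: "f x \<in> carrier N" if "x \<in> carrier M" for x using F(6) that by auto
  have ex: "\<exists>x\<in>carrier M. y = f x" if "y \<in> carrier N" for y using F(6) that by auto
  have "addhom N M ?g"
  proof (rule addhomI)
    fix y assume "y \<in> carrier N"
    then obtain x where x: "x \<in> carrier M" "y = f x" using ex by blast
    then show "?g y \<in> carrier M" using g1 by simp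
    fix y' assume "y' \<in> carrier N"
    then obtain x' where x': "x' \<in> carrier M" "y' = f x'" using ex by blast
    show "?g (y \<oplus>\<^bsub>N\<^esub> y') = ?g y \<oplus>\<^bsub>M\<^esub> ?g y'"
      using x x' g1 g1[OF M.a_closed[OF x(1) x'(1)]] by (simp add: addhom_add[OF F(1)])
  qed
  moreover have "?g (ract N y b) = ract M (?g y) b" if "y \<in> carrier N" "b \<in> carrier B" for y b
  proof -
    obtain x where x: "x \<in> carrier M" "y = f x" using ex \<open>y \<in> carrier N\<close> by blast
    show ?thesis unfolding x(2) F(2)[OF x(1) that(2), symmetric] g1[OF x(1)] by (rule g1[OF M.ract_closed[OF x(1) that(2)]])
  qed
  moreover have "?g ` hcomp N i \<subseteq> hcomp M i" for i
  proof
    fix z assume "z \<in> ?g ` hcomp N i"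
    then obtain x where x: "x \<in> hcomp M i" "z = ?g (f x)" unfolding dg_iso_hcomp[OF M N f, symmetric] by blast
    then show "z \<in> hcomp M i" using g1[OF M.hcomp_closed[OF x(1)]] by simp
  qed
  moreover have "?g (dif N y) = dif M (?g y)" if "y \<in> carrier N" for y
  proof -
    obtain x where x: "x \<in> carrier M" "y = f x" using ex \<open>y \<in> carrier N\<close> by blast
    show ?thesis unfolding x(2) F(4)[OF x(1), symmetric] g1[OF x(1)] by (rule g1[OF M.dif_closed[OF x(1)]])
  qed
  moreover have "bij_betw ?g (carrier N) (carrier M)"
    using f by (intro bij_betw_the_inv_into) (simp add: dg_iso_def)
  ultimately show ?thesis by (simp add: dg_iso_def dg_hom_def)
qed

lemma boundaries_subgroup:
  assumes "dg_complex M" shows "subgroup (dif M ` hcomp M n) (add_monoid M)"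
proof -
  interpret dg_complex M by fact
  show ?thesis
  proof (rule subgroupI')
    show "\<zero>\<^bsub>M\<^esub> \<in> dif M ` hcomp M n"
      using addhom_zero[OF abelian_group_axioms abelian_group_axioms dif_hom] hcomp_zero by (metis imageI)
    show "x \<oplus>\<^bsub>M\<^esub> y \<in> dif M ` hcomp M n" if "x \<in> dif M ` hcomp M n" "y \<in> dif M ` hcomp M n" for x y
      using that hcomp_closed by (auto simp: dif_add[symmetric] hcomp_add)
    show "\<ominus>\<^bsub>M\<^esub> x \<in> dif M ` hcomp M n" if "x \<in> dif M ` hcomp M n" for x
      using that hcomp_closed hcomp_neg addhom_minus[OF abelian_group_axioms abelian_group_axioms dif_hom]
      by (auto simp: image_iff) (metis)
  qed (use hcomp_closed in auto)
qed

lemma quasi_iso_of_iso: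
  assumes M: "dg_module B M" and N: "dg_module B N" and f: "dg_iso B M N f"
  shows "quasi_iso B M N f"
  unfolding quasi_iso_def
proof (intro conjI allI)
  interpret M: dg_module B M by fact
  interpret N: dg_module B N by fact
  note F = dg_isoD[OF f]
  show "dg_hom B M N f" using f by (simp add: dg_iso_def)
  fix n
  let ?BM = "dif M ` hcomp M (n + 1)" and ?BN = "dif N ` hcomp N (n + 1)"
  let ?ZM = "{x \<in> hcomp M n. dif M x = \<zero>\<^bsub>M\<^esub>}" and ?ZN = "{x \<in> hcomp N n. dif N x = \<zero>\<^bsub>N\<^esub>}"
  note HM = boundaries_subgroup[OF M.dg_complex_axioms, of "n + 1"]
    and HN = boundaries_subgroup[OF N.dg_complex_axioms, of "n + 1"]
  have fc: "f x \<in> carrier N" if "x \<in> carrier M" for x using F(6) that by auto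
  have fB: "f ` ?BM = ?BN"
  proof -
    have "f ` ?BM = dif N ` (f ` hcomp M (n + 1))"
      using F(4) M.hcomp_closed by (force simp: image_image)
    then show ?thesis using dg_iso_hcomp[OF M N f] by simp
  qed
  have fZ: "f ` ?ZM = ?ZN"
  proof
    have f0: "f \<zero>\<^bsub>M\<^esub> = \<zero>\<^bsub>N\<^esub>" by (rule addhom_zero[OF M.abelian_group_axioms N.abelian_group_axioms F(1)])
    show "f ` ?ZM \<subseteq> ?ZN" using F(3) F(4)[symmetric] M.hcomp_closed f0 by auto
    show "?ZN \<subseteq> f ` ?ZM"
    proof
      fix y assume y: "y \<in> ?ZN"
      then obtain x where x: "x \<in> hcomp M n" "y = f x" using dg_iso_hcomp[OF M N f, of n] by blast
      have "f (dif M x) = f \<zero>\<^bsub>M\<^esub>" using y x F(4)[of x] M.hcomp_closed f0 by auto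
      then have "dif M x = \<zero>\<^bsub>M\<^esub>" using F(5) M.hcomp_closed[OF x(1)] by (auto simp: inj_on_def)
      then show "y \<in> f ` ?ZM" using x by blast
    qed
  qed
  have ZMc: "x \<in> ?ZM \<Longrightarrow> x \<in> carrier M" for x using M.hcomp_closed by auto
  have ZNc: "x \<in> ?ZN \<Longrightarrow> x \<in> carrier N" for x using N.hcomp_closed by auto
  have cM: "carrier (dg_homology M n) = M.acoset ?BM ` ?ZM"
    by (auto simp: dg_homology_def homology_def FactGroup_def RCOSETS_def r_coset_def M.acoset_def)
  have cN: "carrier (dg_homology N n) = N.acoset ?BN ` ?ZN"
    by (auto simp: dg_homology_def homology_def FactGroup_def RCOSETS_def r_coset_def N.acoset_def)
  have mM: "M.acoset ?BM x \<otimes>\<^bsub>dg_homology M n\<^esub> M.acoset ?BM y = M.acoset ?BM (x \<oplus>\<^bsub>M\<^esub> y)" if "x \<in> ?ZM" "y \<in> ?ZM" for x y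
    unfolding M.acoset_add[OF HM ZMc[OF that(1)] ZMc[OF that(2)], symmetric]
    by (auto simp: dg_homology_def homology_def FactGroup_def set_mult_def)
  have mN: "N.acoset ?BN x \<otimes>\<^bsub>dg_homology N n\<^esub> N.acoset ?BN y = N.acoset ?BN (x \<oplus>\<^bsub>N\<^esub> y)" if "x \<in> ?ZN" "y \<in> ?ZN" for x y
    unfolding N.acoset_add[OF HN ZNc[OF that(1)] ZNc[OF that(2)], symmetric]
    by (auto simp: dg_homology_def homology_def FactGroup_def set_mult_def)
  let ?Phi = "\<lambda>X. ?BN <+>\<^bsub>N\<^esub> (f ` X)"
  have Phi: "?Phi (M.acoset ?BM x) = N.acoset ?BN (f x)" if x: "x \<in> ?ZM" for x
  proof -
    have "f ` M.acoset ?BM x = (\<lambda>h. f (h \<oplus>\<^bsub>M\<^esub> x)) ` ?BM" unfolding M.acoset_def by blast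
    also have "\<dots> = (\<lambda>h. f h \<oplus>\<^bsub>N\<^esub> f x) ` ?BM"
      using addhom_add[OF F(1) M.subgroup_carrier[OF HM] ZMc[OF x]] by (intro image_cong) auto
    also have "\<dots> = {f h \<oplus>\<^bsub>N\<^esub> f x | h. h \<in> ?BM}" by blast
    also have "\<dots> = N.acoset ?BN (f x)" unfolding N.acoset_def fB[symmetric] by auto
    finally have 1: "?Phi (M.acoset ?BM x) = {h \<oplus>\<^bsub>N\<^esub> k | h k. h \<in> ?BN \<and> k \<in> N.acoset ?BN (f x)}"
      by (auto simp: set_add_def set_mult_def)
    have 2: "N.acoset ?BN \<zero>\<^bsub>N\<^esub> = ?BN" using N.subgroup_carrier[OF HN] by (force simp: N.acoset_def)
    show ?thesis
      using N.acoset_add[OF HN N.zero_closed fc[OF ZMc[OF x]]] fc[OF ZMc[OF x]] unfolding 1 2 by simp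
  qed
  have add: "x \<oplus>\<^bsub>M\<^esub> y \<in> ?ZM" if "x \<in> ?ZM" "y \<in> ?ZM" for x y
    using that M.hcomp_closed by (auto simp: M.hcomp_add M.dif_add)
  have fZ': "f x \<in> ?ZN" if "x \<in> ?ZM" for x using fZ that by blast
  show "?Phi \<in> iso (dg_homology M n) (dg_homology N n)"
    unfolding iso_def mem_Collect_eq
  proof (intro conjI)
    show "?Phi \<in> hom (dg_homology M n) (dg_homology N n)"
    proof (rule homI)
      fix X assume "X \<in> carrier (dg_homology M n)"
      then obtain x where x: "x \<in> ?ZM" "X = M.acoset ?BM x" unfolding cM by blast
      then show "?Phi X \<in> carrier (dg_homology N n)" unfolding cN using Phi fZ' by blast
      fix Y assume "Y \<in> carrier (dg_homology M n)"
      then obtain y where y: "y \<in> ?ZM" "Y = M.acoset ?BM y" unfolding cM by blast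
      have "?Phi (X \<otimes>\<^bsub>dg_homology M n\<^esub> Y) = N.acoset ?BN (f (x \<oplus>\<^bsub>M\<^esub> y))"
        unfolding x(2) y(2) mM[OF x(1) y(1)] by (rule Phi[OF add[OF x(1) y(1)]])
      also have "\<dots> = ?Phi X \<otimes>\<^bsub>dg_homology N n\<^esub> ?Phi Y"
        unfolding x(2) y(2) Phi[OF x(1)] Phi[OF y(1)] mN[OF fZ'[OF x(1)] fZ'[OF y(1)]]
        using addhom_add[OF F(1) ZMc[OF x(1)] ZMc[OF y(1)]] by simp
      finally show "?Phi (X \<otimes>\<^bsub>dg_homology M n\<^esub> Y) = ?Phi X \<otimes>\<^bsub>dg_homology N n\<^esub> ?Phi Y" .
    qed
    show "bij_betw ?Phi (carrier (dg_homology M n)) (carrier (dg_homology N n))"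
      unfolding bij_betw_def
    proof
      show "inj_on ?Phi (carrier (dg_homology M n))"
      proof (rule inj_onI)
        fix X Y assume "X \<in> carrier (dg_homology M n)" "Y \<in> carrier (dg_homology M n)" and eq: "?Phi X = ?Phi Y"
        then obtain x y where x: "x \<in> ?ZM" "X = M.acoset ?BM x" and y: "y \<in> ?ZM" "Y = M.acoset ?BM y" unfolding cM by blast
        note c = ZMc[OF x(1)] ZMc[OF y(1)]
        have "N.acoset ?BN (f x) = N.acoset ?BN (f y)" using eq unfolding x(2) y(2) Phi[OF x(1)] Phi[OF y(1)] .
        then have "f x \<ominus>\<^bsub>N\<^esub> f y \<in> ?BN" using N.acoset_eq[OF HN fc[OF c(1)] fc[OF c(2)]] by simp
        then have "f (x \<ominus>\<^bsub>M\<^esub> y) \<in> f ` ?BM"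
          using c addhom_diff[OF M.abelian_group_axioms N.abelian_group_axioms F(1)] fB by simp
        then have "x \<ominus>\<^bsub>M\<^esub> y \<in> ?BM"
          using inj_on_image_mem_iff[OF F(5), of "x \<ominus>\<^bsub>M\<^esub> y" ?BM] c M.subgroup_carrier[OF HM] by blast
        then show "X = Y" unfolding x(2) y(2) using M.acoset_eq[OF HM c] by simp
      qed
      show "?Phi ` carrier (dg_homology M n) = carrier (dg_homology N n)"
        unfolding cM cN fZ[symmetric] image_image using Phi by (intro image_cong) auto
    qed
  qed
qed

text \<open>A copy of M on another type, along an injection; the modules in \<open>liftable\<close> live in a prescribed
  type.\<close>

definition transport :: "('m \<Rightarrow> 'n) \<Rightarrow> ('b, 'm) dg_mod \<Rightarrow> ('b, 'n) dg_mod" where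
  "transport h M = (let k = the_inv_into (carrier M) h in
     \<lparr>carrier = h ` carrier M, mult = undefined, one = undefined, ring.zero = h \<zero>\<^bsub>M\<^esub>,
      add = (\<lambda>x y. h (k x \<oplus>\<^bsub>M\<^esub> k y)), hcomp = (\<lambda>i. h ` hcomp M i), dif = (\<lambda>x. h (dif M (k x))),
      ract = (\<lambda>x b. h (ract M (k x) b))\<rparr>)"

lemma transport_module:
  assumes M: "dg_module B M" and B: "dg_algebra R B" and inj: "inj_on h (carrier M)"
  shows "dg_module B (transport h M)" "dg_iso B M (transport h M) h"
proof -
  interpret M: dg_module B M by fact
  interpret B: dg_algebra R B by fact
  let ?N = "transport h M"
  define k where "k = the_inv_into (carrier M) h"
  have k: "k (h x) = x" if "x \<in> carrier M" for x unfolding k_def using the_inv_into_f_f[OF inj that] .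
  have S: "carrier ?N = h ` carrier M" "\<zero>\<^bsub>?N\<^esub> = h \<zero>\<^bsub>M\<^esub>" "hcomp ?N i = h ` hcomp M i" for i
    by (simp_all add: transport_def Let_def)
  have add: "h x \<oplus>\<^bsub>?N\<^esub> h y = h (x \<oplus>\<^bsub>M\<^esub> y)" if "x \<in> carrier M" "y \<in> carrier M" for x y
    using that k by (simp add: transport_def Let_def k_def)
  have dif: "dif ?N (h x) = h (dif M x)" if "x \<in> carrier M" for x
    using that k by (simp add: transport_def Let_def k_def)
  have ract: "ract ?N (h x) b = h (ract M x b)" if "x \<in> carrier M" for x b
    using that k by (simp add: transport_def Let_def k_def)
  have ab: "abelian_group ?N" by (rule abelian_group_image[OF M.abelian_group_axioms S(1,2) add])
  interpret N: abelian_group ?N by (rule ab)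
  have hom: "addhom M ?N h" using S add by (intro addhomI) auto
  have khom: "addhom ?N M k" using S add k by (intro addhomI) auto
  have ex: "\<exists>x\<in>carrier M. y = h x" if "y \<in> carrier ?N" for y using that S by auto
  have sub: "subgroup (hcomp ?N i) (add_monoid ?N)" for i
  proof (rule N.subgroupI')
    show "hcomp ?N i \<subseteq> carrier ?N" using S M.hcomp_closed by auto
    show "\<zero>\<^bsub>?N\<^esub> \<in> hcomp ?N i" using S M.hcomp_zero by auto
    show "x \<oplus>\<^bsub>?N\<^esub> y \<in> hcomp ?N i" if "x \<in> hcomp ?N i" "y \<in> hcomp ?N i" for x y
      using that S(3) add M.hcomp_closed M.hcomp_add by auto
    show "\<ominus>\<^bsub>?N\<^esub> x \<in> hcomp ?N i" if "x \<in> hcomp ?N i" for x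
      using that S(3) M.hcomp_closed M.hcomp_neg addhom_minus[OF M.abelian_group_axioms ab hom, symmetric] by auto
  qed
  have dec: "\<exists>!c. is_decomp ?N y c" if "y \<in> carrier ?N" for y
  proof -
    obtain x where x: "x \<in> carrier M" "y = h x" using ex \<open>y \<in> carrier ?N\<close> by blast
    let ?p = "\<lambda>i y. h (hpart M (k y) i)"
    have p: "addhom ?N ?N (?p i)" for i
      by (rule addhom_compose[OF addhom_compose[OF khom M.hpart_hom] hom])
    show ?thesis
    proof (rule is_decomp_ex1[where p = ?p and S = "hsupp M x" and c = "\<lambda>i. h (hpart M x i)", OF ab sub p])
      show "?p i y = y" if "y \<in> hcomp ?N i" for i y
        using that S(3) k M.hcomp_closed M.hpart_homog by auto
      show "?p i y = \<zero>\<^bsub>?N\<^esub>" if "y \<in> hcomp ?N j" "i \<noteq> j" for i j y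
        using that S k M.hcomp_closed M.hpart_homog by auto
      show "finite (hsupp M x)" by (rule M.finite_hsupp[OF x(1)])
      show "h (hpart M x i) \<in> hcomp ?N i" for i using S(3) M.hpart_hcomp[OF x(1)] by auto
      have "y = h (\<Oplus>\<^bsub>M\<^esub>i\<in>hsupp M x. hpart M x i)" using x M.hpart_sum by simp
      also have "\<dots> = (\<Oplus>\<^bsub>?N\<^esub>i\<in>hsupp M x. h (hpart M x i))"
        using x M.finite_hsupp by (intro addhom_finsum[OF M.abelian_group_axioms ab hom]) auto
      finally show "y = (\<Oplus>\<^bsub>?N\<^esub>i\<in>hsupp M x. h (hpart M x i))" .
    qed
  qed
  have cx: "dg_complex ?N"
  proof (intro dg_complex.intro dg_complex_axioms.intro ab sub dec)
    show "addhom ?N ?N (dif ?N)"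
      using ex by (intro addhomI) (auto simp: S dif add M.dif_add)
    show "dif ?N x \<in> hcomp ?N (i - 1)" if "x \<in> hcomp ?N i" for x i
      using that M.hcomp_closed M.dif_degree by (auto simp: S dif)
    show "dif ?N (dif ?N x) = \<zero>\<^bsub>?N\<^esub>" if "x \<in> carrier ?N" for x
      using that by (auto simp: S dif M.dif_dif)
  qed
  show mod: "dg_module B ?N"
  proof (intro dg_module.intro cx dg_module_axioms.intro)
    fix x i b j assume "x \<in> hcomp ?N i" and b: "b \<in> hcomp B j"
    then obtain u where u: "u \<in> hcomp M i" "x = h u" by (auto simp: S)
    note uc = M.hcomp_closed[OF u(1)] and bc = B.A.hcomp_closed[OF b]
    have "dif ?N (ract ?N x b) = h (ract M (dif M u) b \<oplus>\<^bsub>M\<^esub> sgs M i (ract M u (dif B b)))"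
      using uc bc by (simp add: u(2) ract dif M.ract_closed M.leibniz_sgs[OF u(1) b])
    also have "\<dots> = ract ?N (dif ?N x) b \<oplus>\<^bsub>?N\<^esub> sgs ?N i (ract ?N x (dif B b))"
      using uc bc addhom_sgs[OF M.abelian_group_axioms ab hom]
      by (simp add: u(2) ract dif add[symmetric] M.ract_closed)
    finally show "dif ?N (ract ?N x b) = ract ?N (dif ?N x) b \<oplus>\<^bsub>?N\<^esub> [sg i] \<cdot>\<^bsub>?N\<^esub> ract ?N x (dif B b)"
      using uc bc N.sg_add_pow[of "ract ?N x (dif B b)" i] by (simp add: u(2) ract S M.ract_closed)
  next
    fix x i b j assume "x \<in> hcomp ?N i" and b: "b \<in> hcomp B j"
    then show "ract ?N x b \<in> hcomp ?N (i + j)" using M.hcomp_closed M.ract_degree by (auto simp: S ract)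
  qed (auto simp: S ract add M.ract_closed M.ract_add_left M.ract_add_right M.ract_mult M.ract_one)
  show "dg_iso B M ?N h"
    using hom ract dif S inj by (auto simp: dg_iso_def dg_hom_def bij_betw_def)
qed

lemma graded_basis_iso:
  assumes M: "dg_module B M" and N: "dg_module B N" and f: "dg_iso B M N f" and F: "graded_basis B M F"
  shows "graded_basis B N (f ` F)"
proof -
  interpret M: dg_module B M by fact
  interpret N: dg_module B N by fact
  note I = dg_isoD[OF f]
  have "F \<subseteq> (\<Union>i. hcomp M i)" using F unfolding graded_basis_def by (elim conjE)
  then have Fh: "F \<subseteq> (\<Union>i. hcomp M i)" and Fc: "F \<subseteq> carrier M" using M.hcomp_closed by auto
  have injF: "inj_on f T" if "T \<subseteq> F" for T using I(5) that Fc by (meson inj_on_subset order_trans)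
  have sum: "f (\<Oplus>\<^bsub>M\<^esub>e\<in>T. ract M e (c (f e))) = (\<Oplus>\<^bsub>N\<^esub>e\<in>f ` T. ract N e (c e))"
    if T: "finite T" "T \<subseteq> F" "\<And>e. e \<in> T \<Longrightarrow> c (f e) \<in> carrier B" for T c
  proof -
    have Tc: "e \<in> T \<Longrightarrow> e \<in> carrier M" for e using T Fc by auto
    have "f (\<Oplus>\<^bsub>M\<^esub>e\<in>T. ract M e (c (f e))) = (\<Oplus>\<^bsub>N\<^esub>e\<in>T. f (ract M e (c (f e))))"
      using T Tc M.ract_closed by (intro addhom_finsum[OF M.abelian_group_axioms N.abelian_group_axioms I(1)]) auto
    also have "\<dots> = (\<Oplus>\<^bsub>N\<^esub>e\<in>T. ract N (f e) (c (f e)))"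
      using T Tc addhom_closed[OF I(1)] by (intro N.finsum_cong') (auto simp: I(2) intro!: N.ract_closed)
    also have "\<dots> = (\<Oplus>\<^bsub>N\<^esub>e\<in>f ` T. ract N e (c e))"
      using T Tc addhom_closed[OF I(1)] injF[OF T(2)]
      by (intro N.finsum_reindex[symmetric]) (auto intro!: N.ract_closed)
    finally show ?thesis .
  qed
  have "f ` F \<subseteq> (\<Union>i. hcomp N i)" using Fh I(3) by blast
  moreover have "rspan B N (f ` F) = carrier N"
  proof
    show "rspan B N (f ` F) \<subseteq> carrier N"
    proof
      fix y assume "y \<in> rspan B N (f ` F)"
      then obtain T c where T: "T \<subseteq> f ` F" "c ` T \<subseteq> carrier B" "y = (\<Oplus>\<^bsub>N\<^esub>e\<in>T. ract N e (c e))"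
        by (auto simp: rspan_def)
      show "y \<in> carrier N"
        unfolding T(3) using T Fc addhom_closed[OF I(1)] by (intro N.finsum_closed) (auto intro!: N.ract_closed)
    qed
    show "carrier N \<subseteq> rspan B N (f ` F)"
    proof
      fix y assume "y \<in> carrier N"
      then obtain x where x: "x \<in> carrier M" "y = f x" using I(6) by blast
      have "rspan B M F = carrier M" using F unfolding graded_basis_def by (elim conjE)
      then obtain T c where T: "finite T" "T \<subseteq> F" "c ` T \<subseteq> carrier B" "x = (\<Oplus>\<^bsub>M\<^esub>e\<in>T. ract M e (c e))"
        using x(1) by (force simp: rspan_def)
      let ?d = "\<lambda>y. c (the_inv_into T f y)"
      have d: "?d (f e) = c e" if "e \<in> T" for e using the_inv_into_f_f[OF injF[OF T(2)] that] by simp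
      have "x = (\<Oplus>\<^bsub>M\<^esub>e\<in>T. ract M e (?d (f e)))"
        unfolding T(4) using T Fc d by (intro M.finsum_cong') (auto intro!: M.ract_closed)
      then have "y = (\<Oplus>\<^bsub>N\<^esub>e\<in>f ` T. ract N e (?d e))" using sum[of T ?d] T d x by (simp add: image_subset_iff)
      moreover have "?d ` f ` T \<subseteq> carrier B" using T(3) d by auto
      ultimately show "y \<in> rspan B N (f ` F)"
        unfolding rspan_def using T by (auto intro!: exI[of _ "f ` T"] exI[of _ ?d])
    qed
  qed
  moreover have "c e = \<zero>\<^bsub>B\<^esub>" if T: "finite T" "T \<subseteq> f ` F" "c ` T \<subseteq> carrier B" "(\<Oplus>\<^bsub>N\<^esub>e\<in>T. ract N e (c e)) = \<zero>\<^bsub>N\<^esub>" "e \<in> T" for T c e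
  proof -
    obtain T' where T': "T' \<subseteq> F" "finite T'" "T = f ` T'" using finite_subset_image[OF T(1,2)] by blast
    have c: "c (f e) \<in> carrier B" if "e \<in> T'" for e using that T(3) T'(3) by auto
    have sc: "(\<Oplus>\<^bsub>M\<^esub>e\<in>T'. ract M e (c (f e))) \<in> carrier M"
      using T' Fc c by (intro M.finsum_closed) (auto intro!: M.ract_closed)
    have "f (\<Oplus>\<^bsub>M\<^esub>e\<in>T'. ract M e (c (f e))) = f \<zero>\<^bsub>M\<^esub>"
      using sum[of T' c] T' T(4) c addhom_zero[OF M.abelian_group_axioms N.abelian_group_axioms I(1)] by simp
    then have z: "(\<Oplus>\<^bsub>M\<^esub>e\<in>T'. ract M e (c (f e))) = \<zero>\<^bsub>M\<^esub>" using I(5) sc by (auto simp: inj_on_def)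
    have "\<forall>T c. finite T \<and> T \<subseteq> F \<and> c ` T \<subseteq> carrier B \<and> (\<Oplus>\<^bsub>M\<^esub>e\<in>T. ract M e (c e)) = \<zero>\<^bsub>M\<^esub> \<longrightarrow> (\<forall>e\<in>T. c e = \<zero>\<^bsub>B\<^esub>)"
      using F unfolding graded_basis_def by (elim conjE)
    then have "finite T' \<and> T' \<subseteq> F \<and> (\<lambda>e. c (f e)) ` T' \<subseteq> carrier B \<and> (\<Oplus>\<^bsub>M\<^esub>e\<in>T'. ract M e (c (f e))) = \<zero>\<^bsub>M\<^esub>
        \<longrightarrow> (\<forall>e\<in>T'. c (f e) = \<zero>\<^bsub>B\<^esub>)" by (elim allE)
    then show ?thesis using T' c z T(5) by (auto simp: image_subset_iff)
  qed
  ultimately show ?thesis unfolding graded_basis_def by blast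
qed

section \<open>Naive liftings and liftings\<close>

lemma (in dg_module) kernel_submodule:
  assumes M: "dg_module B M" and f: "dg_hom B N M f"
  shows "dg_submodule B N {x \<in> carrier N. f x = \<zero>\<^bsub>M\<^esub>}"
proof -
  interpret M: dg_module B M by fact
  have hom: "addhom N M f" and deg: "\<And>i x. x \<in> hcomp N i \<Longrightarrow> f x \<in> hcomp M (i + 0)"
    and lin: "\<And>x b. x \<in> carrier N \<Longrightarrow> b \<in> carrier B \<Longrightarrow> f (ract N x b) = ract M (f x) b"
    and dif: "\<And>x. x \<in> carrier N \<Longrightarrow> f (dif N x) = dif M (f x)"
    using f by (auto simp: dg_hom_def image_subset_iff)
  note f0 = addhom_zero[OF abelian_group_axioms M.abelian_group_axioms hom]
  show ?thesis
    unfolding dg_submodule_def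
  proof (intro conjI ballI allI)
    show "subgroup {x \<in> carrier N. f x = \<zero>\<^bsub>M\<^esub>} (add_monoid N)"
      using f0 addhom_add[OF hom] addhom_minus[OF abelian_group_axioms M.abelian_group_axioms hom]
      by (intro subgroupI') auto
    fix x assume x: "x \<in> {x \<in> carrier N. f x = \<zero>\<^bsub>M\<^esub>}"
    show "ract N x b \<in> {x \<in> carrier N. f x = \<zero>\<^bsub>M\<^esub>}" if "b \<in> carrier B" for b
      using x that addhom_zero[OF M.abelian_group_axioms M.abelian_group_axioms M.ract_hom_left[OF that]]
      by (simp add: lin ract_closed)
    show "dif N x \<in> {x \<in> carrier N. f x = \<zero>\<^bsub>M\<^esub>}"
      using x addhom_zero[OF M.abelian_group_axioms M.abelian_group_axioms M.dif_hom] by (simp add: dif)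
    show "hpart N x i \<in> {x \<in> carrier N. f x = \<zero>\<^bsub>M\<^esub>}" for i
      using x hpart_map[OF M.dg_complex_axioms hom deg, of x i] M.hpart_homog[OF M.hcomp_zero, of i i] by simp
  qed
qed

lemma (in dg_module) image_submodule:
  assumes M: "dg_module B M" and f: "dg_hom B N M f"
  shows "dg_submodule B M (f ` carrier N)"
proof -
  interpret M: dg_module B M by fact
  have hom: "addhom N M f" and deg: "\<And>i x. x \<in> hcomp N i \<Longrightarrow> f x \<in> hcomp M (i + 0)"
    and lin: "\<And>x b. x \<in> carrier N \<Longrightarrow> b \<in> carrier B \<Longrightarrow> f (ract N x b) = ract M (f x) b"
    and dif: "\<And>x. x \<in> carrier N \<Longrightarrow> f (dif N x) = dif M (f x)"
    using f by (auto simp: dg_hom_def image_subset_iff)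
  show ?thesis
    unfolding dg_submodule_def
  proof (intro conjI ballI allI)
    show "subgroup (f ` carrier N) (add_monoid M)"
    proof (rule M.subgroupI')
      show "f ` carrier N \<subseteq> carrier M" using addhom_closed[OF hom] by auto
      show "\<zero>\<^bsub>M\<^esub> \<in> f ` carrier N"
        using addhom_zero[OF abelian_group_axioms M.abelian_group_axioms hom, symmetric] by auto
      show "x \<oplus>\<^bsub>M\<^esub> y \<in> f ` carrier N" if "x \<in> f ` carrier N" "y \<in> f ` carrier N" for x y
        using that by (auto simp: addhom_add[OF hom, symmetric])
      show "\<ominus>\<^bsub>M\<^esub> x \<in> f ` carrier N" if "x \<in> f ` carrier N" for x
        using that by (auto simp: addhom_minus[OF abelian_group_axioms M.abelian_group_axioms hom, symmetric])
    qed
    fix y assume "y \<in> f ` carrier N"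
    then obtain x where x: "x \<in> carrier N" "y = f x" by blast
    show "ract M y b \<in> f ` carrier N" if "b \<in> carrier B" for b
      using x that ract_closed by (auto simp: lin[symmetric])
    show "dif M y \<in> f ` carrier N" using x by (auto simp: dif[symmetric])
    show "hpart M y i \<in> f ` carrier N" for i
      using x hpart_map[OF M.dg_complex_axioms hom deg, of x i] by auto
  qed
qed

text \<open>The kernel of p is a complement of the image of the section.\<close>

lemma direct_summand_of_split:
  assumes N: "dg_module B N" and X: "dg_module B X" and s: "dg_hom B N X s" and p: "dg_hom B X N p"
    and ps: "\<And>x. x \<in> carrier N \<Longrightarrow> p (s x) = x"
  shows "dg_direct_summand B N X"
  unfolding dg_direct_summand_def
proof (intro exI conjI)
  interpret N: dg_module B N by fact
  interpret X: dg_module B X by fact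
  have sh: "addhom N X s" and ph: "addhom X N p" using s p by (auto simp: dg_hom_def)
  let ?S = "s ` carrier N" and ?K = "{x \<in> carrier X. p x = \<zero>\<^bsub>N\<^esub>}"
  show "dg_submodule B X ?S" by (rule N.image_submodule[OF X s])
  show "dg_submodule B X ?K" by (rule X.kernel_submodule[OF N p])
  have s0: "s \<zero>\<^bsub>N\<^esub> = \<zero>\<^bsub>X\<^esub>" and p0: "p \<zero>\<^bsub>X\<^esub> = \<zero>\<^bsub>N\<^esub>"
    using addhom_zero[OF N.abelian_group_axioms X.abelian_group_axioms sh]
      addhom_zero[OF X.abelian_group_axioms N.abelian_group_axioms ph] by auto
  show "?S \<inter> ?K = {\<zero>\<^bsub>X\<^esub>}"
  proof
    show "?S \<inter> ?K \<subseteq> {\<zero>\<^bsub>X\<^esub>}" using ps s0 by auto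
    show "{\<zero>\<^bsub>X\<^esub>} \<subseteq> ?S \<inter> ?K" using s0[symmetric] p0 X.zero_closed by auto
  qed
  show "?S <+>\<^bsub>X\<^esub> ?K = carrier X"
  proof
    show "?S <+>\<^bsub>X\<^esub> ?K \<subseteq> carrier X" using addhom_closed[OF sh] by (auto simp: set_add_def set_mult_def)
    show "carrier X \<subseteq> ?S <+>\<^bsub>X\<^esub> ?K"
    proof
      fix x assume x: "x \<in> carrier X"
      have c: "p x \<in> carrier N" "s (p x) \<in> carrier X" using x addhom_closed[OF ph] addhom_closed[OF sh] by auto
      have "p (x \<ominus>\<^bsub>X\<^esub> s (p x)) = \<zero>\<^bsub>N\<^esub>"
        using x c ps[OF c(1)] by (simp add: addhom_diff[OF X.abelian_group_axioms N.abelian_group_axioms ph])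
          (simp add: a_minus_def N.r_neg)
      moreover have "x = s (p x) \<oplus>\<^bsub>X\<^esub> (x \<ominus>\<^bsub>X\<^esub> s (p x))"
        using x c X.add_diff_cancel[OF x c(2)] by (simp add: X.a_comm)
      ultimately show "x \<in> ?S <+>\<^bsub>X\<^esub> ?K"
        using c(1) X.minus_closed[OF x c(2)] unfolding set_add_def set_mult_def by auto
    qed
  qed
  show "dg_iso B N (dg_sub X ?S) s"
    using s ps N.hcomp_closed inj_on_inverseI[of "carrier N" p s]
    by (auto simp: dg_iso_def dg_hom_def dg_sub_def bij_betw_def hom_def image_subset_iff)
qed

lemma dg_iso_id: "dg_iso B M M (\<lambda>x. x)"
  by (auto simp: dg_iso_def dg_hom_def hom_def bij_betw_def)

context lift_setup
begin

text \<open>By the ordering of a basis by degree, N is semifree over A.  So it is its own semifree resolution, and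
  \<open>N \<otimes>\<^sub>A B\<close> represents the derived tensor product.\<close>

lemma tensor_liftable:
  assumes gf: "graded_free A \<phi> B" and bb: "bounded_below N"
  shows "liftable A \<phi> B TN.T"
proof -
  \<comment> \<open>Injections of the types of N and of the tensor product into the type of \<open>liftable\<close>.\<close>
  let ?i = "\<lambda>n :: 'n. {(0 :: nat, undefined :: 'a, undefined :: 'b, {frag_of (n, undefined :: 'b)})}"
  let ?j = "\<lambda>t :: ('n \<times> 'b \<Rightarrow>\<^sub>0 int) set. {(0 :: nat, undefined :: 'a, undefined :: 'b, t)}"
  have i: "inj_on ?i (carrier NA)" by (auto simp: inj_on_def frag_of_eq)
  have j: "inj_on ?j (carrier TN.T)" by (auto simp: inj_on_def)
  let ?P = "transport ?i NA" and ?Z = "transport ?j TN.T"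
  note P = transport_module[OF TN.M.dg_module_axioms A_alg i]
  note Z = transport_module[OF TN.T_module B_alg j]
  obtain k where k: "\<And>i x. x \<in> hcomp N i \<Longrightarrow> i < k \<Longrightarrow> x = \<zero>\<^bsub>N\<^esub>" using bounded_below_bound[OF bb] by blast
  have kP: "x = \<zero>\<^bsub>?P\<^esub>" if "x \<in> hcomp ?P d" "d < k" for d x
    using that k unfolding transport_def Let_def by auto
  obtain G where G: "graded_basis A BA G" using gf by (auto simp: graded_free_def)
  have sf: "semifree A ?P"
  proof (cases "\<one>\<^bsub>A\<^esub> = \<zero>\<^bsub>A\<^esub>")
    case True
    then show ?thesis by (rule dg_module.trivial_semifree[OF P(1) A.A.abelian_group_axioms])
  next
    case False
    have b: "graded_basis A ?P (?i ` {ract N f g | f g. f \<in> F \<and> g \<in> G})"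
      by (rule graded_basis_iso[OF TN.M.dg_module_axioms P restrict_basis[OF G False]])
    interpret PB: based_module R A ?P "?i ` {ract N f g | f g. f \<in> F \<and> g \<in> G}"
      using P(1) A_alg b by (simp add: based_module_def based_module_axioms_def)
    show ?thesis by (rule PB.semifree_bounded_below[OF kP])
  qed
  have q1: "quasi_iso A ?P ?P (\<lambda>x. x)" by (rule quasi_iso_of_iso[OF P(1) P(1) dg_iso_id])
  interpret TP: dg_tens R A B \<phi> ?P using P(1) dg_ext_axioms by (simp add: dg_tens_def)
  have inv: "dg_iso B ?Z TN.T (the_inv_into (carrier TN.T) ?j)"
    by (rule dg_iso_inv[OF TN.T_module Z])
  have g: "dg_iso B TN.T TP.T (tens_fun A NA \<phi> B ?P ?i)"
    by (rule tens_fun_iso[OF TN.M.dg_module_axioms P])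
  have "derived_iso TYPE(('a, 'b, ('n \<times> 'b \<Rightarrow>\<^sub>0 int) set) universe) B TN.T TP.T"
    unfolding derived_iso_def
    using Z(1) quasi_iso_of_iso[OF Z(1) TN.T_module inv] quasi_iso_of_iso[OF Z(1) TP.T_module dg_iso_comp[OF inv g]]
    by blast
  then show ?thesis unfolding liftable_def using P(1) sf q1 by blast
qed

end

theorem theorem1p2:
  fixes R :: "('r, 'y) ring_scheme"
    and A :: "('r, 'a) dg_alg" and B :: "('r, 'b) dg_alg" and \<phi> :: "'a \<Rightarrow> 'b"
    and N :: "('b, 'n) dg_mod"
  assumes "cring R" and "dg_algebra R A" and "dg_algebra R B"
    and "dg_alg_hom R A B \<phi>" and "dg_smooth A \<phi> B"
    and "dg_module B N" and "semifree B N" and "bounded_below N"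
    and "\<And>i. i \<ge> 1 \<Longrightarrow> trivial_group (Ext B i N N)"
  shows "naively_liftable A \<phi> B N
    \<and> (\<exists>X :: ('b, ('n \<times> 'b \<Rightarrow>\<^sub>0 int) set) dg_mod.
          dg_module B X \<and> liftable A \<phi> B X \<and> dg_direct_summand B N X)"
proof -
  obtain F r where F: "semifree_basis B N F r" using assms(7) by (auto simp: semifree_def)
  then have F: "graded_basis B N F" by (simp add: semifree_basis_def)
  interpret lift_setup R A B \<phi> N F
    using assms(2,3,4,6) F
    by (simp add: lift_setup_def dg_setup_def dg_ext_def based_module_def based_module_axioms_def)
  have nl: "naively_liftable A \<phi> B N" by (rule naive_lifting[OF assms(5,8,9)])
  then obtain s where s: "dg_hom B N TN.T s" "\<And>x. x \<in> carrier N \<Longrightarrow> pi_mod N (s x) = x"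
    unfolding naively_liftable_def by blast
  have "graded_free A \<phi> B" using assms(5) by (simp add: dg_smooth_def)
  then have "liftable A \<phi> B TN.T" by (rule tensor_liftable[OF _ assms(8)])
  moreover have "dg_direct_summand B N TN.T"
    by (rule direct_summand_of_split[OF N.dg_module_axioms TN.T_module s(1) pi_mod_dg_hom s(2)])
  ultimately show ?thesis using nl TN.T_module by blast
qed

end
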